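(* Let $\tau>0$, $0\le a<b\le T$, and let $X$ be an $(\mathcal F_t)$-weak Dirichlet process with finite quadratic variation and decomposition $X=M+A$, $M$ a local martingale. Let $F:[a,b]\times C([-\tau,0])\to\mathbb R$ be continuous such that (i) $F(t,\cdot)$ is Fréchet differentiable for every $t\in[a,b]$; (ii) $(t,\eta)\mapsto D^{\perp}F(t,\eta)$ is bounded (in total variation norm) on each compact subset of $[a,b]\times C([-\tau,0])$; (iii) $F$ fulfills the support predictability property on $[a,b]$; (iv) $(t,\eta)\mapsto D^{\delta_0}F(t,\eta)$ is continuous on $]a,b]\times C([-\tau,0])$ and admits a continuous extension to $[a,b]\times C([-\tau,0])$. Then $(F(t,X_t(\cdot)))_{t\in[a,b]}$ is an $(\mathcal F_t)$-weak Dirichlet process with martingale part $$\tilde M^F_t=F(a,X_a(\cdot))+\int_a^tD^{\delta_0}F(s,X_s(\cdot))\,dM_s,\quad t\in[a,b].$$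
   Context: Fix a probability space with filtration $(\mathcal F_t)$ satisfying the usual conditions and $T>0$; processes on $[0,T]$ are extended by $X_t=X_0$ for $t\le0$, $X_t=X_T$ for $t\ge T$. For real processes $X,Y$ with $X$ continuous, $[X,Y]^{\epsilon}_t=\int_0^t\frac{(X_{s+\epsilon}-X_s)(Y_{s+\epsilon}-Y_s)}{\epsilon}ds$; $X,Y$ admit a covariation $[X,Y]$ if for each $t$ the limit in probability exists and has a continuous modification; finite quadratic variation means $[X,X]$ exists. An adapted process $A$ is $(\mathcal F_t)$-martingale orthogonal if $[A,N]=0$ for every continuous $(\mathcal F_t)$-local martingale $N$. A continuous real process is $(\mathcal F_t)$-weak Dirichlet if it equals $M+A$ with $M$ a continuous $(\mathcal F_t)$-local martingale (its martingale part) and $A$ martingale orthogonal, $A_0=0$ (this decomposition is unique). Window process: $X_t(y)=X_{t+y}$, $y\in[-\tau,0]$. For $F(t,\cdot)$ differentiable, $DF(t,\eta)\in\mathcal M([-\tau,0])=C([-\tau,0])^*$, $D^{\delta_0}F(t,\eta):=DF(t,\eta)(\{0\})$, and $D^\perp F(t,\eta):=DF(t,\eta)-D^{\delta_0}F(t,\eta)\delta_0$, with $|D^\perp_{dr}F|(t,\eta)$ its total variation measure. Support predictability property: $F:[a,b]\times C([-\tau,0])\to\mathbb R$ with $F(t,\cdot)$ differentiable for all $t$ fulfills it if for every compact $K\subset C([-\tau,0])$, $$\int_a^b\Big[\sup_{\eta\in K}\frac1\epsilon\int_{(-\epsilon)\vee(-\tau)}^{0}|D^\perp_{dr}F|(t,\eta)\Big]dt=O(\epsilon)\quad(\epsilon\to0).$$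 *)

theory Defs
  imports "HOL-Analysis.Analysis" "HOL-Probability.Probability"
begin

text \<open>A process is a function real => 'a => real; only its values on [lo,hi] matter.
  It is extended by X_t = X_lo for t <= lo and X_t = X_hi for t >= hi.\<close>

definition cf_clamp :: "real \<Rightarrow> real \<Rightarrow> real \<Rightarrow> real" where
  "cf_clamp lo hi t = max lo (min hi t)"

definition cf_ext :: "real \<Rightarrow> real \<Rightarrow> (real \<Rightarrow> 'a \<Rightarrow> real) \<Rightarrow> real \<Rightarrow> 'a \<Rightarrow> real" where
  "cf_ext lo hi X t = X (cf_clamp lo hi t)"

definition cf_meas :: "'a measure \<Rightarrow> 'a set set \<Rightarrow> ('a \<Rightarrow> real) \<Rightarrow> bool" where
  "cf_meas P A f \<longleftrightarrow> (\<forall>B\<in>sets borel. f -` B \<inter> space P \<in> A)"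

definition cf_filtration :: "'a measure \<Rightarrow> real \<Rightarrow> real \<Rightarrow> (real \<Rightarrow> 'a set set) \<Rightarrow> bool" where
  "cf_filtration P lo hi Fl \<longleftrightarrow>
     (\<forall>t\<in>{lo..hi}. sigma_algebra (space P) (Fl t) \<and> Fl t \<subseteq> sets P) \<and>
     (\<forall>s t. lo \<le> s \<longrightarrow> s \<le> t \<longrightarrow> t \<le> hi \<longrightarrow> Fl s \<subseteq> Fl t)"

definition cf_usual :: "'a measure \<Rightarrow> real \<Rightarrow> real \<Rightarrow> (real \<Rightarrow> 'a set set) \<Rightarrow> bool" where
  "cf_usual P lo hi Fl \<longleftrightarrow> cf_filtration P lo hi Fl \<and>
     (\<forall>A\<in>null_sets P. \<forall>N. N \<subseteq> A \<longrightarrow> N \<in> Fl lo) \<and>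
     (\<forall>t\<in>{lo..<hi}. Fl t = (\<Inter>s\<in>{t<..hi}. Fl s))"

definition cf_adapted :: "'a measure \<Rightarrow> real \<Rightarrow> real \<Rightarrow> (real \<Rightarrow> 'a set set) \<Rightarrow> (real \<Rightarrow> 'a \<Rightarrow> real) \<Rightarrow> bool" where
  "cf_adapted P lo hi Fl X \<longleftrightarrow> (\<forall>t\<in>{lo..hi}. cf_meas P (Fl t) (X t))"

definition cf_cont_paths :: "'a measure \<Rightarrow> real \<Rightarrow> real \<Rightarrow> (real \<Rightarrow> 'a \<Rightarrow> real) \<Rightarrow> bool" where
  "cf_cont_paths P lo hi X \<longleftrightarrow> (\<forall>\<omega>\<in>space P. continuous_on {lo..hi} (\<lambda>t. X t \<omega>))"

definition cf_stopping_time :: "'a measure \<Rightarrow> real \<Rightarrow> real \<Rightarrow> (real \<Rightarrow> 'a set set) \<Rightarrow> ('a \<Rightarrow> real) \<Rightarrow> bool" where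
  "cf_stopping_time P lo hi Fl \<sigma> \<longleftrightarrow> (\<forall>\<omega>\<in>space P. \<sigma> \<omega> \<in> {lo..hi}) \<and>
     (\<forall>t\<in>{lo..hi}. {\<omega>\<in>space P. \<sigma> \<omega> \<le> t} \<in> Fl t)"

definition cf_martingale :: "'a measure \<Rightarrow> real \<Rightarrow> real \<Rightarrow> (real \<Rightarrow> 'a set set) \<Rightarrow> (real \<Rightarrow> 'a \<Rightarrow> real) \<Rightarrow> bool" where
  "cf_martingale P lo hi Fl Y \<longleftrightarrow> cf_adapted P lo hi Fl Y \<and>
     (\<forall>t\<in>{lo..hi}. integrable P (Y t)) \<and>
     (\<forall>s t. lo \<le> s \<longrightarrow> s \<le> t \<longrightarrow> t \<le> hi \<longrightarrow>
        (\<forall>A\<in>Fl s. set_lebesgue_integral P A (Y t) = set_lebesgue_integral P A (Y s)))"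

definition cf_cont_local_martingale :: "'a measure \<Rightarrow> real \<Rightarrow> real \<Rightarrow> (real \<Rightarrow> 'a set set) \<Rightarrow> (real \<Rightarrow> 'a \<Rightarrow> real) \<Rightarrow> bool" where
  "cf_cont_local_martingale P lo hi Fl N \<longleftrightarrow> cf_adapted P lo hi Fl N \<and> cf_cont_paths P lo hi N \<and>
     (\<exists>\<sigma> :: nat \<Rightarrow> 'a \<Rightarrow> real. (\<forall>n. cf_stopping_time P lo hi Fl (\<sigma> n)) \<and>
        (\<forall>n. \<forall>\<omega>\<in>space P. \<sigma> n \<omega> \<le> \<sigma> (Suc n) \<omega>) \<and>
        (AE \<omega> in P. \<exists>n. \<sigma> n \<omega> = hi) \<and>
        (\<forall>n. cf_martingale P lo hi Fl (\<lambda>t \<omega>. N (min t (\<sigma> n \<omega>)) \<omega> - N lo \<omega>)))"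

definition cf_conv_prob :: "'a measure \<Rightarrow> (real \<Rightarrow> 'a \<Rightarrow> real) \<Rightarrow> ('a \<Rightarrow> real) \<Rightarrow> bool" where
  "cf_conv_prob P Z L \<longleftrightarrow> (\<forall>\<epsilon>>0. Z \<epsilon> \<in> borel_measurable P) \<and> L \<in> borel_measurable P \<and>
     (\<forall>\<delta>>0. ((\<lambda>\<epsilon>. measure P {\<omega>\<in>space P. \<delta> < \<bar>Z \<epsilon> \<omega> - L \<omega>\<bar>}) \<longlongrightarrow> 0) (at_right 0))"

definition cf_seq_conv_prob :: "'a measure \<Rightarrow> (nat \<Rightarrow> 'a \<Rightarrow> real) \<Rightarrow> ('a \<Rightarrow> real) \<Rightarrow> bool" where
  "cf_seq_conv_prob P Z L \<longleftrightarrow> (\<forall>n. Z n \<in> borel_measurable P) \<and> L \<in> borel_measurable P \<and>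
     (\<forall>\<delta>>0. (\<lambda>n. measure P {\<omega>\<in>space P. \<delta> < \<bar>Z n \<omega> - L \<omega>\<bar>}) \<longlonglongrightarrow> 0)"

definition cf_cov_eps :: "real \<Rightarrow> real \<Rightarrow> (real \<Rightarrow> 'a \<Rightarrow> real) \<Rightarrow> (real \<Rightarrow> 'a \<Rightarrow> real) \<Rightarrow> real \<Rightarrow> real \<Rightarrow> 'a \<Rightarrow> real" where
  "cf_cov_eps lo hi X Y \<epsilon> t \<omega> =
     (LBINT s:{lo..t}. (cf_ext lo hi X (s + \<epsilon>) \<omega> - cf_ext lo hi X s \<omega>) *
                       (cf_ext lo hi Y (s + \<epsilon>) \<omega> - cf_ext lo hi Y s \<omega>) / \<epsilon>)"

definition cf_has_covariation :: "'a measure \<Rightarrow> real \<Rightarrow> real \<Rightarrow> (real \<Rightarrow> 'a \<Rightarrow> real) \<Rightarrow> (real \<Rightarrow> 'a \<Rightarrow> real) \<Rightarrow> (real \<Rightarrow> 'a \<Rightarrow> real) \<Rightarrow> bool" where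
  "cf_has_covariation P lo hi X Y C \<longleftrightarrow> cf_cont_paths P lo hi X \<and> cf_cont_paths P lo hi C \<and>
     (\<forall>t\<in>{lo..hi}. cf_conv_prob P (\<lambda>\<epsilon>. cf_cov_eps lo hi X Y \<epsilon> t) (C t))"

definition cf_finite_qv :: "'a measure \<Rightarrow> real \<Rightarrow> real \<Rightarrow> (real \<Rightarrow> 'a \<Rightarrow> real) \<Rightarrow> bool" where
  "cf_finite_qv P lo hi X \<longleftrightarrow> (\<exists>C. cf_has_covariation P lo hi X X C)"

definition cf_mart_orthogonal :: "'a measure \<Rightarrow> real \<Rightarrow> real \<Rightarrow> (real \<Rightarrow> 'a set set) \<Rightarrow> (real \<Rightarrow> 'a \<Rightarrow> real) \<Rightarrow> bool" where
  "cf_mart_orthogonal P lo hi Fl A \<longleftrightarrow> cf_adapted P lo hi Fl A \<and>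
     (\<forall>N. cf_cont_local_martingale P lo hi Fl N \<longrightarrow> cf_has_covariation P lo hi A N (\<lambda>t \<omega>. 0))"

definition cf_weak_dirichlet :: "'a measure \<Rightarrow> real \<Rightarrow> real \<Rightarrow> (real \<Rightarrow> 'a set set) \<Rightarrow> (real \<Rightarrow> 'a \<Rightarrow> real) \<Rightarrow> (real \<Rightarrow> 'a \<Rightarrow> real) \<Rightarrow> bool" where
  "cf_weak_dirichlet P lo hi Fl X Mp \<longleftrightarrow> cf_cont_paths P lo hi X \<and> cf_adapted P lo hi Fl X \<and>
     cf_cont_local_martingale P lo hi Fl Mp \<and>
     cf_mart_orthogonal P lo hi Fl (\<lambda>t \<omega>. X t \<omega> - Mp t \<omega>) \<and>
     (\<forall>\<omega>\<in>space P. X lo \<omega> - Mp lo \<omega> = 0)"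

definition cf_stoch_int :: "'a measure \<Rightarrow> real \<Rightarrow> real \<Rightarrow> (real \<Rightarrow> 'a \<Rightarrow> real) \<Rightarrow> (real \<Rightarrow> 'a \<Rightarrow> real) \<Rightarrow> (real \<Rightarrow> 'a \<Rightarrow> real) \<Rightarrow> bool" where
  "cf_stoch_int P lo hi H N I \<longleftrightarrow> cf_cont_paths P lo hi I \<and> (\<forall>\<omega>\<in>space P. I lo \<omega> = 0) \<and>
     (\<forall>t\<in>{lo..hi}. cf_seq_conv_prob P
        (\<lambda>n \<omega>. \<Sum>k<n. H (lo + real k * (t - lo) / real n) \<omega> *
              (N (lo + real (Suc k) * (t - lo) / real n) \<omega> - N (lo + real k * (t - lo) / real n) \<omega>))
        (I t))"

text \<open>C([-tau,0]) with the sup norm is identified isometrically with the closed linear subspace of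
  bounded continuous functions on the reals that are constant on ]-inf,-tau] and on [0,inf[.\<close>
definition cf_C :: "real \<Rightarrow> (real \<Rightarrow>\<^sub>C real) set" where
  "cf_C \<tau> = {f. (\<forall>y. y \<le> -\<tau> \<longrightarrow> apply_bcontfun f y = apply_bcontfun f (-\<tau>)) \<and>
               (\<forall>y. 0 \<le> y \<longrightarrow> apply_bcontfun f y = apply_bcontfun f 0)}"

text \<open>Window process X_t(y) = X_{t+y}, y in [-tau,0] (X already extended in time).\<close>
definition cf_window :: "real \<Rightarrow> (real \<Rightarrow> 'a \<Rightarrow> real) \<Rightarrow> real \<Rightarrow> 'a \<Rightarrow> (real \<Rightarrow>\<^sub>C real)" where
  "cf_window \<tau> X t \<omega> = Bcontfun (\<lambda>y. X (t + max (-\<tau>) (min 0 y)) \<omega>)"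

definition cf_frechet :: "real \<Rightarrow> ((real \<Rightarrow>\<^sub>C real) \<Rightarrow> real) \<Rightarrow> (real \<Rightarrow>\<^sub>C real) \<Rightarrow> ((real \<Rightarrow>\<^sub>C real) \<Rightarrow> real) \<Rightarrow> bool" where
  "cf_frechet \<tau> G \<eta> L \<longleftrightarrow>
     (\<forall>h\<in>cf_C \<tau>. \<forall>k\<in>cf_C \<tau>. \<forall>c. L (h + k) = L h + L k \<and> L (c *\<^sub>R h) = c * L h) \<and>
     (\<exists>K. \<forall>h\<in>cf_C \<tau>. \<bar>L h\<bar> \<le> K * norm h) \<and>
     ((\<lambda>h. (G (\<eta> + h) - G \<eta> - L h) / norm h) \<longlongrightarrow> 0) (at 0 within cf_C \<tau>)"

definition cf_differentiable :: "real \<Rightarrow> ((real \<Rightarrow>\<^sub>C real) \<Rightarrow> real) \<Rightarrow> bool" where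
  "cf_differentiable \<tau> G \<longleftrightarrow> (\<forall>\<eta>\<in>cf_C \<tau>. \<exists>L. cf_frechet \<tau> G \<eta> L)"

text \<open>A finite signed Borel measure on [-tau,0] given by its Jordan decomposition (mu_p, mu_n),
  representing the functional L on C([-tau,0]).\<close>
definition cf_jordan_rep :: "real \<Rightarrow> ((real \<Rightarrow>\<^sub>C real) \<Rightarrow> real) \<Rightarrow> real measure \<Rightarrow> real measure \<Rightarrow> bool" where
  "cf_jordan_rep \<tau> L \<mu>p \<mu>n \<longleftrightarrow> sets \<mu>p = sets borel \<and> sets \<mu>n = sets borel \<and>
     finite_measure \<mu>p \<and> finite_measure \<mu>n \<and>
     emeasure \<mu>p (- {-\<tau>..0}) = 0 \<and> emeasure \<mu>n (- {-\<tau>..0}) = 0 \<and>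
     (\<exists>S\<in>sets borel. emeasure \<mu>p S = 0 \<and> emeasure \<mu>n (- S) = 0) \<and>
     (\<forall>h\<in>cf_C \<tau>. L h = (\<integral>x. apply_bcontfun h x \<partial>\<mu>p) - (\<integral>x. apply_bcontfun h x \<partial>\<mu>n))"

definition cf_DF :: "real \<Rightarrow> (real \<Rightarrow> (real \<Rightarrow>\<^sub>C real) \<Rightarrow> real) \<Rightarrow> real \<Rightarrow> (real \<Rightarrow>\<^sub>C real) \<Rightarrow> real measure \<times> real measure" where
  "cf_DF \<tau> F t \<eta> = (THE p. \<exists>L. cf_frechet \<tau> (F t) \<eta> L \<and> cf_jordan_rep \<tau> L (fst p) (snd p))"

definition cf_Ddelta0 :: "real \<Rightarrow> (real \<Rightarrow> (real \<Rightarrow>\<^sub>C real) \<Rightarrow> real) \<Rightarrow> real \<Rightarrow> (real \<Rightarrow>\<^sub>C real) \<Rightarrow> real" where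
  "cf_Ddelta0 \<tau> F t \<eta> = measure (fst (cf_DF \<tau> F t \<eta>)) {0} - measure (snd (cf_DF \<tau> F t \<eta>)) {0}"

text \<open>|D^perp F|(t,eta)(S): total variation measure of DF(t,eta) - DF(t,eta)({0}) delta_0.\<close>
definition cf_Dperp_tv :: "real \<Rightarrow> (real \<Rightarrow> (real \<Rightarrow>\<^sub>C real) \<Rightarrow> real) \<Rightarrow> real \<Rightarrow> (real \<Rightarrow>\<^sub>C real) \<Rightarrow> real set \<Rightarrow> ennreal" where
  "cf_Dperp_tv \<tau> F t \<eta> S = emeasure (fst (cf_DF \<tau> F t \<eta>)) (S - {0}) + emeasure (snd (cf_DF \<tau> F t \<eta>)) (S - {0})"

definition cf_support_predictable :: "real \<Rightarrow> real \<Rightarrow> real \<Rightarrow> (real \<Rightarrow> (real \<Rightarrow>\<^sub>C real) \<Rightarrow> real) \<Rightarrow> bool" where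
  "cf_support_predictable \<tau> a b F \<longleftrightarrow>
     (\<forall>K. compact K \<and> K \<subseteq> cf_C \<tau> \<longrightarrow>
        (\<exists>C \<epsilon>0. 0 < \<epsilon>0 \<and> (\<forall>\<epsilon>. 0 < \<epsilon> \<and> \<epsilon> \<le> \<epsilon>0 \<longrightarrow>
           (\<integral>\<^sup>+ t \<in> {a..b}. (SUP \<eta>\<in>K. cf_Dperp_tv \<tau> F t \<eta> {max (-\<epsilon>) (-\<tau>)..0} / ennreal \<epsilon>) \<partial>lborel)
             \<le> ennreal (C * \<epsilon>))))"

end

theory Submission
  imports Defs "HOL-Complex_Analysis.Great_Picard"
begin

text \<open>Freezing the path at time \<open>s\<close> splits the increment of \<open>F\<close> along the windows over \<open>[s, s + ep]\<close>
 into a small part known at time \<open>s\<close>, which averages out against martingale increments, and the effect of the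
 new piece of path. By the mean value theorem the latter is \<open>D^delta0 F\<close> times the increment of \<open>X\<close>, up to an
 error controlled by the mass of \<open>D^perp F\<close> near \<open>0\<close>. With high probability the path lies in a compact set of
 paths with a prescribed modulus of continuity, on which support predictability makes the time integral of this
 error \<open>O(ep^2)\<close>. Finally the increment of \<open>X\<close> is that of \<open>M\<close>, which the stochastic integral cancels in
 mean square, plus that of \<open>A\<close>, which stays orthogonal to martingales after multiplication by a continuous
 weight.\<close>

section \<open>The path space\<close>

text \<open>The part of the increment that comes from freezing is uniformly small but has no rate in
  \<open>ep\<close>, while the covariation divides by \<open>ep\<close>. Only the orthogonality of
  martingale increments rescues it, and this needs a quantity known at time \<open>s\<close> and
  increments over disjoint blocks of length \<open>ep\<close>. The mean value theorem evaluates
  derivatives at intermediate paths that are not windows of X, so the compact sets are chosen stable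
  under time changes, freezing and convex combinations. The derivative measures are given by a
  definite description of a Jordan pair; nothing can be said about them before Riesz representation
  and uniqueness of the pair are available. All mean square arguments are made for bounded
  martingales and transported by exceptional events of small probability. These may depend on
  \<open>ep\<close>, which is exactly what convergence in probability tolerates. The stochastic
  integral is a limit of dyadic transforms, so its error against the integrand times the increment
  of M is again a limit of transforms, bounded by the energy of M over
  \<open>[s, s + ep]\<close>.\<close>

abbreviation (input) bm :: "'b measure => ('b => 'c::topological_space) set" where
 "bm M \<equiv> borel_measurable M"

abbreviation (input) ap :: "(real \<Rightarrow>\<^sub>C real) => real => real" where
 "ap \<equiv> apply_bcontfun"

definition clampw :: "real => real => real" where
 "clampw \<tau> y = max (-\<tau>) (min 0 y)"

text \<open>Extension by constants, the form in which \<open>cf_C\<close> stores a path.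
  \<open>Bcontfun\<close> is meaningful on bounded continuous functions only, hence the continuity
  premise wherever \<open>cfun\<close> is evaluated.\<close>

definition cfun :: "real => (real => real) => real \<Rightarrow>\<^sub>C real" where
 "cfun \<tau> g = Bcontfun (\<lambda>y. g (clampw \<tau> y))"

lemma clampw_in: "0 <= \<tau> ==> clampw \<tau> y \<in> {-\<tau>..0}"
 by (auto simp: clampw_def)

lemma clampw_id: "y \<in> {-\<tau>..0} ==> clampw \<tau> y = y"
 by (auto simp: clampw_def)

lemma clampw_lipschitz: "\<bar>clampw \<tau> y - clampw \<tau> z\<bar> <= \<bar>y - z\<bar>"
 by (auto simp: clampw_def)

lemma cfun_apply:
 assumes "0 <= \<tau>" "continuous_on {-\<tau>..0} g"
 shows "ap (cfun \<tau> g) = (\<lambda>y. g (clampw \<tau> y))"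
proof -
 have 1: "continuous_on UNIV (\<lambda>y. g (clampw \<tau> y))"
  by (rule continuous_on_compose2[OF assms(2)])
    (use clampw_in[OF assms(1)] in \<open>auto simp: clampw_def intro!: continuous_intros\<close>)
 have "bounded (g ` {-\<tau>..0})"
  by (intro compact_imp_bounded compact_continuous_image assms) auto
 then have 2: "bounded (range (\<lambda>y. g (clampw \<tau> y)))"
  by (rule bounded_subset) (use clampw_in[OF assms(1)] in auto)
 show ?thesis unfolding cfun_def
  by (rule Bcontfun_inverse) (use 1 2 in \<open>auto simp: bcontfun_def\<close>)
qed

lemma cfun_in_C: "0 <= \<tau> ==> continuous_on {-\<tau>..0} g ==> cfun \<tau> g \<in> cf_C \<tau>"
 by (auto simp: cf_C_def cfun_apply) (auto simp: clampw_def)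

lemma cf_C_clampw: "0 <= \<tau> ==> f \<in> cf_C \<tau> ==> ap f (clampw \<tau> y) = ap f y"
 unfolding cf_C_def clampw_def
 by (smt (verit) mem_Collect_eq)

lemma cf_C_eqI:
 assumes "0 <= \<tau>" "f \<in> cf_C \<tau>" "g \<in> cf_C \<tau>" "\<And>y. y \<in> {-\<tau>..0} ==> ap f y = ap g y"
 shows "f = g"
 by (metis apply_bcontfun_inject assms cf_C_clampw clampw_in ext)

lemma cf_C_zero [simp]: "0 \<in> cf_C \<tau>"
 by (simp add: cf_C_def)

lemma cf_C_add: "f \<in> cf_C \<tau> ==> g \<in> cf_C \<tau> ==> f + g \<in> cf_C \<tau>"
 unfolding cf_C_def mem_Collect_eq plus_bcontfun.rep_eq by metis

lemma cf_C_diff: "f \<in> cf_C \<tau> ==> g \<in> cf_C \<tau> ==> f - g \<in> cf_C \<tau>"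
 unfolding cf_C_def mem_Collect_eq minus_bcontfun.rep_eq by metis

lemma cf_C_scaleR: "f \<in> cf_C \<tau> ==> c *\<^sub>R f \<in> cf_C \<tau>"
 unfolding cf_C_def mem_Collect_eq scaleR_bcontfun.rep_eq by metis

lemma cf_C_sum: "(\<And>i. i \<in> I ==> f i \<in> cf_C \<tau>) ==> (\<Sum>i\<in>I. f i) \<in> cf_C \<tau>"
 by (induction I rule: infinite_finite_induct) (auto intro: cf_C_add)

lemma apply_bcontfun_sum: "ap (\<Sum>i\<in>I. f i) y = (\<Sum>i\<in>I. ap (f i) y)"
 by (induction I rule: infinite_finite_induct) auto

lemma cont_apply_bcontfun: "continuous_on A (ap f)"
 using apply_bcontfun[of f] by (auto simp: bcontfun_def intro: continuous_on_subset)

lemma norm_bcontfun_le: "(\<And>y. \<bar>ap f y\<bar> <= c) ==> norm f <= c"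
 by (rule norm_bound) auto

lemma bounded_linear_apply_bcontfun: "bounded_linear (\<lambda>f::real \<Rightarrow>\<^sub>C real. ap f y)"
 by (rule bounded_linear_intro[where K = 1]) (use norm_bounded[where 'b = real] in auto)

lemma norm_cf_C_le:
 assumes "0 <= \<tau>" "f \<in> cf_C \<tau>" "\<And>y. y \<in> {-\<tau>..0} ==> \<bar>ap f y\<bar> <= c"
 shows "norm f <= c"
 by (rule norm_bcontfun_le) (metis assms cf_C_clampw clampw_in)

section \<open>Piecewise linear interpolation on \<open>[-\<tau>, 0]\<close>\<close>

definition hat :: "real => nat => nat => real \<Rightarrow>\<^sub>C real" where
 "hat \<tau> n k = cfun \<tau> (\<lambda>r. max 0 (1 - \<bar>(r + \<tau>) * n / \<tau> - k\<bar>))"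

lemma hat_apply: "0 < \<tau> ==> ap (hat \<tau> n k) y = max 0 (1 - \<bar>(clampw \<tau> y + \<tau>) * n / \<tau> - k\<bar>)"
 unfolding hat_def by (subst cfun_apply) (auto intro!: continuous_intros)

lemma hat_in_C: "0 < \<tau> ==> hat \<tau> n k \<in> cf_C \<tau>"
 unfolding hat_def by (intro cfun_in_C) (auto intro!: continuous_intros)

text \<open>Up to \<open>n\<close> the tent at \<open>n + 1\<close> vanishes; beyond
  \<open>n\<close> only the last two tents are nonzero, and they add up to one.\<close>

lemma tent_sum: "0 <= z ==> z <= real n ==> (\<Sum>k\<le>n. max 0 (1 - \<bar>z - real k\<bar>)) = 1"
proof (induction n)
 case (Suc n)
 show ?case
 proof (cases "z <= n")
  case True
  with Suc show ?thesis by simp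
 next
  case False
  have "(\<Sum>k<n. max 0 (1 - \<bar>z - real k\<bar>)) = 0"
  proof (intro sum.neutral ballI)
   fix k assume "k \<in> {..<n}"
   then have "real k + 1 <= real n" by auto
   with False show "max 0 (1 - \<bar>z - real k\<bar>) = 0" by auto
  qed
  moreover have "{..Suc n} = insert (Suc n) (insert n {..<n})" by auto
  ultimately show ?thesis using False Suc.prems by (auto simp: lessThan_Suc_atMost)
 qed
qed auto

lemma hat_nonneg: "0 < \<tau> ==> 0 <= ap (hat \<tau> n k) y"
 by (simp add: hat_apply)

lemma hat_sum:
 assumes "0 < \<tau>" shows "(\<Sum>k\<le>n. ap (hat \<tau> n k) y) = 1"
proof -
 have "clampw \<tau> y \<in> {-\<tau>..0}" using assms clampw_in by auto
 then have "0 <= (clampw \<tau> y + \<tau>) * n / \<tau>" "(clampw \<tau> y + \<tau>) * n <= \<tau> * n"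
  using assms by (auto intro!: mult_right_mono)
 then show ?thesis using assms
  by (simp add: hat_apply) (rule tent_sum, auto simp: pos_divide_le_eq mult.commute)
qed

text \<open>For \<open>n > 0\<close> the piecewise linear path with value \<open>c k\<close> at the
  node \<open>-\<tau> + k \<tau> / n\<close>. It reduces a path to finitely many numbers, once to
  represent functionals by measures and once to prove measurability.\<close>

definition interp :: "real => nat => (nat => real) => real \<Rightarrow>\<^sub>C real" where
 "interp \<tau> n c = (\<Sum>k\<le>n. c k *\<^sub>R hat \<tau> n k)"

lemma interp_in_C: "0 < \<tau> ==> interp \<tau> n c \<in> cf_C \<tau>"
 unfolding interp_def by (intro cf_C_sum cf_C_scaleR hat_in_C)

lemma norm_interp_le:
 assumes "0 < \<tau>" "\<And>k. k <= n ==> \<bar>c k\<bar> <= C"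
 shows "norm (interp \<tau> n c) <= C"
proof (rule norm_bcontfun_le)
 fix y
 have "\<bar>ap (interp \<tau> n c) y\<bar> <= (\<Sum>k\<le>n. \<bar>c k * ap (hat \<tau> n k) y\<bar>)"
  by (simp add: interp_def apply_bcontfun_sum)
 also have "... <= (\<Sum>k\<le>n. C * ap (hat \<tau> n k) y)"
  using assms by (intro sum_mono) (auto simp: abs_mult hat_nonneg intro!: mult_right_mono)
 also have "... = C" using hat_sum[OF assms(1)] by (simp flip: sum_distrib_left)
 finally show "\<bar>ap (interp \<tau> n c) y\<bar> <= C" .
qed

lemma interp_approx:
 assumes \<tau>: "0 < \<tau>" "0 < n" and f: "f \<in> cf_C \<tau>"
  and osc: "\<And>y z. y \<in> {-\<tau>..0} ==> z \<in> {-\<tau>..0} ==> \<bar>y - z\<bar> <= \<tau> / n ==> \<bar>ap f y - ap f z\<bar> <= e"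
  and c: "\<And>k. k <= n ==> \<bar>c k - ap f (-\<tau> + k * \<tau> / n)\<bar> <= e"
 shows "norm (interp \<tau> n c - f) <= 2 * e"
proof (rule norm_cf_C_le[of \<tau>])
 show "0 <= \<tau>" using \<tau> by simp
 show "interp \<tau> n c - f \<in> cf_C \<tau>" by (intro cf_C_diff interp_in_C \<tau> f)
 fix y assume y: "y \<in> {-\<tau>..0}"
 let ?h = "\<lambda>k. ap (hat \<tau> n k) y"
 have bnd: "\<bar>c k - ap f y\<bar> * ?h k <= 2 * e * ?h k" if "k <= n" for k
 proof (cases "?h k = 0")
  case False
  then have "\<bar>(y + \<tau>) * n / \<tau> - k\<bar> < 1"
   using \<tau> y by (auto simp: hat_apply clampw_id max_def split: if_splits)
  then have "\<bar>(y + \<tau>) * n / \<tau> - k\<bar> * (\<tau> / n) <= 1 * (\<tau> / n)"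
   using \<tau> by (intro mult_right_mono) auto
  moreover have "\<bar>(y + \<tau>) * n / \<tau> - k\<bar> * (\<tau> / n) = \<bar>y - (-\<tau> + k * \<tau> / n)\<bar>"
  proof -
   have "\<bar>(y + \<tau>) * n / \<tau> - k\<bar> * (\<tau> / n) = \<bar>((y + \<tau>) * n / \<tau> - k) * (\<tau> / n)\<bar>"
    using \<tau> by (simp add: abs_mult)
   also have "((y + \<tau>) * n / \<tau> - k) * (\<tau> / n) = y - (-\<tau> + k * \<tau> / n)"
    using \<tau> by (simp add: field_simps)
   finally show ?thesis .
  qed
  moreover have "-\<tau> + k * \<tau> / n \<in> {-\<tau>..0}"
   using \<tau> that by (auto simp: field_simps)
  ultimately have "\<bar>ap f y - ap f (-\<tau> + k * \<tau> / n)\<bar> <= e"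
   using y by (intro osc) auto
  with c[OF that] have "\<bar>c k - ap f y\<bar> <= 2 * e" by linarith
  then show ?thesis using hat_nonneg \<tau> by (intro mult_right_mono) auto
 qed simp
 have "ap (interp \<tau> n c - f) y = (\<Sum>k\<le>n. c k * ?h k) - ap f y * (\<Sum>k\<le>n. ?h k)"
  by (simp add: interp_def apply_bcontfun_sum hat_sum[OF \<tau>(1)])
 also have "... = (\<Sum>k\<le>n. (c k - ap f y) * ?h k)"
  by (simp add: left_diff_distrib sum_subtractf sum_distrib_left)
 finally have "\<bar>ap (interp \<tau> n c - f) y\<bar> <= (\<Sum>k\<le>n. \<bar>(c k - ap f y) * ?h k\<bar>)"
  by simp
 also have "... <= (\<Sum>k\<le>n. 2 * e * ?h k)"
  using bnd \<tau> hat_nonneg by (intro sum_mono) (auto simp: abs_mult)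
 also have "... = 2 * e" using hat_sum[OF \<tau>(1)] by (simp flip: sum_distrib_left)
 finally show "\<bar>ap (interp \<tau> n c - f) y\<bar> <= 2 * e" .
qed

lemma cf_C_osc:
 fixes e :: real
 assumes "0 < \<tau>" "0 < e"
 obtains N where "\<And>n y z. n \<ge> N ==> 0 < n ==> y \<in> {-\<tau>..0} ==> z \<in> {-\<tau>..0} ==> \<bar>y - z\<bar> <= \<tau> / real n ==>
   \<bar>ap f y - ap f z\<bar> <= e"
proof -
 have "uniformly_continuous_on {-\<tau>..0} (ap f)"
  by (intro compact_uniformly_continuous cont_apply_bcontfun) auto
 then obtain d where d: "d > 0" "\<And>y z. y \<in> {-\<tau>..0} ==> z \<in> {-\<tau>..0} ==> dist y z < d ==>
   dist (ap f y) (ap f z) < e"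
  using assms(2) unfolding uniformly_continuous_on_def by metis
 obtain N where N: "\<tau> / d < real N" using reals_Archimedean2 by blast
 show ?thesis
 proof (rule that[of N])
  fix n y z assume *: "n \<ge> N" "0 < n" "y \<in> {-\<tau>..0}" "z \<in> {-\<tau>..0}" "\<bar>y - z\<bar> <= \<tau> / real n"
  have "\<tau> / d < real n" using N *(1) by linarith
  then have "\<tau> / real n < d" using d(1) *(2) by (simp add: field_simps)
  then show "\<bar>ap f y - ap f z\<bar> <= e"
   using d(2)[OF *(3,4)] *(5) by (auto simp: dist_real_def)
 qed
qed

text \<open>The sequence \<open>d\<close> encodes a modulus of continuity, one radius for each
  tolerance \<open>1 / Suc j\<close>. Countably many conditions are enough for Arzela-Ascoli, and
  each of them can be arranged at the price of a summable probability.\<close>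

definition ppath :: "real => (nat => real) => (real => real) => bool" where
 "ppath R d x \<longleftrightarrow> (\<forall>s. \<bar>x s\<bar> <= R) \<and> (\<forall>j s t. \<bar>s - t\<bar> <= d j \<longrightarrow> \<bar>x s - x t\<bar> <= 1 / Suc j)"

definition ppath_set :: "real => real => (nat => real) => (real \<Rightarrow>\<^sub>C real) set" where
 "ppath_set \<tau> R d = {f \<in> cf_C \<tau>. ppath R d (ap f)}"

lemma ppath_continuous:
 assumes "\<And>j. d j > 0" "ppath R d x" shows "continuous_on A x"
proof -
 have "\<exists>dl>0. \<forall>y. dist y z < dl \<longrightarrow> dist (x y) (x z) < e" if "e > 0" for e z
 proof -
  obtain j where j: "1 / Suc j < e" using \<open>e > 0\<close> nat_approx_posE by (metis of_nat_Suc)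
  show ?thesis
  proof (rule exI[of _ "d j"], intro conjI allI impI)
   fix y assume "dist y z < d j"
   then have "\<bar>x y - x z\<bar> <= 1 / Suc j" using assms(2) unfolding ppath_def dist_real_def by (meson less_imp_le)
   then show "dist (x y) (x z) < e" using j by (simp add: dist_real_def)
  qed (use assms in auto)
 qed
 then have "continuous_on UNIV x"
  unfolding continuous_on_iff by (metis UNIV_I)
 then show ?thesis by (rule continuous_on_subset) auto
qed

text \<open>Shifting, windowing by \<open>clampw\<close> and freezing by \<open>min s\<close> are
  all time changes of this kind.\<close>

lemma ppath_lipschitz:
 assumes "ppath R d x" "\<And>s t. \<bar>g s - g t\<bar> <= \<bar>s - t\<bar>" shows "ppath R d (\<lambda>s. x (g s))"
 using assms unfolding ppath_def by (meson order_trans)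

text \<open>Keeps the intermediate point of the mean value theorem in the compact set.\<close>

lemma ppath_convex:
 assumes "ppath R d x" "ppath R d y" "0 <= \<theta>" "\<theta> <= 1"
 shows "ppath R d (\<lambda>s. x s + \<theta> * (y s - x s))"
proof -
 have conv: "\<bar>u + \<theta> * (v - u)\<bar> <= c" if "\<bar>u\<bar> <= c" "\<bar>v\<bar> <= c" for u v c
 proof -
  have "\<bar>(1-\<theta>) * u + \<theta> * v\<bar> <= (1-\<theta>) * \<bar>u\<bar> + \<theta> * \<bar>v\<bar>"
   using assms by (metis abs_mult abs_of_nonneg abs_triangle_ineq diff_ge_0_iff_ge)
  also have "... <= (1-\<theta>) * c + \<theta> * c" using assms that by (intro add_mono mult_left_mono) auto
  finally show ?thesis by (simp add: algebra_simps)
 qed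
 have "\<bar>(x s + \<theta> * (y s - x s)) - (x t + \<theta> * (y t - x t))\<bar> <= 1 / Suc j" if "\<bar>s - t\<bar> <= d j" for s t j
  using conv[of "x s - x t" "1 / Suc j" "y s - y t"] assms(1,2) that
  unfolding ppath_def by (simp add: algebra_simps)
 then show ?thesis using conv assms(1,2) unfolding ppath_def by blast
qed

text \<open>Arzela-Ascoli on \<open>[-\<tau>, 0]\<close> gives a uniform limit of a subsequence; the
  inequalities in \<open>ppath\<close> are weak and pass to pointwise limits.\<close>

lemma compact_ppath_set:
 assumes "0 <= \<tau>" "\<And>j. d j > 0" shows "compact (ppath_set \<tau> R d)"
 unfolding compact_eq_seq_compact_metric seq_compact_def
proof (intro allI impI)
 fix f :: "nat => real \<Rightarrow>\<^sub>C real" assume f: "\<forall>n. f n \<in> ppath_set \<tau> R d"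
 have "\<exists>dl>0. \<forall>n y. y \<in> {-\<tau>..0} \<and> norm (x - y) < dl \<longrightarrow> norm (ap (f n) x - ap (f n) y) < e"
  if "e > 0" for x e :: real
 proof -
  obtain j where j: "1 / Suc j < e" using \<open>e > 0\<close> nat_approx_posE by (metis of_nat_Suc)
  show ?thesis
  proof (rule exI[of _ "d j"], intro conjI allI impI)
   fix n y assume "y \<in> {-\<tau>..0} \<and> norm (x - y) < d j"
   then have "\<bar>ap (f n) x - ap (f n) y\<bar> <= 1 / Suc j"
    using f unfolding ppath_set_def ppath_def by (auto simp: less_imp_le)
   then show "norm (ap (f n) x - ap (f n) y) < e" using j by simp
  qed (use assms in auto)
 qed
 then obtain g k where g: "continuous_on {-\<tau>..0} g" "strict_mono (k :: nat => nat)"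
   "\<And>e. 0 < e ==> \<exists>N. \<forall>n x. n \<ge> N \<and> x \<in> {-\<tau>..0} \<longrightarrow> norm (ap (f (k n)) x - g x) < e"
  using f by (elim Arzela_Ascoli[of "{-\<tau>..0}" "\<lambda>n. ap (f n)" R, rotated -1])
        (auto simp: ppath_set_def ppath_def)
 let ?l = "cfun \<tau> g"
 have lC: "?l \<in> cf_C \<tau>" by (intro cfun_in_C assms g)
 have lim: "(f \<circ> k) \<longlonglongrightarrow> ?l"
 proof (rule LIMSEQ_I)
  fix e :: real assume "e > 0"
  then obtain N where N: "\<forall>n x. n \<ge> N \<and> x \<in> {-\<tau>..0} \<longrightarrow> norm (ap (f (k n)) x - g x) < e/2"
   using g(3)[of "e/2"] by auto
  have "norm ((f \<circ> k) n - ?l) <= e/2" if "n \<ge> N" for n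
  proof (rule norm_cf_C_le[OF assms(1)])
   show "(f \<circ> k) n - ?l \<in> cf_C \<tau>" using f lC by (auto simp: ppath_set_def intro: cf_C_diff)
   fix y assume "y \<in> {-\<tau>..0}"
   then show "\<bar>ap ((f \<circ> k) n - ?l) y\<bar> <= e/2"
    using N that assms g(1) by (auto simp: cfun_apply clampw_id intro: less_imp_le)
  qed
  then show "\<exists>no. \<forall>n\<ge>no. norm ((f \<circ> k) n - ?l) < e" using \<open>e > 0\<close>
   by (intro exI[of _ N]) (metis field_sum_of_halves le_less_trans less_add_same_cancel1 half_gt_zero)
 qed
 have pt: "(\<lambda>n. ap (f (k n)) y) \<longlonglongrightarrow> ap ?l y" for y
  using bounded_linear.tendsto[OF bounded_linear_apply_bcontfun lim, of y] by (simp add: o_def)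
 have "ppath R d (ap ?l)"
  unfolding ppath_def
 proof (intro conjI allI impI)
  fix s show "\<bar>ap ?l s\<bar> <= R"
   by (rule LIMSEQ_le_const2[OF tendsto_rabs[OF pt]]) (use f in \<open>auto simp: ppath_set_def ppath_def\<close>)
 next
  fix j :: nat and s t assume "\<bar>s - t\<bar> <= d j"
  then show "\<bar>ap ?l s - ap ?l t\<bar> <= 1 / Suc j"
   by (intro LIMSEQ_le_const2[OF tendsto_rabs[OF tendsto_diff[OF pt pt]]])
     (use f in \<open>auto simp: ppath_set_def ppath_def\<close>)
 qed
 then show "\<exists>l\<in>ppath_set \<tau> R d. \<exists>r. strict_mono r \<and> (f \<circ> r) \<longlonglongrightarrow> l"
  using lC lim g(2) by (auto simp: ppath_set_def)
qed

section \<open>Riesz representation on the path space\<close>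

text \<open>Stands in for signed measures: an identity between differences \<open>p - n\<close> and
  \<open>p' - n'\<close> is stated as \<open>p + n' = p' + n\<close>, where both sides are
  measures.\<close>

definition msum :: "'b measure => 'b measure => 'b measure" where
 "msum M N = measure_of (space M) (sets M) (\<lambda>A. emeasure M A + emeasure N A)"

lemma sets_msum [simp]: "sets (msum M N) = sets M"
 and space_msum [simp]: "space (msum M N) = space M"
 by (simp_all add: msum_def)

lemma emeasure_msum:
 assumes "sets N = sets M" "A \<in> sets M"
 shows "emeasure (msum M N) A = emeasure M A + emeasure N A"
 unfolding msum_def
proof (rule emeasure_measure_of_sigma)
 show "sigma_algebra (space M) (sets M)" by (rule sets.sigma_algebra_axioms)
 show "positive (sets M) (\<lambda>A. emeasure M A + emeasure N A)" by (simp add: positive_def)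
 show "countably_additive (sets M) (\<lambda>A. emeasure M A + emeasure N A)"
  unfolding countably_additive_def
 proof (intro allI impI)
  fix B :: "nat => 'a set" assume B: "range B \<subseteq> sets M" "disjoint_family B"
  have "(\<Sum>i. emeasure M (B i) + emeasure N (B i)) = (\<Sum>i. emeasure M (B i)) + (\<Sum>i. emeasure N (B i))"
   by (rule suminf_add[symmetric]) auto
  then show "(\<Sum>i. emeasure M (B i) + emeasure N (B i)) = emeasure M (\<Union>i. B i) + emeasure N (\<Union>i. B i)"
   using suminf_emeasure[of B M] suminf_emeasure[of B N] B assms by simp
 qed
qed (use assms in auto)

lemma finite_measure_msum:
 assumes "finite_measure M" "finite_measure N" "sets N = sets M"
 shows "finite_measure (msum M N)"
proof
 have "space N = space M" using assms by (metis sets_eq_imp_space_eq)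
 then show "emeasure (msum M N) (space (msum M N)) \<noteq> \<infinity>"
  using assms finite_measure.emeasure_finite[of M] finite_measure.emeasure_finite[of N]
  by (simp add: emeasure_msum)
qed

text \<open>Applied with \<open>L = msum M N\<close>, relative to which both summands have real
  densities; comparing measures then becomes comparing functions.\<close>

lemma finite_measure_density:
 assumes "finite_measure N" "sets N = sets L" "finite_measure L" "absolutely_continuous L N"
 obtains f :: "'b => real" where "f \<in> bm L" "\<And>x. 0 <= f x" "integrable L f" "density L f = N"
proof -
 interpret L: finite_measure L by fact
 obtain D where D: "D \<in> bm L" "AE x in L. RN_deriv L N x = ennreal (D x)" "\<And>x. 0 <= D x"
  using L.real_RN_deriv[OF assms(1,4,2)] by metis
 have "density L (\<lambda>x. ennreal (D x)) = density L (RN_deriv L N)"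
  using D by (intro density_cong) auto
 then have dens: "density L D = N" using L.density_RN_deriv[OF assms(4,2)] by simp
 have "integrable L D"
 proof (rule integrableI_bounded)
  have "(\<integral>\<^sup>+ x. ennreal (norm (D x)) \<partial>L) = emeasure (density L D) (space L)"
   using D by (subst emeasure_density) (auto intro!: nn_integral_cong)
  also have "... < \<infinity>" using dens finite_measure.emeasure_finite[OF assms(1)] by (simp add: less_top)
  finally show "(\<integral>\<^sup>+ x. ennreal (norm (D x)) \<partial>L) < \<infinity>" .
 qed (use D in auto)
 with dens D show ?thesis using that by metis
qed

lemma absolutely_continuous_msum:
 assumes "sets N = sets M" shows "absolutely_continuous (msum M N) M" "absolutely_continuous (msum M N) N"
 using assms by (auto simp: absolutely_continuous_def null_sets_def emeasure_msum)

lemma integral_msum: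
 fixes h :: "'b => real"
 assumes "finite_measure M" "finite_measure N" "sets N = sets M" "h \<in> bm M" "\<And>x. \<bar>h x\<bar> <= C"
 shows "(\<integral>x. h x \<partial>msum M N) = (\<integral>x. h x \<partial>M) + (\<integral>x. h x \<partial>N)"
proof -
 define L where "L = msum M N"
 have L: "finite_measure L" "sets L = sets M" using assms by (auto simp: L_def finite_measure_msum)
 then have N: "sets N = sets L" "sets M = sets L" using assms by auto
 obtain f where f: "f \<in> bm L" "\<And>x. 0 <= f x" "integrable L f" "density L f = M"
  using finite_measure_density[OF assms(1) N(2) L(1)] absolutely_continuous_msum assms L_def by metis
 obtain g where g: "g \<in> bm L" "\<And>x. 0 <= g x" "integrable L g" "density L g = N"
  using finite_measure_density[OF assms(2) N(1) L(1)] absolutely_continuous_msum assms L_def by metis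
 have h[measurable]: "h \<in> bm L" using assms N by (simp cong: measurable_cong_sets)
 note f(1)[measurable] g(1)[measurable]
 \<comment> \<open>That \<open>f + g\<close> equals one almost everywhere is never extracted; it is
   enough that its density reproduces \<open>L\<close>.\<close>
 have "density L (\<lambda>x. f x + g x) = L"
 proof (rule measure_eqI)
  fix A assume "A \<in> sets (density L (\<lambda>x. ennreal (f x + g x)))"
  then have A[measurable]: "A \<in> sets L" by simp
  have "emeasure (density L (\<lambda>x. ennreal (f x + g x))) A = (\<integral>\<^sup>+x. ennreal (f x) * indicator A x + ennreal (g x) * indicator A x \<partial>L)"
   using f g by (subst emeasure_density) (auto intro!: nn_integral_cong simp: distrib_right)
  also have "... = emeasure (density L f) A + emeasure (density L g) A"
   by (subst nn_integral_add) (auto simp: emeasure_density)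
  also have "... = emeasure L A"
   using f(4) g(4) A L assms by (simp add: L_def emeasure_msum)
  finally show "emeasure (density L (\<lambda>x. ennreal (f x + g x))) A = emeasure L A" .
 qed simp
 then have "(\<integral>x. h x \<partial>L) = (\<integral>x. h x \<partial>density L (\<lambda>x. ennreal (f x + g x)))" by simp
 also have "... = (\<integral>x. (f x + g x) * h x \<partial>L)"
  using f g by (subst integral_density) auto
 also have "... = (\<integral>x. f x * h x \<partial>L) + (\<integral>x. g x * h x \<partial>L)"
 proof -
  have "integrable L (\<lambda>x. k x * h x)" if "integrable L k" for k
  proof (rule Bochner_Integration.integrable_bound[of L "\<lambda>x. C * k x" "\<lambda>x. k x * h x"])
   have "\<bar>k x * h x\<bar> <= \<bar>C * k x\<bar>" for x
    using mult_right_mono[of "\<bar>h x\<bar>" "\<bar>C\<bar>" "\<bar>k x\<bar>"] assms(5)[of x] by (simp add: abs_mult mult.commute)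
   then show "AE x in L. norm (k x * h x) <= norm (C * k x)" by simp
  qed (use that in auto)
  then show ?thesis using f g by (simp add: distrib_right)
 qed
 also have "... = (\<integral>x. h x \<partial>density L f) + (\<integral>x. h x \<partial>density L g)"
  using f(1,2) g(1,2) by (simp add: integral_density)
 finally show ?thesis using f(4) g(4) by (simp add: L_def)
qed

text \<open>Jordan decomposition of \<open>M - N\<close>. With densities \<open>f\<close>,
  \<open>g\<close> relative to the sum, the positive and negative parts of \<open>f - g\<close> are
  the densities of \<open>p\<close> and \<open>n\<close>, and \<open>S\<close> is the set where
  \<open>f \<le> g\<close>. The clause on common null sets later keeps the pair concentrated on
  \<open>[-\<tau>, 0]\<close>.\<close>

lemma singular_decomposition:
 fixes M N :: "'b measure"
 assumes M: "finite_measure M" and N: "finite_measure N" and MN: "sets N = sets M"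
 obtains p n S where "sets p = sets M" "sets n = sets M" "finite_measure p" "finite_measure n"
  "S \<in> sets M" "emeasure p S = 0" "emeasure n (space M - S) = 0"
  "\<And>A. A \<in> sets M ==> emeasure M A = 0 ==> emeasure N A = 0 ==> emeasure p A = 0 \<and> emeasure n A = 0"
  "\<And>(h::'b => real) C. h \<in> bm M ==> (\<And>x. \<bar>h x\<bar> <= C) ==>
    (\<integral>x. h x \<partial>p) - (\<integral>x. h x \<partial>n) = (\<integral>x. h x \<partial>M) - (\<integral>x. h x \<partial>N)"
proof -
 define L where "L = msum M N"
 have L: "finite_measure L" "sets L = sets M" using assms by (auto simp: L_def finite_measure_msum)
 then have NL: "sets N = sets L" "sets M = sets L" using assms by auto
 have sp: "space M = space L" using L sets_eq_imp_space_eq by blast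
 obtain f where f: "f \<in> bm L" "\<And>x. 0 <= f x" "integrable L f" "density L f = M"
  using finite_measure_density[OF assms(1) NL(2) L(1)] absolutely_continuous_msum assms L_def by metis
 obtain g where g: "g \<in> bm L" "\<And>x. 0 <= g x" "integrable L g" "density L g = N"
  using finite_measure_density[OF assms(2) NL(1) L(1)] absolutely_continuous_msum assms L_def by metis
 note f(1)[measurable] g(1)[measurable]
 define p where "p = density L (\<lambda>x. ennreal (max 0 (f x - g x)))"
 define n where "n = density L (\<lambda>x. ennreal (max 0 (g x - f x)))"
 define S where "S = {x\<in>space L. f x <= g x}"
 have S[measurable]: "S \<in> sets L" unfolding S_def by measurable
 have fin: "finite_measure (density L (\<lambda>x. ennreal (max 0 (k x - l x))))"
  if "k \<in> bm L" "l \<in> bm L" "integrable L k" "\<And>x. 0 <= k x" "\<And>x. 0 <= l x" for k l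
 proof
  note [measurable] = that(1,2)
  have "emeasure (density L (\<lambda>x. ennreal (max 0 (k x - l x)))) (space L) <= (\<integral>\<^sup>+x. ennreal (k x) \<partial>L)"
   using that by (subst emeasure_density) (auto intro!: nn_integral_mono split: split_indicator)
  also have "... < \<infinity>" using that(3,4) by (simp add: integrable_iff_bounded)
  finally show "emeasure (density L (\<lambda>x. ennreal (max 0 (k x - l x)))) (space (density L (\<lambda>x. ennreal (max 0 (k x - l x))))) \<noteq> \<infinity>"
   by simp
 qed
 show ?thesis
 proof (rule that[of p n S])
  show "sets p = sets M" "sets n = sets M" using L by (auto simp: p_def n_def)
  show "finite_measure p" "finite_measure n"
   unfolding p_def n_def by (rule fin[OF f(1) g(1) f(3,2) g(2)], rule fin[OF g(1) f(1) g(3,2) f(2)])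
  show "S \<in> sets M" using S L by simp
  have "(\<integral>\<^sup>+x. ennreal (max 0 (f x - g x)) * indicator S x \<partial>L) = (\<integral>\<^sup>+x. 0 \<partial>L)"
   by (intro nn_integral_cong) (auto simp: S_def ennreal_neg split: split_indicator)
  then show "emeasure p S = 0" unfolding p_def by (subst emeasure_density) auto
  have "(\<integral>\<^sup>+x. ennreal (max 0 (g x - f x)) * indicator (space L - S) x \<partial>L) = (\<integral>\<^sup>+x. 0 \<partial>L)"
   by (intro nn_integral_cong) (auto simp: S_def ennreal_neg split: split_indicator)
  then show "emeasure n (space M - S) = 0" unfolding n_def sp by (subst emeasure_density) auto
  fix A assume A: "A \<in> sets M" "emeasure M A = 0" "emeasure N A = 0"
  then have "A \<in> null_sets L" using MN L by (auto simp: L_def emeasure_msum)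
  then have "A \<in> null_sets p" "A \<in> null_sets n"
   using absolutely_continuousI_density[of "\<lambda>x. ennreal (max 0 (f x - g x))" L]
    absolutely_continuousI_density[of "\<lambda>x. ennreal (max 0 (g x - f x))" L]
   unfolding p_def n_def absolutely_continuous_def by auto
  then show "emeasure p A = 0 \<and> emeasure n A = 0" by auto
 next
  fix h :: "'b => real" and C assume h: "h \<in> bm M" "\<And>x. \<bar>h x\<bar> <= C"
  have h'[measurable]: "h \<in> bm L" using h(1) L by (simp cong: measurable_cong_sets)
  have int: "integrable L (\<lambda>x. k x * h x)" if "integrable L k" for k
  proof (rule Bochner_Integration.integrable_bound[of L "\<lambda>x. C * k x" "\<lambda>x. k x * h x"])
   have "\<bar>k x * h x\<bar> <= \<bar>C * k x\<bar>" for x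
    using mult_right_mono[of "\<bar>h x\<bar>" "\<bar>C\<bar>" "\<bar>k x\<bar>"] h(2)[of x] by (simp add: abs_mult mult.commute)
   then show "AE x in L. norm (k x * h x) <= norm (C * k x)" by simp
  qed (use that in auto)
  have mx: "integrable L (\<lambda>x. max 0 (f x - g x))" "integrable L (\<lambda>x. max 0 (g x - f x))"
   using f g by auto
  have "(\<integral>x. h x \<partial>p) - (\<integral>x. h x \<partial>n) = (\<integral>x. max 0 (f x - g x) * h x \<partial>L) - (\<integral>x. max 0 (g x - f x) * h x \<partial>L)"
   unfolding p_def n_def by (subst (1 2) integral_density) auto
  also have "... = (\<integral>x. max 0 (f x - g x) * h x - max 0 (g x - f x) * h x \<partial>L)"
   by (rule Bochner_Integration.integral_diff[symmetric]) (intro int mx)+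
  also have "... = (\<integral>x. f x * h x - g x * h x \<partial>L)"
   by (intro Bochner_Integration.integral_cong) (auto simp: max_def algebra_simps)
  also have "... = (\<integral>x. f x * h x \<partial>L) - (\<integral>x. g x * h x \<partial>L)"
   by (intro Bochner_Integration.integral_diff int f g)
  also have "... = (\<integral>x. h x \<partial>density L f) - (\<integral>x. h x \<partial>density L g)"
   using f(1,2) g(1,2) by (simp add: integral_density)
  finally show "(\<integral>x. h x \<partial>p) - (\<integral>x. h x \<partial>n) = (\<integral>x. h x \<partial>M) - (\<integral>x. h x \<partial>N)"
   using f g by simp
 qed
qed

text \<open>\<open>p\<close> lives off \<open>S\<close>, where \<open>n\<close> vanishes, so
  \<open>eq\<close> gives \<open>p \<le> p'\<close> there and hence everywhere. The situation is
  symmetric, so \<open>p = p'\<close>, and finiteness of \<open>p\<close> allows it to be cancelled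
  from \<open>eq\<close>.\<close>

lemma singular_unique:
 fixes p n p' n' :: "'b measure"
 assumes sets: "sets n = sets p" "sets p' = sets p" "sets n' = sets p"
  and fin: "finite_measure p" "finite_measure n" "finite_measure p'" "finite_measure n'"
  and S: "S \<in> sets p" "emeasure p S = 0" "emeasure n (space p - S) = 0"
  and S': "S' \<in> sets p" "emeasure p' S' = 0" "emeasure n' (space p - S') = 0"
  and eq: "\<And>A. A \<in> sets p ==> emeasure p A + emeasure n' A = emeasure p' A + emeasure n A"
 shows "p = p'" "n = n'"
proof -
 have le: "emeasure p A <= emeasure p' A"
  if "S \<in> sets p" "emeasure p S = 0" "emeasure n (space p - S) = 0" "A \<in> sets p"
   "sets n = sets p" "sets p' = sets p" "sets n' = sets p"
   "\<And>A. A \<in> sets p ==> emeasure p A + emeasure n' A = emeasure p' A + emeasure n A"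
  for p n p' n' :: "'b measure" and S A
 proof -
  have "emeasure p A <= emeasure p (A - S) + emeasure p S"
  proof -
   have "emeasure p A <= emeasure p ((A - S) \<union> S)" using that by (intro emeasure_mono) auto
   also have "... <= emeasure p (A - S) + emeasure p S" using that by (intro emeasure_subadditive) auto
   finally show ?thesis .
  qed
  then have "emeasure p A <= emeasure p (A - S)" using that by simp
  also have "... <= emeasure p' (A - S) + emeasure n (A - S)"
   using that(8)[of "A - S"] that(1,4) by (metis le_iff_add sets.Diff)
  also have "emeasure n (A - S) <= emeasure n (space p - S)"
   using that(1,4,5) sets.sets_into_space[OF that(4)] by (intro emeasure_mono) auto
  then have "emeasure n (A - S) = 0" using that by simp
  also have "emeasure p' (A - S) + 0 <= emeasure p' A"
   using that by (auto intro!: emeasure_mono)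
  finally show ?thesis by simp
 qed
 have sp: "space p = space p'" "space n = space p" "space n' = space p" using sets sets_eq_imp_space_eq by metis+
 have pp: "emeasure p A = emeasure p' A" if "A \<in> sets p" for A
 proof (rule antisym)
  show "emeasure p A <= emeasure p' A" using le[of S p n A p' n'] S sets eq that by simp
  show "emeasure p' A <= emeasure p A" proof (rule le[of S' p' n' A p n])
   show "emeasure p' B + emeasure n B = emeasure p B + emeasure n' B" if "B \<in> sets p'" for B
    using eq[of B] that sets by metis
   show "emeasure n' (space p' - S') = 0" using S' sp by simp
  qed (use S' sets that in simp_all)
 qed
 then show "p = p'" using sets by (intro measure_eqI) auto
 show "n = n'"
 proof (rule measure_eqI)
  fix A assume "A \<in> sets n"
  then have "A \<in> sets p" using sets by simp
  then have "emeasure p A + emeasure n' A = emeasure p A + emeasure n A" using eq[of A] pp[of A] by simp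
  then show "emeasure n A = emeasure n' A"
   using finite_measure.emeasure_finite[OF fin(1), of A] by (simp add: ennreal_add_left_cancel)
 qed (use sets in simp)
qed

text \<open>The ramps of slope \<open>m\<close> starting at \<open>x\<close> and capped at one are
  paths that increase to the indicator of the half-line beyond \<open>x\<close>; these half-lines
  determine finite measures.\<close>

lemma cf_C_determines_measure:
 fixes p n p' n' :: "real measure"
 assumes \<tau>: "0 <= \<tau>"
  and sets: "sets p = sets borel" "sets n = sets borel" "sets p' = sets borel" "sets n' = sets borel"
  and fin: "finite_measure p" "finite_measure n" "finite_measure p'" "finite_measure n'"
  and supp: "emeasure p (- {-\<tau>..0}) = 0" "emeasure n (- {-\<tau>..0}) = 0"
   "emeasure p' (- {-\<tau>..0}) = 0" "emeasure n' (- {-\<tau>..0}) = 0"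
  and eq: "\<And>h. h \<in> cf_C \<tau> ==> (\<integral>x. ap h x \<partial>p) + (\<integral>x. ap h x \<partial>n') =
    (\<integral>x. ap h x \<partial>p') + (\<integral>x. ap h x \<partial>n)"
  and A: "A \<in> sets borel"
 shows "emeasure p A + emeasure n' A = emeasure p' A + emeasure n A"
proof -
 have tail: "measure p {x<..} + measure n' {x<..} = measure p' {x<..} + measure n {x<..}" for x
 proof -
  define h where "h m = cfun \<tau> (\<lambda>y. min 1 (real m * max 0 (y - x)))" for m
  have hC: "h m \<in> cf_C \<tau>" for m unfolding h_def
   by (intro cfun_in_C \<tau>) (auto intro!: continuous_intros)
  have ha: "ap (h m) y = min 1 (real m * max 0 (clampw \<tau> y - x))" for m y
   unfolding h_def by (subst cfun_apply[OF \<tau>]) (auto intro!: continuous_intros)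
  have lim: "(\<lambda>m. \<integral>y. ap (h m) y \<partial>q) \<longlonglongrightarrow> measure q {x<..}"
   if q: "sets q = sets borel" "finite_measure q" "emeasure q (- {-\<tau>..0}) = 0" for q
  proof -
   interpret finite_measure q by fact
   have AE: "AE y in q. y \<in> {-\<tau>..0}"
    by (rule AE_I'[of "- {-\<tau>..0}"]) (use q in auto)
   have "(\<lambda>m. \<integral>y. ap (h m) y \<partial>q) \<longlonglongrightarrow> (\<integral>y. indicator {x<..} y \<partial>q)"
   proof (rule integral_dominated_convergence[where w="\<lambda>_. 1"])
    show "AE y in q. (\<lambda>m. ap (h m) y) \<longlonglongrightarrow> indicator {x<..} y"
     using AE
    proof eventually_elim
     case (elim y)
     show ?case
     proof (cases "x < y")
      case True
      obtain N where N: "1 / (y - x) < real N" using reals_Archimedean2 by blast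
      have "ap (h m) y = 1" if "m \<ge> N" for m
      proof -
       have "1 / (y - x) <= real m" using N that by linarith
       then show ?thesis using True elim by (auto simp: ha clampw_id field_simps)
      qed
      then show ?thesis using True
       by (intro tendsto_eventually) (auto simp: eventually_sequentially)
     qed (use elim in \<open>auto simp: ha clampw_id\<close>)
    qed
    have "continuous_on UNIV (ap (h m))" for m by simp
    then show "ap (h m) \<in> bm q" for m
     using q(1) by (simp add: borel_measurable_continuous_onI cong: measurable_cong_sets)
    show "(indicator {x<..} :: real => real) \<in> bm q"
     using q(1) by (simp cong: measurable_cong_sets)
    show "AE y in q. norm (ap (h m) y) <= 1" for m
     by (auto simp: ha)
   qed auto
   then show ?thesis using q(1) sets_eq_imp_space_eq[OF q(1)] by simp
  qed
  have "(\<lambda>m. (\<integral>y. ap (h m) y \<partial>p) + (\<integral>y. ap (h m) y \<partial>n')) \<longlonglongrightarrow> measure p {x<..} + measure n' {x<..}"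
   by (intro tendsto_add lim sets fin supp)
  moreover have "(\<lambda>m. (\<integral>y. ap (h m) y \<partial>p) + (\<integral>y. ap (h m) y \<partial>n')) \<longlonglongrightarrow> measure p' {x<..} + measure n {x<..}"
   unfolding eq[OF hC] by (intro tendsto_add lim sets fin supp)
  ultimately show ?thesis by (rule LIMSEQ_unique)
 qed
 have "msum p n' = msum p' n"
 proof (rule measure_eqI_lessThan)
  fix x
  show "emeasure (msum p n') {x<..} < \<infinity>"
   using finite_measure.emeasure_finite[OF finite_measure_msum[of p n']] sets fin by (simp add: less_top)
  show "emeasure (msum p n') {x<..} = emeasure (msum p' n) {x<..}"
   using tail[of x] sets fin
   by (simp add: emeasure_msum finite_measure.emeasure_eq_measure ennreal_plus[symmetric] del: ennreal_plus)
 qed (use sets in auto)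
 then show ?thesis using A sets by (metis emeasure_msum)
qed

section \<open>Representing measures as weak limits of discrete ones\<close>

lemma discrete_distribution:
 fixes w x :: "nat => real"
 assumes "\<And>k. k <= n ==> 0 <= w k" "(\<Sum>k\<le>n. w k) = 1"
 obtains p where "real_distribution p"
  "\<And>h::real => real. h \<in> bm borel ==> (\<integral>y. h y \<partial>p) = (\<Sum>k\<le>n. w k * h (x k))"
proof -
 define w' where "w' k = (if k <= n then w k else 0)" for k
 have "(\<integral>\<^sup>+k. ennreal (w' k) \<partial>count_space UNIV) = (\<Sum>k\<le>n. ennreal (w' k))"
  by (rule nn_integral_count_space') (auto simp: w'_def)
 also have "... = ennreal (\<Sum>k\<le>n. w' k)" using assms by (intro sum_ennreal) (auto simp: w'_def)
 also have "(\<Sum>k\<le>n. w' k) = 1" using assms by (simp add: w'_def)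
 finally have 1: "(\<integral>\<^sup>+k. ennreal (w' k) \<partial>count_space UNIV) = 1" by simp
 have pm: "pmf (embed_pmf w') k = w' k" for k
  by (rule pmf_embed_pmf) (use assms 1 in \<open>auto simp: w'_def\<close>)
 show ?thesis
 proof (rule that[of "distr (embed_pmf w') borel x"])
  show "real_distribution (distr (embed_pmf w') borel x)"
   by (rule prob_space.real_distribution_distr) (auto intro: prob_space_measure_pmf)
  fix h :: "real => real" assume h: "h \<in> bm borel"
  have "(\<integral>y. h y \<partial>distr (embed_pmf w') borel x) = (\<integral>k. h (x k) \<partial>embed_pmf w')"
   by (rule integral_distr) (use h in auto)
  also have "... = (\<Sum>k\<le>n. h (x k) * pmf (embed_pmf w') k)"
   by (rule integral_measure_pmf_real) (auto simp: set_pmf_eq pm w'_def split: if_splits)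
  finally show "(\<integral>y. h y \<partial>distr (embed_pmf w') borel x) = (\<Sum>k\<le>n. w k * h (x k))"
   by (simp add: pm w'_def mult.commute)
 qed
qed

text \<open>The prescribed sequence \<open>s\<close> makes it possible to extract a second family
  along the subsequence already found for the first.\<close>

lemma tight_limit:
 fixes p :: "nat => real measure"
 assumes "\<And>n. real_distribution (p n)" "\<And>n. measure (p n) {l<..u} = 1" "l < (u::real)" "strict_mono s"
 obtains r q where "strict_mono (r :: nat => nat)" "real_distribution q" "weak_conv_m (p \<circ> s \<circ> r) q"
proof -
 have "tight p" unfolding tight_def
 proof (intro conjI allI impI)
  fix ep :: real assume "0 < ep"
  then show "\<exists>a b. a < b \<and> (\<forall>n. 1 - ep < measure (p n) {a<..b})"
   using assms by (intro exI[of _ l] exI[of _ u]) auto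
 qed (use assms in auto)
 then show ?thesis using tight_imp_convergent_subsubsequence[OF _ assms(4)] that by metis
qed

lemma isCont_apply_bcontfun: "isCont (ap h) y"
 using cont_apply_bcontfun[of UNIV h] by (metis UNIV_I continuous_on_eq_continuous_at open_UNIV)

lemma linear_sum_cf_C:
 assumes lin: "\<And>h k c. h \<in> cf_C \<tau> ==> k \<in> cf_C \<tau> ==> L (h + k) = L h + L k \<and> L (c *\<^sub>R h) = c * L h"
  and "\<And>i. i \<in> I ==> f i \<in> cf_C \<tau>"
 shows "L (\<Sum>i\<in>I. c i *\<^sub>R f i) = (\<Sum>i\<in>I. c i * L (f i))"
proof -
 have "L 0 = 0" using lin[of 0 0 0] by simp
 then show ?thesis using assms(2)
 proof (induction I rule: infinite_finite_induct)
  case (insert i I)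
  then show ?case
   using lin[of "f i" "f i" "c i"] lin[of "c i *\<^sub>R f i" "\<Sum>i\<in>I. c i *\<^sub>R f i"]
   by (simp add: cf_C_scaleR cf_C_sum)
 qed auto
qed

text \<open>On interpolants \<open>L\<close> is a finite sum of point evaluations whose coefficients
  have total absolute value at most \<open>K\<close>. Their positive and negative parts are discrete
  measures with masses that vary with \<open>n\<close>; an atom at 0 fills each up to the fixed mass
  \<open>K + 1\<close>, which is positive even if \<open>K = 0\<close>, and scaling gives
  probability measures to which Helly selection applies. The two fillings differ by the sum of all
  coefficients, which is \<open>L one\<close> for every \<open>n\<close>, so the correction in the
  limit is a fixed multiple of evaluation at 0.\<close>

lemma riesz_cf_C:
 assumes \<tau>: "0 < \<tau>"
  and lin: "\<And>h k c. h \<in> cf_C \<tau> ==> k \<in> cf_C \<tau> ==> L (h + k) = L h + L k \<and> L (c *\<^sub>R h) = c * L h"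
  and bdd: "\<And>h. h \<in> cf_C \<tau> ==> \<bar>L h\<bar> <= K * norm h"
 obtains \<mu> \<nu> where "sets \<mu> = sets borel" "sets \<nu> = sets borel" "finite_measure \<mu>" "finite_measure \<nu>"
  "emeasure \<mu> (- {-\<tau>..0}) = 0" "emeasure \<nu> (- {-\<tau>..0}) = 0"
  "\<And>h. h \<in> cf_C \<tau> ==> L h = (\<integral>x. ap h x \<partial>\<mu>) - (\<integral>x. ap h x \<partial>\<nu>)"
proof -
 note sum.atMost_Suc[simp del]
 define x where "x n k = -\<tau> + real k * \<tau> / real n" for n k
 define one where "one = cfun \<tau> (\<lambda>_. 1)"
 have onea: "ap one y = 1" for y unfolding one_def by (subst cfun_apply) (use \<tau> in auto)
 have K0: "0 <= K"
 proof -
  have "0 < norm one" using onea by (metis apply_bcontfun_inject zero_bcontfun.rep_eq zero_less_norm_iff zero_neq_one)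
  moreover have "one \<in> cf_C \<tau>" unfolding one_def by (rule cfun_in_C) (use \<tau> in auto)
  ultimately show ?thesis using bdd[of one] by (smt (verit) mult_neg_pos)
 qed
 define c where "c n k = L (hat \<tau> n k)" for n k
 have Lint: "L (interp \<tau> n v) = (\<Sum>k\<le>n. v k * c n k)" for n v
  unfolding interp_def c_def by (rule linear_sum_cf_C[OF lin]) (auto intro: hat_in_C[OF \<tau>])
 have abs_c: "(\<Sum>k\<le>n. \<bar>c n k\<bar>) <= K" for n
 proof -
  \<comment> \<open>The test path carries the signs of the coefficients and has norm at most
    one.\<close>
  have "(\<Sum>k\<le>n. \<bar>c n k\<bar>) = L (interp \<tau> n (\<lambda>k. sgn (c n k)))"
   unfolding Lint by (intro sum.cong) (auto simp: abs_sgn mult.commute)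
  also have "... <= K * norm (interp \<tau> n (\<lambda>k. sgn (c n k)))"
   using bdd[OF interp_in_C[OF \<tau>]] by (metis abs_le_D1)
  also have "... <= K * 1" by (intro mult_left_mono norm_interp_le \<tau> K0) (auto simp: abs_sgn_eq)
  finally show ?thesis by simp
 qed
 have dist: "\<exists>p. real_distribution p \<and> (\<forall>h::real => real. h \<in> bm borel \<longrightarrow>
   (K + 1) * (\<integral>y. h y \<partial>p) = (\<Sum>k\<le>n. v k * h (x n k)) + (K + 1 - (\<Sum>k\<le>n. v k)) * h 0)
   \<and> measure p {-\<tau>-1<..1} = 1"
  if n: "0 < n" and v: "\<And>k. 0 <= v k" "(\<Sum>k\<le>n. v k) <= K" for n v
 proof -
  \<comment> \<open>The last node is the point 0, so the filling mass is added to its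
    weight.\<close>
  define w where "w k = (v k + (if k = n then K + 1 - (\<Sum>k\<le>n. v k) else 0)) / (K + 1)" for k
  have sum: "(\<Sum>k\<le>n. w k * g k) = ((\<Sum>k\<le>n. v k * g k) + (K + 1 - (\<Sum>k\<le>n. v k)) * g n) / (K + 1)" for g
  proof -
   have "w k * g k = (v k * g k + (if k = n then (K + 1 - (\<Sum>k\<le>n. v k)) * g k else 0)) / (K + 1)" for k
    by (simp add: w_def field_simps)
   then show ?thesis by (simp add: sum_divide_distrib[symmetric] sum.distrib)
  qed
  have xn: "x n n = 0" using n by (simp add: x_def)
  obtain p where p: "real_distribution p"
   "\<And>h::real => real. h \<in> bm borel ==> (\<integral>y. h y \<partial>p) = (\<Sum>k\<le>n. w k * h (x n k))"
  proof (rule discrete_distribution[of n w "x n"])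
   show "0 <= w k" for k using v K0 by (auto simp: w_def)
   show "(\<Sum>k\<le>n. w k) = 1" using sum[of "\<lambda>_. 1"] K0 by simp
  qed blast
  interpret p: real_distribution p by (rule p)
  \<comment> \<open>Tightness is phrased with half-open intervals; a margin of one on either side of
    \<open>[-\<tau>, 0]\<close> accommodates this.\<close>
  have xin: "x n k \<in> {-\<tau>-1<..1}" if "k <= n" for k
  proof -
   have "real k * \<tau> <= real n * \<tau>" "0 <= real k * \<tau> / real n" using that \<tau> by (auto intro: mult_right_mono)
   then have "real k * \<tau> / real n <= \<tau>" using n by (simp add: field_simps)
   with \<open>0 <= real k * \<tau> / real n\<close> show ?thesis by (simp add: x_def)
  qed
  have "measure p {-\<tau>-1<..1} = (\<integral>y. indicator {-\<tau>-1<..1} y \<partial>p)" by simp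
  also have "... = (\<Sum>k\<le>n. w k * indicator {-\<tau>-1<..1} (x n k))" by (rule p) auto
  also have "... = (\<Sum>k\<le>n. w k * 1)" using xin by (intro sum.cong) auto
  also have "... = 1" using sum[of "\<lambda>_. 1"] K0 by simp
  finally have "measure p {-\<tau>-1<..1} = 1" .
  moreover have "(K + 1) * (\<integral>y. h y \<partial>p) = (\<Sum>k\<le>n. v k * h (x n k)) + (K + 1 - (\<Sum>k\<le>n. v k)) * h 0"
   if "h \<in> bm borel" for h :: "real => real"
   using p(2)[OF that] sum[of "\<lambda>k. h (x n k)"] K0 xn by simp
  ultimately show ?thesis using p(1) by blast
 qed
 define cp where "cp n k = max 0 (c n k)" for n k
 define cm where "cm n k = max 0 (- c n k)" for n k
 have cpm: "(\<Sum>k\<le>n. cp n k) <= K" "(\<Sum>k\<le>n. cm n k) <= K" for n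
 proof -
  have "(\<Sum>k\<le>n. cp n k) <= (\<Sum>k\<le>n. \<bar>c n k\<bar>)" by (intro sum_mono) (simp add: cp_def)
  then show "(\<Sum>k\<le>n. cp n k) <= K" using abs_c[of n] by linarith
  have "(\<Sum>k\<le>n. cm n k) <= (\<Sum>k\<le>n. \<bar>c n k\<bar>)" by (intro sum_mono) (simp add: cm_def)
  then show "(\<Sum>k\<le>n. cm n k) <= K" using abs_c[of n] by linarith
 qed
 define P1 where "P1 n p \<longleftrightarrow> real_distribution p \<and> (\<forall>h::real => real. h \<in> bm borel \<longrightarrow>
   (K + 1) * (\<integral>y. h y \<partial>p) = (\<Sum>k\<le>Suc n. cp (Suc n) k * h (x (Suc n) k)) + (K + 1 - (\<Sum>k\<le>Suc n. cp (Suc n) k)) * h 0)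
   \<and> measure p {-\<tau>-1<..1} = 1" for n p
 define P2 where "P2 n p \<longleftrightarrow> real_distribution p \<and> (\<forall>h::real => real. h \<in> bm borel \<longrightarrow>
   (K + 1) * (\<integral>y. h y \<partial>p) = (\<Sum>k\<le>Suc n. cm (Suc n) k * h (x (Suc n) k)) + (K + 1 - (\<Sum>k\<le>Suc n. cm (Suc n) k)) * h 0)
   \<and> measure p {-\<tau>-1<..1} = 1" for n p
 have "\<exists>p. P1 n p" for n unfolding P1_def by (rule dist[OF _ _ cpm(1)]) (auto simp: cp_def)
 then obtain p where p: "\<And>n. P1 n (p n)" by metis
 have "\<exists>p. P2 n p" for n unfolding P2_def by (rule dist[OF _ _ cpm(2)]) (auto simp: cm_def)
 then obtain q where q: "\<And>n. P2 n (q n)" by metis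
 have lt: "-\<tau>-1 < (1::real)" using \<tau> by simp
 obtain r1 \<mu> where r1: "strict_mono (r1 :: nat => nat)" "real_distribution \<mu>" "weak_conv_m (p \<circ> id \<circ> r1) \<mu>"
  using tight_limit[OF _ _ lt strict_mono_id, of p] p unfolding P1_def by (metis (no_types, lifting))
 obtain r2 \<nu> where r2: "strict_mono (r2 :: nat => nat)" "real_distribution \<nu>" "weak_conv_m (q \<circ> r1 \<circ> r2) \<nu>"
  using tight_limit[OF _ _ lt r1(1), of q] q unfolding P2_def by (metis (no_types, lifting))
 interpret \<mu>: real_distribution \<mu> by (rule r1)
 interpret \<nu>: real_distribution \<nu> by (rule r2)
 define r where "r = r1 \<circ> r2"
 have rm: "strict_mono r" unfolding r_def using r1 r2 by (simp add: strict_mono_o)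
 have w1: "weak_conv_m (\<lambda>n. p (r n)) \<mu>"
 proof -
  have "weak_conv_m (\<lambda>n. p (r1 n)) \<mu>" using r1(3) by (simp add: comp_def)
  then show ?thesis unfolding weak_conv_m_def weak_conv_def r_def
   using LIMSEQ_subseq_LIMSEQ[OF _ r2(1)] by (auto simp: comp_def)
 qed
 have w2: "weak_conv_m (\<lambda>n. q (r n)) \<nu>" using r2(3) by (simp add: r_def comp_def)
 define \<ll> where "\<ll> = L one"
 have key: "L h = (K + 1) * (\<integral>y. ap h y \<partial>\<mu>) - (K + 1) * (\<integral>y. ap h y \<partial>\<nu>) + \<ll> * ap h 0"
  if h: "h \<in> cf_C \<tau>" for h
 proof -
  have hb: "ap h \<in> bm borel"
   by (intro borel_measurable_continuous_onI) simp
  define v where "v n = interp \<tau> (Suc n) (\<lambda>k. ap h (x (Suc n) k))" for n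
  have "v \<longlonglongrightarrow> h"
  proof (rule LIMSEQ_I)
   fix e :: real assume "0 < e"
   then obtain N where N: "\<And>n y z. n \<ge> N ==> 0 < n ==> y \<in> {-\<tau>..0} ==> z \<in> {-\<tau>..0} ==> \<bar>y - z\<bar> <= \<tau> / real n ==>
     \<bar>ap h y - ap h z\<bar> <= e / 3"
    using cf_C_osc[OF \<tau>, of "e/3" h] by auto
   have "norm (v n - h) <= 2 * (e/3)" if "n \<ge> N" for n
    unfolding v_def
   proof (rule interp_approx[OF \<tau> _ h])
    show "\<bar>ap h y - ap h z\<bar> <= e / 3"
     if "y \<in> {-\<tau>..0}" "z \<in> {-\<tau>..0}" "\<bar>y - z\<bar> <= \<tau> / real (Suc n)" for y z
     by (rule N[of "Suc n"]) (use that \<open>n \<ge> N\<close> in auto)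
   qed (use \<open>0 < e\<close> in \<open>auto simp: x_def\<close>)
   moreover have "2 * (e/3) < e" using \<open>0 < e\<close> by simp
   ultimately show "\<exists>no. \<forall>n\<ge>no. norm (v n - h) < e" by (meson le_less_trans)
  qed
  have Lv: "(\<lambda>n. L (v n)) \<longlonglongrightarrow> L h"
  proof (rule LIM_zero_cancel, rule Lim_null_comparison[OF always_eventually])
   show "\<forall>n. norm (L (v n) - L h) <= K * norm (v n - h)"
   proof
    fix n
    have vC: "v n \<in> cf_C \<tau>" unfolding v_def by (rule interp_in_C[OF \<tau>])
    have "L (v n + (-1) *\<^sub>R h) = L (v n) + L ((-1) *\<^sub>R h)" "L ((-1) *\<^sub>R h) = -1 * L h"
     using lin[OF vC cf_C_scaleR[OF h, of "-1"]] lin[OF h h, of "-1"] by blast+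
    moreover have e: "v n - h = v n + (-1) *\<^sub>R h" by simp
    have "L (v n - h) = L (v n + (-1) *\<^sub>R h)" by (rule arg_cong[OF e])
    ultimately have "L (v n) - L h = L (v n - h)" by linarith
    then show "norm (L (v n) - L h) <= K * norm (v n - h)" using bdd[OF cf_C_diff[OF vC h]] by simp
   qed
   have "(\<lambda>n. K * norm (v n - h)) \<longlonglongrightarrow> K * norm (h - h)" by (intro tendsto_intros \<open>v \<longlonglongrightarrow> h\<close>)
   then show "(\<lambda>n. K * norm (v n - h)) \<longlonglongrightarrow> 0" by simp
  qed
  have sum1: "(\<Sum>k\<le>Suc n. cp (Suc n) k) - (\<Sum>k\<le>Suc n. cm (Suc n) k) = \<ll>" for n
  proof -
   have "(\<Sum>k\<le>Suc n. cp (Suc n) k) - (\<Sum>k\<le>Suc n. cm (Suc n) k) = (\<Sum>k\<le>Suc n. 1 * c (Suc n) k)"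
    unfolding sum_subtractf[symmetric] by (intro sum.cong) (auto simp: cp_def cm_def max_def)
   also have "... = L (interp \<tau> (Suc n) (\<lambda>_. 1))" by (rule Lint[symmetric])
   also have "interp \<tau> (Suc n) (\<lambda>_. 1) = one"
    by (rule bcontfun_eqI) (simp only: interp_def apply_bcontfun_sum onea scaleR_one hat_sum[OF \<tau>])
   finally show ?thesis by (simp add: \<ll>_def)
  qed
  have Lvn: "L (v n) = (K + 1) * (\<integral>y. ap h y \<partial>p n) - (K + 1) * (\<integral>y. ap h y \<partial>q n) + \<ll> * ap h 0" for n
  proof -
   have "L (v n) = (\<Sum>k\<le>Suc n. cp (Suc n) k * ap h (x (Suc n) k)) - (\<Sum>k\<le>Suc n. cm (Suc n) k * ap h (x (Suc n) k))"
    unfolding v_def Lint sum_subtractf[symmetric] by (intro sum.cong) (auto simp: cp_def cm_def max_def)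
   also have "... = (K + 1) * (\<integral>y. ap h y \<partial>p n) - (K + 1) * (\<integral>y. ap h y \<partial>q n)
     + ((\<Sum>k\<le>Suc n. cp (Suc n) k) - (\<Sum>k\<le>Suc n. cm (Suc n) k)) * ap h 0"
    using p[of n] q[of n] hb unfolding P1_def P2_def by (simp only: left_diff_distrib)
   finally show ?thesis unfolding sum1 .
  qed
  have int: "(\<lambda>n. \<integral>y. ap h y \<partial>p (r n)) \<longlonglongrightarrow> (\<integral>y. ap h y \<partial>\<mu>)"
  proof (rule weak_conv_imp_integral_bdd_continuous_conv[where B="norm h"])
   show "real_distribution (p (r n))" for n using p unfolding P1_def by blast
   show "isCont (ap h) y" for y
    by (rule isCont_apply_bcontfun)
  qed (use w1 r1 norm_bounded[of h] in auto)
  have int': "(\<lambda>n. \<integral>y. ap h y \<partial>q (r n)) \<longlonglongrightarrow> (\<integral>y. ap h y \<partial>\<nu>)"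
  proof (rule weak_conv_imp_integral_bdd_continuous_conv[where B="norm h"])
   show "real_distribution (q (r n))" for n using q unfolding P2_def by blast
   show "isCont (ap h) y" for y
    by (rule isCont_apply_bcontfun)
  qed (use w2 r2 norm_bounded[of h] in auto)
  have "(\<lambda>n. L (v (r n))) \<longlonglongrightarrow> (K + 1) * (\<integral>y. ap h y \<partial>\<mu>) - (K + 1) * (\<integral>y. ap h y \<partial>\<nu>) + \<ll> * ap h 0"
   unfolding Lvn by (intro tendsto_intros int int')
  moreover have "(\<lambda>n. L (v (r n))) \<longlonglongrightarrow> L h" using LIMSEQ_subseq_LIMSEQ[OF Lv rm] by (simp add: comp_def)
  ultimately show ?thesis using LIMSEQ_unique by blast
 qed
 have cl: "clampw \<tau> \<in> bm borel"
  unfolding clampw_def by measurable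
 define d0 where "d0 = return (borel :: real measure) 0"
 have sc: "finite_measure (density M (\<lambda>_. ennreal s))" if "finite_measure M" for M :: "real measure" and s
  using that by (intro finite_measureI) (simp add: emeasure_density nn_integral_cmult ennreal_mult_eq_top_iff finite_measure.emeasure_finite)
 \<comment> \<open>The weak limits are only known as measures on the line. The image under
   \<open>clampw\<close> sits on \<open>[-\<tau>, 0]\<close> and integrates paths in
   \<open>cf_C \<tau>\<close> to the same value; the signed atom at 0 goes to one of the two
   measures according to its sign.\<close>
 define mk where "mk \<rho> s = msum (density (distr \<rho> borel (clampw \<tau>)) (\<lambda>_. ennreal (K + 1))) (density d0 (\<lambda>_. ennreal s))" for \<rho> s
 have mk: "sets (mk \<rho> s) = sets borel" "finite_measure (mk \<rho> s)" "emeasure (mk \<rho> s) (- {-\<tau>..0}) = 0"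
  "\<And>h. h \<in> cf_C \<tau> ==> (\<integral>y. ap h y \<partial>mk \<rho> s) = (K + 1) * (\<integral>y. ap h y \<partial>\<rho>) + s * ap h 0"
  if \<rho>: "real_distribution \<rho>" and s: "0 <= s" for \<rho> s
 proof -
  interpret \<rho>: real_distribution \<rho> by (rule \<rho>)
  have clm: "clampw \<tau> \<in> measurable \<rho> borel" using cl by simp
  have f1: "finite_measure (distr \<rho> borel (clampw \<tau>))" by (rule \<rho>.finite_measure_distr) (rule clm)
  have f2: "finite_measure d0" unfolding d0_def
   by (intro prob_space.finite_measure prob_space_return) simp
  show "sets (mk \<rho> s) = sets borel" by (simp add: mk_def)
  show "finite_measure (mk \<rho> s)" unfolding mk_def
   by (intro finite_measure_msum sc f1 f2) (simp add: d0_def)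
  have "emeasure (distr \<rho> borel (clampw \<tau>)) (- {-\<tau>..0}) = emeasure \<rho> (clampw \<tau> -` (- {-\<tau>..0}) \<inter> space \<rho>)"
   by (rule emeasure_distr) (use clm in auto)
  also have "clampw \<tau> -` (- {-\<tau>..0}) = {}" using clampw_in[of \<tau>] \<tau> by auto
  finally have e1: "emeasure (distr \<rho> borel (clampw \<tau>)) (- {-\<tau>..0}) = 0" by simp
  have e2: "emeasure d0 (- {-\<tau>..0}) = 0" using \<tau> by (simp add: d0_def)
  have e3: "emeasure (density M (\<lambda>_. ennreal u)) (- {-\<tau>..0}) = 0"
   if "emeasure M (- {-\<tau>..0}) = 0" "sets M = sets borel" for M u
   using that by (subst emeasure_density) (auto simp: nn_integral_cmult)
  show "emeasure (mk \<rho> s) (- {-\<tau>..0}) = 0" unfolding mk_def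
   by (subst emeasure_msum) (use e3[OF e1] e3[OF e2] in \<open>auto simp: d0_def\<close>)
  fix h assume h: "h \<in> cf_C \<tau>"
  have hb: "ap h \<in> bm borel"
   by (intro borel_measurable_continuous_onI) simp
  have "(\<integral>y. ap h y \<partial>mk \<rho> s) =
    (\<integral>y. ap h y \<partial>density (distr \<rho> borel (clampw \<tau>)) (\<lambda>_. ennreal (K + 1))) + (\<integral>y. ap h y \<partial>density d0 (\<lambda>_. ennreal s))"
   unfolding mk_def
   by (rule integral_msum[where C="norm h"]) (use sc f1 f2 hb norm_bounded[of h] in \<open>auto simp: d0_def\<close>)
  also have "(\<integral>y. ap h y \<partial>density (distr \<rho> borel (clampw \<tau>)) (\<lambda>_. ennreal (K + 1))) =
    (K + 1) * (\<integral>y. ap h y \<partial>distr \<rho> borel (clampw \<tau>))"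
   using hb K0 by (subst integral_density) auto
  also have "(\<integral>y. ap h y \<partial>distr \<rho> borel (clampw \<tau>)) = (\<integral>y. ap h y \<partial>\<rho>)"
   by (subst integral_distr) (use hb clm cf_C_clampw[OF _ h] \<tau> in auto)
  also have "(\<integral>y. ap h y \<partial>density d0 (\<lambda>_. ennreal s)) = s * ap h 0"
   using hb s by (subst integral_density) (auto simp: d0_def integral_return)
  finally show "(\<integral>y. ap h y \<partial>mk \<rho> s) = (K + 1) * (\<integral>y. ap h y \<partial>\<rho>) + s * ap h 0" .
 qed
 show ?thesis
 proof (rule that[of "mk \<mu> (max 0 \<ll>)" "mk \<nu> (max 0 (-\<ll>))"])
  fix h assume h: "h \<in> cf_C \<tau>"
  show "L h = (\<integral>y. ap h y \<partial>mk \<mu> (max 0 \<ll>)) - (\<integral>y. ap h y \<partial>mk \<nu> (max 0 (- \<ll>)))"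
   using key[OF h] mk(4)[OF r1(2) _ h, of "max 0 \<ll>"] mk(4)[OF r2(2) _ h, of "max 0 (-\<ll>)"]
   by (auto simp: max_def split: if_splits)
 qed (use mk[OF r1(2)] mk[OF r2(2)] in auto)
qed

section \<open>Frechet derivatives and their Jordan pairs\<close>

lemma cf_frechet_DERIV:
 assumes L: "cf_frechet \<tau> G \<eta> L" and h: "h \<in> cf_C \<tau>"
 shows "((\<lambda>c. G (\<eta> + c *\<^sub>R h)) has_real_derivative L h) (at 0)"
proof -
 have lin: "L (c *\<^sub>R h) = c * L h" for c using L h unfolding cf_frechet_def by blast
 show ?thesis
 proof (cases "h = 0")
  case True
  then have "L h = 0" using lin[of 0] by simp
  with True show ?thesis by simp
 next
  case False
  have lim: "((\<lambda>h. (G (\<eta> + h) - G \<eta> - L h) / norm h) \<longlongrightarrow> 0) (at 0 within cf_C \<tau>)"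
   using L unfolding cf_frechet_def by blast
  have "filterlim (\<lambda>c. c *\<^sub>R h) (at 0 within cf_C \<tau>) (at (0::real))"
   unfolding filterlim_at
  proof
   show "\<forall>\<^sub>F c in at (0::real). c *\<^sub>R h \<in> cf_C \<tau> \<and> c *\<^sub>R h \<noteq> 0"
    using False h by (auto simp: eventually_at_filter intro!: cf_C_scaleR always_eventually)
   have "((\<lambda>c. c *\<^sub>R h) \<longlongrightarrow> 0 *\<^sub>R h) (at (0::real))" by (intro tendsto_intros)
   then show "((\<lambda>c. c *\<^sub>R h) \<longlongrightarrow> 0) (at (0::real))" by simp
  qed
  then have "((\<lambda>c. (G (\<eta> + c *\<^sub>R h) - G \<eta> - L (c *\<^sub>R h)) / norm (c *\<^sub>R h)) \<longlongrightarrow> 0) (at 0)"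
   by (rule filterlim_compose[OF lim])
  then have "((\<lambda>c. \<bar>(G (\<eta> + c *\<^sub>R h) - G \<eta> - L (c *\<^sub>R h)) / norm (c *\<^sub>R h)\<bar> * norm h) \<longlongrightarrow> \<bar>0\<bar> * norm h) (at 0)"
   by (intro tendsto_intros)
  then have "((\<lambda>c. \<bar>(G (\<eta> + c *\<^sub>R h) - G \<eta> - L (c *\<^sub>R h)) / norm (c *\<^sub>R h)\<bar> * norm h) \<longlongrightarrow> 0) (at 0)" by simp
  then have "((\<lambda>c. \<bar>(G (\<eta> + c *\<^sub>R h) - G \<eta>) / c - L h\<bar>) \<longlongrightarrow> 0) (at 0)"
  proof (rule Lim_transform_eventually)
   have "\<bar>(G (\<eta> + c *\<^sub>R h) - G \<eta> - L (c *\<^sub>R h)) / norm (c *\<^sub>R h)\<bar> * norm h = \<bar>(G (\<eta> + c *\<^sub>R h) - G \<eta>) / c - L h\<bar>" if "c \<noteq> 0" for c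
   proof -
    have "(G (\<eta> + c *\<^sub>R h) - G \<eta>) / c - L h = (G (\<eta> + c *\<^sub>R h) - G \<eta> - L (c *\<^sub>R h)) / c"
     using that lin[of c] by (simp add: field_simps)
    then show ?thesis using that False by (simp add: abs_divide abs_mult)
   qed
   then show "\<forall>\<^sub>F c in at 0. \<bar>(G (\<eta> + c *\<^sub>R h) - G \<eta> - L (c *\<^sub>R h)) / norm (c *\<^sub>R h)\<bar> * norm h = \<bar>(G (\<eta> + c *\<^sub>R h) - G \<eta>) / c - L h\<bar>"
    by (auto simp: eventually_at_filter intro!: always_eventually)
  qed
  then have "((\<lambda>c. (G (\<eta> + c *\<^sub>R h) - G \<eta>) / c) \<longlongrightarrow> L h) (at 0)"
   using tendsto_rabs_zero_cancel LIM_zero_cancel by fastforce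
  then show ?thesis by (simp add: DERIV_def)
 qed
qed

text \<open>Along each line the derivative is an ordinary one. Uniqueness is limited to
  \<open>cf_C \<tau>\<close> because \<open>cf_frechet\<close> says nothing about \<open>L\<close>
  elsewhere.\<close>

lemma cf_frechet_unique: "cf_frechet \<tau> G \<eta> L ==> cf_frechet \<tau> G \<eta> L' ==> h \<in> cf_C \<tau> ==> L h = L' h"
 by (rule DERIV_unique[OF cf_frechet_DERIV cf_frechet_DERIV])

text \<open>Makes the definite description in \<open>cf_DF\<close> usable. Existence is Riesz
  followed by the Jordan decomposition. For uniqueness, two derivative functionals agree on paths,
  paths determine the difference of the measures, and mutual singularity then determines each
  measure.\<close>

lemma cf_DF_spec:
 assumes \<tau>: "0 < \<tau>" and diff: "cf_differentiable \<tau> (F t)" and \<eta>: "\<eta> \<in> cf_C \<tau>"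
 obtains L where "cf_frechet \<tau> (F t) \<eta> L" "cf_jordan_rep \<tau> L (fst (cf_DF \<tau> F t \<eta>)) (snd (cf_DF \<tau> F t \<eta>))"
proof -
 obtain L where L: "cf_frechet \<tau> (F t) \<eta> L" using diff \<eta> unfolding cf_differentiable_def by blast
 then obtain K where lin: "\<And>h k c. h \<in> cf_C \<tau> ==> k \<in> cf_C \<tau> ==> L (h + k) = L h + L k \<and> L (c *\<^sub>R h) = c * L h"
  and bdd: "\<And>h. h \<in> cf_C \<tau> ==> \<bar>L h\<bar> <= K * norm h" unfolding cf_frechet_def by blast
 obtain \<mu> \<nu> where m: "sets \<mu> = sets borel" "sets \<nu> = sets borel" "finite_measure \<mu>" "finite_measure \<nu>"
  "emeasure \<mu> (- {-\<tau>..0}) = 0" "emeasure \<nu> (- {-\<tau>..0}) = 0"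
  "\<And>h. h \<in> cf_C \<tau> ==> L h = (\<integral>x. ap h x \<partial>\<mu>) - (\<integral>x. ap h x \<partial>\<nu>)"
  using riesz_cf_C[OF \<tau> lin bdd] by metis
 obtain p n S where pn: "sets p = sets \<mu>" "sets n = sets \<mu>" "finite_measure p" "finite_measure n"
  "S \<in> sets \<mu>" "emeasure p S = 0" "emeasure n (space \<mu> - S) = 0"
  "\<And>A. A \<in> sets \<mu> ==> emeasure \<mu> A = 0 ==> emeasure \<nu> A = 0 ==> emeasure p A = 0 \<and> emeasure n A = 0"
  "\<And>(h::real => real) C. h \<in> bm \<mu> ==> (\<And>x. \<bar>h x\<bar> <= C) ==>
    (\<integral>x. h x \<partial>p) - (\<integral>x. h x \<partial>n) = (\<integral>x. h x \<partial>\<mu>) - (\<integral>x. h x \<partial>\<nu>)"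
  using singular_decomposition[OF m(3,4)] m(1,2) by metis
 have sp: "space \<mu> = UNIV" using m(1) sets_eq_imp_space_eq by fastforce
 have "cf_jordan_rep \<tau> L p n"
  unfolding cf_jordan_rep_def
 proof (intro conjI bexI[of _ S] ballI)
  fix h assume h: "h \<in> cf_C \<tau>"
  have "ap h \<in> bm \<mu>"
   using m(1) by (simp add: borel_measurable_continuous_onI cong: measurable_cong_sets)
  then show "L h = integral\<^sup>L p (ap h) - integral\<^sup>L n (ap h)"
   using m(7)[OF h] pn(9)[of "ap h" "norm h"] norm_bounded[of h] by simp
 qed (use m pn sp in \<open>auto simp: Compl_eq_Diff_UNIV\<close>)
 moreover have uniq: "(p1, n1) = (p, n)" if L1: "cf_frechet \<tau> (F t) \<eta> L1" and J1: "cf_jordan_rep \<tau> L1 p1 n1" for L1 p1 n1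
 proof -
  note J = J1[unfolded cf_jordan_rep_def]
  note J0 = \<open>cf_jordan_rep \<tau> L p n\<close>[unfolded cf_jordan_rep_def]
  obtain S1 where S1: "S1 \<in> sets borel" "emeasure p1 S1 = 0" "emeasure n1 (- S1) = 0" using J by blast
  obtain S0 where S0: "S0 \<in> sets borel" "emeasure p S0 = 0" "emeasure n (- S0) = 0" using J0 by blast
  have s1: "sets p1 = sets borel" "sets n1 = sets borel" and s0: "sets p = sets borel" "sets n = sets borel"
   and f1: "finite_measure p1" "finite_measure n1" and f0: "finite_measure p" "finite_measure n"
   and z1: "emeasure p1 (- {-\<tau>..0}) = 0" "emeasure n1 (- {-\<tau>..0}) = 0"
   and z0: "emeasure p (- {-\<tau>..0}) = 0" "emeasure n (- {-\<tau>..0}) = 0"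
   using J J0 by blast+
  have sp1: "space p1 = UNIV" using sets_eq_imp_space_eq[OF s1(1)] by simp
  have eq: "emeasure p1 A + emeasure n A = emeasure p A + emeasure n1 A" if "A \<in> sets borel" for A
  proof (rule cf_C_determines_measure[OF _ s1 s0 f1 f0 z1 z0 _ that])
   fix h assume h: "h \<in> cf_C \<tau>"
   have "L1 h = L h" by (rule cf_frechet_unique[OF L1 L h])
   moreover have "L1 h = (\<integral>x. ap h x \<partial>p1) - (\<integral>x. ap h x \<partial>n1)"
    "L h = (\<integral>x. ap h x \<partial>p) - (\<integral>x. ap h x \<partial>n)" using J J0 h by blast+
   ultimately show "(\<integral>x. ap h x \<partial>p1) + (\<integral>x. ap h x \<partial>n) =
     (\<integral>x. ap h x \<partial>p) + (\<integral>x. ap h x \<partial>n1)" by linarith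
  qed (use \<tau> in simp)
  have e: "sets n1 = sets p1" "sets p = sets p1" "sets n = sets p1" "S1 \<in> sets p1" "S0 \<in> sets p1"
   "emeasure n1 (space p1 - S1) = 0" "emeasure n (space p1 - S0) = 0"
   using s1 s0 S1 S0 sp1 by (simp_all add: Compl_eq_Diff_UNIV)
  have eq': "emeasure p1 A + emeasure n A = emeasure p A + emeasure n1 A" if "A \<in> sets p1" for A
   using eq[of A] that s1 by simp
  note su = singular_unique[OF e(1-3) f1 f0 e(4) S1(2) e(6) e(5) S0(2) e(7) eq']
  have "p1 = p" "n1 = n" using su by blast+
  then show ?thesis by simp
 qed
 ultimately have "cf_DF \<tau> F t \<eta> = (p, n)"
  unfolding cf_DF_def
 proof (intro the_equality)
  fix pr assume "\<exists>L. cf_frechet \<tau> (F t) \<eta> L \<and> cf_jordan_rep \<tau> L (fst pr) (snd pr)"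
  then show "pr = (p, n)" using uniq by (metis prod.collapse)
 next
  show "\<exists>L. cf_frechet \<tau> (F t) \<eta> L \<and> cf_jordan_rep \<tau> L (fst (p, n)) (snd (p, n))"
   using L \<open>cf_jordan_rep \<tau> L p n\<close> unfolding fst_conv snd_conv by blast
 qed
 then show ?thesis using that[OF L] \<open>cf_jordan_rep \<tau> L p n\<close> by simp
qed

section \<open>Windows and functionals of windows\<close>

definition win :: "real => (real => real) => real => real \<Rightarrow>\<^sub>C real" where
 "win \<tau> x s = cfun \<tau> (\<lambda>r. x (s + r))"

lemma cf_window_win: "cf_window \<tau> X t w = win \<tau> (\<lambda>r. X r w) t"
 by (simp add: cf_window_def win_def cfun_def clampw_def)

lemma continuous_on_shift: "continuous_on UNIV x ==> continuous_on A (\<lambda>r. x (s + r :: real) :: real)"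
 by (rule continuous_on_compose2[of UNIV x]) (auto intro!: continuous_intros)

lemma win_apply: "0 <= \<tau> ==> continuous_on UNIV x ==> ap (win \<tau> x s) y = x (s + clampw \<tau> y)"
 unfolding win_def by (subst cfun_apply) (auto intro: continuous_on_shift)

lemma win_in_C: "0 <= \<tau> ==> continuous_on UNIV x ==> win \<tau> x s \<in> cf_C \<tau>"
 unfolding win_def by (intro cfun_in_C continuous_on_shift)

lemma win_in_ppath_set:
 assumes "0 <= \<tau>" "\<And>j. d j > 0" "ppath R d x" shows "win \<tau> x s \<in> ppath_set \<tau> R d"
proof -
 have c: "continuous_on UNIV x" by (rule ppath_continuous[OF assms(2,3)])
 have "ppath R d (\<lambda>y. x (s + clampw \<tau> y))"
  by (rule ppath_lipschitz[OF assms(3)]) (use clampw_lipschitz in auto)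
 moreover have "ap (win \<tau> x s) = (\<lambda>y. x (s + clampw \<tau> y))"
  by (rule ext) (rule win_apply[OF assms(1) c])
 ultimately show ?thesis using win_in_C[OF assms(1) c] by (simp add: ppath_set_def)
qed

lemma norm_win_diff_le:
 assumes "0 <= \<tau>" "continuous_on UNIV x" "continuous_on UNIV z"
  "\<And>y. y \<in> {-\<tau>..0} ==> \<bar>x (s + y) - z (t + y)\<bar> <= c"
 shows "norm (win \<tau> x s - win \<tau> z t) <= c"
 by (rule norm_cf_C_le[OF assms(1) cf_C_diff[OF win_in_C win_in_C]])
   (use assms in \<open>auto simp: win_apply clampw_id\<close>)

lemma continuous_on_win:
 assumes "0 <= \<tau>" "continuous_on UNIV x" "continuous_on UNIV g"
 shows "continuous_on A (\<lambda>s. win \<tau> (\<lambda>r. x (min (g s) r)) (s + e))"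
  and "continuous_on A (\<lambda>s. win \<tau> x (s + e))"
proof -
 have ft: "continuous_on UNIV (\<lambda>s. win \<tau> (\<lambda>r. x (min (k s) r)) (s + e))" if k: "continuous_on UNIV k" for k
  unfolding continuous_on_iff
 proof (intro ballI allI impI)
  fix s0 e0 :: real assume "0 < e0"
  \<comment> \<open>All times at which \<open>x\<close> is read while \<open>s\<close> and
    \<open>k s\<close> stay within distance one of their values at \<open>s0\<close>.\<close>
  define I where "I = {min (k s0 - 1) (s0 + e - \<tau> - 1)..max (s0 + e + 1) (k s0 + 1)}"
  have "uniformly_continuous_on I x"
   unfolding I_def by (intro compact_uniformly_continuous continuous_on_subset[OF assms(2)]) auto
  then obtain dl where dl: "dl > 0" "\<And>p q. p \<in> I ==> q \<in> I ==> dist p q < dl ==> dist (x p) (x q) < e0/2"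
   using \<open>0 < e0\<close> unfolding uniformly_continuous_on_def by (metis half_gt_zero)
  obtain dl' where dl': "dl' > 0" "\<And>s. dist s s0 < dl' ==> dist (k s) (k s0) < min 1 dl"
   using k dl(1) unfolding continuous_on_iff by (metis UNIV_I min_less_iff_conj zero_less_one)
  show "\<exists>d>0. \<forall>s\<in>UNIV. dist s s0 < d \<longrightarrow> dist (win \<tau> (\<lambda>r. x (min (k s) r)) (s + e)) (win \<tau> (\<lambda>r. x (min (k s0) r)) (s0 + e)) < e0"
  proof (intro exI[of _ "min 1 (min dl dl')"] conjI ballI impI)
   fix s assume s: "dist s s0 < min 1 (min dl dl')"
   have ks: "\<bar>k s - k s0\<bar> < min 1 dl" using dl'(2)[of s] s by (simp add: dist_real_def)
   have cm: "continuous_on UNIV (\<lambda>r. x (min c r))" for c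
    by (rule continuous_on_compose2[OF assms(2)]) (auto intro!: continuous_intros)
   have "norm (win \<tau> (\<lambda>r. x (min (k s) r)) (s + e) - win \<tau> (\<lambda>r. x (min (k s0) r)) (s0 + e)) <= e0/2"
   proof (rule norm_win_diff_le[OF assms(1) cm cm])
    fix y assume y: "y \<in> {-\<tau>..0}"
    have "dist (x (min (k s) (s + e + y))) (x (min (k s0) (s0 + e + y))) < e0/2"
     by (rule dl(2)) (use s ks y in \<open>auto simp: dist_real_def I_def min_def max_def abs_real_def split: if_splits\<close>)
    then show "\<bar>x (min (k s) (s + e + y)) - x (min (k s0) (s0 + e + y))\<bar> <= e0/2"
     by (simp add: dist_real_def)
   qed
   then show "dist (win \<tau> (\<lambda>r. x (min (k s) r)) (s + e)) (win \<tau> (\<lambda>r. x (min (k s0) r)) (s0 + e)) < e0"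
    using \<open>0 < e0\<close> by (simp add: dist_norm)
  qed (use dl dl' in auto)
 qed
 show "continuous_on A (\<lambda>s. win \<tau> (\<lambda>r. x (min (g s) r)) (s + e))"
  using ft[OF assms(3)] by (rule continuous_on_subset) auto
 have cm: "continuous_on UNIV (\<lambda>r. x (min c r))" for c
  by (rule continuous_on_compose2[OF assms(2)]) (auto intro!: continuous_intros)
 \<comment> \<open>Freezing at \<open>s + e\<close> does not alter a window that ends at
   \<open>s + e\<close>, so the second claim is an instance of the first.\<close>
 have "continuous_on UNIV (\<lambda>s. win \<tau> (\<lambda>r. x (min (s + e) r)) (s + e))"
  by (rule ft) (auto intro!: continuous_intros)
 also have "(\<lambda>s. win \<tau> (\<lambda>r. x (min (s + e) r)) (s + e)) = (\<lambda>s. win \<tau> x (s + e))"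
 proof
  fix s show "win \<tau> (\<lambda>r. x (min (s + e) r)) (s + e) = win \<tau> x (s + e)"
   by (rule cf_C_eqI[OF assms(1) win_in_C win_in_C])
     (use assms cm in \<open>auto simp: win_apply clampw_id\<close>)
 qed
 finally show "continuous_on A (\<lambda>s. win \<tau> x (s + e))" by (rule continuous_on_subset) auto
qed

lemma interp_cong: "(\<And>k. k <= n ==> c k = c' k) ==> interp \<tau> n c = interp \<tau> n c'"
 unfolding interp_def by (intro sum.cong) auto

text \<open>No sigma-algebra on the path space is used. The window is approximated by interpolants
  whose coefficients are rounded to multiples of \<open>1 / Suc n\<close>; these take countably many
  values, so any function of them is measurable, and continuity of \<open>\<phi>\<close> carries
  this to the limit. Only times in \<open>{u-\<tau>..u}\<close> are read, which is what adaptedness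
  needs.\<close>

lemma measurable_window_functional:
 assumes \<tau>: "0 < \<tau>" and Y: "\<And>r. r \<in> {u-\<tau>..u} ==> Y r \<in> bm N"
  and cont: "\<And>w. w \<in> space N ==> continuous_on UNIV (\<lambda>r. Y r w)"
  and \<phi>: "continuous_on (cf_C \<tau>) (\<phi> :: _ => real)"
 shows "(\<lambda>w. \<phi> (win \<tau> (\<lambda>r. Y r w) u)) \<in> bm N"
proof -
 define p where "p n k = u - \<tau> + real k * \<tau> / real (Suc n)" for n k
 have p: "p n k \<in> {u-\<tau>..u}" if "k <= Suc n" for n k
 proof -
  have "real k * \<tau> <= real (Suc n) * \<tau>" using that \<tau> by (intro mult_right_mono) auto
  then have "real k * \<tau> / real (Suc n) <= \<tau>" by (simp add: field_simps)
  then show ?thesis using \<tau> by (simp add: p_def)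
 qed
 define W where "W n w = interp \<tau> (Suc n) (\<lambda>k. real_of_int \<lfloor>real (Suc n) * Y (p n k) w\<rfloor> / real (Suc n))" for n w
 have WC: "W n w \<in> cf_C \<tau>" for n w unfolding W_def by (rule interp_in_C[OF \<tau>])
 have meas: "(\<lambda>w. \<phi> (W n w)) \<in> bm N" for n
 proof -
  \<comment> \<open>The rounded window as a list of integers, an element of a countable
    type.\<close>
  define ll where "ll w = map (\<lambda>k. \<lfloor>real (Suc n) * Y (p n k) w\<rfloor>) [0..<Suc (Suc n)]" for w
  define \<psi> where "\<psi> l = \<phi> (interp \<tau> (Suc n) (\<lambda>k. real_of_int (l ! k) / real (Suc n)))" for l :: "int list"
  have fl: "(\<lambda>w. \<lfloor>real (Suc n) * Y (p n k) w\<rfloor>) \<in> measurable N (count_space UNIV)" if "k < Suc (Suc n)" for k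
  proof -
   have [measurable]: "Y (p n k) \<in> bm N" by (rule Y[OF p]) (use that in auto)
   show ?thesis by measurable
  qed
  have "ll \<in> measurable N (count_space UNIV)"
   unfolding measurable_count_space_eq_countable[OF countableI_type]
  proof (intro conjI ballI)
   fix l :: "int list"
   show "ll -` {l} \<inter> space N \<in> sets N"
   proof (cases "length l = Suc (Suc n)")
    case True
    then have "ll -` {l} \<inter> space N = {w\<in>space N. \<forall>k\<in>{..<Suc (Suc n)}. \<lfloor>real (Suc n) * Y (p n k) w\<rfloor> = l ! k}"
     by (auto simp: ll_def list_eq_iff_nth_eq simp del: upt_Suc)
    also have "... \<in> sets N"
    proof (rule sets.sets_Collect_finite_All')
     fix k assume "k \<in> {..<Suc (Suc n)}"
     then have [measurable]: "(\<lambda>w. \<lfloor>real (Suc n) * Y (p n k) w\<rfloor>) \<in> measurable N (count_space UNIV)" using fl by simp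
     show "{w\<in>space N. \<lfloor>real (Suc n) * Y (p n k) w\<rfloor> = l ! k} \<in> sets N" by measurable
    qed auto
    finally show ?thesis .
   next
    case False
    then have "ll -` {l} \<inter> space N = {}" by (auto simp: ll_def simp del: upt_Suc)
    then show ?thesis by simp
   qed
  qed auto
  then have "(\<lambda>w. \<psi> (ll w)) \<in> bm N"
   by (rule measurable_compose) simp
  moreover have "\<psi> (ll w) = \<phi> (W n w)" for w
   unfolding \<psi>_def W_def
   by (intro arg_cong[where f=\<phi>] interp_cong) (simp add: ll_def del: upt_Suc)
  ultimately show ?thesis by simp
 qed
 show ?thesis
 proof (rule borel_measurable_LIMSEQ_real[OF _ meas])
  fix w assume w: "w \<in> space N"
  let ?f = "win \<tau> (\<lambda>r. Y r w) u"
  have fC: "?f \<in> cf_C \<tau>" using \<tau> cont[OF w] by (intro win_in_C) auto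
  have Wlim: "(\<lambda>n. W n w) \<longlonglongrightarrow> ?f"
  proof (rule LIMSEQ_I)
   fix e :: real assume e: "0 < e"
   then obtain N1 where N1: "\<And>n y z. n \<ge> N1 ==> 0 < n ==> y \<in> {-\<tau>..0} ==> z \<in> {-\<tau>..0} ==> \<bar>y - z\<bar> <= \<tau> / real n ==>
     \<bar>ap ?f y - ap ?f z\<bar> <= e / 3"
    using cf_C_osc[OF \<tau>, of "e/3" ?f] by auto
   obtain N2 :: nat where N2: "3 / e < real N2" using reals_Archimedean2 by blast
   have "norm (W n w - ?f) <= 2 * (e/3)" if n: "n \<ge> max N1 N2" for n
    unfolding W_def
   proof (rule interp_approx[OF \<tau> _ fC])
    show "\<bar>ap ?f y - ap ?f z\<bar> <= e / 3"
     if "y \<in> {-\<tau>..0}" "z \<in> {-\<tau>..0}" "\<bar>y - z\<bar> <= \<tau> / real (Suc n)" for y z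
     by (rule N1[of "Suc n"]) (use that n in auto)
    fix k assume k: "k <= Suc n"
    have in': "-\<tau> + real k * \<tau> / real (Suc n) \<in> {-\<tau>..0}" using p[OF k] by (auto simp: p_def)
    have ap: "ap ?f (-\<tau> + real k * \<tau> / real (Suc n)) = Y (p n k) w"
     using in' \<tau> cont[OF w] by (subst win_apply) (auto simp: clampw_id p_def algebra_simps)
    let ?v = "real (Suc n) * Y (p n k) w"
    have "real_of_int \<lfloor>?v\<rfloor> / real (Suc n) - Y (p n k) w = (real_of_int \<lfloor>?v\<rfloor> - ?v) / real (Suc n)"
     by (simp add: diff_divide_distrib)
    then have "\<bar>real_of_int \<lfloor>?v\<rfloor> / real (Suc n) - Y (p n k) w\<bar> = \<bar>real_of_int \<lfloor>?v\<rfloor> - ?v\<bar> / real (Suc n)"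
     by (simp only: abs_divide abs_of_nat)
    also have "... <= 1 / real (Suc n)" by (intro divide_right_mono) linarith+
    also have "... <= e/3"
    proof -
     have "3 / e < real (Suc n)" using N2 n by linarith
     then show ?thesis using e by (simp add: field_simps)
    qed
    finally show "\<bar>real_of_int \<lfloor>?v\<rfloor> / real (Suc n) - ap ?f (-\<tau> + real k * \<tau> / real (Suc n))\<bar> <= e/3"
     unfolding ap .
   qed auto
   moreover have "2 * (e/3) < e" using e by simp
   ultimately show "\<exists>no. \<forall>n\<ge>no. norm (W n w - ?f) < e" by (meson le_less_trans)
  qed
  show "(\<lambda>n. \<phi> (W n w)) \<longlonglongrightarrow> \<phi> ?f"
   by (rule continuous_on_tendsto_compose[OF \<phi> Wlim fC]) (simp add: WC)
 qed
qed

section \<open>First-order expansion along frozen windows\<close>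

text \<open>The ordinary mean value theorem along the segment. The conclusion is for every
  derivative at the intermediate point, because the point is found with one choice of functional and
  used with another.\<close>

lemma frechet_mvt:
 assumes diff: "cf_differentiable \<tau> G" and "\<eta> \<in> cf_C \<tau>" "h \<in> cf_C \<tau>"
 obtains \<theta> where "0 < \<theta>" "\<theta> < 1" "\<And>L. cf_frechet \<tau> G (\<eta> + \<theta> *\<^sub>R h) L ==> G (\<eta> + h) - G \<eta> = L h"
proof -
 have C: "\<eta> + c *\<^sub>R h \<in> cf_C \<tau>" for c using assms by (intro cf_C_add cf_C_scaleR)
 have D: "((\<lambda>c. G (\<eta> + c *\<^sub>R h)) has_real_derivative L h) (at c)" if "cf_frechet \<tau> G (\<eta> + c *\<^sub>R h) L" for c L
 proof -
  have "((\<lambda>u. G ((\<eta> + c *\<^sub>R h) + (u + - c) *\<^sub>R h)) has_real_derivative L h) (at c)"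
   using cf_frechet_DERIV[OF that assms(3)]
    DERIV_shift[of "\<lambda>u. G ((\<eta> + c *\<^sub>R h) + u *\<^sub>R h)" "L h" c "-c"] by simp
  moreover have "(\<eta> + c *\<^sub>R h) + (u + - c) *\<^sub>R h = \<eta> + u *\<^sub>R h" for u
   by (simp add: scaleR_left_diff_distrib)
  ultimately show ?thesis by (simp only:)
 qed
 define L where "L c = (SOME L. cf_frechet \<tau> G (\<eta> + c *\<^sub>R h) L)" for c
 have L: "cf_frechet \<tau> G (\<eta> + c *\<^sub>R h) (L c)" for c
  unfolding L_def using diff C[of c] unfolding cf_differentiable_def by (metis someI_ex)
 obtain \<theta> where \<theta>: "0 < \<theta>" "\<theta> < 1" "G (\<eta> + 1 *\<^sub>R h) - G (\<eta> + 0 *\<^sub>R h) = (1 - 0) * L \<theta> h"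
  using MVT2[of 0 1 "\<lambda>c. G (\<eta> + c *\<^sub>R h)" "\<lambda>c. L c h"] D[OF L] by auto
 show ?thesis
  by (rule that[OF \<theta>(1,2)]) (use \<theta>(3) D[OF L] D DERIV_unique in fastforce)
qed

text \<open>\<open>h\<close> vanishes up to time \<open>-ep\<close>, so integrating it sees the atom
  at 0, which is \<open>cf_Ddelta0\<close>, and the mass of the derivative measures on
  \<open>[-ep, 0[\<close>, which is what \<open>cf_Dperp_tv\<close> measures.\<close>

lemma cf_DF_near:
 assumes \<tau>: "0 < \<tau>" and diff: "cf_differentiable \<tau> (F t)" and \<eta>: "\<eta> \<in> cf_C \<tau>" and h: "h \<in> cf_C \<tau>"
  and hc: "\<And>y. \<bar>ap h y\<bar> <= c" and h0: "\<And>y. y <= -ep ==> ap h y = 0"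
  and ep: "0 < ep" and L: "cf_frechet \<tau> (F t) \<eta> L"
 shows "ennreal \<bar>L h - cf_Ddelta0 \<tau> F t \<eta> * ap h 0\<bar> <= ennreal c * cf_Dperp_tv \<tau> F t \<eta> {max (-ep) (-\<tau>)..0}"
proof -
 define p where "p = fst (cf_DF \<tau> F t \<eta>)"
 define n where "n = snd (cf_DF \<tau> F t \<eta>)"
 obtain L' where L': "cf_frechet \<tau> (F t) \<eta> L'" "cf_jordan_rep \<tau> L' p n"
  using cf_DF_spec[of \<tau> F t \<eta>, OF \<tau> diff \<eta>] unfolding p_def n_def by metis
 note J = L'(2)[unfolded cf_jordan_rep_def]
 have s: "sets p = sets borel" "sets n = sets borel" and f: "finite_measure p" "finite_measure n"
  and z: "emeasure p (- {-\<tau>..0}) = 0" "emeasure n (- {-\<tau>..0}) = 0" using J by blast+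
 have Lh: "L h = (\<integral>x. ap h x \<partial>p) - (\<integral>x. ap h x \<partial>n)"
  using J h cf_frechet_unique[OF L L'(1) h] by metis
 have c0: "0 <= c" using hc[of 0] by linarith
 define B where "B = {max (-ep) (-\<tau>)..0} - {0::real}"
 have B: "B \<in> sets borel" unfolding B_def by auto
 have est: "\<bar>(\<integral>x. ap h x \<partial>q) - measure q {0} * ap h 0\<bar> <= c * measure q B"
  if q: "sets q = sets borel" "finite_measure q" "emeasure q (- {-\<tau>..0}) = 0" for q
 proof -
  interpret finite_measure q by fact
  have sp: "space q = UNIV" using sets_eq_imp_space_eq[OF q(1)] by simp
  have hb: "ap h \<in> bm q"
   using q(1) by (simp add: borel_measurable_continuous_onI cong: measurable_cong_sets)
  have Bq: "B \<in> sets q" "{0} \<in> sets q" using B q by auto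
  have i1: "integrable q (\<lambda>x. indicator {0} x * ap h 0)"
   using Bq by (intro integrable_mult_left) (simp add: less_top[symmetric] emeasure_finite)
  have i2: "integrable q (\<lambda>x. indicator B x * ap h x)"
   using Bq hb hc c0
   by (intro integrable_const_bound[where B=c]) (auto simp: abs_mult split: split_indicator)
  have "(\<integral>x. ap h x \<partial>q) = (\<integral>x. indicator {0} x * ap h 0 + indicator B x * ap h x \<partial>q)"
  proof (rule Bochner_Integration.integral_cong_AE)
   have "AE x in q. x \<in> {-\<tau>..0}"
    by (rule AE_I'[of "- {-\<tau>..0}"]) (use q in auto)
   then show "AE x in q. ap h x = indicator {0} x * ap h 0 + indicator B x * ap h x"
   proof eventually_elim
    case (elim x)
    show ?case
    proof (cases "x <= -ep")
     case True
     then show ?thesis using h0[of x] ep by (auto simp: indicator_def)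
    next
     case False
     then show ?thesis using elim by (auto simp: B_def indicator_def)
    qed
   qed
  qed (use hb i1 i2 in auto)
  also have "... = measure q {0} * ap h 0 + (\<integral>x. indicator B x * ap h x \<partial>q)"
   using i1 i2 sp by simp
  finally have "(\<integral>x. ap h x \<partial>q) - measure q {0} * ap h 0 = (\<integral>x. indicator B x * ap h x \<partial>q)"
   by simp
  also have "\<bar>...\<bar> <= (\<integral>x. c * indicator B x \<partial>q)"
  proof (rule order_trans[OF integral_abs_bound integral_mono])
   show "integrable q (\<lambda>x. \<bar>indicator B x * ap h x\<bar>)" using i2 by simp
   show "integrable q (\<lambda>x. c * indicator B x)"
    using Bq by (intro integrable_mult_right) (simp add: less_top[symmetric] emeasure_finite)
   show "\<bar>indicator B x * ap h x\<bar> <= c * indicator B x" for x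
    using hc[of x] by (auto simp: indicator_def)
  qed
  also have "... = c * measure q B" using sp by simp
  finally show ?thesis .
 qed
 have "\<bar>L h - cf_Ddelta0 \<tau> F t \<eta> * ap h 0\<bar> <= c * measure p B + c * measure n B"
  using est[OF s(1) f(1) z(1)] est[OF s(2) f(2) z(2)]
  unfolding Lh cf_Ddelta0_def p_def[symmetric] n_def[symmetric] left_diff_distrib by linarith
 then have "ennreal \<bar>L h - cf_Ddelta0 \<tau> F t \<eta> * ap h 0\<bar> <= ennreal (c * (measure p B + measure n B))"
  by (intro ennreal_leI) (simp add: distrib_left)
 also have "... = ennreal c * (emeasure p B + emeasure n B)"
  using c0 f by (simp add: ennreal_mult finite_measure.emeasure_eq_measure)
 also have "emeasure p B + emeasure n B = cf_Dperp_tv \<tau> F t \<eta> {max (-ep) (-\<tau>)..0}"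
  by (simp add: cf_Dperp_tv_def B_def p_def n_def)
 finally show ?thesis .
qed

lemma abs_convex_le:
 fixes u v c \<theta> :: real
 assumes "\<bar>u\<bar> <= c" "\<bar>v\<bar> <= c" "0 <= \<theta>" "\<theta> <= 1" shows "\<bar>u + \<theta> * (v - u)\<bar> <= c"
proof -
 have "\<bar>(1-\<theta>) * u + \<theta> * v\<bar> <= (1-\<theta>) * \<bar>u\<bar> + \<theta> * \<bar>v\<bar>"
  using assms by (metis abs_mult abs_of_nonneg abs_triangle_ineq diff_ge_0_iff_ge)
 also have "... <= (1-\<theta>) * c + \<theta> * c" using assms by (intro add_mono mult_left_mono) auto
 finally show ?thesis by (simp add: algebra_simps)
qed

text \<open>The window at \<open>s + ep\<close> and its frozen version differ only on
  \<open>]-ep, 0]\<close>, and at 0 by the increment of \<open>x\<close>. The difference is bounded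
  crudely by \<open>2 * R\<close>: the rate comes from the smallness of the measure near 0, not from
  that of the path increment. The estimate is in \<open>ennreal\<close> since the supremum could be
  infinite.\<close>

lemma frozen_expansion:
 assumes \<tau>: "0 < \<tau>" and ep: "0 < ep" "ep <= \<tau>" and diff: "cf_differentiable \<tau> (F (s + ep))"
  and d: "\<And>j. d j > 0" and x: "ppath R d x"
  and w: "\<And>p q. \<bar>p - q\<bar> <= ep ==> \<bar>x p - x q\<bar> <= w"
 obtains \<eta> where "\<eta> \<in> ppath_set \<tau> R d" "norm (\<eta> - win \<tau> x s) <= w"
  "ennreal \<bar>F (s + ep) (win \<tau> x (s + ep)) - F (s + ep) (win \<tau> (\<lambda>r. x (min s r)) (s + ep))
    - cf_Ddelta0 \<tau> F (s + ep) \<eta> * (x (s + ep) - x s)\<bar>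
   <= ennreal (2 * R) * (SUP \<eta>\<in>ppath_set \<tau> R d. cf_Dperp_tv \<tau> F (s + ep) \<eta> {max (-ep) (-\<tau>)..0})"
proof -
 have t0: "0 <= \<tau>" using \<tau> by simp
 define z where "z r = x (min s r)" for r
 have z: "ppath R d z" unfolding z_def by (rule ppath_lipschitz[OF x]) auto
 have cx: "continuous_on UNIV x" and cz: "continuous_on UNIV z" by (rule ppath_continuous[OF d x] ppath_continuous[OF d z])+
 let ?W1 = "win \<tau> x (s + ep)" and ?W0 = "win \<tau> z (s + ep)"
 define h where "h = ?W1 - ?W0"
 have C: "?W1 \<in> cf_C \<tau>" "?W0 \<in> cf_C \<tau>" "h \<in> cf_C \<tau>"
  unfolding h_def by (intro win_in_C t0 cx cz cf_C_diff)+
 have ha: "ap h y = x (s + ep + clampw \<tau> y) - x (min s (s + ep + clampw \<tau> y))" for y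
  unfolding h_def by (simp add: win_apply[OF t0 cx] win_apply[OF t0 cz] z_def)
 obtain \<theta> where \<theta>: "0 < \<theta>" "\<theta> < 1"
  "\<And>L. cf_frechet \<tau> (F (s + ep)) (?W0 + \<theta> *\<^sub>R h) L ==> F (s + ep) (?W0 + h) - F (s + ep) ?W0 = L h"
  using frechet_mvt[OF diff C(2,3)] by metis
 define \<eta> where "\<eta> = ?W0 + \<theta> *\<^sub>R h"
 have \<eta>C: "\<eta> \<in> cf_C \<tau>" unfolding \<eta>_def by (intro cf_C_add cf_C_scaleR C)
 have \<eta>a: "ap \<eta> y = z (s + ep + clampw \<tau> y) + \<theta> * (x (s + ep + clampw \<tau> y) - z (s + ep + clampw \<tau> y))" for y
  unfolding \<eta>_def by (simp add: ha win_apply[OF t0 cz] z_def)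
 obtain L where L: "cf_frechet \<tau> (F (s + ep)) \<eta> L" using diff \<eta>C unfolding cf_differentiable_def by blast
 have incr: "F (s + ep) ?W1 - F (s + ep) ?W0 = L h" using \<theta>(3)[of L] L unfolding \<eta>_def h_def by simp
 have "ppath R d (\<lambda>y. z (s + ep + clampw \<tau> y) + \<theta> * (x (s + ep + clampw \<tau> y) - z (s + ep + clampw \<tau> y)))"
  by (intro ppath_convex ppath_lipschitz[OF x] ppath_lipschitz[OF z]) (use \<theta> clampw_lipschitz in auto)
 then have "ppath R d (ap \<eta>)" by (metis (no_types, lifting) \<eta>a ext)
 then have \<eta>K: "\<eta> \<in> ppath_set \<tau> R d" using \<eta>C by (simp add: ppath_set_def)
 have near: "norm (\<eta> - win \<tau> x s) <= w"
 proof (rule norm_cf_C_le[OF t0 cf_C_diff[OF \<eta>C win_in_C[OF t0 cx]]])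
  fix y assume y: "y \<in> {-\<tau>..0}"
  let ?c = "x (s + y)" and ?u = "z (s + ep + y)" and ?v = "x (s + ep + y)"
  have "\<bar>(?u - ?c) + \<theta> * ((?v - ?c) - (?u - ?c))\<bar> <= w"
   by (rule abs_convex_le) (use \<theta> ep y in \<open>auto simp: z_def intro!: w\<close>)
  then show "\<bar>ap (\<eta> - win \<tau> x s) y\<bar> <= w"
   using y by (simp add: \<eta>a win_apply[OF t0 cx] clampw_id algebra_simps)
 qed
 have bd: "\<bar>ap h y\<bar> <= 2 * R" for y
 proof -
  have "\<bar>x p\<bar> <= R" for p using x unfolding ppath_def by blast
  from this[of "s + ep + clampw \<tau> y"] this[of "min s (s + ep + clampw \<tau> y)"]
  show ?thesis unfolding ha by linarith
 qed
 have h0: "ap h y = 0" if "y <= -ep" for y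
 proof -
  \<comment> \<open>Requires that the window be at least \<open>ep\<close> long.\<close>
  have "clampw \<tau> y <= -ep" using that ep by (auto simp: clampw_def)
  then have "min s (s + ep + clampw \<tau> y) = s + ep + clampw \<tau> y" by simp
  then show ?thesis unfolding ha by simp
 qed
 have h00: "ap h 0 = x (s + ep) - x s" using \<tau> ep by (simp add: ha clampw_def)
 have "ennreal \<bar>L h - cf_Ddelta0 \<tau> F (s + ep) \<eta> * ap h 0\<bar>
   <= ennreal (2 * R) * cf_Dperp_tv \<tau> F (s + ep) \<eta> {max (-ep) (-\<tau>)..0}"
  by (rule cf_DF_near[where F = F and t = "s + ep", OF \<tau> diff \<eta>C C(3) bd h0 ep(1) L])
 also have "... <= ennreal (2 * R) * (SUP \<eta>\<in>ppath_set \<tau> R d. cf_Dperp_tv \<tau> F (s + ep) \<eta> {max (-ep) (-\<tau>)..0})"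
  by (intro mult_left_mono SUP_upper \<eta>K) auto
 finally show ?thesis using that[OF \<eta>K near] incr h00 unfolding z_def by simp
qed

text \<open>Uniform continuity of \<open>F\<close> and \<open>G\<close> on the compact set
  \<open>{a..b} \<times> ppath_set \<tau> R d\<close> makes the choice of \<open>ep0\<close>
  independent of the path. Replacing the derivative at the intermediate path and time
  \<open>s + ep\<close> by \<open>G\<close> at the current window costs \<open>dl\<close> times the
  increment of \<open>x\<close>, which is subtracted on the left so that only the measure term
  remains on the right.\<close>

lemma frozen_uniform:
 fixes G :: "real \<times> (real \<Rightarrow>\<^sub>C real) => real"
 assumes \<tau>: "0 < \<tau>" and d: "\<And>j. d j > 0"
  and diff: "\<And>t. t \<in> {a..b} ==> cf_differentiable \<tau> (F t)"
  and F: "continuous_on ({a..b} \<times> cf_C \<tau>) (\<lambda>(t, \<eta>). F t \<eta>)"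
  and G: "continuous_on ({a..b} \<times> cf_C \<tau>) G"
  and GD: "\<And>t \<eta>. t \<in> {a<..b} ==> \<eta> \<in> cf_C \<tau> ==> G (t, \<eta>) = cf_Ddelta0 \<tau> F t \<eta>"
  and dl: "0 < dl"
 obtains ep0 where "0 < ep0" "ep0 <= \<tau>"
  "\<And>ep x s. 0 < ep ==> ep <= ep0 ==> ppath R d x ==> s \<in> {a..b-ep} ==>
    \<bar>F (s + ep) (win \<tau> (\<lambda>r. x (min s r)) (s + ep)) - F s (win \<tau> x s)\<bar> <= dl"
  "\<And>ep x s. 0 < ep ==> ep <= ep0 ==> ppath R d x ==> s \<in> {a..b-ep} ==>
    ennreal (\<bar>F (s + ep) (win \<tau> x (s + ep)) - F (s + ep) (win \<tau> (\<lambda>r. x (min s r)) (s + ep))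
     - G (s, win \<tau> x s) * (x (s + ep) - x s)\<bar> - dl * \<bar>x (s + ep) - x s\<bar>)
   <= ennreal (2 * R) * (SUP \<eta>\<in>ppath_set \<tau> R d. cf_Dperp_tv \<tau> F (s + ep) \<eta> {max (-ep) (-\<tau>)..0})"
proof -
 let ?K = "{a..b} \<times> ppath_set \<tau> R d"
 have t0: "0 <= \<tau>" using \<tau> by simp
 have KC: "?K \<subseteq> {a..b} \<times> cf_C \<tau>" by (auto simp: ppath_set_def)
 have comp: "compact ?K" by (intro compact_Times compact_ppath_set t0 d) auto
 have "uniformly_continuous_on ?K (\<lambda>(t, \<eta>). F t \<eta>)" "uniformly_continuous_on ?K G"
  using compact_uniformly_continuous[OF continuous_on_subset[OF F KC] comp]
   compact_uniformly_continuous[OF continuous_on_subset[OF G KC] comp] by auto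
 then obtain e1 e2 where e1: "e1 > 0" "\<And>p q. p \<in> ?K ==> q \<in> ?K ==> dist p q < e1 ==> dist ((\<lambda>(t, \<eta>). F t \<eta>) p) ((\<lambda>(t, \<eta>). F t \<eta>) q) < dl"
  and e2: "e2 > 0" "\<And>p q. p \<in> ?K ==> q \<in> ?K ==> dist p q < e2 ==> dist (G p) (G q) < dl"
  using dl unfolding uniformly_continuous_on_def by metis
 define e where "e = min e1 e2"
 have e: "e > 0" using e1 e2 by (simp add: e_def)
 obtain j where j: "1 / real (Suc j) < e / 2" using e nat_approx_posE[of "e/2"] by (metis half_gt_zero of_nat_Suc)
 define ep0 where "ep0 = min \<tau> (min (d j) (e/4))"
 have close: "dist p q < e" if "\<bar>fst p - fst q\<bar> <= ep0" "norm (snd p - snd q) <= 1 / real (Suc j)"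
  for p q :: "real \<times> (real \<Rightarrow>\<^sub>C real)"
 proof -
  have "dist p q <= dist (fst p) (fst q) + dist (snd p) (snd q)"
   unfolding dist_prod_def by (rule sqrt_sum_squares_le_sum) auto
  also have "... <= e/4 + 1 / real (Suc j)" using that by (auto simp: ep0_def dist_norm)
  also have "... < e" using j e by simp
  finally show ?thesis .
 qed
 show ?thesis
 proof (rule that[of ep0])
  show "0 < ep0" "ep0 <= \<tau>" using \<tau> d e by (auto simp: ep0_def)
  fix ep x s assume ep: "0 < ep" "ep <= ep0" and x: "ppath R d x" and s: "s \<in> {a..b-ep}"
  have w: "\<bar>x p - x q\<bar> <= 1 / real (Suc j)" if "\<bar>p - q\<bar> <= ep" for p q
   using x that ep unfolding ppath_def ep0_def by auto
  define z where "z r = x (min s r)" for r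
  have z: "ppath R d z" unfolding z_def by (rule ppath_lipschitz[OF x]) auto
  have cx: "continuous_on UNIV x" and cz: "continuous_on UNIV z" by (rule ppath_continuous[OF d x] ppath_continuous[OF d z])+
  have sK: "(s, win \<tau> x s) \<in> ?K" using s ep win_in_ppath_set[OF t0 d x] by auto
  have zK: "(s + ep, win \<tau> z (s + ep)) \<in> ?K" using s ep win_in_ppath_set[OF t0 d z] by auto
  have "norm (win \<tau> z (s + ep) - win \<tau> x s) <= 1 / real (Suc j)"
  proof (rule norm_win_diff_le[OF t0 cz cx])
   fix y assume "y \<in> {-\<tau>..0}"
   then show "\<bar>z (s + ep + y) - x (s + y)\<bar> <= 1 / real (Suc j)"
    unfolding z_def using ep by (intro w) (auto simp: min_def)
  qed
  then have "dist (s + ep, win \<tau> z (s + ep)) (s, win \<tau> x s) < e" using ep by (intro close) auto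
  then show "\<bar>F (s + ep) (win \<tau> (\<lambda>r. x (min s r)) (s + ep)) - F s (win \<tau> x s)\<bar> <= dl"
   using e1(2)[OF zK sK] unfolding z_def by (simp add: e_def dist_real_def)
  have e\<tau>: "ep <= \<tau>" using ep by (simp add: ep0_def)
  have df: "cf_differentiable \<tau> (F (s + ep))" using s ep by (intro diff) auto
  let ?D = "x (s + ep) - x s"
  let ?I = "F (s + ep) (win \<tau> x (s + ep)) - F (s + ep) (win \<tau> (\<lambda>r. x (min s r)) (s + ep))"
  obtain \<eta> where \<eta>: "\<eta> \<in> ppath_set \<tau> R d" "norm (\<eta> - win \<tau> x s) <= 1 / real (Suc j)"
   "ennreal \<bar>?I - cf_Ddelta0 \<tau> F (s + ep) \<eta> * ?D\<bar>
   <= ennreal (2 * R) * (SUP \<eta>\<in>ppath_set \<tau> R d. cf_Dperp_tv \<tau> F (s + ep) \<eta> {max (-ep) (-\<tau>)..0})"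
   using frozen_expansion[where F=F and s=s and d=d and x=x and w="1 / real (Suc j)", OF \<tau> ep(1) e\<tau> df d x w] by metis
  have "(s + ep, \<eta>) \<in> ?K" using s ep \<eta> by auto
  moreover have "dist (s + ep, \<eta>) (s, win \<tau> x s) < e" using ep \<eta> by (intro close) auto
  ultimately have "\<bar>G (s + ep, \<eta>) - G (s, win \<tau> x s)\<bar> <= dl"
   using e2(2)[OF _ sK] by (auto simp: e_def dist_real_def intro: less_imp_le)
  \<comment> \<open>The derivative is evaluated at time \<open>s + ep > a\<close>, where
    \<open>G\<close> agrees with it even for \<open>s = a\<close>.\<close>
  moreover have "G (s + ep, \<eta>) = cf_Ddelta0 \<tau> F (s + ep) \<eta>"
   using s ep \<eta>(1) by (intro GD) (auto simp: ppath_set_def)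
  ultimately have "\<bar>cf_Ddelta0 \<tau> F (s + ep) \<eta> - G (s, win \<tau> x s)\<bar> * \<bar>?D\<bar> <= dl * \<bar>?D\<bar>"
   by (intro mult_right_mono) auto
  then have "\<bar>cf_Ddelta0 \<tau> F (s + ep) \<eta> * ?D - G (s, win \<tau> x s) * ?D\<bar> <= dl * \<bar>?D\<bar>"
   by (simp add: abs_mult[symmetric] left_diff_distrib)
  then have "\<bar>?I - G (s, win \<tau> x s) * ?D\<bar> - dl * \<bar>?D\<bar> <= \<bar>?I - cf_Ddelta0 \<tau> F (s + ep) \<eta> * ?D\<bar>"
   by linarith
  then show "ennreal (\<bar>?I - G (s, win \<tau> x s) * ?D\<bar> - dl * \<bar>?D\<bar>)
    <= ennreal (2 * R) * (SUP \<eta>\<in>ppath_set \<tau> R d. cf_Dperp_tv \<tau> F (s + ep) \<eta> {max (-ep) (-\<tau>)..0})"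
   using \<eta>(3) by (meson ennreal_leI order_trans)
 qed
qed

text \<open>The integrand of the support predictability property need not be measurable, so its integral is
 only compared, through a translation, with integrals of measurable minorants.\<close>

lemma support_predictable_integral:
 assumes sp: "cf_support_predictable \<tau> a b F" and K: "compact K" "K \<subseteq> cf_C \<tau>"
 obtains C ep1 where "0 <= C" "0 < ep1"
  "\<And>ep R q. 0 < ep ==> ep <= ep1 ==> 0 < R ==> q \<in> bm borel ==>
   (\<And>s. s \<in> {a..b-ep} ==> ennreal (q s) <= ennreal R * (SUP \<eta>\<in>K. cf_Dperp_tv \<tau> F (s + ep) \<eta> {max (-ep) (-\<tau>)..0})) ==>
   (\<integral>\<^sup>+s. ennreal (q s) * indicator {a..b-ep} s \<partial>lborel) <= ennreal (R * C * ep\<^sup>2)"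
proof -
 obtain C0 ep1 where C0: "0 < ep1" "\<And>ep. 0 < ep ==> ep <= ep1 ==>
   (\<integral>\<^sup>+ t \<in> {a..b}. (SUP \<eta>\<in>K. cf_Dperp_tv \<tau> F t \<eta> {max (-ep) (-\<tau>)..0} / ennreal ep) \<partial>lborel) <= ennreal (C0 * ep)"
  using sp[unfolded cf_support_predictable_def, rule_format, OF conjI[OF K]] by blast
 define C where "C = max 0 C0"
 show ?thesis
 proof (rule that[of C ep1])
  show "0 <= C" "0 < ep1" using C0 by (auto simp: C_def)
  fix ep R :: real and q :: "real => real"
  assume ep: "0 < ep" "ep <= ep1" and R: "0 < R" and q[measurable]: "q \<in> bm borel"
   and le: "\<And>s. s \<in> {a..b-ep} ==> ennreal (q s) <= ennreal R * (SUP \<eta>\<in>K. cf_Dperp_tv \<tau> F (s + ep) \<eta> {max (-ep) (-\<tau>)..0})"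
  have "(\<integral>\<^sup>+s. ennreal (q s) * indicator {a..b-ep} s \<partial>lborel)
    = (\<integral>\<^sup>+t. ennreal (q (-ep + 1 * t)) * indicator {a..b-ep} (-ep + 1 * t) \<partial>lborel)"
   by (subst nn_integral_real_affine[where c=1 and t="-ep"]) auto
  also have "... = (\<integral>\<^sup>+t. ennreal (R * ep) * (ennreal (q (t - ep) / (R * ep)) * indicator {a+ep..b} t) \<partial>lborel)"
  proof (intro nn_integral_cong)
   fix t
   have "ennreal (q (t - ep)) = ennreal (R * ep) * ennreal (q (t - ep) / (R * ep))"
    using R ep by (subst ennreal_mult'[symmetric]) auto
   then show "ennreal (q (-ep + 1 * t)) * indicator {a..b-ep} (-ep + 1 * t)
     = ennreal (R * ep) * (ennreal (q (t - ep) / (R * ep)) * indicator {a+ep..b} t)"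
    by (auto simp: indicator_def add.commute)
  qed
  also have "... = ennreal (R * ep) * (\<integral>\<^sup>+t. ennreal (q (t - ep) / (R * ep)) * indicator {a+ep..b} t \<partial>lborel)"
   by (rule nn_integral_cmult) measurable
  also have "... <= ennreal (R * ep) * (\<integral>\<^sup>+ t \<in> {a..b}. (SUP \<eta>\<in>K. cf_Dperp_tv \<tau> F t \<eta> {max (-ep) (-\<tau>)..0} / ennreal ep) \<partial>lborel)"
  proof (intro mult_left_mono nn_integral_mono)
   fix t
   let ?S = "SUP \<eta>\<in>K. cf_Dperp_tv \<tau> F t \<eta> {max (-ep) (-\<tau>)..0}"
   show "ennreal (q (t - ep) / (R * ep)) * indicator {a+ep..b} t
     <= (SUP \<eta>\<in>K. cf_Dperp_tv \<tau> F t \<eta> {max (-ep) (-\<tau>)..0} / ennreal ep) * indicator {a..b} t"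
   proof (cases "t \<in> {a+ep..b}")
    case True
    have qS: "ennreal (q (t - ep)) <= ennreal R * ?S" using le[of "t - ep"] True by simp
    have "ennreal (q (t - ep) / (R * ep)) <= ?S / ennreal ep"
    proof (cases ?S)
     case (real s)
     have "ennreal (q (t - ep)) <= ennreal (R * s)" using qS real R by (simp add: ennreal_mult)
     then have "q (t - ep) <= R * s" using real R by (subst (asm) ennreal_le_iff) auto
     then have "q (t - ep) / (R * ep) <= s / ep" using R ep by (simp add: field_simps)
     then show ?thesis using real ep by (simp add: divide_ennreal ennreal_leI)
    next
     case top
     then have "?S / ennreal ep = top" unfolding top using ep by (simp add: ennreal_top_divide)
     then show ?thesis by (metis top_greatest)
    qed
    then show ?thesis using True ep by (simp add: SUP_divide_ennreal)
   qed simp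
  qed auto
  also have "... <= ennreal (R * ep) * ennreal (C * ep)"
   using C0(2)[OF ep] ep by (intro mult_left_mono order_trans[OF C0(2)[OF ep]] ennreal_leI) (auto simp: C_def intro!: mult_right_mono)
  also have "... = ennreal (R * C * ep\<^sup>2)"
   using R ep by (subst ennreal_mult[symmetric]) (auto simp: C_def power2_eq_square mult_ac)
  finally show "(\<integral>\<^sup>+s. ennreal (q s) * indicator {a..b-ep} s \<partial>lborel) <= ennreal (R * C * ep\<^sup>2)" .
 qed
qed

section \<open>Continuous martingales on a compact interval\<close>

text \<open>The time interval is a parameter because two of them occur: the one on which X and M are
  given, and \<open>[a, b]\<close> for the functional.\<close>

locale filtered_prob = prob_space P for P :: "'a measure" +
 fixes lo hi :: real and Fl :: "real => 'a set set"
 assumes lohi: "lo < hi" and filt: "cf_filtration P lo hi Fl"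
  and null_in: "\<And>A N. A \<in> null_sets P ==> N \<subseteq> A ==> N \<in> Fl lo"
begin

text \<open>The sigma-algebra as a measure space, so that \<open>measurable\<close> and conditional
  expectations apply; its measure is of no interest.\<close>

definition Fm :: "real => 'a measure" where
 "Fm t = sigma (space P) (Fl t)"

abbreviation mart :: "(real => 'a => real) => bool" where
 "mart \<equiv> cf_martingale P lo hi Fl"

abbreviation (input) lmart :: "(real => 'a => real) => bool" where
 "lmart \<equiv> cf_cont_local_martingale P lo hi Fl"

abbreviation (input) cpaths :: "(real => 'a => real) => bool" where
 "cpaths \<equiv> cf_cont_paths P lo hi"

abbreviation (input) incr :: "real => (real => 'a => real) => real => 'a => real" where
 "incr ep X s w \<equiv> cf_ext lo hi X (s + ep) w - cf_ext lo hi X s w"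

lemma space_Fm [simp]: "space (Fm t) = space P"
 by (simp add: Fm_def space_measure_of_conv)

lemma sets_Fm: "t \<in> {lo..hi} ==> sets (Fm t) = Fl t"
 using filt unfolding cf_filtration_def Fm_def by (metis sigma_algebra.sets_measure_of_eq)

lemma Fm_subset: "lo <= s ==> s <= t ==> t <= hi ==> sets (Fm s) \<subseteq> sets (Fm t)"
 using filt unfolding cf_filtration_def by (simp add: sets_Fm)

lemma Fm_P: "t \<in> {lo..hi} ==> sets (Fm t) \<subseteq> sets P"
 using filt unfolding cf_filtration_def by (simp add: sets_Fm)

lemma subalg_Fm: "t \<in> {lo..hi} ==> subalgebra P (Fm t)"
 using Fm_P by (simp add: subalgebra_def)

lemma meas_mono: "f \<in> measurable (Fm s) N ==> lo <= s ==> s <= t ==> t <= hi ==> f \<in> measurable (Fm t) N"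
 by (rule measurable_from_subalg[of "Fm t" "Fm s"]) (simp_all add: subalgebra_def Fm_subset)

lemma meas_P: "f \<in> measurable (Fm t) N ==> t \<in> {lo..hi} ==> f \<in> measurable P N"
 by (rule measurable_from_subalg[OF subalg_Fm])

lemma cf_meas_iff: "t \<in> {lo..hi} ==> cf_meas P (Fl t) f \<longleftrightarrow> f \<in> bm (Fm t)"
 unfolding cf_meas_def measurable_def by (simp add: sets_Fm)

lemma adapted_iff: "cf_adapted P lo hi Fl X \<longleftrightarrow> (\<forall>t\<in>{lo..hi}. X t \<in> bm (Fm t))"
 unfolding cf_adapted_def using cf_meas_iff by auto

lemma martD:
 assumes "mart Y" "t \<in> {lo..hi}"
 shows "Y t \<in> bm (Fm t)" "integrable P (Y t)" "Y t \<in> bm P"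
 using assms unfolding cf_martingale_def by (auto simp: adapted_iff)

lemma integrable_bdd_mult:
 assumes "integrable P f" "Z \<in> bm P" "\<And>w. w \<in> space P ==> \<bar>Z w\<bar> <= C"
 shows "integrable P (\<lambda>w. Z w * f w :: real)"
proof (rule Bochner_Integration.integrable_bound)
 show "integrable P (\<lambda>w. C * f w)" using assms by simp
 show "AE w in P. norm (Z w * f w) <= norm (C * f w)"
 proof (rule AE_I2)
  fix w assume "w \<in> space P"
  then have "\<bar>Z w\<bar> <= \<bar>C\<bar>" using assms(3)[of w] by linarith
  then show "norm (Z w * f w) <= norm (C * f w)" by (simp add: abs_mult mult_right_mono)
 qed
qed (use assms in measurable)

lemma integrable_bdd:
 assumes "Z \<in> bm P" "\<And>w. w \<in> space P ==> \<bar>Z w\<bar> <= (C::real)"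
 shows "integrable P Z"
 by (rule integrable_const_bound[where B=C]) (use assms in auto)

text \<open>The definition tests only with indicators; through conditional expectation it extends to
  bounded weights known at time \<open>s\<close>.\<close>

lemma mart_mult:
 assumes Y: "mart Y" and st: "lo <= s" "s <= t" "t <= hi" and Z: "Z \<in> bm (Fm s)"
  and C: "\<And>w. w \<in> space P ==> \<bar>Z w\<bar> <= C"
 shows "(\<integral>w. Z w * (Y t w - Y s w) \<partial>P) = 0"
proof -
 have in': "s \<in> {lo..hi}" "t \<in> {lo..hi}" using st by auto
 interpret S: finite_measure_subalgebra P "Fm s"
  by unfold_locales (rule subalg_Fm[OF in'(1)])
 have ZP: "Z \<in> bm P" by (rule meas_P[OF Z in'(1)])
 have int: "integrable P (\<lambda>w. Z w * Y t w)" "integrable P (\<lambda>w. Z w * Y s w)"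
  by (rule integrable_bdd_mult[OF martD(2)[OF Y] ZP C]; use in' in simp)+
 have "AE w in P. real_cond_exp P (Fm s) (Y t) w = Y s w"
 proof (rule S.real_cond_exp_charact)
  show "set_lebesgue_integral P A (Y t) = set_lebesgue_integral P A (Y s)" if "A \<in> sets (Fm s)" for A
   using Y[unfolded cf_martingale_def] st that[unfolded sets_Fm[OF in'(1)]] by blast
 qed (rule martD(2)[OF Y in'(2)] martD(2)[OF Y in'(1)] martD(1)[OF Y in'(1)])+
 then have "(\<integral>w. Z w * real_cond_exp P (Fm s) (Y t) w \<partial>P) = (\<integral>w. Z w * Y s w \<partial>P)"
  using ZP martD(3)[OF Y in'(1)] by (intro integral_cong_AE) auto
 moreover have "(\<integral>w. Z w * real_cond_exp P (Fm s) (Y t) w \<partial>P) = (\<integral>w. Z w * Y t w \<partial>P)"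
  by (rule S.real_cond_exp_intg(2)[OF int(1) Z martD(3)[OF Y in'(2)]])
 ultimately show ?thesis using int by (simp add: right_diff_distrib)
qed

lemma martI:
 assumes "\<And>t. t \<in> {lo..hi} ==> Y t \<in> bm (Fm t)"
  and int: "\<And>t. t \<in> {lo..hi} ==> integrable P (Y t)"
  and eq: "\<And>s t A. lo <= s ==> s <= t ==> t <= hi ==> A \<in> sets (Fm s) ==> (\<integral>w. indicator A w * (Y t w - Y s w) \<partial>P) = 0"
 shows "mart Y"
 unfolding cf_martingale_def adapted_iff
proof (intro conjI allI impI ballI)
 fix s t A assume *: "lo <= s" "s <= t" "t <= hi" "A \<in> Fl s"
 then have A: "A \<in> sets (Fm s)" by (simp add: sets_Fm)
 have AP: "A \<in> sets P" using A Fm_P[of s] * by auto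
 have i: "integrable P (\<lambda>w. indicator A w * Y r w)" if "r \<in> {lo..hi}" for r
  using integrable_bdd_mult[OF int[OF that], of "indicator A" 1] AP by (simp add: indicator_def)
 show "set_lebesgue_integral P A (Y t) = set_lebesgue_integral P A (Y s)"
  using eq[OF *(1-3) A] i[of s] i[of t] * unfolding set_lebesgue_integral_def
  by (simp add: right_diff_distrib)
qed (use assms in auto)

lemma mart_diff_const: "mart Y ==> mart (\<lambda>t w. Y t w - Y lo w)"
proof (rule martI)
 assume Y: "mart Y"
 have lo: "lo \<in> {lo..hi}" using lohi by simp
 show "(\<lambda>w. Y t w - Y lo w) \<in> bm (Fm t)" if "t \<in> {lo..hi}" for t
  using martD(1)[OF Y that] meas_mono[OF martD(1)[OF Y lo], of t] that by auto
 show "integrable P (\<lambda>w. Y t w - Y lo w)" if "t \<in> {lo..hi}" for t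
  using martD(2)[OF Y that] martD(2)[OF Y lo] by simp
 show "(\<integral>w. indicator A w * ((Y t w - Y lo w) - (Y s w - Y lo w)) \<partial>P) = 0"
  if "lo <= s" "s <= t" "t <= hi" "A \<in> sets (Fm s)" for s t A
  using mart_mult[OF Y that(1-3), of "indicator A" 1] that(4) by (simp add: indicator_def)
qed

lemma mart_zero: "mart (\<lambda>t w. 0)"
 by (rule martI) auto

lemma mart_add:
 assumes Y: "mart Y" and Y': "mart Y'" shows "mart (\<lambda>t w. Y t w + Y' t w)"
proof (rule martI)
 show "(\<lambda>w. Y t w + Y' t w) \<in> bm (Fm t)" if "t \<in> {lo..hi}" for t
  using martD(1)[OF Y that] martD(1)[OF Y' that] by simp
 show "integrable P (\<lambda>w. Y t w + Y' t w)" if "t \<in> {lo..hi}" for t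
  using martD(2)[OF Y that] martD(2)[OF Y' that] by simp
 fix s t A assume *: "lo <= s" "s <= t" "t <= hi" "A \<in> sets (Fm s)"
 then have AP: "A \<in> sets P" using Fm_P[of s] by auto
 have int: "integrable P (\<lambda>w. indicator A w * (Z t w - Z s w))" if "mart Z" for Z
  using martD(2)[OF that, of s] martD(2)[OF that, of t] * AP
  by (intro integrable_bdd_mult[where C=1]) (auto simp: indicator_def)
 have "(\<integral>w. indicator A w * (Z t w - Z s w) \<partial>P) = 0" if "mart Z" for Z
  using mart_mult[OF that *(1-3), of "indicator A" 1] *(4) by (simp add: indicator_def)
 then have "(\<integral>w. indicator A w * (Y t w - Y s w) + indicator A w * (Y' t w - Y' s w) \<partial>P) = 0"
  using int Y Y' by simp
 then show "(\<integral>w. indicator A w * (Y t w + Y' t w - (Y s w + Y' s w)) \<partial>P) = 0"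
  by (simp add: algebra_simps)
qed

text \<open>One summand of an elementary integral. Over \<open>[s, t]\<close> it moves only on the
  overlap with \<open>[u, v]\<close>, and the cases locate this overlap.\<close>

lemma mart_step:
 assumes Y: "mart Y" and uv: "lo <= u" "u <= v" "v <= hi" and Z: "Z \<in> bm (Fm u)"
  and C: "\<And>w. w \<in> space P ==> \<bar>Z w\<bar> <= C"
 shows "mart (\<lambda>t w. Z w * (Y (min v t) w - Y (min u t) w))"
proof (rule martI)
 have ZP: "Z \<in> bm P" by (rule meas_P[OF Z]) (use uv in auto)
 fix t assume t: "t \<in> {lo..hi}"
 show "integrable P (\<lambda>w. Z w * (Y (min v t) w - Y (min u t) w))"
  using martD(2)[OF Y, of "min v t"] martD(2)[OF Y, of "min u t"] t uv
  by (intro integrable_bdd_mult[OF _ ZP C]) auto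
 show "(\<lambda>w. Z w * (Y (min v t) w - Y (min u t) w)) \<in> bm (Fm t)"
 proof (cases "t <= u")
  case True
  then have "min v t = t" "min u t = t" using uv by auto
  then have "(\<lambda>w. Z w * (Y (min v t) w - Y (min u t) w)) = (\<lambda>_. 0)" by simp
  then show ?thesis by simp
 next
  case False
  have [measurable]: "Z \<in> bm (Fm t)" "Y (min v t) \<in> bm (Fm t)" "Y (min u t) \<in> bm (Fm t)"
   by (rule meas_mono[OF Z] meas_mono[OF martD(1)[OF Y]]; use uv t False in auto)+
  show ?thesis by measurable
 qed
next
 fix s t A assume *: "lo <= s" "s <= t" "t <= hi" "A \<in> sets (Fm s)"
 have bd: "\<bar>indicator A w * Z w\<bar> <= max C 0" if "w \<in> space P" for w
  using C[OF that] by (auto simp: indicator_def)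
 have key: "(\<integral>w. (indicator A w * Z w) * (Y q w - Y p w) \<partial>P) = 0" if "u <= p" "s <= p" "p <= q" "q <= hi" for p q
 proof (rule mart_mult[OF Y _ that(3,4) _ bd])
  have [measurable]: "Z \<in> bm (Fm p)" "A \<in> sets (Fm p)"
   using meas_mono[OF Z, of p] Fm_subset[of s p] * that uv by auto
  show "(\<lambda>w. indicator A w * Z w) \<in> bm (Fm p)" by measurable
 qed (use that * in auto)
 have alt: "indicator A w * (Z w * (Y (min v t) w - Y (min u t) w) - Z w * (Y (min v s) w - Y (min u s) w))
   = (indicator A w * Z w) * (Y q w - Y p w)"
  if "Y (min v t) w - Y (min u t) w - Y (min v s) w + Y (min u s) w = Y q w - Y p w" for w p q
  unfolding that[symmetric] by (simp add: algebra_simps)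
 consider "t <= u" | "s <= u" "u < t" | "u < s" "v <= s" | "u < s" "s < v" by linarith
 then show "(\<integral>w. indicator A w * (Z w * (Y (min v t) w - Y (min u t) w) - Z w * (Y (min v s) w - Y (min u s) w)) \<partial>P) = 0"
 proof cases
  case 1
  then show ?thesis using uv * by (simp add: min_absorb2)
 next
  case 2
  then have eq: "(indicator A w * (Z w * (Y (min v t) w - Y (min u t) w) - Z w * (Y (min v s) w - Y (min u s) w)))
    = (indicator A w * Z w) * (Y (min v t) w - Y u w)" for w
   by (intro alt) (use uv in \<open>simp add: min_absorb1 min_absorb2\<close>)
  show ?thesis unfolding eq by (rule key) (use 2 uv * in auto)
 next
  case 3
  then show ?thesis using uv * by (simp add: min_absorb1)
 next
  case 4
  then have eq: "(indicator A w * (Z w * (Y (min v t) w - Y (min u t) w) - Z w * (Y (min v s) w - Y (min u s) w)))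
    = (indicator A w * Z w) * (Y (min v t) w - Y s w)" for w
   by (intro alt) (use uv * in \<open>simp add: min_absorb1 min_absorb2\<close>)
  show ?thesis unfolding eq by (rule key) (use 4 uv * in auto)
 qed
qed

definition grid_in :: "(nat => real) => bool" where
 "grid_in u \<longleftrightarrow> mono u \<and> range u \<subseteq> {lo..hi}"

lemma grid_inD: "grid_in u ==> lo <= u j" "grid_in u ==> u j <= hi" "grid_in u ==> i <= j ==> u i <= u j"
 unfolding grid_in_def by (simp_all add: mono_def image_subset_iff)

text \<open>The elementary stochastic integral of \<open>Z\<close>, sampled at left end points.
  Stopping both ends of every cell at \<open>t\<close> turns it into a process in
  \<open>t\<close>.\<close>

definition tr :: "(nat => real) => nat => (real => 'a => real) => (real => 'a => real) => real => 'a => real" where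
 "tr u n Z Y t w = (\<Sum>j<n. Z (u j) w * (Y (min (u (Suc j)) t) w - Y (min (u j) t) w))"

lemma mart_tr:
 assumes Y: "mart Y" and u: "grid_in u" and Z: "\<And>r. r \<in> {lo..hi} ==> Z r \<in> bm (Fm r)"
  and C: "\<And>r w. w \<in> space P ==> r \<in> {lo..hi} ==> \<bar>Z r w\<bar> <= C"
 shows "mart (tr u n Z Y)"
proof (induction n)
 case 0
 have "tr u 0 Z Y = (\<lambda>t w. 0)" by (auto simp: tr_def fun_eq_iff)
 then show ?case using mart_zero by simp
next
 case (Suc n)
 have "tr u (Suc n) Z Y = (\<lambda>t w. tr u n Z Y t w + Z (u n) w * (Y (min (u (Suc n)) t) w - Y (min (u n) t) w))"
  by (auto simp: tr_def fun_eq_iff)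
 moreover have "mart (\<lambda>t w. Z (u n) w * (Y (min (u (Suc n)) t) w - Y (min (u n) t) w))"
  by (rule mart_step[OF Y, where C=C]) (use u Z C grid_inD[OF u] in auto)
 ultimately show ?case using mart_add[OF Suc] by simp
qed

text \<open>Grows with \<open>n\<close> and serves integrability only; the effective estimate is the
  one in mean square.\<close>

lemma tr_bound:
 assumes "\<And>t. \<bar>Y t w\<bar> <= k" "\<And>j. \<bar>Z (u j) w\<bar> <= C"
 shows "\<bar>tr u n Z Y t w\<bar> <= real n * (C * (2 * k))"
proof -
 have "\<bar>tr u n Z Y t w\<bar> <= (\<Sum>j<n. \<bar>Z (u j) w * (Y (min (u (Suc j)) t) w - Y (min (u j) t) w)\<bar>)"
  unfolding tr_def by (rule sum_abs)
 also have "... <= (\<Sum>j<n. C * (2 * k))"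
 proof (rule sum_mono)
  fix j
  have "0 <= C" using assms(2)[of 0] by linarith
  moreover have "\<bar>Y (min (u (Suc j)) t) w - Y (min (u j) t) w\<bar> <= 2 * k"
   using assms(1)[of "min (u (Suc j)) t"] assms(1)[of "min (u j) t"] by linarith
  ultimately show "\<bar>Z (u j) w * (Y (min (u (Suc j)) t) w - Y (min (u j) t) w)\<bar> <= C * (2 * k)"
   unfolding abs_mult using assms(2)[of j] by (intro mult_mono) auto
 qed
 finally show ?thesis by simp
qed

text \<open>Pythagoras: the cross term \<open>Y s * (Y t - Y s)\<close> has mean zero.\<close>

lemma mart_sq_incr:
 assumes Y: "mart Y" and k: "\<And>t w. w \<in> space P ==> t \<in> {lo..hi} ==> \<bar>Y t w\<bar> <= k" and st: "lo <= s" "s <= t" "t <= hi"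
  and Z: "Z \<in> bm (Fm s)" and C: "\<And>w. w \<in> space P ==> \<bar>Z w\<bar> <= C"
 shows "(\<integral>w. (Y t w - Y s w)\<^sup>2 \<partial>P) = (\<integral>w. (Y t w)\<^sup>2 \<partial>P) - (\<integral>w. (Y s w)\<^sup>2 \<partial>P)"
  and "(\<integral>w. (Z w * (Y t w - Y s w))\<^sup>2 \<partial>P) <= C\<^sup>2 * ((\<integral>w. (Y t w)\<^sup>2 \<partial>P) - (\<integral>w. (Y s w)\<^sup>2 \<partial>P))"
proof -
 have in': "s \<in> {lo..hi}" "t \<in> {lo..hi}" using st by auto
 have [measurable]: "Y s \<in> bm P" "Y t \<in> bm P" using martD(3)[OF Y] in' by auto
 have ks: "\<bar>Y s w\<bar> <= k" "\<bar>Y t w\<bar> <= k" if "w \<in> space P" for w using k in' that by auto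
 have int2: "integrable P (\<lambda>w. (Y r w)\<^sup>2)" if "r = s \<or> r = t" for r
 proof (rule integrable_bdd[where C="k\<^sup>2"])
  show "(\<lambda>w. (Y r w)\<^sup>2) \<in> bm P" using that by auto
  show "\<bar>(Y r w)\<^sup>2\<bar> <= k\<^sup>2" if "w \<in> space P" for w
   using ks[OF that] \<open>r = s \<or> r = t\<close> power_mono[of "\<bar>Y r w\<bar>" k 2] by auto
 qed
 have intc: "integrable P (\<lambda>w. 2 * (Y s w * (Y t w - Y s w)))"
  by (intro integrable_mult_right integrable_bdd_mult[where C=k])
    (use martD(2)[OF Y] in' ks in auto)
 have eq: "(Y t w - Y s w)\<^sup>2 = (Y t w)\<^sup>2 - (Y s w)\<^sup>2 - 2 * (Y s w * (Y t w - Y s w))" for w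
  by (simp add: power2_eq_square algebra_simps)
 have "(\<integral>w. (Y t w - Y s w)\<^sup>2 \<partial>P) = (\<integral>w. (Y t w)\<^sup>2 \<partial>P) - (\<integral>w. (Y s w)\<^sup>2 \<partial>P) - (\<integral>w. 2 * (Y s w * (Y t w - Y s w)) \<partial>P)"
  unfolding eq using int2[of s] int2[of t] intc by simp
 moreover have "(\<integral>w. Y s w * (Y t w - Y s w) \<partial>P) = 0"
  by (rule mart_mult[OF Y st martD(1)[OF Y in'(1)] ks(1)])
 ultimately show 1: "(\<integral>w. (Y t w - Y s w)\<^sup>2 \<partial>P) = (\<integral>w. (Y t w)\<^sup>2 \<partial>P) - (\<integral>w. (Y s w)\<^sup>2 \<partial>P)"
  by simp
 have ZP[measurable]: "Z \<in> bm P" by (rule meas_P[OF Z in'(1)])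
 have intd: "integrable P (\<lambda>w. (Y t w - Y s w)\<^sup>2)"
  unfolding eq using int2[of s] int2[of t] intc by simp
 have Zsq: "\<bar>(Z w)\<^sup>2\<bar> <= C\<^sup>2" if "w \<in> space P" for w
  using power_mono[OF C[OF that], of 2] by simp
 have "(\<integral>w. (Z w * (Y t w - Y s w))\<^sup>2 \<partial>P) <= (\<integral>w. C\<^sup>2 * (Y t w - Y s w)\<^sup>2 \<partial>P)"
 proof (rule integral_mono)
  show "integrable P (\<lambda>w. (Z w * (Y t w - Y s w))\<^sup>2)"
   unfolding power_mult_distrib by (rule integrable_bdd_mult[OF intd _ Zsq]) auto
  show "integrable P (\<lambda>w. C\<^sup>2 * (Y t w - Y s w)\<^sup>2)" using intd by simp
  show "(Z w * (Y t w - Y s w))\<^sup>2 <= C\<^sup>2 * (Y t w - Y s w)\<^sup>2" if "w \<in> space P" for w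
   unfolding power_mult_distrib using Zsq[OF that] by (intro mult_right_mono) auto
 qed
 then show "(\<integral>w. (Z w * (Y t w - Y s w))\<^sup>2 \<partial>P) <= C\<^sup>2 * ((\<integral>w. (Y t w)\<^sup>2 \<partial>P) - (\<integral>w. (Y s w)\<^sup>2 \<partial>P))"
  using 1 by simp
qed

lemma mart_sq_mono:
 assumes Y: "mart Y" and k: "\<And>t w. w \<in> space P ==> t \<in> {lo..hi} ==> \<bar>Y t w\<bar> <= k" and st: "lo <= s" "s <= t" "t <= hi"
 shows "(\<integral>w. (Y s w)\<^sup>2 \<partial>P) <= (\<integral>w. (Y t w)\<^sup>2 \<partial>P)"
proof -
 have "0 <= (\<integral>w. (Y t w - Y s w)\<^sup>2 \<partial>P)" by simp
 also have "... = (\<integral>w. (Y t w)\<^sup>2 \<partial>P) - (\<integral>w. (Y s w)\<^sup>2 \<partial>P)"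
  by (rule mart_sq_incr(1)[OF Y k st, of "\<lambda>_. 0" 0]) auto
 finally show ?thesis by simp
qed

text \<open>The summands are orthogonal, and those before time \<open>s\<close> vanish.\<close>

lemma tr_L2:
 assumes Y: "mart Y" and k: "\<And>t w. w \<in> space P ==> t \<in> {lo..hi} ==> \<bar>Y t w\<bar> <= k" and u: "grid_in u"
  and Z: "\<And>r. r \<in> {lo..hi} ==> Z r \<in> bm (Fm r)"
  and C: "\<And>r w. w \<in> space P ==> r \<in> {lo..hi} ==> \<bar>Z r w\<bar> <= C"
  and Z0: "\<And>r w. r < s ==> Z r w = 0" and st: "lo <= s" "s <= t" "t <= hi"
 shows "integrable P (\<lambda>w. (tr u n Z Y t w)\<^sup>2)"
  "(\<integral>w. (tr u n Z Y t w)\<^sup>2 \<partial>P) <= C\<^sup>2 * ((\<integral>w. (Y t w)\<^sup>2 \<partial>P) - (\<integral>w. (Y s w)\<^sup>2 \<partial>P))"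
proof -
 define e where "e r = (\<integral>w. (Y r w)\<^sup>2 \<partial>P)" for r
 have e_mono: "e p <= e q" if "lo <= p" "p <= q" "q <= hi" for p q
  unfolding e_def by (rule mart_sq_mono[OF Y k that])
 have tin: "t \<in> {lo..hi}" using st by auto
 have kk: "\<bar>tr u n Z Y t w\<bar> <= real n * (C * (2 * k))" if "w \<in> space P" for n w
 proof -
  \<comment> \<open>\<open>tr_bound\<close> wants a bound at all real times, which the clamped
    process has.\<close>
  have "\<bar>tr u n Z (\<lambda>r. Y (max lo (min hi r))) t w\<bar> <= real n * (C * (2 * k))"
   by (rule tr_bound) (use that k C lohi grid_inD[OF u] in auto)
  moreover have "max lo (min hi (min (u i) t)) = min (u i) t" for i
   using grid_inD(1,2)[OF u, of i] st by auto
  then have "tr u n Z (\<lambda>r. Y (max lo (min hi r))) t w = tr u n Z Y t w" by (simp add: tr_def)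
  ultimately show ?thesis by simp
 qed
 have trm[measurable]: "tr u n Z Y t \<in> bm P" for n
  using martD(3)[OF mart_tr[OF Y u Z C] tin] by blast
 have sqi: "integrable P (\<lambda>w. (tr u n Z Y t w)\<^sup>2)" for n
 proof (rule integrable_bdd[where C="(real n * (C * (2 * k)))\<^sup>2"])
  show "\<bar>(tr u n Z Y t w)\<^sup>2\<bar> <= (real n * (C * (2 * k)))\<^sup>2" if "w \<in> space P" for w
   using power_mono[OF kk[OF that], where n = 2] by simp
 qed measurable
 then show "integrable P (\<lambda>w. (tr u n Z Y t w)\<^sup>2)" .
 \<comment> \<open>The first \<open>n\<close> cells can have consumed only the energy of
   \<open>Y\<close> between \<open>s\<close> and the last grid point reached, capped at
   \<open>t\<close>.\<close>
 have "(\<integral>w. (tr u n Z Y t w)\<^sup>2 \<partial>P) <= C\<^sup>2 * (e (max s (min (u n) t)) - e s)"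
 proof (induction n)
  case 0
  have "e s <= e (max s (min (u 0) t))" using st by (intro e_mono) auto
  then show ?case by (simp add: tr_def)
 next
  case (Suc n)
  define D where "D w = Y (min (u (Suc n)) t) w - Y (min (u n) t) w" for w
  have un: "lo <= u n" "u n <= u (Suc n)" "u (Suc n) <= hi" using grid_inD[OF u] by auto
  have step: "tr u (Suc n) Z Y t w = tr u n Z Y t w + Z (u n) w * D w" for w
   by (simp add: tr_def D_def)
  show ?case
  proof (cases "t <= u n \<or> u n < s")
   case True
   then have zero: "Z (u n) w * D w = 0" for w
   proof (cases "t <= u n")
    case True
    then have "min (u (Suc n)) t = t" "min (u n) t = t" using un by auto
    then show ?thesis by (simp add: D_def)
   qed (use Z0 \<open>t <= u n \<or> u n < s\<close> in simp)
   have "tr u (Suc n) Z Y t = tr u n Z Y t" by (rule ext) (simp only: step zero add_0_right)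
   then have "(\<integral>w. (tr u (Suc n) Z Y t w)\<^sup>2 \<partial>P) = (\<integral>w. (tr u n Z Y t w)\<^sup>2 \<partial>P)" by simp
   also have "... <= C\<^sup>2 * (e (max s (min (u n) t)) - e s)" by (rule Suc)
   also have "... <= C\<^sup>2 * (e (max s (min (u (Suc n)) t)) - e s)"
    using un st by (intro mult_left_mono diff_right_mono e_mono) auto
   finally show ?thesis .
  next
   case False
   then have un': "s <= u n" "u n < t" by auto
   let ?v = "min (u (Suc n)) t"
   have v: "u n <= ?v" "?v <= hi" using un un' st by auto
   have D: "D w = Y ?v w - Y (u n) w" for w using un' by (simp add: D_def min_absorb1)
   have uin: "u n \<in> {lo..hi}" "?v \<in> {lo..hi}" using un v un' by auto
   have [measurable]: "Y ?v \<in> bm P" "Y (u n) \<in> bm P" "Z (u n) \<in> bm P"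
    using martD(3)[OF Y] uin meas_P[OF Z[OF uin(1)]] by auto
   have Dm[measurable]: "D \<in> bm P" unfolding D_def[abs_def] using un' by (simp add: min_absorb1)
   have Db: "\<bar>D w\<bar> <= 2 * k" if "w \<in> space P" for w
    using k[OF that uin(1)] k[OF that uin(2)] unfolding D by linarith
   have "tr u n Z Y t \<in> bm (Fm (u n))"
    unfolding tr_def
   proof (intro borel_measurable_sum borel_measurable_times borel_measurable_diff)
    fix j assume "j \<in> {..<n}"
    then have j: "u j <= u n" "u (Suc j) <= u n" using grid_inD(3)[OF u] by auto
    show "Z (u j) \<in> bm (Fm (u n))"
     by (rule meas_mono[OF Z]) (use j grid_inD[OF u] un in auto)
    show "Y (min (u (Suc j)) t) \<in> bm (Fm (u n))" "Y (min (u j) t) \<in> bm (Fm (u n))"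
     by (rule meas_mono[OF martD(1)[OF Y]]; use j grid_inD[OF u] un st in \<open>auto simp: min_le_iff_disj\<close>)+
   qed
   then have trZ: "(\<lambda>w. tr u n Z Y t w * Z (u n) w) \<in> bm (Fm (u n))"
    using Z[OF uin(1)] by simp
   have trZb: "\<bar>tr u n Z Y t w * Z (u n) w\<bar> <= (real n * (C * (2 * k))) * C" if "w \<in> space P" for w
    unfolding abs_mult
    by (rule mult_mono[OF kk[OF that] C[OF that uin(1)] order_trans[OF abs_ge_zero kk[OF that]] abs_ge_zero])
   have cross: "(\<integral>w. tr u n Z Y t w * Z (u n) w * D w \<partial>P) = 0"
    unfolding D by (rule mart_mult[OF Y _ v trZ trZb]) (use un in auto)
   have crossi: "integrable P (\<lambda>w. tr u n Z Y t w * Z (u n) w * D w)"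
    by (rule integrable_bdd_mult[OF _ _ trZb, where f=D]) (use integrable_bdd[OF Dm Db] in auto)
   have ZDi: "integrable P (\<lambda>w. (Z (u n) w * D w)\<^sup>2)"
   proof (rule integrable_bdd[where C="(C * (2 * k))\<^sup>2"])
    show "\<bar>(Z (u n) w * D w)\<^sup>2\<bar> <= (C * (2 * k))\<^sup>2" if "w \<in> space P" for w
    proof -
     have "\<bar>Z (u n) w * D w\<bar> <= C * (2 * k)"
      unfolding abs_mult
      by (rule mult_mono[OF C[OF that uin(1)] Db[OF that] order_trans[OF abs_ge_zero C[OF that uin(1)]] abs_ge_zero])
     from power_mono[OF this, of 2] show ?thesis by simp
    qed
   qed measurable
   have "(tr u (Suc n) Z Y t w)\<^sup>2 = (tr u n Z Y t w)\<^sup>2 + 2 * (tr u n Z Y t w * Z (u n) w * D w) + (Z (u n) w * D w)\<^sup>2" for w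
    unfolding step by (simp add: power2_eq_square algebra_simps)
   then have "(\<integral>w. (tr u (Suc n) Z Y t w)\<^sup>2 \<partial>P) = (\<integral>w. (tr u n Z Y t w)\<^sup>2 \<partial>P) + (\<integral>w. (Z (u n) w * D w)\<^sup>2 \<partial>P)"
    using sqi[of n] crossi ZDi cross by simp
   also have "(\<integral>w. (Z (u n) w * D w)\<^sup>2 \<partial>P) <= C\<^sup>2 * (e ?v - e (u n))"
    unfolding D e_def by (rule mart_sq_incr(2)[OF Y k un(1) v Z[OF uin(1)] C[OF _ uin(1)]])
   also have "(\<integral>w. (tr u n Z Y t w)\<^sup>2 \<partial>P) <= C\<^sup>2 * (e (max s (min (u n) t)) - e s)" by (rule Suc)
   also have "C\<^sup>2 * (e (max s (min (u n) t)) - e s) + C\<^sup>2 * (e ?v - e (u n)) = C\<^sup>2 * (e (max s ?v) - e s)"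
   proof -
    have "max s (min (u n) t) = u n" "max s ?v = ?v" using un' un st by auto
    then show ?thesis by (simp add: algebra_simps)
   qed
   finally show ?thesis by simp
  qed
 qed
 also have "... <= C\<^sup>2 * (e t - e s)"
  using st by (intro mult_left_mono diff_right_mono e_mono) auto
 finally show "(\<integral>w. (tr u n Z Y t w)\<^sup>2 \<partial>P) <= C\<^sup>2 * ((\<integral>w. (Y t w)\<^sup>2 \<partial>P) - (\<integral>w. (Y s w)\<^sup>2 \<partial>P))"
  by (simp add: e_def)
qed

end

section \<open>Dyadic grids, the maximal inequality and stopping\<close>

lemma dyadic_below:
 fixes x :: real assumes "0 <= x" "x <= 1"
 obtains k where "k <= 2 ^ N" "real k / 2 ^ N <= x" "x <= real k / 2 ^ N + 1 / 2 ^ N"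
proof -
 define k where "k = nat \<lfloor>x * 2 ^ N\<rfloor>"
 have f: "0 <= \<lfloor>x * 2 ^ N\<rfloor>" using assms by simp
 have k1: "real k <= x * 2 ^ N" "x * 2 ^ N <= real k + 1" using f by (auto simp: k_def)
 have "x * 2 ^ N <= 1 * 2 ^ N" using assms by (intro mult_right_mono) auto
 then have "real k <= 2 ^ N" using k1 by linarith
 then have "k <= 2 ^ N" by simp
 then show ?thesis using k1 by (intro that[of k]) (auto simp: field_simps)
qed

text \<open>The transform of the indicator of times before \<open>s\<close> telescopes up to the
  first grid point at or after \<open>s\<close>. That index depends on the grid and \<open>s\<close>
  only, so one \<open>i\<close> serves all \<open>f\<close> and \<open>t\<close>.\<close>

lemma tel_sum:
 fixes u :: "nat => real" and f :: "real => real"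
 assumes "mono u" "s <= u n"
 obtains i where "i <= n" "s <= u i" "\<And>j. j < i ==> u j < s"
  "\<And>f t. (\<Sum>j<n. of_bool (u j < s) * (f (min (u (Suc j)) t) - f (min (u j) t))) = f (min (u i) t) - (f (min (u 0) t) :: real)"
proof -
 define i where "i = (LEAST i. s <= u i)"
 have i: "s <= u i" "i <= n" unfolding i_def using assms(2) by (auto intro: LeastI Least_le)
 have less: "u j < s" if "j < i" for j using not_less_Least[of j "\<lambda>i. s <= u i"] that unfolding i_def by auto
 have ge: "\<not> u j < s" if "i <= j" for j using monoD[OF assms(1) that] i by linarith
 show ?thesis
 proof (rule that[OF i(2,1) less])
  fix f :: "real => real" and t
  have "(\<Sum>j<n. of_bool (u j < s) * (f (min (u (Suc j)) t) - f (min (u j) t))) =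
    (\<Sum>j<i. of_bool (u j < s) * (f (min (u (Suc j)) t) - f (min (u j) t)))"
   using i(2) ge by (intro sum.mono_neutral_right) auto
  also have "... = (\<Sum>j<i. f (min (u (Suc j)) t) - f (min (u j) t))"
   using less by (intro sum.cong) auto
  also have "... = f (min (u i) t) - f (min (u 0) t)"
   by (rule sum_lessThan_telescope)
  finally show "(\<Sum>j<n. of_bool (u j < s) * (f (min (u (Suc j)) t) - f (min (u j) t))) = f (min (u i) t) - f (min (u 0) t)" .
 qed
qed

context filtered_prob
begin

text \<open>Constant after index \<open>2 ^ N\<close>, so that it is a monotone sequence within
  \<open>[lo, hi]\<close> as \<open>grid_in\<close> requires.\<close>

definition gr :: "nat => nat => real" where
 "gr N j = lo + real (min j (2 ^ N)) * (hi - lo) / 2 ^ N"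

definition mesh :: "nat => real" where
 "mesh N = (hi - lo) / 2 ^ N"

lemma gr_mesh: "gr N j = lo + real (min j (2 ^ N)) * mesh N"
 by (simp add: gr_def mesh_def)

lemma mesh_pos: "0 < mesh N"
 using lohi by (simp add: mesh_def)

lemma mesh_lim: "mesh \<longlonglongrightarrow> 0"
proof -
 have "(\<lambda>N. (hi - lo) * (1/2) ^ N) \<longlonglongrightarrow> (hi - lo) * 0"
  by (intro tendsto_intros LIMSEQ_power_zero) auto
 then show ?thesis by (simp add: mesh_def[abs_def] power_divide)
qed

lemma gr_0 [simp]: "gr N 0 = lo" by (simp add: gr_def)
lemma gr_end [simp]: "gr N (2 ^ N) = hi" by (simp add: gr_def)

lemma grid_gr: "grid_in (gr N)"
 unfolding grid_in_def
proof
 show m: "mono (gr N)"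
  unfolding gr_mesh using mesh_pos[of N] by (intro monoI add_left_mono mult_right_mono) auto
 have "gr N j <= hi" for j
 proof -
  have "real (min j (2 ^ N)) * mesh N <= real (2 ^ N) * mesh N" using mesh_pos[of N] by (intro mult_right_mono) auto
  then show ?thesis unfolding gr_mesh by (simp add: mesh_def)
 qed
 moreover have "lo <= gr N j" for j unfolding gr_mesh using mesh_pos[of N] by simp
 ultimately show "range (gr N) \<subseteq> {lo..hi}" by auto
qed

lemma gr_Suc_le: "gr N (Suc j) <= gr N j + mesh N"
proof -
 have "real (min (Suc j) (2 ^ N)) <= real (min j (2 ^ N)) + 1" by auto
 then have "real (min (Suc j) (2 ^ N)) * mesh N <= (real (min j (2 ^ N)) + 1) * mesh N"
  using mesh_pos[of N] by (intro mult_right_mono) auto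
 then show ?thesis unfolding gr_mesh by (simp add: distrib_right)
qed

lemma gr_in: "gr N j \<in> {lo..hi}"
 using grid_inD[OF grid_gr] by auto

lemma gr_below:
 assumes "t \<in> {lo..hi}"
 obtains j where "j <= 2 ^ N" "gr N j <= t" "t <= gr N j + mesh N"
proof -
 have "0 <= (t - lo) / (hi - lo)" "(t - lo) / (hi - lo) <= 1" using assms lohi by auto
 then obtain k where k: "k <= 2 ^ N" "real k / 2 ^ N <= (t - lo) / (hi - lo)" "(t - lo) / (hi - lo) <= real k / 2 ^ N + 1 / 2 ^ N"
  by (rule dyadic_below)
 have "gr N k <= t" using k(1,2) lohi by (simp add: gr_def field_simps)
 moreover have "t <= gr N k + mesh N"
 proof -
  have "(t - lo) / (hi - lo) * (hi - lo) <= (real k / 2 ^ N + 1 / 2 ^ N) * (hi - lo)"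
   using k(3) lohi by (intro mult_right_mono) auto
  then have "t - lo <= (real k / 2 ^ N + 1 / 2 ^ N) * (hi - lo)" using lohi by simp
  then show ?thesis using k(1) by (simp add: gr_def mesh_def distrib_right)
 qed
 ultimately show ?thesis using k(1) that by blast
qed

lemma gr_refine: "N <= M ==> j <= 2 ^ N ==> gr N j = gr M (j * 2 ^ (M - N))"
proof -
 assume *: "N <= M" "j <= 2 ^ N"
 have e: "(2::nat) ^ M = 2 ^ N * 2 ^ (M - N)" "(2::real) ^ M = 2 ^ N * 2 ^ (M - N)" using *(1) by (simp_all flip: power_add)
 then have "j * 2 ^ (M - N) <= 2 ^ M" using *(2) by simp
 then show ?thesis using *(2) unfolding gr_def by (simp add: min_absorb1 e(2))
qed

text \<open>Kolmogorov's argument: split the event by the first index \<open>i\<close> with a value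
  above \<open>l\<close>. The set \<open>A i\<close> is known at that time, so on it the mean square
  can only grow until the last index.\<close>

lemma discrete_maximal:
 assumes Y: "mart Y" and k: "\<And>t w. w \<in> space P ==> t \<in> {lo..hi} ==> \<bar>Y t w\<bar> <= k" and u: "grid_in u" and l: "0 < l"
 shows "{w\<in>space P. \<exists>i\<le>n. l < \<bar>Y (u i) w\<bar>} \<in> sets P"
  "measure P {w\<in>space P. \<exists>i\<le>n. l < \<bar>Y (u i) w\<bar>} <= (\<integral>w. (Y (u n) w)\<^sup>2 \<partial>P) / l\<^sup>2"
proof -
 have uin: "u i \<in> {lo..hi}" for i using grid_inD[OF u] by auto
 have Ym[measurable]: "Y (u i) \<in> bm P" for i using martD(3)[OF Y uin] .
 define E where "E = {w\<in>space P. \<exists>i\<in>{..n}. l < \<bar>Y (u i) w\<bar>}"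
 define A where "A i = {w\<in>space P. l < \<bar>Y (u i) w\<bar> \<and> (\<forall>j\<in>{..<i}. \<bar>Y (u j) w\<bar> <= l)}" for i
 have E[measurable]: "E \<in> sets P" unfolding E_def by measurable
 have E_eq: "E = {w\<in>space P. \<exists>i\<le>n. l < \<bar>Y (u i) w\<bar>}" by (auto simp: E_def)
 show "{w\<in>space P. \<exists>i\<le>n. l < \<bar>Y (u i) w\<bar>} \<in> sets P" using E E_eq by simp
 have AFm: "A i \<in> sets (Fm (u i))" for i
 proof -
  have [measurable]: "Y (u i) \<in> bm (Fm (u i))" by (rule martD(1)[OF Y uin])
  have s1: "{w\<in>space (Fm (u i)). l < \<bar>Y (u i) w\<bar>} \<in> sets (Fm (u i))" by measurable
  have s2: "{w\<in>space (Fm (u i)). \<forall>j\<in>{..<i}. \<bar>Y (u j) w\<bar> <= l} \<in> sets (Fm (u i))"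
  proof (rule sets.sets_Collect_finite_All)
   fix j assume "j \<in> {..<i}"
   then have [measurable]: "Y (u j) \<in> bm (Fm (u i))"
    by (intro meas_mono[OF martD(1)[OF Y uin]]) (use grid_inD[OF u] in auto)
   show "{w\<in>space (Fm (u i)). \<bar>Y (u j) w\<bar> <= l} \<in> sets (Fm (u i))" by measurable
  qed auto
  have Aeq: "A i = {w\<in>space (Fm (u i)). l < \<bar>Y (u i) w\<bar>} \<inter> {w\<in>space (Fm (u i)). \<forall>j\<in>{..<i}. \<bar>Y (u j) w\<bar> <= l}"
   by (auto simp: A_def)
  show ?thesis unfolding Aeq by (rule sets.Int[OF s1 s2])
 qed
 have AP[measurable]: "A i \<in> sets P" for i using AFm Fm_P[OF uin] by blast
 have sqi: "integrable P (\<lambda>w. (Y (u i) w)\<^sup>2)" for i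
 proof (rule integrable_bdd[where C="k\<^sup>2"])
  show "\<bar>(Y (u i) w)\<^sup>2\<bar> <= k\<^sup>2" if "w \<in> space P" for w
   using power_mono[OF k[OF that uin[of i]], where n=2] by simp
 qed measurable
 have i1: "integrable P (\<lambda>w. indicator (A i) w * (Y (u j) w)\<^sup>2)" for i j
  by (rule integrable_bdd_mult[OF sqi, where C=1]) (auto simp: indicator_def)
 have step: "(\<integral>w. indicator (A i) w * (Y (u i) w)\<^sup>2 \<partial>P) <= (\<integral>w. indicator (A i) w * (Y (u n) w)\<^sup>2 \<partial>P)" if "i <= n" for i
 proof -
  have Zm: "(\<lambda>w. indicator (A i) w * Y (u i) w) \<in> bm (Fm (u i))"
   using AFm[of i] martD(1)[OF Y uin[of i]] by simp
  have Zb: "\<bar>indicator (A i) w * Y (u i) w\<bar> <= k" if "w \<in> space P" for w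
   using k[OF that uin[of i]] by (auto simp: indicator_def)
  have z: "(\<integral>w. (indicator (A i) w * Y (u i) w) * (Y (u n) w - Y (u i) w) \<partial>P) = 0"
   by (rule mart_mult[OF Y _ _ _ Zm Zb]) (use grid_inD[OF u] that in auto)
  have zi: "integrable P (\<lambda>w. (indicator (A i) w * Y (u i) w) * (Y (u n) w - Y (u i) w))"
   by (rule integrable_bdd_mult[OF _ _ Zb]) (use martD(2)[OF Y uin] meas_P[OF Zm uin] in auto)
  \<comment> \<open>The added term has mean zero and completes the left side to
    \<open>(Y (u n))\<^sup>2\<close> minus a square.\<close>
  have "(\<integral>w. indicator (A i) w * (Y (u i) w)\<^sup>2 + 2 * ((indicator (A i) w * Y (u i) w) * (Y (u n) w - Y (u i) w)) \<partial>P)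
    <= (\<integral>w. indicator (A i) w * (Y (u n) w)\<^sup>2 \<partial>P)"
  proof (rule integral_mono)
   show "integrable P (\<lambda>w. indicator (A i) w * (Y (u i) w)\<^sup>2 + 2 * ((indicator (A i) w * Y (u i) w) * (Y (u n) w - Y (u i) w)))"
    by (rule Bochner_Integration.integrable_add[OF i1 integrable_mult_right[OF zi]])
   fix w
   have "0 <= indicator (A i) w * (Y (u n) w - Y (u i) w)\<^sup>2" by simp
   then show "indicator (A i) w * (Y (u i) w)\<^sup>2 + 2 * ((indicator (A i) w * Y (u i) w) * (Y (u n) w - Y (u i) w))
     <= indicator (A i) w * (Y (u n) w)\<^sup>2" by (simp add: power2_eq_square algebra_simps)
  qed (rule i1)
  then show ?thesis
   using i1[of i i] integrable_mult_right[OF zi, of 2] z by (subst (asm) Bochner_Integration.integral_add) auto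
 qed
 have sumE: "indicator E w * l\<^sup>2 <= (\<Sum>i\<le>n. indicator (A i) w * (Y (u i) w)\<^sup>2)" if "w \<in> space P" for w
 proof (cases "w \<in> E")
  case True
  define i where "i = (LEAST i. l < \<bar>Y (u i) w\<bar>)"
  from True obtain i0 where i0: "i0 <= n" "l < \<bar>Y (u i0) w\<bar>" by (auto simp: E_def)
  have i: "i <= n" "l < \<bar>Y (u i) w\<bar>" unfolding i_def
   using Least_le[of "\<lambda>i. l < \<bar>Y (u i) w\<bar>" i0] LeastI[of "\<lambda>i. l < \<bar>Y (u i) w\<bar>" i0] i0 by auto
  have less: "\<bar>Y (u j) w\<bar> <= l" if "j < i" for j
   using not_less_Least[OF that[unfolded i_def]] by simp
  have "w \<in> A i" unfolding A_def using i less \<open>w \<in> space P\<close> by simp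
  then have "l\<^sup>2 <= indicator (A i) w * (Y (u i) w)\<^sup>2"
   using i(2) l power_mono[of l "\<bar>Y (u i) w\<bar>" 2] by simp
  also have "... <= (\<Sum>i\<le>n. indicator (A i) w * (Y (u i) w)\<^sup>2)"
   by (rule member_le_sum) (use i in auto)
  finally show ?thesis using True by simp
 qed (auto intro: sum_nonneg)
 have sumA: "(\<Sum>i\<le>n. indicator (A i) w) <= (1::real)" for w
 proof -
  have "card {i\<in>{..n}. w \<in> A i} <= 1"
  proof (rule card_le_Suc0_iff_eq[THEN iffD2, unfolded One_nat_def[symmetric]])
   show "\<forall>a1\<in>{i\<in>{..n}. w \<in> A i}. \<forall>a2\<in>{i\<in>{..n}. w \<in> A i}. a1 = a2"
   proof (intro ballI)
    fix p q assume "p \<in> {i\<in>{..n}. w \<in> A i}" "q \<in> {i\<in>{..n}. w \<in> A i}"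
    then have "\<not> p < q" "\<not> q < p" unfolding A_def by (auto simp: not_less[symmetric])
    then show "p = q" by simp
   qed
  qed auto
  moreover have "(\<Sum>i\<le>n. indicator (A i) w) = real (card {i\<in>{..n}. w \<in> A i})"
   by (simp add: indicator_def sum.If_cases Int_def)
  ultimately show ?thesis by simp
 qed
 have "measure P E * l\<^sup>2 = (\<integral>w. indicator E w * l\<^sup>2 \<partial>P)" by simp
 also have "... <= (\<integral>w. (\<Sum>i\<le>n. indicator (A i) w * (Y (u i) w)\<^sup>2) \<partial>P)"
 proof (rule integral_mono[OF _ _ sumE])
  show "integrable P (\<lambda>w. indicator E w * l\<^sup>2)" by (rule integrable_bdd[where C="l\<^sup>2"]) (auto simp: indicator_def)
  show "integrable P (\<lambda>w. \<Sum>i\<le>n. indicator (A i) w * (Y (u i) w)\<^sup>2)"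
   by (intro Bochner_Integration.integrable_sum i1)
 qed
 also have "... = (\<Sum>i\<le>n. \<integral>w. indicator (A i) w * (Y (u i) w)\<^sup>2 \<partial>P)"
  by (rule Bochner_Integration.integral_sum) (rule i1)
 also have "... <= (\<Sum>i\<le>n. \<integral>w. indicator (A i) w * (Y (u n) w)\<^sup>2 \<partial>P)"
  using step by (intro sum_mono) auto
 also have "... = (\<integral>w. (\<Sum>i\<le>n. indicator (A i) w * (Y (u n) w)\<^sup>2) \<partial>P)"
  by (rule Bochner_Integration.integral_sum[symmetric]) (rule i1)
 also have "... <= (\<integral>w. (Y (u n) w)\<^sup>2 \<partial>P)"
 proof (rule integral_mono)
  show "integrable P (\<lambda>w. (\<Sum>i\<le>n. indicator (A i) w * (Y (u n) w)\<^sup>2))"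
   by (intro Bochner_Integration.integrable_sum i1)
  show "(\<Sum>i\<le>n. indicator (A i) w * (Y (u n) w)\<^sup>2) <= (Y (u n) w)\<^sup>2" for w
   using mult_right_mono[OF sumA[of w], of "(Y (u n) w)\<^sup>2"] by (simp add: sum_distrib_right)
 qed (rule sqi)
 finally show "measure P {w\<in>space P. \<exists>i\<le>n. l < \<bar>Y (u i) w\<bar>} <= (\<integral>w. (Y (u n) w)\<^sup>2 \<partial>P) / l\<^sup>2"
  using l E_eq by (simp add: field_simps)
qed


text \<open>The inequality in the event is strict, so by continuity it already holds at some dyadic
  time; the events for successive grids increase.\<close>

lemma maximal_inequality:
 assumes Y: "mart Y" and k: "\<And>t w. w \<in> space P ==> t \<in> {lo..hi} ==> \<bar>Y t w\<bar> <= k" and l: "0 < l"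
  and cont: "cpaths Y"
 shows "{w\<in>space P. \<exists>t\<in>{lo..hi}. l < \<bar>Y t w\<bar>} \<in> sets P"
  "measure P {w\<in>space P. \<exists>t\<in>{lo..hi}. l < \<bar>Y t w\<bar>} <= (\<integral>w. (Y hi w)\<^sup>2 \<partial>P) / l\<^sup>2"
proof -
 define E where "E N = {w\<in>space P. \<exists>i\<le>2^N. l < \<bar>Y (gr N i) w\<bar>}" for N :: nat
 have Em: "E N \<in> sets P" and El: "measure P (E N) <= (\<integral>w. (Y hi w)\<^sup>2 \<partial>P) / l\<^sup>2" for N
 proof -
  show "E N \<in> sets P" unfolding E_def by (rule discrete_maximal(1)[OF Y k grid_gr l])
  show "measure P (E N) <= (\<integral>w. (Y hi w)\<^sup>2 \<partial>P) / l\<^sup>2"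
   using discrete_maximal(2)[OF Y k grid_gr[of N] l, of "2^N"] by (simp only: E_def gr_end)
 qed
 have UN: "(\<Union>N. E N) = {w\<in>space P. \<exists>t\<in>{lo..hi}. l < \<bar>Y t w\<bar>}"
 proof (intro equalityI subsetI)
  fix w assume "w \<in> {w\<in>space P. \<exists>t\<in>{lo..hi}. l < \<bar>Y t w\<bar>}"
  then obtain t where t: "w \<in> space P" "t \<in> {lo..hi}" "l < \<bar>Y t w\<bar>" by auto
  have "continuous_on {lo..hi} (\<lambda>t. Y t w)" using cont t(1) unfolding cf_cont_paths_def by auto
  then obtain d where d: "d > 0" "\<And>s. s \<in> {lo..hi} ==> dist s t < d ==> dist (Y s w) (Y t w) < \<bar>Y t w\<bar> - l"
   using t unfolding continuous_on_iff by (metis diff_gt_0_iff_gt)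
  have "\<forall>\<^sub>F N in sequentially. mesh N < d" using order_tendstoD(2)[OF mesh_lim d(1)] .
  then obtain N where N: "mesh N < d" by (auto simp: eventually_sequentially)
  obtain j where j: "j <= 2 ^ N" "gr N j <= t" "t <= gr N j + mesh N" by (rule gr_below[OF t(2)])
  have "dist (Y (gr N j) w) (Y t w) < \<bar>Y t w\<bar> - l" by (rule d(2)[OF gr_in]) (use j N in \<open>auto simp: dist_real_def\<close>)
  then have "l < \<bar>Y (gr N j) w\<bar>" by (auto simp: dist_real_def)
  then show "w \<in> (\<Union>N. E N)" using j t unfolding E_def by auto
 qed (use gr_in in \<open>auto simp: E_def\<close>)
 have inc: "incseq E"
 proof (rule incseq_SucI, rule subsetI)
  fix N w assume "w \<in> E N"
  then obtain i where i: "w \<in> space P" "i <= 2 ^ N" "l < \<bar>Y (gr N i) w\<bar>" by (auto simp: E_def)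
  then have "gr N i = gr (Suc N) (i * 2)" "i * 2 <= 2 ^ Suc N" using gr_refine[of N "Suc N" i] by auto
  then show "w \<in> E (Suc N)" using i unfolding E_def by (intro CollectI conjI exI[of _ "i * 2"]) simp_all
 qed
 show "{w\<in>space P. \<exists>t\<in>{lo..hi}. l < \<bar>Y t w\<bar>} \<in> sets P" unfolding UN[symmetric] using Em by auto
 have "(\<lambda>N. measure P (E N)) \<longlonglongrightarrow> measure P (\<Union>N. E N)"
  by (rule finite_Lim_measure_incseq[OF _ inc]) (use Em in auto)
 then show "measure P {w\<in>space P. \<exists>t\<in>{lo..hi}. l < \<bar>Y t w\<bar>} <= (\<integral>w. (Y hi w)\<^sup>2 \<partial>P) / l\<^sup>2"
  unfolding UN[symmetric] by (rule LIMSEQ_le_const2) (use El in auto)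
qed

text \<open>The grid point reached in \<open>tel_sum\<close> overshoots \<open>s\<close> by at most
  the mesh.\<close>

lemma tel_lim:
 fixes f :: "real => real"
 assumes f: "continuous_on {lo..hi} f" and s: "s \<in> {lo..hi}" and t: "t \<in> {lo..hi}"
 shows "(\<lambda>N. \<Sum>j<2^N. of_bool (gr N j < s) * (f (min (gr N (Suc j)) t) - f (min (gr N j) t))) \<longlonglongrightarrow> f (min s t) - f lo"
proof -
 have "\<exists>c. c \<in> {lo..hi} \<and> s <= c \<and> c <= s + mesh N \<and>
   (\<Sum>j<2^N. of_bool (gr N j < s) * (f (min (gr N (Suc j)) t) - f (min (gr N j) t))) = f (min c t) - f lo" for N
 proof -
  have ms: "mono (gr N)" "s <= gr N (2^N)" using grid_gr[of N] s by (auto simp: grid_in_def)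
  obtain i where i: "i <= 2^N" "s <= gr N i" "\<And>j. j < i ==> gr N j < s"
   "\<And>f t. (\<Sum>j<2^N. of_bool (gr N j < s) * (f (min (gr N (Suc j)) t) - f (min (gr N j) t))) = f (min (gr N i) t) - (f (min (gr N 0) t) :: real)"
   using tel_sum[OF ms] by blast
  have "gr N i <= s + mesh N"
  proof (cases i)
   case 0
   then show ?thesis using s mesh_pos[of N] by simp
  next
   case (Suc j)
   then show ?thesis using i(3)[of j] gr_Suc_le[of N j] by simp
  qed
  moreover have "min (gr N 0) t = lo" using t by simp
  ultimately show ?thesis using i(2) i(4)[of f t] gr_in[of N i] by (intro exI[of _ "gr N i"]) simp
 qed
 then obtain c where c: "\<And>N. c N \<in> {lo..hi}" "\<And>N. s <= c N" "\<And>N. c N <= s + mesh N"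
   "\<And>N. (\<Sum>j<2^N. of_bool (gr N j < s) * (f (min (gr N (Suc j)) t) - f (min (gr N j) t))) = f (min (c N) t) - f lo"
  by metis
 have "c \<longlonglongrightarrow> s"
 proof (rule tendsto_sandwich[of "\<lambda>_. s" c sequentially "\<lambda>N. s + mesh N"])
  have "(\<lambda>N. s + mesh N) \<longlonglongrightarrow> s + 0" by (intro tendsto_intros mesh_lim)
  then show "(\<lambda>N. s + mesh N) \<longlonglongrightarrow> s" by simp
 qed (use c in auto)
 then have m: "(\<lambda>N. min (c N) t) \<longlonglongrightarrow> min s t" by (intro tendsto_intros)
 have "(\<lambda>N. f (min (c N) t)) \<longlonglongrightarrow> f (min s t)"
 proof (rule continuous_on_tendsto_compose[OF f m])
  show "min s t \<in> {lo..hi}" using s t by auto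
  show "\<forall>\<^sub>F N in sequentially. min (c N) t \<in> {lo..hi}"
   by (intro always_eventually allI) (use c(1) t in \<open>auto simp: min_def\<close>)
 qed
 then show ?thesis unfolding c(4) by (intro tendsto_intros)
qed

lemma stop_meas:
 assumes "cf_stopping_time P lo hi Fl \<sigma>" "u \<in> {lo..hi}"
 shows "(\<lambda>w. of_bool (u < \<sigma> w) :: real) \<in> bm (Fm u)"
proof -
 have "{w\<in>space P. \<sigma> w <= u} \<in> sets (Fm u)" using assms by (auto simp: cf_stopping_time_def sets_Fm)
 then have "(\<lambda>w. 1 - indicator {w\<in>space P. \<sigma> w <= u} w :: real) \<in> bm (Fm u)" by simp
 then show ?thesis by (rule measurable_cong[THEN iffD1, rotated]) (auto simp: indicator_def)
qed

text \<open>The stopped process is the limit of the transforms \<open>tr (gr N) (2 ^ N)\<close> of the integrand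
 \<open>1_{u < \<sigma>}\<close>; on \<open>B N\<close>, where the transform exceeds \<open>k + 1\<close>, its mass is dominated by that of \<open>Y t\<close>,
 which replaces uniform integrability.\<close>

lemma stopped_mart:
 assumes Y: "mart Y" and cont: "cpaths Y" and st: "cf_stopping_time P lo hi Fl \<sigma>"
  and k: "\<And>t w. w \<in> space P ==> t \<in> {lo..hi} ==> \<bar>Y (min t (\<sigma> w)) w\<bar> <= k"
  and Y0: "\<And>w. w \<in> space P ==> Y lo w = 0"
 shows "mart (\<lambda>t w. Y (min t (\<sigma> w)) w)"
proof -
 define Z where "Z u w = (of_bool (u < \<sigma> w) :: real)" for u w
 define S where "S N = tr (gr N) (2 ^ N) Z Y" for N
 have \<sigma>: "\<sigma> w \<in> {lo..hi}" if "w \<in> space P" for w using st that by (auto simp: cf_stopping_time_def)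
 have Z: "Z r \<in> bm (Fm r)" if "r \<in> {lo..hi}" for r
  unfolding Z_def[abs_def] by (rule stop_meas[OF st that])
 have Zb: "\<bar>Z r w\<bar> <= 1" for r w by (simp add: Z_def)
 have S: "mart (S N)" for N unfolding S_def by (rule mart_tr[OF Y grid_gr Z Zb])
 have lim: "(\<lambda>N. S N t w) \<longlonglongrightarrow> Y (min t (\<sigma> w)) w" if "w \<in> space P" "t \<in> {lo..hi}" for t w
 proof -
  have "continuous_on {lo..hi} (\<lambda>t. Y t w)" using cont that unfolding cf_cont_paths_def by auto
  from tel_lim[OF this \<sigma>[OF that(1)] that(2)] show ?thesis
   using Y0[OF that(1)] by (simp add: S_def tr_def Z_def min.commute)
 qed
 have Sm[measurable]: "S N t \<in> bm P" if "t \<in> {lo..hi}" for N t using martD(3)[OF S that] .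
 have main: "(\<lambda>N. \<integral>w. indicator A w * S N t w \<partial>P) \<longlonglongrightarrow> (\<integral>w. indicator A w * Y (min t (\<sigma> w)) w \<partial>P)"
  if t: "t \<in> {lo..hi}" and A[measurable]: "A \<in> sets P" for t A
 proof -
  define B where "B N = {w\<in>space P. k + 1 < \<bar>S N t w\<bar>}" for N
  have B[measurable]: "B N \<in> sets P" for N unfolding B_def using Sm[OF t] by measurable
  have Sint: "integrable P (S N t)" for N by (rule martD(2)[OF S t])
  have Yint: "integrable P (Y t)" by (rule martD(2)[OF Y t])
  note Sm[OF t, measurable] martD(3)[OF Y t, measurable]
  have dom: "(\<integral>w. indicator (B N) w * \<bar>S N t w\<bar> \<partial>P) <= (\<integral>w. indicator (B N) w * \<bar>Y t w\<bar> \<partial>P)" for N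
  proof -
   \<comment> \<open>Testing the remainder \<open>Y t - S N t\<close> against this weight shows that
     \<open>S N t\<close> and \<open>Y t\<close> have the same mean against it.\<close>
   define \<xi> where "\<xi> w = indicator (B N) w * sgn (S N t w)" for w
   have \<xi>m[measurable]: "\<xi> \<in> bm P" unfolding \<xi>_def[abs_def] by measurable
   have \<xi>b: "\<bar>\<xi> w\<bar> <= 1" for w by (auto simp: \<xi>_def indicator_def sgn_if)
   have diff: "Y t w - S N t w = (\<Sum>j<2^N. of_bool (\<sigma> w <= gr N j) * (Y (min (gr N (Suc j)) t) w - Y (min (gr N j) t) w))"
    if "w \<in> space P" for w
   proof -
    have "(\<Sum>j<2^N. Y (min (gr N (Suc j)) t) w - Y (min (gr N j) t) w) = Y (min (gr N (2^N)) t) w - Y (min (gr N 0) t) w"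
     by (rule sum_lessThan_telescope)
    also have "... = Y t w" using t Y0[OF that] by (simp add: min_absorb2)
    finally have "Y t w = (\<Sum>j<2^N. Y (min (gr N (Suc j)) t) w - Y (min (gr N j) t) w)" by simp
    moreover have "S N t w + (\<Sum>j<2^N. of_bool (\<sigma> w <= gr N j) * (Y (min (gr N (Suc j)) t) w - Y (min (gr N j) t) w))
      = (\<Sum>j<2^N. Y (min (gr N (Suc j)) t) w - Y (min (gr N j) t) w)"
     unfolding S_def tr_def Z_def sum.distrib[symmetric] by (intro sum.cong) (auto simp: not_less)
    ultimately show ?thesis by linarith
   qed
   \<comment> \<open>Once the grid time has passed \<open>\<sigma>\<close> the transform no longer
     moves and equals the partial sum \<open>Sj\<close>. On that event \<open>\<xi>\<close> is
     therefore known at the grid time, and the next increment of \<open>Y\<close> has mean zero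
     against it.\<close>
   have zero: "(\<integral>w. (\<xi> w * of_bool (\<sigma> w <= gr N j)) * (Y (min (gr N (Suc j)) t) w - Y (min (gr N j) t) w) \<partial>P) = 0"
    if "j < 2^N" for j
   proof (cases "t <= gr N j")
    case True
    then have "min (gr N (Suc j)) t = t" "min (gr N j) t = t" using grid_inD(3)[OF grid_gr, of j "Suc j" N] by auto
    then show ?thesis by simp
   next
    case False
    let ?g = "gr N j"
    have g: "?g \<in> {lo..hi}" by (rule gr_in)
    define Sj where "Sj w = (\<Sum>i<j. Z (gr N i) w * (Y (min (gr N (Suc i)) t) w - Y (min (gr N i) t) w))" for w
    have Sjm[measurable]: "Sj \<in> bm (Fm ?g)"
     unfolding Sj_def[abs_def]
    proof (intro borel_measurable_sum borel_measurable_times borel_measurable_diff)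
     fix i assume "i \<in> {..<j}"
     then have i: "gr N i <= ?g" "gr N (Suc i) <= ?g" using grid_inD(3)[OF grid_gr] by auto
     show "Z (gr N i) \<in> bm (Fm ?g)"
      by (rule meas_mono[OF Z]) (use i gr_in[of N i] g in auto)
     show "Y (min (gr N (Suc i)) t) \<in> bm (Fm ?g)" "Y (min (gr N i) t) \<in> bm (Fm ?g)"
      by (rule meas_mono[OF martD(1)[OF Y]]; use i gr_in[of N i] gr_in[of N "Suc i"] g t in \<open>auto simp: min_le_iff_disj\<close>)+
    qed
    have SSj: "S N t w = Sj w" if "\<sigma> w <= ?g" for w
     unfolding S_def tr_def Sj_def
    proof (rule sum.mono_neutral_right)
     show "\<forall>i\<in>{..<2^N} - {..<j}. Z (gr N i) w * (Y (min (gr N (Suc i)) t) w - Y (min (gr N i) t) w) = 0"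
      using that grid_inD(3)[OF grid_gr, of j _ N] by (auto simp: Z_def not_less intro: order_trans)
    qed (use \<open>j < 2^N\<close> in auto)
    have b1[measurable]: "(\<lambda>w. of_bool (\<sigma> w <= ?g) :: real) \<in> bm (Fm ?g)"
    proof -
     have "(\<lambda>w. 1 - Z ?g w) \<in> bm (Fm ?g)" using Z[OF g] by simp
     also have "(\<lambda>w. 1 - Z ?g w) = (\<lambda>w. of_bool (\<sigma> w <= ?g))" by (auto simp: Z_def fun_eq_iff)
     finally show ?thesis .
    qed
    have e1: "\<xi> w * of_bool (\<sigma> w <= ?g) = of_bool (k + 1 < \<bar>Sj w\<bar>) * sgn (Sj w) * of_bool (\<sigma> w <= ?g)" if "w \<in> space P" for w
     using SSj[of w] that by (auto simp: \<xi>_def B_def indicator_def)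
    have "(\<lambda>w. of_bool (k + 1 < \<bar>Sj w\<bar>) * sgn (Sj w) * of_bool (\<sigma> w <= ?g)) \<in> bm (Fm ?g)"
     by measurable
    then have \<xi>j: "(\<lambda>w. \<xi> w * of_bool (\<sigma> w <= ?g)) \<in> bm (Fm ?g)"
     by (rule measurable_cong[THEN iffD1, rotated]) (use e1 in auto)
    have m: "min ?g t = ?g" using False by simp
    show ?thesis unfolding m
    proof (rule mart_mult[OF Y _ _ _ \<xi>j])
     show "\<bar>\<xi> w * of_bool (\<sigma> w <= ?g)\<bar> <= 1" for w using \<xi>b[of w] by auto
    qed (use False g t grid_inD(3)[OF grid_gr, of j "Suc j" N] in auto)
   qed
   have b2[measurable]: "(\<lambda>w. of_bool (\<sigma> w <= gr N j) :: real) \<in> bm P" for j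
   proof -
    have "(\<lambda>w. 1 - Z (gr N j) w) \<in> bm P" using meas_P[OF Z[OF gr_in] gr_in] by simp
    also have "(\<lambda>w. 1 - Z (gr N j) w) = (\<lambda>w. of_bool (\<sigma> w <= gr N j))" by (auto simp: Z_def fun_eq_iff)
    finally show ?thesis .
   qed
   have ti: "integrable P (\<lambda>w. (\<xi> w * of_bool (\<sigma> w <= gr N j)) * (Y (min (gr N (Suc j)) t) w - Y (min (gr N j) t) w))" for j
   proof (rule integrable_bdd_mult[where C=1])
    show "\<bar>\<xi> w * of_bool (\<sigma> w <= gr N j)\<bar> <= 1" for w using \<xi>b[of w] by auto
    show "integrable P (\<lambda>w. Y (min (gr N (Suc j)) t) w - Y (min (gr N j) t) w)"
     by (intro Bochner_Integration.integrable_diff martD(2)[OF Y]) (use t gr_in[of N j] gr_in[of N "Suc j"] in auto)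
   qed measurable
   have "(\<integral>w. \<xi> w * (Y t w - S N t w) \<partial>P)
     = (\<integral>w. (\<Sum>j<2^N. (\<xi> w * of_bool (\<sigma> w <= gr N j)) * (Y (min (gr N (Suc j)) t) w - Y (min (gr N j) t) w)) \<partial>P)"
    by (intro Bochner_Integration.integral_cong refl) (simp only: diff sum_distrib_left mult.assoc)
   also have "... = (\<Sum>j<2^N. \<integral>w. (\<xi> w * of_bool (\<sigma> w <= gr N j)) * (Y (min (gr N (Suc j)) t) w - Y (min (gr N j) t) w) \<partial>P)"
    by (rule Bochner_Integration.integral_sum) (rule ti)
   also have "... = 0" by (rule sum.neutral) (use zero in auto)
   finally have z: "(\<integral>w. \<xi> w * (Y t w - S N t w) \<partial>P) = 0" .
   have xi: "integrable P (\<lambda>w. \<xi> w * f w)" if "integrable P f" for f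
    by (rule integrable_bdd_mult[OF that \<xi>m \<xi>b])
   have "(\<integral>w. indicator (B N) w * \<bar>S N t w\<bar> \<partial>P) = (\<integral>w. \<xi> w * S N t w \<partial>P)"
    by (intro Bochner_Integration.integral_cong) (auto simp: \<xi>_def abs_sgn mult_ac)
   also have "... = (\<integral>w. \<xi> w * Y t w \<partial>P)"
    using z xi[OF Sint[of N]] xi[OF Yint] by (simp add: right_diff_distrib)
   also have "... <= (\<integral>w. indicator (B N) w * \<bar>Y t w\<bar> \<partial>P)"
   proof (rule integral_mono[OF xi[OF Yint]])
    show "integrable P (\<lambda>w. indicator (B N) w * \<bar>Y t w\<bar>)"
     by (rule integrable_bdd_mult[where C=1]) (use Yint in \<open>auto simp: indicator_def\<close>)
    show "\<xi> w * Y t w <= indicator (B N) w * \<bar>Y t w\<bar>" for w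
     by (auto simp: \<xi>_def indicator_def sgn_if)
   qed
   finally show ?thesis .
  qed
  \<comment> \<open>The limit is bounded by \<open>k\<close>, so truncation at \<open>k + 1\<close>
    is inactive in the limit, while off \<open>B N\<close> it changes nothing.\<close>
  define trc where "trc x = max (-(k+1)) (min (k+1) x)" for x :: real
  have k0: "0 <= k" using k[of _ t] t not_empty by (metis abs_ge_zero ex_in_conv order_trans)
  have Bev: "\<forall>\<^sub>F N in sequentially. w \<notin> B N" if "w \<in> space P" for w
  proof -
   have "\<bar>Y (min t (\<sigma> w)) w\<bar> < k + 1" using k[OF that t] by linarith
   then have "\<forall>\<^sub>F N in sequentially. \<bar>S N t w\<bar> < k + 1"
    using order_tendstoD(2)[OF tendsto_rabs[OF lim[OF that t]]] by blast
   then show ?thesis by eventually_elim (auto simp: B_def)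
  qed
  have l1: "(\<lambda>N. \<integral>w. indicator (B N) w * \<bar>Y t w\<bar> \<partial>P) \<longlonglongrightarrow> (\<integral>w. 0 \<partial>P)"
  proof (rule integral_dominated_convergence[where w="\<lambda>w. \<bar>Y t w\<bar>"])
   show "AE w in P. (\<lambda>N. indicator (B N) w * \<bar>Y t w\<bar>) \<longlonglongrightarrow> 0"
   proof (rule AE_I2)
    fix w assume "w \<in> space P"
    from Bev[OF this] show "(\<lambda>N. indicator (B N) w * \<bar>Y t w\<bar>) \<longlonglongrightarrow> 0"
     by (intro tendsto_eventually) (auto elim!: eventually_mono)
   qed
  qed (use Yint in \<open>auto simp: indicator_def\<close>)
  have l2: "(\<lambda>N. \<integral>w. indicator A w * trc (S N t w) \<partial>P) \<longlonglongrightarrow> (\<integral>w. indicator A w * Y (min t (\<sigma> w)) w \<partial>P)"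
  proof (rule integral_dominated_convergence[where w="\<lambda>w. k + 1"])
   have Yl: "(\<lambda>w. Y (min t (\<sigma> w)) w) \<in> bm P"
    by (rule borel_measurable_LIMSEQ_real[OF lim[OF _ t] Sm[OF t]])
   then show "(\<lambda>w. indicator A w * Y (min t (\<sigma> w)) w) \<in> bm P" by simp
   show "AE w in P. (\<lambda>N. indicator A w * trc (S N t w)) \<longlonglongrightarrow> indicator A w * Y (min t (\<sigma> w)) w"
   proof (rule AE_I2)
    fix w assume w: "w \<in> space P"
    have "(\<lambda>N. trc (S N t w)) \<longlonglongrightarrow> trc (Y (min t (\<sigma> w)) w)"
     unfolding trc_def by (intro tendsto_intros lim w t)
    moreover have "trc (Y (min t (\<sigma> w)) w) = Y (min t (\<sigma> w)) w" using k[OF w t] by (auto simp: trc_def)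
    ultimately show "(\<lambda>N. indicator A w * trc (S N t w)) \<longlonglongrightarrow> indicator A w * Y (min t (\<sigma> w)) w"
     by (intro tendsto_intros) simp
   qed
   show "(\<lambda>w. indicator A w * trc (S N t w)) \<in> bm P" for N unfolding trc_def by measurable
   show "AE w in P. norm (indicator A w * trc (S N t w)) <= k + 1" for N
    using k0 by (auto simp: trc_def indicator_def)
  qed simp
  have l3: "(\<lambda>N. (\<integral>w. indicator A w * S N t w \<partial>P) - (\<integral>w. indicator A w * trc (S N t w) \<partial>P)) \<longlonglongrightarrow> 0"
  proof (rule Lim_null_comparison[OF always_eventually])
   show "(\<lambda>N. \<integral>w. indicator (B N) w * \<bar>Y t w\<bar> \<partial>P) \<longlonglongrightarrow> 0" using l1 by simp
   show "\<forall>N. norm ((\<integral>w. indicator A w * S N t w \<partial>P) - (\<integral>w. indicator A w * trc (S N t w) \<partial>P))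
      <= (\<integral>w. indicator (B N) w * \<bar>Y t w\<bar> \<partial>P)"
   proof
    fix N
    have i1: "integrable P (\<lambda>w. indicator A w * S N t w)"
     by (rule integrable_bdd_mult[where C=1]) (use Sint in \<open>auto simp: indicator_def\<close>)
    have i2: "integrable P (\<lambda>w. indicator A w * trc (S N t w))"
     by (rule integrable_bdd[where C="k+1"]) (use k0 in \<open>auto simp: trc_def indicator_def\<close>)
    have "norm ((\<integral>w. indicator A w * S N t w \<partial>P) - (\<integral>w. indicator A w * trc (S N t w) \<partial>P))
      = \<bar>\<integral>w. indicator A w * S N t w - indicator A w * trc (S N t w) \<partial>P\<bar>" using i1 i2 by simp
    also have "... <= (\<integral>w. indicator (B N) w * \<bar>S N t w\<bar> \<partial>P)"
    proof (rule order_trans[OF integral_abs_bound integral_mono])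
     show "integrable P (\<lambda>w. \<bar>indicator A w * S N t w - indicator A w * trc (S N t w)\<bar>)" using i1 i2 by simp
     show "integrable P (\<lambda>w. indicator (B N) w * \<bar>S N t w\<bar>)"
      by (rule integrable_bdd_mult[where C=1]) (use Sint in \<open>auto simp: indicator_def\<close>)
     show "\<bar>indicator A w * S N t w - indicator A w * trc (S N t w)\<bar> <= indicator (B N) w * \<bar>S N t w\<bar>" if "w \<in> space P" for w
      using k0 that by (auto simp: trc_def indicator_def B_def)
    qed
    also note dom
    finally show "norm ((\<integral>w. indicator A w * S N t w \<partial>P) - (\<integral>w. indicator A w * trc (S N t w) \<partial>P))
      <= (\<integral>w. indicator (B N) w * \<bar>Y t w\<bar> \<partial>P)" .
   qed
  qed
  from tendsto_add[OF l3 l2] show ?thesis by simp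
 qed
 show ?thesis
 proof (rule martI)
  fix t assume t: "t \<in> {lo..hi}"
  show Ym: "(\<lambda>w. Y (min t (\<sigma> w)) w) \<in> bm (Fm t)"
   by (rule borel_measurable_LIMSEQ_real[where u="\<lambda>N. S N t"]) (use lim t martD(1)[OF S t] in auto)
  show "integrable P (\<lambda>w. Y (min t (\<sigma> w)) w)"
   by (rule integrable_bdd[OF meas_P[OF Ym t]]) (use k t in auto)
 next
  fix s t A assume *: "lo <= s" "s <= t" "t <= hi" "A \<in> sets (Fm s)"
  have AP: "A \<in> sets P" using * Fm_P[of s] by auto
  have in': "s \<in> {lo..hi}" "t \<in> {lo..hi}" using * by auto
  have ii: "integrable P (\<lambda>w. indicator A w * Y (min r (\<sigma> w)) w)" if r: "r \<in> {lo..hi}" for r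
  proof -
   have "(\<lambda>w. Y (min r (\<sigma> w)) w) \<in> bm P"
    by (rule borel_measurable_LIMSEQ_real[OF lim[OF _ r] Sm[OF r]])
   then have "integrable P (\<lambda>w. Y (min r (\<sigma> w)) w)" by (rule integrable_bdd) (use k r in auto)
   then show ?thesis by (rule integrable_bdd_mult[where C=1]) (use AP in \<open>auto simp: indicator_def\<close>)
  qed
  have "(\<integral>w. indicator A w * S N t w \<partial>P) = (\<integral>w. indicator A w * S N s w \<partial>P)" for N
  proof -
   have "integrable P (\<lambda>w. indicator A w * S N r w)" if "r \<in> {lo..hi}" for r
    by (rule integrable_bdd_mult[OF martD(2)[OF S that], where C=1]) (use AP in \<open>auto simp: indicator_def\<close>)
   moreover have "(\<integral>w. indicator A w * (S N t w - S N s w) \<partial>P) = 0"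
    by (rule mart_mult[OF S *(1-3), where C=1]) (use *(4) in \<open>auto simp: indicator_def\<close>)
   ultimately show ?thesis using in' by (simp add: right_diff_distrib)
  qed
  then have "(\<integral>w. indicator A w * Y (min t (\<sigma> w)) w \<partial>P) = (\<integral>w. indicator A w * Y (min s (\<sigma> w)) w \<partial>P)"
   using LIMSEQ_unique[OF main[OF in'(2) AP]] main[OF in'(1) AP] by simp
  then show "(\<integral>w. indicator A w * (Y (min t (\<sigma> w)) w - Y (min s (\<sigma> w)) w) \<partial>P) = 0"
   using ii in' by (simp add: right_diff_distrib)
 qed
qed

end

section \<open>Hitting times and localization\<close>

definition first_ge :: "real => real => real => (real => real) => real" where
 "first_ge l h c f = (if \<exists>t\<in>{l..h}. c <= f t then Inf {t\<in>{l..h}. c <= f t} else h)"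

text \<open>The level set is closed, so the infimum is attained when the level is reached. The third
  part excludes \<open>t = h\<close>, which is also the default value; the last part excludes
  \<open>q = l\<close>, where \<open>f\<close> may start above \<open>c\<close>.\<close>

lemma first_ge:
 assumes f: "continuous_on {l..h} f" and lh: "l <= h"
 shows "first_ge l h c f \<in> {l..h}"
  "\<And>t. t \<in> {l..h} ==> t < first_ge l h c f ==> f t < c"
  "\<And>t. l <= t ==> t < h ==> first_ge l h c f <= t \<longleftrightarrow> (\<exists>s\<in>{l..t}. c <= f s)"
  "\<And>c'. c <= c' ==> first_ge l h c f <= first_ge l h c' f"
  "(\<And>t. t \<in> {l..h} ==> f t < c) ==> first_ge l h c f = h"
  "\<And>q. q \<in> {l..h} ==> q <= first_ge l h c f ==> l < q ==> f q <= c"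
proof -
 define S where "S c = {t\<in>{l..h}. c <= f t}" for c
 have cl: "closed (S c)" for c
 proof -
  have "closed ({l..h} \<inter> f -` {c..})" by (rule continuous_closed_preimage[OF f]) auto
  then show ?thesis by (simp add: S_def Int_def vimage_def)
 qed
 have bb: "bdd_below (S c)" for c unfolding S_def by (rule bdd_belowI[of _ l]) auto
 have e1: "first_ge l h c f = Inf (S c)" "first_ge l h c f \<in> S c" if "S c \<noteq> {}" for c
  using that closed_contains_Inf[OF that bb cl] by (auto simp: first_ge_def S_def)
 have e2: "first_ge l h c f = h" if "S c = {}" for c
  using that by (auto simp: first_ge_def S_def)
 have in': "first_ge l h c f \<in> {l..h}" for c
  using e1(2)[of c] e2[of c] lh by (cases "S c = {}") (auto simp: S_def)
 show "first_ge l h c f \<in> {l..h}" by (rule in')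
 have low: "first_ge l h c f <= t" if "t \<in> S c" for t c
 proof -
  have "S c \<noteq> {}" using that by auto
  then show ?thesis using e1(1)[of c] cInf_lower[OF that bb] by simp
 qed
 show less: "f t < c" if "t \<in> {l..h}" "t < first_ge l h c f" for t
  using low[of t c] that unfolding S_def by (auto simp: not_le[symmetric])
 show "first_ge l h c f <= t \<longleftrightarrow> (\<exists>s\<in>{l..t}. c <= f s)" if t: "l <= t" "t < h" for t
 proof
  assume "first_ge l h c f <= t"
  then have "S c \<noteq> {}" using e2[of c] t by auto
  then have "first_ge l h c f \<in> S c" by (rule e1)
  with \<open>first_ge l h c f <= t\<close> show "\<exists>s\<in>{l..t}. c <= f s" unfolding S_def by (intro bexI[of _ "first_ge l h c f"]) auto
 next
  assume "\<exists>s\<in>{l..t}. c <= f s"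
  then obtain s where s: "s \<in> {l..t}" "c <= f s" by auto
  then have "s \<in> S c" using t by (auto simp: S_def)
  from low[OF this] s show "first_ge l h c f <= t" by auto
 qed
 show "first_ge l h c f <= first_ge l h c' f" if "c <= c'" for c'
 proof (cases "S c' = {}")
  case True
  then show ?thesis using e2[OF True] in'[of c] by auto
 next
  case False
  then have "first_ge l h c' f \<in> S c" using e1(2)[OF False] that by (auto simp: S_def)
  then show ?thesis by (rule low)
 qed
 show "first_ge l h c f = h" if "\<And>t. t \<in> {l..h} ==> f t < c"
  by (rule e2) (use that in \<open>auto simp: S_def not_le[symmetric]\<close>)
 fix q assume q: "q \<in> {l..h}" "q <= first_ge l h c f" "l < q"
 have clq: "closure {l..<q} = {l..q}" using q by simp
 show "f q <= c"
 proof (rule continuous_le_on_closure[of "{l..<q}" f])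
  show "continuous_on (closure {l..<q}) f" unfolding clq by (rule continuous_on_subset[OF f]) (use q in auto)
  show "q \<in> closure {l..<q}" unfolding clq using q by auto
  show "f x <= c" if "x \<in> {l..<q}" for x using less[of x] that q by auto
 qed
qed

context filtered_prob
begin

text \<open>The maximum over \<open>[lo, t]\<close> is attained, hence it is at least
  \<open>c\<close> exactly if the values at dyadic points of \<open>[lo, t]\<close> come within
  every \<open>1 / Suc i\<close> of \<open>c\<close>. The dyadic points are those of
  \<open>[lo, t]\<close>, not of \<open>[lo, hi]\<close>, to stay measurable at time
  \<open>t\<close>.\<close>

lemma hit_meas:
 assumes Z: "\<And>s. s \<in> {lo..hi} ==> Z s \<in> bm (Fm s)"
  and cont: "cpaths Z" and t: "t \<in> {lo..hi}"
 shows "{w\<in>space P. \<exists>s\<in>{lo..t}. c <= Z s w} \<in> sets (Fm t)"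
proof -
 define D where "D N k = lo + (t - lo) * (real (min k (2^N)) / 2^N)" for N k :: nat
 have Din: "D N k \<in> {lo..t}" for N k
 proof -
  have "real (min k (2^N)) / 2^N <= 1" by (simp add: min_le_iff_disj)
  then have "(t - lo) * (real (min k (2^N)) / 2^N) <= (t - lo) * 1" using t by (intro mult_left_mono) auto
  then show ?thesis using t by (simp add: D_def)
 qed
 have Dm[measurable]: "Z (D N k) \<in> bm (Fm t)" for N k
  by (rule meas_mono[OF Z]) (use Din[of N k] t in auto)
 have "{w\<in>space P. \<exists>s\<in>{lo..t}. c <= Z s w} = (\<Inter>i::nat. \<Union>N. \<Union>k. {w\<in>space (Fm t). c - 1 / real (Suc i) < Z (D N k) w})"
 proof (intro equalityI subsetI)
  fix w assume "w \<in> {w\<in>space P. \<exists>s\<in>{lo..t}. c <= Z s w}"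
  then obtain s where s: "w \<in> space P" "s \<in> {lo..t}" "c <= Z s w" by auto
  have cZ: "continuous_on {lo..t} (\<lambda>t. Z t w)" using cont s(1) t unfolding cf_cont_paths_def by (auto intro: continuous_on_subset)
  have "\<exists>N k. c - 1 / real (Suc i) < Z (D N k) w" for i :: nat
  proof (cases "t = lo")
   case True
   then have "D 0 0 = s" using s by (simp add: D_def)
   then show ?thesis using s(3) by (intro exI[of _ 0]) (simp add: order_le_less_trans[of _ "Z s w"] algebra_simps add_strict_increasing)
  next
   case False
   then have tl: "lo < t" using t by auto
   obtain d where d: "d > 0" "\<And>r. r \<in> {lo..t} ==> dist r s < d ==> dist (Z r w) (Z s w) < 1 / real (Suc i)"
    using cZ s(2) unfolding continuous_on_iff by (metis of_nat_0_less_iff zero_less_Suc zero_less_divide_1_iff)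
   have "(\<lambda>N. (t - lo) * (1/2) ^ N) \<longlonglongrightarrow> (t - lo) * 0" by (intro tendsto_intros LIMSEQ_power_zero) auto
   then have "\<forall>\<^sub>F N in sequentially. (t - lo) * (1/2)^N < d" using order_tendstoD(2)[OF _ d(1)] by simp
   then obtain N where N: "(t - lo) * (1/2)^N < d" by (auto simp: eventually_sequentially)
   have "0 <= (s - lo) / (t - lo)" "(s - lo) / (t - lo) <= 1" using s tl by auto
   then obtain k where k: "k <= 2^N" "real k / 2^N <= (s - lo) / (t - lo)" "(s - lo) / (t - lo) <= real k / 2^N + 1 / 2^N"
    by (rule dyadic_below)
   have Dk: "D N k = lo + (t - lo) * (real k / 2^N)" using k by (simp add: D_def min_absorb1)
   have m: "(t - lo) * ((s - lo) / (t - lo)) = s - lo" using tl by simp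
   have "D N k <= s" unfolding Dk using mult_left_mono[OF k(2), of "t - lo"] tl m by linarith
   moreover have "s <= D N k + (t - lo) * (1/2)^N"
    unfolding Dk using mult_left_mono[OF k(3), of "t - lo"] tl m by (simp add: distrib_left power_divide)
   ultimately have "dist (Z (D N k) w) (Z s w) < 1 / real (Suc i)"
    using N by (intro d(2)[OF Din]) (auto simp: dist_real_def)
   then show ?thesis using s(3) by (intro exI[of _ N] exI[of _ k]) (auto simp: dist_real_def)
  qed
  then show "w \<in> (\<Inter>i::nat. \<Union>N. \<Union>k. {w\<in>space (Fm t). c - 1 / real (Suc i) < Z (D N k) w})" using s(1) by auto
 next
  fix w assume mem: "w \<in> (\<Inter>i::nat. \<Union>N. \<Union>k. {w\<in>space (Fm t). c - 1 / real (Suc i) < Z (D N k) w})"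
  then have w: "w \<in> space P" by auto
  have cZ: "continuous_on {lo..t} (\<lambda>t. Z t w)" using cont w t unfolding cf_cont_paths_def by (auto intro: continuous_on_subset)
  obtain s where s: "s \<in> {lo..t}" "\<And>r. r \<in> {lo..t} ==> Z r w <= Z s w"
   using continuous_attains_sup[OF compact_Icc _ cZ] t by fastforce
  have "c - 1 / real (Suc i) < Z s w" for i :: nat
  proof -
   have "w \<in> (\<Union>N. \<Union>k. {w\<in>space (Fm t). c - 1 / real (Suc i) < Z (D N k) w})" using mem by blast
   then obtain N k where "c - 1 / real (Suc i) < Z (D N k) w" by blast
   then show ?thesis using s(2)[OF Din, of N k] by linarith
  qed
  then have "c <= Z s w"
  proof (intro leI notI)
   assume "Z s w < c"
   then obtain i :: nat where "1 / real (Suc i) < c - Z s w" using nat_approx_posE[of "c - Z s w"] by (metis diff_gt_0_iff_gt of_nat_Suc)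
   then show False using \<open>c - 1 / real (Suc i) < Z s w\<close> by linarith
  qed
  then show "w \<in> {w\<in>space P. \<exists>s\<in>{lo..t}. c <= Z s w}" using s(1) w by auto
 qed
 also have "... \<in> sets (Fm t)" by measurable
 finally show ?thesis .
qed

lemma hit_stopping:
 assumes Z: "\<And>s. s \<in> {lo..hi} ==> Z s \<in> bm (Fm s)"
  and cont: "cpaths Z"
 shows "cf_stopping_time P lo hi Fl (\<lambda>w. first_ge lo hi c (\<lambda>t. Z t w))"
 unfolding cf_stopping_time_def
proof (intro conjI ballI)
 have cZ: "continuous_on {lo..hi} (\<lambda>t. Z t w)" if "w \<in> space P" for w using cont that unfolding cf_cont_paths_def by auto
 have lh: "lo <= hi" using lohi by simp
 show "first_ge lo hi c (\<lambda>t. Z t w) \<in> {lo..hi}" if "w \<in> space P" for w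
  by (rule first_ge(1)[OF cZ[OF that] lh])
 fix t assume t: "t \<in> {lo..hi}"
 show "{w\<in>space P. first_ge lo hi c (\<lambda>t. Z t w) <= t} \<in> Fl t"
 proof (cases "t = hi")
  case True
  then have "{w\<in>space P. first_ge lo hi c (\<lambda>t. Z t w) <= t} = space (Fm t)"
   using first_ge(1)[OF cZ lh] by auto
  then show ?thesis using sets.top[of "Fm t"] sets_Fm[OF t] by simp
 next
  case False
  then have "{w\<in>space P. first_ge lo hi c (\<lambda>t. Z t w) <= t} = {w\<in>space P. \<exists>s\<in>{lo..t}. c <= Z s w}"
  proof (intro Collect_cong conj_cong refl)
   fix w assume "w \<in> space P"
   from first_ge(3)[OF cZ[OF this] lh, of t] show "(first_ge lo hi c (\<lambda>t. Z t w) <= t) = (\<exists>s\<in>{lo..t}. c <= Z s w)"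
    using t False by simp
  qed
  then show ?thesis using hit_meas[OF Z cont t] sets_Fm[OF t] by simp
 qed
qed

lemma stopping_min:
 assumes "cf_stopping_time P lo hi Fl \<sigma>" "cf_stopping_time P lo hi Fl \<theta>"
 shows "cf_stopping_time P lo hi Fl (\<lambda>w. min (\<sigma> w) (\<theta> w))"
 unfolding cf_stopping_time_def
proof (intro conjI ballI)
 show "min (\<sigma> w) (\<theta> w) \<in> {lo..hi}" if "w \<in> space P" for w
  using assms that by (auto simp: cf_stopping_time_def min_def)
 fix t assume t: "t \<in> {lo..hi}"
 have "{w\<in>space P. \<sigma> w <= t} \<in> sets (Fm t)" "{w\<in>space P. \<theta> w <= t} \<in> sets (Fm t)"
  using assms t by (auto simp: cf_stopping_time_def sets_Fm)
 then have "{w\<in>space P. \<sigma> w <= t} \<union> {w\<in>space P. \<theta> w <= t} \<in> sets (Fm t)" by (rule sets.Un)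
 moreover have "{w\<in>space P. min (\<sigma> w) (\<theta> w) <= t} = {w\<in>space P. \<sigma> w <= t} \<union> {w\<in>space P. \<theta> w <= t}"
  by (auto simp: min_le_iff_disj)
 ultimately show "{w\<in>space P. min (\<sigma> w) (\<theta> w) <= t} \<in> Fl t" using sets_Fm[OF t] by simp
qed

text \<open>One sequence that reduces M and bounds a given adapted continuous process. The bound on
  \<open>H\<close> holds strictly before \<open>\<rho> n\<close> only, since \<open>H lo\<close> may
  be large; that on M includes the stopping time, because \<open>M - M lo\<close> starts at
  0.\<close>

lemma localization:
 assumes M: "lmart M"
  and H: "\<And>s. s \<in> {lo..hi} ==> H s \<in> bm (Fm s)" and Hc: "cpaths H"
 obtains \<rho> :: "nat => 'a => real" where "\<And>n. cf_stopping_time P lo hi Fl (\<rho> n)"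
  "\<And>n w. w \<in> space P ==> \<rho> n w <= \<rho> (Suc n) w"
  "AE w in P. \<exists>n. \<rho> n w = hi"
  "\<And>n. mart (\<lambda>t w. M (min t (\<rho> n w)) w - M lo w)"
  "\<And>n w t. w \<in> space P ==> t \<in> {lo..hi} ==> \<bar>M (min t (\<rho> n w)) w - M lo w\<bar> <= real n"
  "\<And>n w u. w \<in> space P ==> u \<in> {lo..hi} ==> u < \<rho> n w ==> \<bar>H u w\<bar> <= real n"
proof -
 have Ma: "\<And>s. s \<in> {lo..hi} ==> M s \<in> bm (Fm s)" and Mc: "cpaths M"
  using M unfolding cf_cont_local_martingale_def adapted_iff by auto
 obtain \<sigma> :: "nat => 'a => real" where \<sigma>: "\<And>n. cf_stopping_time P lo hi Fl (\<sigma> n)"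
  "\<And>n w. w \<in> space P ==> \<sigma> n w <= \<sigma> (Suc n) w" "AE w in P. \<exists>n. \<sigma> n w = hi"
  "\<And>n. mart (\<lambda>t w. M (min t (\<sigma> n w)) w - M lo w)"
  using M unfolding cf_cont_local_martingale_def by auto
 have lh: "lo <= hi" and loin: "lo \<in> {lo..hi}" using lohi by auto
 define Z where "Z t w = max \<bar>M t w - M lo w\<bar> \<bar>H t w\<bar>" for t w
 have Za: "Z s \<in> bm (Fm s)" if s: "s \<in> {lo..hi}" for s
 proof -
  have [measurable]: "M s \<in> bm (Fm s)" "M lo \<in> bm (Fm s)" "H s \<in> bm (Fm s)"
   using Ma[OF s] H[OF s] meas_mono[OF Ma[OF loin], of s] s by auto
  show ?thesis unfolding Z_def[abs_def] by measurable
 qed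
 have Zc: "cpaths Z"
  using Mc Hc unfolding cf_cont_paths_def Z_def by (auto intro!: continuous_intros)
 have cZ: "continuous_on {lo..hi} (\<lambda>t. Z t w)" if "w \<in> space P" for w using Zc that unfolding cf_cont_paths_def by auto
 define \<theta> where "\<theta> n w = first_ge lo hi (real n) (\<lambda>t. Z t w)" for n w
 have \<theta>st: "cf_stopping_time P lo hi Fl (\<theta> n)" for n
  unfolding \<theta>_def[abs_def] by (rule hit_stopping[OF Za Zc])
 define \<rho> where "\<rho> n w = min (\<sigma> n w) (\<theta> n w)" for n w
 have \<rho>st: "cf_stopping_time P lo hi Fl (\<rho> n)" for n unfolding \<rho>_def[abs_def] by (rule stopping_min[OF \<sigma>(1) \<theta>st])
 have \<sigma>in: "\<sigma> n w \<in> {lo..hi}" and \<theta>in: "\<theta> n w \<in> {lo..hi}" if "w \<in> space P" for n w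
  using \<sigma>(1) \<theta>st that unfolding cf_stopping_time_def by blast+
 have Mb: "\<bar>M q w - M lo w\<bar> <= real n" if "w \<in> space P" "q \<in> {lo..hi}" "q <= \<theta> n w" for q n w
 proof (cases "q = lo")
  case False
  then have "Z q w <= real n" using first_ge(6)[OF cZ[OF that(1)] lh that(2), of "real n"] that by (auto simp: \<theta>_def)
  then show ?thesis by (simp add: Z_def)
 qed simp
 show ?thesis
 proof (rule that[of \<rho>])
  show "cf_stopping_time P lo hi Fl (\<rho> n)" for n by (rule \<rho>st)
  show "\<rho> n w <= \<rho> (Suc n) w" if "w \<in> space P" for n w
   unfolding \<rho>_def \<theta>_def using \<sigma>(2)[OF that, of n] first_ge(4)[OF cZ[OF that] lh, of "real n" "real (Suc n)"]
   by (intro min.mono) auto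
  show "AE w in P. \<exists>n. \<rho> n w = hi"
   using \<sigma>(3) AE_space
  proof eventually_elim
   case (elim w)
   then obtain n0 where n0: "\<sigma> n0 w = hi" by auto
   have \<sigma>n: "\<sigma> n w = hi" if "n \<ge> n0" for n
   proof -
    have "\<sigma> n0 w <= \<sigma> n w" by (rule lift_Suc_mono_le[of "\<lambda>n. \<sigma> n w", OF _ that]) (use \<sigma>(2) elim in auto)
    then show ?thesis using n0 \<sigma>in[of w n] elim by auto
   qed
   obtain s where s: "\<And>r. r \<in> {lo..hi} ==> Z r w <= Z s w"
    using continuous_attains_sup[OF compact_Icc _ cZ[of w]] elim loin by blast
   obtain n1 :: nat where n1: "Z s w < real n1" using reals_Archimedean2 by blast
   have "\<theta> (max n0 n1) w = hi" unfolding \<theta>_def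
   proof (rule first_ge(5)[OF cZ lh])
    show "Z t w < real (max n0 n1)" if "t \<in> {lo..hi}" for t
     using s[OF that] n1 by (simp add: of_nat_max)
   qed (use elim in simp)
   then have "\<rho> (max n0 n1) w = hi" using \<sigma>n[of "max n0 n1"] by (simp add: \<rho>_def)
   then show ?case by blast
  qed
  fix n
  show mb: "\<bar>M (min t (\<rho> n w)) w - M lo w\<bar> <= real n" if "w \<in> space P" "t \<in> {lo..hi}" for w t
   by (rule Mb) (use that \<sigma>in[of w n] \<theta>in[of w n] in \<open>auto simp: \<rho>_def min_def\<close>)
  show "\<bar>H u w\<bar> <= real n" if "w \<in> space P" "u \<in> {lo..hi}" "u < \<rho> n w" for w u
   using first_ge(2)[OF cZ[OF that(1)] lh that(2), of "real n"] that(3) by (auto simp: \<rho>_def \<theta>_def Z_def)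
  \<comment> \<open>Already a martingale by the given localization; it is stopped once more at the
    hitting time.\<close>
  define Y where "Y t w = M (min t (\<sigma> n w)) w - M lo w" for t w
  have "mart (\<lambda>t w. Y (min t (\<theta> n w)) w)"
  proof (rule stopped_mart[OF _ _ \<theta>st, where k="real n"])
   show "mart Y" unfolding Y_def[abs_def] by (rule \<sigma>(4))
   show "cpaths Y"
    unfolding cf_cont_paths_def Y_def
   proof (intro ballI continuous_on_diff continuous_on_const)
    fix w assume w: "w \<in> space P"
    have "continuous_on {lo..hi} (\<lambda>t. M t w)" using Mc w unfolding cf_cont_paths_def by auto
    then show "continuous_on {lo..hi} (\<lambda>t. M (min t (\<sigma> n w)) w)"
     by (rule continuous_on_compose2) (use \<sigma>in[OF w, of n] in \<open>auto intro!: continuous_intros simp: min_le_iff_disj\<close>)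
   qed
   show "\<bar>Y (min t (\<theta> n w)) w\<bar> <= real n" if "w \<in> space P" "t \<in> {lo..hi}" for t w
    using mb[OF that] by (simp add: Y_def \<rho>_def min.assoc min.commute[of "\<theta> n w"])
   show "Y lo w = 0" if "w \<in> space P" for w using \<sigma>in[OF that, of n] by (simp add: Y_def min_def)
  qed
  then show "mart (\<lambda>t w. M (min t (\<rho> n w)) w - M lo w)"
   by (simp add: Y_def \<rho>_def min.assoc min.commute[of "\<theta> n _"])
 qed
qed

text \<open>Turns an almost sure statement about a sequence into one index that works with
  probability close to one.\<close>

lemma stopping_tight:
 assumes st: "\<And>n. cf_stopping_time P lo hi Fl (\<rho> n)" and mono: "\<And>n w. w \<in> space P ==> \<rho> n w <= \<rho> (Suc n) w"
  and ae: "AE w in P. \<exists>n::nat. \<rho> n w = hi" and kp: "0 < kp"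
 obtains n B where "B \<in> sets P" "measure P B <= kp" "\<And>w. w \<in> space P - B ==> \<rho> n w = hi"
proof -
 have in': "\<rho> n w \<in> {lo..hi}" if "w \<in> space P" for n w using st that unfolding cf_stopping_time_def by blast
 define A where "A n = {w\<in>space P. \<rho> n w = hi}" for n
 have A[measurable]: "A n \<in> sets P" for n
 proof -
  \<comment> \<open>Events of the form \<open>\<rho> n w <= t\<close> are available for
    \<open>t\<close> in \<open>[lo, hi]\<close> only; the levels approaching \<open>hi\<close> are
    scaled to start at \<open>lo\<close>.\<close>
  have "A n = space P - (\<Union>i::nat. {w\<in>space P. \<rho> n w <= hi - (hi - lo) / real (Suc i)})"
  proof (intro equalityI subsetI)
   fix w assume "w \<in> A n"
   then show "w \<in> space P - (\<Union>i::nat. {w\<in>space P. \<rho> n w <= hi - (hi - lo) / real (Suc i)})"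
    using lohi by (auto simp: A_def field_simps)
  next
   fix w assume w: "w \<in> space P - (\<Union>i::nat. {w\<in>space P. \<rho> n w <= hi - (hi - lo) / real (Suc i)})"
   have "\<rho> n w = hi"
   proof (rule ccontr)
    assume "\<rho> n w \<noteq> hi"
    then have "0 < (hi - \<rho> n w) / (hi - lo)" using in'[of w n] w lohi by auto
    then obtain i :: nat where "1 / real (Suc i) < (hi - \<rho> n w) / (hi - lo)" using nat_approx_posE by (metis of_nat_Suc)
    then have "\<rho> n w <= hi - (hi - lo) / real (Suc i)" using lohi by (simp add: field_simps)
    then show False using w by auto
   qed
   then show "w \<in> A n" using w by (simp add: A_def)
  qed
  also have "... \<in> sets P"
  proof (intro sets.Diff sets.top sets.countable_UN image_subsetI)
   fix i :: nat
   have "(hi - lo) / real (Suc i) <= (hi - lo) / 1" using lohi by (intro divide_left_mono) auto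
   moreover have "0 <= (hi - lo) / real (Suc i)" using lohi by simp
   ultimately have h: "hi - (hi - lo) / real (Suc i) \<in> {lo..hi}" by simp
   show "{w\<in>space P. \<rho> n w <= hi - (hi - lo) / real (Suc i)} \<in> sets P"
    using st[of n] h Fm_P[OF h] sets_Fm[OF h] unfolding cf_stopping_time_def by blast
  qed
  finally show ?thesis .
 qed
 have "incseq A"
 proof (rule incseq_SucI, rule subsetI)
  fix n w assume "w \<in> A n"
  then show "w \<in> A (Suc n)" using mono[of w n] in'[of w "Suc n"] by (auto simp: A_def)
 qed
 then have "(\<lambda>n. measure P (A n)) \<longlonglongrightarrow> measure P (\<Union>n. A n)" by (intro finite_Lim_measure_incseq) auto
 also have "measure P (\<Union>n. A n) = 1"
 proof -
  have "AE w in P. w \<in> (\<Union>n. A n)" using ae AE_space by eventually_elim (auto simp: A_def)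
  then show ?thesis by (subst prob_eq_1) auto
 qed
 finally have "\<forall>\<^sub>F n in sequentially. 1 - kp < measure P (A n)" using order_tendstoD(1)[of _ 1 _ "1 - kp"] kp by auto
 then obtain n where n: "1 - kp < measure P (A n)" by (auto simp: eventually_sequentially)
 show ?thesis
 proof (rule that[of "space P - A n" n])
  show "space P - A n \<in> sets P" by measurable
  show "measure P (space P - A n) <= kp" using n prob_compl[OF A[of n]] by simp
 qed (auto simp: A_def)
qed

text \<open>The bridge to mean square estimates: results in probability may be proved for the
  bounded martingale \<open>m\<close>, which has the same increments as M off a small event.\<close>

lemma bounded_version:
 assumes M: "lmart M" and kp: "0 < kp"
 shows "\<exists>m k B. mart m \<and> cpaths m \<and> 0 <= (k::real) \<and>
  (\<forall>w\<in>space P. \<forall>t\<in>{lo..hi}. \<bar>m t w\<bar> <= k) \<and> (\<forall>w\<in>space P. m lo w = 0) \<and>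
  B \<in> sets P \<and> measure P B <= kp \<and> (\<forall>w\<in>space P - B. \<forall>t\<in>{lo..hi}. m t w = M t w - M lo w)"
proof -
 have Mc: "cpaths M" using M unfolding cf_cont_local_martingale_def by auto
 obtain \<rho> :: "nat => 'a => real" where \<rho>: "\<And>n. cf_stopping_time P lo hi Fl (\<rho> n)"
  "\<And>n w. w \<in> space P ==> \<rho> n w <= \<rho> (Suc n) w"
  "AE w in P. \<exists>n. \<rho> n w = hi"
  "\<And>n. mart (\<lambda>t w. M (min t (\<rho> n w)) w - M lo w)"
  "\<And>n w t. w \<in> space P ==> t \<in> {lo..hi} ==> \<bar>M (min t (\<rho> n w)) w - M lo w\<bar> <= real n"
  using localization[OF M, of "\<lambda>_ _. 0"] by (auto simp: cf_cont_paths_def)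
 obtain n B where nB: "B \<in> sets P" "measure P B <= kp" "\<And>w. w \<in> space P - B ==> \<rho> n w = hi"
  using stopping_tight[OF \<rho>(1-3) kp] by blast
 have \<rho>in: "\<rho> n w \<in> {lo..hi}" if "w \<in> space P" for w using \<rho>(1)[of n] that unfolding cf_stopping_time_def by blast
 show ?thesis
 proof (intro exI[of _ "\<lambda>t w. M (min t (\<rho> n w)) w - M lo w"] exI[of _ "real n"] exI[of _ B] conjI ballI nB(1,2) \<rho>(4)[of n])
  show "\<bar>M (min t (\<rho> n w)) w - M lo w\<bar> <= real n" if "w \<in> space P" "t \<in> {lo..hi}" for w t by (rule \<rho>(5)[OF that])
  show "cpaths (\<lambda>t w. M (min t (\<rho> n w)) w - M lo w)"
   unfolding cf_cont_paths_def
  proof (intro ballI continuous_on_diff continuous_on_const)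
   fix w assume w: "w \<in> space P"
   have "continuous_on {lo..hi} (\<lambda>t. M t w)" using Mc w unfolding cf_cont_paths_def by auto
   then show "continuous_on {lo..hi} (\<lambda>t. M (min t (\<rho> n w)) w)"
    by (rule continuous_on_compose2) (use \<rho>in[OF w] in \<open>auto intro!: continuous_intros simp: min_le_iff_disj\<close>)
  qed
  show "M (min lo (\<rho> n w)) w - M lo w = 0" if "w \<in> space P" for w
   using \<rho>in[OF that] by (simp add: min_absorb1)
  show "M (min t (\<rho> n w)) w - M lo w = M t w - M lo w" if "w \<in> space P - B" "t \<in> {lo..hi}" for w t
   using nB(3)[OF that(1)] that(2) by (simp add: min_absorb1)
 qed auto
qed

end

section \<open>Stochastic integrals of continuous integrands\<close>

text \<open>Makes integrands bounded for every outcome; on the event of interest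
  \<open>trc_id\<close> shows that nothing was changed.\<close>

definition trc :: "real => real => real" where
 "trc c x = max (- c) (min c x)"

lemma trc_bound: "0 <= c ==> \<bar>trc c x\<bar> <= c"
 by (auto simp: trc_def)

lemma trc_id: "\<bar>x\<bar> <= c ==> trc c x = x"
 by (auto simp: trc_def)

lemma trc_measurable [measurable]: "trc c \<in> bm borel"
 unfolding trc_def[abs_def] by measurable

text \<open>Holds the value of \<open>H\<close> at the last grid point, and is zero outside
  \<open>[v 0, v p[\<close>.\<close>

definition step_fun :: "(nat => real) => nat => (real => 'b => real) => real => 'b => real" where
 "step_fun v p H u w = (\<Sum>k<p. of_bool (v k <= u \<and> u < v (Suc k)) * H (v k) w)"

lemma step_fun_val:
 assumes v: "mono v" and u: "v 0 <= u" "u < v p"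
 obtains k where "k < p" "v k <= u" "u < v (Suc k)" "step_fun v p H u w = H (v k) w"
proof -
 define i where "i = (LEAST i. u < v i)"
 have i: "u < v i" "i <= p" unfolding i_def using u by (auto intro: LeastI Least_le)
 have i0: "i \<noteq> 0" using i(1) u(1) by (metis not_le)
 then obtain k where k: "i = Suc k" by (cases i) auto
 have vk: "v k <= u" using not_less_Least[of k "\<lambda>i. u < v i"] k unfolding i_def[symmetric] by auto
 have "step_fun v p H u w = (\<Sum>j\<in>{k}. of_bool (v j <= u \<and> u < v (Suc j)) * H (v j) w)"
  unfolding step_fun_def
 proof (rule sum.mono_neutral_right)
  show "\<forall>j\<in>{..<p} - {k}. of_bool (v j <= u \<and> u < v (Suc j)) * H (v j) w = 0"
  proof
   fix j assume "j \<in> {..<p} - {k}"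
   then consider "j < k" | "k < j" by fastforce
   then have "\<not> (v j <= u \<and> u < v (Suc j))"
   proof cases
    case 1
    then have "v (Suc j) <= v k" by (intro monoD[OF v]) auto
    then show ?thesis using vk by linarith
   next
    case 2
    then have "v (Suc k) <= v j" by (intro monoD[OF v]) auto
    then show ?thesis using i(1) k by auto
   qed
   then show "of_bool (v j <= u \<and> u < v (Suc j)) * H (v j) w = 0" by simp
  qed
 qed (use i k in auto)
 then have "step_fun v p H u w = H (v k) w" using vk i k by simp
 with vk i k show ?thesis by (intro that[of k]) auto
qed

context filtered_prob
begin

lemma step_fun_meas:
 assumes "grid_in v" "\<And>s. s \<in> {lo..hi} ==> H s \<in> bm (Fm s)" "u \<in> {lo..hi}"
 shows "step_fun v p H u \<in> bm (Fm u)"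
 unfolding step_fun_def[abs_def]
proof (rule borel_measurable_sum)
 fix k
 show "(\<lambda>w. of_bool (v k <= u \<and> u < v (Suc k)) * H (v k) w) \<in> bm (Fm u)"
 proof (cases "v k <= u")
  case True
  have "H (v k) \<in> bm (Fm u)"
   by (rule meas_mono[OF assms(2)]) (use True assms grid_inD[OF assms(1)] in auto)
  then show ?thesis by simp
 qed simp
qed

text \<open>The indicator of a cell is the difference of the indicators of the times before its two
  ends, to which \<open>tel_sum\<close> and \<open>tel_lim\<close> apply.\<close>

lemma tr_step_fun:
 assumes v: "mono v"
 shows "tr u n (step_fun v p H) M t w =
  (\<Sum>k<p. H (v k) w * ((\<Sum>j<n. of_bool (u j < v (Suc k)) * (M (min (u (Suc j)) t) w - M (min (u j) t) w))
    - (\<Sum>j<n. of_bool (u j < v k) * (M (min (u (Suc j)) t) w - M (min (u j) t) w))))"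
proof -
 let ?D = "\<lambda>j. M (min (u (Suc j)) t) w - M (min (u j) t) w"
 have b: "of_bool (v k <= x \<and> x < v (Suc k)) = (of_bool (x < v (Suc k)) - of_bool (x < v k) :: real)" for k x
  using monoD[OF v, of k "Suc k"] by auto
 have "tr u n (step_fun v p H) M t w = (\<Sum>j<n. \<Sum>k<p. H (v k) w * ((of_bool (u j < v (Suc k)) - of_bool (u j < v k)) * ?D j))"
  unfolding tr_def step_fun_def b sum_distrib_right by (intro sum.cong refl) (simp add: mult_ac)
 also have "... = (\<Sum>k<p. \<Sum>j<n. H (v k) w * ((of_bool (u j < v (Suc k)) - of_bool (u j < v k)) * ?D j))"
  by (rule sum.swap)
 also have "... = (\<Sum>k<p. H (v k) w * ((\<Sum>j<n. of_bool (u j < v (Suc k)) * ?D j) - (\<Sum>j<n. of_bool (u j < v k) * ?D j)))"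
  by (intro sum.cong refl) (simp only: left_diff_distrib sum_subtractf sum_distrib_left[symmetric])
 finally show ?thesis .
qed

text \<open>The grid \<open>v\<close> need not be dyadic; this is what later connects uniform
  Riemann sums with dyadic transforms.\<close>

lemma tr_step_fun_lim:
 assumes v: "grid_in v" and M: "continuous_on {lo..hi} (\<lambda>t. M t w)" and t: "t \<in> {lo..hi}"
 shows "(\<lambda>N. tr (gr N) (2^N) (step_fun v p H) M t w) \<longlonglongrightarrow>
   (\<Sum>k<p. H (v k) w * (M (min (v (Suc k)) t) w - M (min (v k) t) w))"
proof -
 have mv: "mono v" using v by (simp add: grid_in_def)
 have vin: "v k \<in> {lo..hi}" for k using grid_inD[OF v] by auto
 have "(\<lambda>N. tr (gr N) (2^N) (step_fun v p H) M t w) \<longlonglongrightarrow>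
   (\<Sum>k<p. H (v k) w * ((M (min (v (Suc k)) t) w - M lo w) - (M (min (v k) t) w - M lo w)))"
  unfolding tr_step_fun[OF mv] by (intro tendsto_intros tel_lim[OF M] vin t)
 then show ?thesis by simp
qed

text \<open>A finer dyadic grid contains the coarser one, so there is no overshoot. Transforms on
  two grids can thus be written on the finer one.\<close>

lemma tr_step_fun_gr:
 assumes N: "N0 <= N" and t: "t \<in> {lo..hi}"
 shows "tr (gr N) (2^N) (step_fun (gr N0) (2^N0) H) M t w = tr (gr N0) (2^N0) H M t w"
proof -
 have m: "mono (gr K)" for K using grid_gr[of K] by (simp add: grid_in_def)
 have ex: "(\<Sum>j<2^N. of_bool (gr N j < gr N0 k) * (M (min (gr N (Suc j)) t) w - M (min (gr N j) t) w))
   = M (min (gr N0 k) t) w - M lo w" if k: "k <= 2^N0" for k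
 proof -
  have le: "gr N0 k <= gr N (2^N)" using gr_in[of N0 k] by simp
  obtain i where i: "i <= 2^N" "gr N0 k <= gr N i" "\<And>j. j < i ==> gr N j < gr N0 k"
   "\<And>f t. (\<Sum>j<2^N. of_bool (gr N j < gr N0 k) * (f (min (gr N (Suc j)) t) - f (min (gr N j) t))) = f (min (gr N i) t) - (f (min (gr N 0) t) :: real)"
   using tel_sum[OF m le] by blast
  define j0 where "j0 = k * 2^(N - N0)"
  have j0: "gr N j0 = gr N0 k" unfolding j0_def by (rule gr_refine[OF N k, symmetric])
  have "\<not> j0 < i" using i(3)[of j0] j0 by auto
  then have "gr N i <= gr N j0" by (intro monoD[OF m]) auto
  then have "gr N i = gr N0 k" using i(2) j0 by linarith
  then show ?thesis using i(4)[of "\<lambda>t. M t w" t] t by simp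
 qed
 show ?thesis unfolding tr_step_fun[OF m]
 proof (subst tr_def, intro sum.cong refl)
  fix k assume "k \<in> {..<(2::nat) ^ N0}"
  then have "Suc k <= 2^N0" "k <= 2^N0" by auto
  then show "H (gr N0 k) w * ((\<Sum>j<2^N. of_bool (gr N j < gr N0 (Suc k)) * (M (min (gr N (Suc j)) t) w - M (min (gr N j) t) w))
    - (\<Sum>j<2^N. of_bool (gr N j < gr N0 k) * (M (min (gr N (Suc j)) t) w - M (min (gr N j) t) w)))
    = H (gr N0 k) w * (M (min (gr N0 (Suc k)) t) w - M (min (gr N0 k) t) w)"
   by (simp only: ex) simp
 qed
qed

lemma tr_diff_Z: "tr u n H M t w - tr u n G M t w = tr u n (\<lambda>r w. H r w - G r w) M t w"
 unfolding tr_def by (simp add: sum_subtractf[symmetric] left_diff_distrib)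

lemma tr_cong:
 assumes "\<And>j. j < n ==> u j < t ==> Z (u j) w = Z' (u j) w"
  "\<And>s. s \<in> {lo..hi} ==> M s w = M' s w + c" "grid_in u" "t \<in> {lo..hi}"
 shows "tr u n Z M t w = tr u n Z' M' t w"
 unfolding tr_def
proof (intro sum.cong refl)
 have m: "min (u j) t \<in> {lo..hi}" for j using grid_inD[OF assms(3), of j] assms(4) by auto
 fix j assume j: "j \<in> {..<n}"
 show "Z (u j) w * (M (min (u (Suc j)) t) w - M (min (u j) t) w) = Z' (u j) w * (M' (min (u (Suc j)) t) w - M' (min (u j) t) w)"
 proof (cases "u j < t")
  case True
  then show ?thesis using assms(1)[of j] j assms(2)[OF m, of j] assms(2)[OF m, of "Suc j"] by simp
 next
  case False
  then have "min (u (Suc j)) t = t" "min (u j) t = t" using grid_inD(3)[OF assms(3), of j "Suc j"] by auto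
  then show ?thesis by simp
 qed
qed

lemma tr_cont:
 assumes "cpaths M" "grid_in u"
 shows "cpaths (tr u n Z M)"
 unfolding cf_cont_paths_def tr_def
proof (intro ballI)
 fix w assume w: "w \<in> space P"
 have M: "continuous_on {lo..hi} (\<lambda>t. M t w)" using assms(1) w unfolding cf_cont_paths_def by auto
 have "continuous_on {lo..hi} (\<lambda>t. M (min (u i) t) w)" for i
  by (rule continuous_on_compose2[OF M]) (use grid_inD[OF assms(2), of i] in \<open>auto intro!: continuous_intros simp: min_le_iff_disj\<close>)
 then show "continuous_on {lo..hi} (\<lambda>t. \<Sum>j<n. Z (u j) w * (M (min (u (Suc j)) t) w - M (min (u j) t) w))"
  by (intro continuous_on_sum continuous_on_mult continuous_on_const continuous_on_diff)
qed

text \<open>Every continuous path satisfies each condition of \<open>ppath\<close> with some radius,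
  so for each \<open>j\<close> a radius \<open>1 / Suc m\<close> fails with probability at most
  \<open>kp / 4 * (1/2)^j\<close>. These sum to \<open>kp / 2\<close>; the other half pays for the
  uniform bound. The conditions are tested at dyadic points, which makes the events
  measurable.\<close>

lemma ppath_tight:
 assumes X: "\<And>t. t \<in> {lo..hi} ==> X t \<in> bm P" and cont: "cpaths X" and kp: "0 < kp"
 shows "\<exists>d R B. (\<forall>j. 0 < d j) \<and> 0 < R \<and> B \<in> sets P \<and> measure P B <= kp \<and>
  (\<forall>w\<in>space P - B. ppath R d (\<lambda>s. cf_ext lo hi X s w))"
proof -
 have cX: "continuous_on {lo..hi} (\<lambda>t. X t w)" if "w \<in> space P" for w using cont that unfolding cf_cont_paths_def by auto
 define A where "A j m = {w\<in>space P. \<forall>N k N' k'. \<bar>gr N k - gr N' k'\<bar> <= 1 / real (Suc m) \<longrightarrow> \<bar>X (gr N k) w - X (gr N' k') w\<bar> <= 1 / real (Suc j)}" for j m :: nat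
 define A' where "A' m = {w\<in>space P. \<forall>N k. \<bar>X (gr N k) w\<bar> <= real m}" for m :: nat
 have [measurable]: "X (gr N k) \<in> bm P" for N k by (rule X[OF gr_in])
 have A[measurable]: "A j m \<in> sets P" for j m unfolding A_def by measurable
 have A'[measurable]: "A' m \<in> sets P" for m unfolding A'_def by measurable
 have small: "\<exists>m. measure P (space P - E m) <= e"
  if E: "\<And>m. E m \<in> sets P" "incseq E" "(\<Union>m. E m) = space P" and e: "0 < e" for E :: "nat => 'a set" and e
 proof -
  have "(\<lambda>m. measure P (E m)) \<longlonglongrightarrow> measure P (\<Union>m. E m)" using E by (intro finite_Lim_measure_incseq) auto
  then have "(\<lambda>m. measure P (E m)) \<longlonglongrightarrow> 1" using E(3) prob_space by simp
  then have "\<forall>\<^sub>F m in sequentially. 1 - e < measure P (E m)" using order_tendstoD(1)[of _ 1 _ "1 - e"] e by auto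
  then obtain m where m: "1 - e < measure P (E m)" by (auto simp: eventually_sequentially)
  then show ?thesis using prob_compl[OF E(1)[of m]] by (intro exI[of _ m]) simp
 qed
 have "\<exists>m. measure P (space P - A j m) <= kp / 4 * (1/2)^j" for j
 proof (rule small[OF A])
  show "incseq (A j)"
  proof (rule incseq_SucI, rule subsetI)
   fix m w assume w: "w \<in> A j m"
   have "1 / real (Suc (Suc m)) <= 1 / real (Suc m)" by (simp add: field_simps)
   then show "w \<in> A j (Suc m)" using w unfolding A_def by (auto intro: order_trans)
  qed
  show "(\<Union>m. A j m) = space P"
  proof (intro equalityI subsetI)
   fix w assume w: "w \<in> space P"
   have "uniformly_continuous_on {lo..hi} (\<lambda>t. X t w)" by (intro compact_uniformly_continuous cX w) auto
   then obtain d where d: "d > 0" "\<And>s t. s \<in> {lo..hi} ==> t \<in> {lo..hi} ==> dist s t < d ==> dist (X s w) (X t w) < 1 / real (Suc j)"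
    unfolding uniformly_continuous_on_def by (metis of_nat_0_less_iff zero_less_Suc zero_less_divide_1_iff)
   obtain m where m: "1 / real (Suc m) < d" using nat_approx_posE[OF d(1)] by (metis of_nat_Suc)
   have "\<bar>X (gr N k) w - X (gr N' k') w\<bar> <= 1 / real (Suc j)" if "\<bar>gr N k - gr N' k'\<bar> <= 1 / real (Suc m)" for N k N' k'
    using d(2)[OF gr_in gr_in, of N k N' k'] that m by (simp add: dist_real_def)
   then have "w \<in> A j m" unfolding A_def using w by blast
   then show "w \<in> (\<Union>m. A j m)" by blast
  qed (auto simp: A_def)
 qed (use kp in auto)
 then obtain mm where mm: "\<And>j. measure P (space P - A j (mm j)) <= kp / 4 * (1/2)^j" by metis
 obtain R0 where R0: "measure P (space P - A' R0) <= kp / 2"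
 proof -
  have "\<exists>m. measure P (space P - A' m) <= kp / 2"
  proof (rule small[OF A'])
   show "incseq A'"
   proof (rule incseq_SucI, rule subsetI)
    fix m w assume "w \<in> A' m"
    moreover have "real m <= real (Suc m)" by simp
    ultimately show "w \<in> A' (Suc m)" unfolding A'_def by (blast intro: order_trans)
   qed
   show "(\<Union>m. A' m) = space P"
   proof (intro equalityI subsetI)
    fix w assume w: "w \<in> space P"
    have "bounded ((\<lambda>t. X t w) ` {lo..hi})" by (intro compact_imp_bounded compact_continuous_image cX w) auto
    then obtain b where "\<forall>x\<in>(\<lambda>t. X t w) ` {lo..hi}. norm x <= b" unfolding bounded_iff by blast
    then have b: "\<And>t. t \<in> {lo..hi} ==> \<bar>X t w\<bar> <= b" by simp
    obtain m :: nat where "b <= real m" using real_arch_simple by blast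
    then have "w \<in> A' m" unfolding A'_def using b[OF gr_in] w by (blast intro: order_trans)
    then show "w \<in> (\<Union>m. A' m)" by blast
   qed (auto simp: A'_def)
  qed (use kp in auto)
  then show ?thesis using that by blast
 qed
 \<comment> \<open>Halved, so that times at distance at most \<open>d j\<close> have dyadic
   approximations at distance strictly below the tested radius.\<close>
 define d where "d j = 1 / real (Suc (mm j)) / 2" for j
 define R where "R = real R0 + 1"
 define B where "B = (space P - A' R0) \<union> (\<Union>j. space P - A j (mm j))"
 show ?thesis
 proof (intro exI[of _ d] exI[of _ R] exI[of _ B] conjI allI ballI)
  show "0 < d j" for j by (simp add: d_def)
  show "0 < R" by (simp add: R_def)
  show "B \<in> sets P" unfolding B_def by measurable
  have summ: "summable (\<lambda>j. kp / 4 * (1/2)^j)" by (intro summable_mult summable_geometric) auto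
  have summ': "summable (\<lambda>j. measure P (space P - A j (mm j)))"
   by (rule summable_comparison_test'[OF summ, of 0]) (use mm in auto)
  have "measure P (\<Union>j. space P - A j (mm j)) <= (\<Sum>j. measure P (space P - A j (mm j)))"
   by (rule finite_measure_subadditive_countably[OF _ summ']) auto
  also have "... <= (\<Sum>j. kp / 4 * (1/2)^j)" by (rule suminf_le[OF mm summ' summ])
  also have "... = kp / 4 * 2" by (subst suminf_mult) (auto simp: suminf_geometric summable_geometric)
  finally have u: "measure P (\<Union>j. space P - A j (mm j)) <= kp / 2" by simp
  have "measure P B <= measure P (space P - A' R0) + measure P (\<Union>j. space P - A j (mm j))"
   unfolding B_def by (rule measure_Un_le) measurable
  then show "measure P B <= kp" using R0 u by linarith
  fix w assume w: "w \<in> space P - B"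
  have wA: "w \<in> A j (mm j)" for j using w unfolding B_def by blast
  have wA': "w \<in> A' R0" using w unfolding B_def by blast
  have ws: "w \<in> space P" using w by simp
  have appr: "\<exists>k. (\<forall>N. gr N (k N) \<in> {lo..hi}) \<and> (\<lambda>N. gr N (k N)) \<longlonglongrightarrow> s" if s: "s \<in> {lo..hi}" for s
  proof -
   have "\<exists>k. gr N k <= s \<and> s <= gr N k + mesh N" for N using gr_below[OF s, of N] by blast
   then obtain k where k: "\<And>N. gr N (k N) <= s" "\<And>N. s <= gr N (k N) + mesh N" by metis
   have "(\<lambda>N. gr N (k N)) \<longlonglongrightarrow> s"
   proof (rule tendsto_sandwich[of "\<lambda>N. s - mesh N" _ sequentially "\<lambda>_. s"])
    have "(\<lambda>N. s - mesh N) \<longlonglongrightarrow> s - 0" by (intro tendsto_intros mesh_lim)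
    then show "(\<lambda>N. s - mesh N) \<longlonglongrightarrow> s" by simp
    show "\<forall>\<^sub>F N in sequentially. s - mesh N <= gr N (k N)" using k(2) by (intro always_eventually allI) (simp add: algebra_simps)
   qed (use k in auto)
   then show ?thesis using gr_in by blast
  qed
  have lim: "(\<lambda>N. X (gr N (k N)) w) \<longlonglongrightarrow> X s w" if "s \<in> {lo..hi}" "(\<lambda>N. gr N (k N)) \<longlonglongrightarrow> s" for s k
   by (rule continuous_on_tendsto_compose[OF cX[OF ws] that(2,1)]) (use gr_in in auto)
  have b1: "\<bar>X s w\<bar> <= R" if s: "s \<in> {lo..hi}" for s
  proof -
   obtain k where "(\<lambda>N. gr N (k N)) \<longlonglongrightarrow> s" using appr[OF s] by blast
   from LIMSEQ_le_const2[OF tendsto_rabs[OF lim[OF s this]], of "real R0"] wA'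
   have "\<bar>X s w\<bar> <= real R0" unfolding A'_def by blast
   then show ?thesis by (simp add: R_def)
  qed
  have b2: "\<bar>X s w - X t w\<bar> <= 1 / real (Suc j)" if s: "s \<in> {lo..hi}" and t: "t \<in> {lo..hi}" and st: "\<bar>s - t\<bar> <= d j" for s t j
  proof -
   obtain k where k: "(\<lambda>N. gr N (k N)) \<longlonglongrightarrow> s" using appr[OF s] by blast
   obtain l where l: "(\<lambda>N. gr N (l N)) \<longlonglongrightarrow> t" using appr[OF t] by blast
   have "(\<lambda>N. \<bar>gr N (k N) - gr N (l N)\<bar>) \<longlonglongrightarrow> \<bar>s - t\<bar>" by (intro tendsto_intros k l)
   moreover have "\<bar>s - t\<bar> < 1 / real (Suc (mm j))"
   proof -
    have "x / 2 < x" if "0 < x" for x :: real using that by simp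
    from this[of "1 / real (Suc (mm j))"] have "d j < 1 / real (Suc (mm j))" by (simp add: d_def)
    with st show ?thesis by (rule le_less_trans)
   qed
   ultimately have "\<forall>\<^sub>F N in sequentially. \<bar>gr N (k N) - gr N (l N)\<bar> < 1 / real (Suc (mm j))" by (rule order_tendstoD(2))
   then have "\<forall>\<^sub>F N in sequentially. \<bar>X (gr N (k N)) w - X (gr N (l N)) w\<bar> <= 1 / real (Suc j)"
    by eventually_elim (use wA[of j] in \<open>unfold A_def, blast intro: less_imp_le\<close>)
   then show ?thesis
    by (intro tendsto_upperbound[OF tendsto_rabs[OF tendsto_diff[OF lim[OF s k] lim[OF t l]]]]) auto
  qed
  have cl: "cf_clamp lo hi s \<in> {lo..hi}" "\<bar>cf_clamp lo hi s - cf_clamp lo hi t\<bar> <= \<bar>s - t\<bar>" for s t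
   using lohi by (auto simp: cf_clamp_def)
  show "ppath R d (\<lambda>s. cf_ext lo hi X s w)"
   unfolding ppath_def cf_ext_def using b1[OF cl(1)] b2[OF cl(1) cl(1)] cl(2) by (meson order_trans)
 qed
qed

end

text \<open>\<open>k + 1\<close> avoids division by zero, and \<open>min 1 kp\<close> is used
  because the square of a number in \<open>]0, 1]\<close> is below the number.\<close>

lemma delta_choice:
 fixes \<eta> kp k :: real
 assumes "0 < \<eta>" "0 < kp" "0 <= k"
 shows "\<exists>dl>0. dl\<^sup>2 * k\<^sup>2 / \<eta>\<^sup>2 <= kp"
proof -
 let ?q = "min 1 kp"
 define dl where "dl = \<eta> * ?q / (k + 1)"
 have q: "0 < ?q" "?q <= 1" "?q <= kp" using assms by auto
 have dl: "0 < dl" using assms q by (simp add: dl_def)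
 have "dl * k <= dl * (k + 1)" using dl by simp
 also have "... = \<eta> * ?q" using assms(3) by (simp add: dl_def)
 finally have "(dl * k)\<^sup>2 <= (\<eta> * ?q)\<^sup>2" using dl assms by (intro power_mono) auto
 also have "... = \<eta>\<^sup>2 * (?q * ?q)" by (simp add: power_mult_distrib power2_eq_square)
 also have "... <= \<eta>\<^sup>2 * (1 * kp)" using q by (intro mult_left_mono mult_mono) auto
 finally have "dl\<^sup>2 * k\<^sup>2 / \<eta>\<^sup>2 <= kp" using assms by (simp add: field_simps power_mult_distrib)
 with dl show ?thesis by blast
qed

section \<open>Existence of the stochastic integral and its local martingale property\<close>

context filtered_prob
begin

lemma mart_sq_le:
 assumes m: "mart m" and k: "\<And>t w. w \<in> space P ==> t \<in> {lo..hi} ==> \<bar>m t w\<bar> <= k" and t: "t \<in> {lo..hi}"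
 shows "(\<integral>w. (m t w)\<^sup>2 \<partial>P) <= k\<^sup>2" "0 <= (\<integral>w. (m t w)\<^sup>2 \<partial>P)"
proof -
 have sq: "\<bar>(m t w)\<^sup>2\<bar> <= k\<^sup>2" if "w \<in> space P" for w
  using power_mono[OF k[OF that t], of 2] by simp
 have "(\<integral>w. (m t w)\<^sup>2 \<partial>P) <= (\<integral>w. k\<^sup>2 \<partial>P)"
  by (rule integral_mono[OF integrable_bdd[OF _ sq]]) (use martD(3)[OF m t] sq in auto)
 then show "(\<integral>w. (m t w)\<^sup>2 \<partial>P) <= k\<^sup>2" using prob_space by simp
qed simp

text \<open>The difference of the two transforms is the transform of \<open>H\<close> minus its step
  function on the coarse grid. On the good event this integrand is at most \<open>dl\<close>, so the
  maximal inequality for the bounded version of M gives smallness uniformly in time and in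
  \<open>N\<close>.\<close>

lemma tr_small:
 assumes H: "\<And>s. s \<in> {lo..hi} ==> H s \<in> bm (Fm s)" and Hc: "cpaths H"
  and M: "lmart M" and \<eta>: "0 < \<eta>" and kp: "0 < kp"
 obtains N0 where "\<And>N. N0 <= N ==> \<exists>B\<in>sets P. measure P B <= kp \<and> (\<forall>w\<in>space P - B. \<forall>t\<in>{lo..hi}.
   \<bar>tr (gr N) (2^N) H M t w - tr (gr N0) (2^N0) H M t w\<bar> <= \<eta>)"
proof -
 have HP: "H t \<in> bm P" if "t \<in> {lo..hi}" for t by (rule meas_P[OF H[OF that] that])
 have k3: "0 < kp / 3" using kp by simp
 obtain R d B1 where B1: "\<And>j. 0 < d j" "0 < R" "B1 \<in> sets P" "measure P B1 <= kp / 3"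
  "\<And>w. w \<in> space P - B1 ==> ppath R d (\<lambda>s. cf_ext lo hi H s w)"
  using ppath_tight[OF HP Hc k3] by blast
 obtain m k B2 where m: "mart m" "cpaths m" "0 <= (k::real)"
  "\<And>t w. w \<in> space P ==> t \<in> {lo..hi} ==> \<bar>m t w\<bar> <= k"
  "\<And>w. w \<in> space P ==> m lo w = 0"
  "B2 \<in> sets P" "measure P B2 <= kp / 3" "\<And>w t. w \<in> space P - B2 ==> t \<in> {lo..hi} ==> m t w = M t w - M lo w"
  using bounded_version[OF M k3] by blast
 obtain dl where dl: "0 < dl" and dlk: "dl\<^sup>2 * k\<^sup>2 / \<eta>\<^sup>2 <= kp / 3" using delta_choice[OF \<eta> k3 m(3)] by blast
 obtain j where j: "1 / real (Suc j) < dl" using nat_approx_posE[OF dl] by (metis of_nat_Suc)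
 have "\<forall>\<^sub>F N in sequentially. mesh N < d j" using order_tendstoD(2)[OF mesh_lim B1(1)] .
 then obtain N0 where N0: "mesh N0 < d j" by (auto simp: eventually_sequentially)
 show ?thesis
 proof (rule that[of N0])
  fix N assume N: "N0 <= N"
  define Z where "Z u w = trc dl (H u w - step_fun (gr N0) (2^N0) H u w)" for u w
  have Zm: "Z u \<in> bm (Fm u)" if "u \<in> {lo..hi}" for u
  proof -
   have [measurable]: "H u \<in> bm (Fm u)" "step_fun (gr N0) (2^N0) H u \<in> bm (Fm u)"
    using H[OF that] step_fun_meas[OF grid_gr H that] by auto
   show ?thesis unfolding Z_def[abs_def] by measurable
  qed
  have Zb: "\<bar>Z u w\<bar> <= dl" for u w unfolding Z_def by (rule trc_bound) (use dl in simp)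
  define Y where "Y = tr (gr N) (2^N) Z m"
  have Y: "mart Y" unfolding Y_def by (rule mart_tr[OF m(1) grid_gr Zm Zb])
  have Yc: "cpaths Y" unfolding Y_def by (rule tr_cont[OF m(2) grid_gr])
  have Yb: "\<bar>Y t w\<bar> <= real (2^N) * (dl * (2 * k))" if "w \<in> space P" "t \<in> {lo..hi}" for t w
  proof -
   have "\<bar>tr (gr N) (2^N) Z (\<lambda>r. m (max lo (min hi r))) t w\<bar> <= real (2^N) * (dl * (2 * k))"
    by (rule tr_bound) (use that m(4) lohi Zb in auto)
   moreover have "max lo (min hi (min (gr N i) t)) = min (gr N i) t" for i
    using gr_in[of N i] that(2) by auto
   ultimately show ?thesis by (simp add: Y_def tr_def)
  qed
  define B3 where "B3 = {w\<in>space P. \<exists>t\<in>{lo..hi}. \<eta> < \<bar>Y t w\<bar>}"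
  have B3: "B3 \<in> sets P" "measure P B3 <= (\<integral>w. (Y hi w)\<^sup>2 \<partial>P) / \<eta>\<^sup>2"
  proof -
   show "B3 \<in> sets P" unfolding B3_def by (rule maximal_inequality(1)[OF Y Yb \<eta> Yc])
   show "measure P B3 <= (\<integral>w. (Y hi w)\<^sup>2 \<partial>P) / \<eta>\<^sup>2"
    unfolding B3_def by (rule maximal_inequality(2)[OF Y Yb \<eta> Yc])
  qed
  have "(\<integral>w. (Y hi w)\<^sup>2 \<partial>P) <= dl\<^sup>2 * ((\<integral>w. (m hi w)\<^sup>2 \<partial>P) - (\<integral>w. (m (lo) w)\<^sup>2 \<partial>P))"
  proof -
   \<comment> \<open>Grid points are never below \<open>lo\<close>; forcing zero there provides the
     vanishing premise of \<open>tr_L2\<close> with \<open>s = lo\<close>.\<close>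
   define Z' where "Z' u w = (if u < lo then 0 else Z u w)" for u w
   have e: "Y = tr (gr N) (2^N) Z' m"
   proof -
    have "Z' (gr N j) w = Z (gr N j) w" for j w using gr_in[of N j] by (simp add: Z'_def)
    then show ?thesis by (simp add: Y_def tr_def fun_eq_iff)
   qed
   have Z'm: "Z' r \<in> bm (Fm r)" if "r \<in> {lo..hi}" for r
    using Zm[OF that] that by (simp add: Z'_def[abs_def])
   show ?thesis unfolding e
    by (rule tr_L2(2)[OF m(1,4) grid_gr Z'm]) (use Zb dl lohi in \<open>auto simp: Z'_def\<close>)
  qed
  also have "... <= dl\<^sup>2 * k\<^sup>2"
  proof (intro mult_left_mono)
   have "lo \<in> {lo..hi}" "hi \<in> {lo..hi}" using lohi by auto
   then show "(\<integral>w. (m hi w)\<^sup>2 \<partial>P) - (\<integral>w. (m lo w)\<^sup>2 \<partial>P) <= k\<^sup>2"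
    using mart_sq_le(1)[OF m(1,4), of hi] mart_sq_le(2)[OF m(1,4), of lo] by linarith
  qed simp
  finally have "measure P B3 <= dl\<^sup>2 * k\<^sup>2 / \<eta>\<^sup>2"
   using B3(2) \<eta> by (meson divide_right_mono order_trans zero_le_power2)
  then have B3k: "measure P B3 <= kp / 3" using dlk by linarith
  have meas: "measure P (B1 \<union> B2 \<union> B3) <= kp"
   using measure_Un_le[OF sets.Un[OF B1(3) m(6)] B3(1)] measure_Un_le[OF B1(3) m(6)] B1(4) m(7) B3k by linarith
  have main: "\<bar>tr (gr N) (2^N) H M t w - tr (gr N0) (2^N0) H M t w\<bar> <= \<eta>"
   if w: "w \<in> space P - (B1 \<union> B2 \<union> B3)" and t: "t \<in> {lo..hi}" for w t
  proof -
   have pp: "ppath R d (\<lambda>s. cf_ext lo hi H s w)" using B1(5) w by blast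
   have ext: "cf_ext lo hi H s w = H s w" if "s \<in> {lo..hi}" for s using that by (simp add: cf_ext_def cf_clamp_def)
   have "tr (gr N) (2^N) H M t w - tr (gr N0) (2^N0) H M t w
     = tr (gr N) (2^N) (\<lambda>r w. H r w - step_fun (gr N0) (2^N0) H r w) M t w"
    unfolding tr_step_fun_gr[OF N t, symmetric] by (rule tr_diff_Z)
   also have "... = Y t w"
    unfolding Y_def
   proof (rule tr_cong[where c="M lo w", OF _ _ grid_gr t])
    show "M s w = m s w + M lo w" if "s \<in> {lo..hi}" for s using m(8)[of w s] w that by auto
    fix i :: nat assume i: "i < 2^N"
    have mo: "mono (gr N0)" using grid_gr[of N0] by (simp add: grid_in_def)
    have lt: "gr N i < gr N0 (2^N0)"
    proof -
     have "real i * mesh N < real (2^N) * mesh N"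
      using i mesh_pos[of N] by (intro mult_strict_right_mono) (simp_all add: of_nat_less_iff del: of_nat_power)
     then show ?thesis using i lohi by (simp add: gr_mesh mesh_def min_absorb1)
    qed
    obtain l where l: "l < 2^N0" "gr N0 l <= gr N i" "gr N i < gr N0 (Suc l)" "step_fun (gr N0) (2^N0) H (gr N i) w = H (gr N0 l) w"
     using step_fun_val[OF mo _ lt, of H w] gr_in[of N i] by auto
    have "\<bar>gr N i - gr N0 l\<bar> <= d j" using l(2,3) gr_Suc_le[of N0 l] N0 by linarith
    then have "\<bar>cf_ext lo hi H (gr N i) w - cf_ext lo hi H (gr N0 l) w\<bar> <= 1 / real (Suc j)"
     using pp unfolding ppath_def by blast
    then have "\<bar>H (gr N i) w - step_fun (gr N0) (2^N0) H (gr N i) w\<bar> <= dl"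
     using l(4) j ext[OF gr_in] by simp
    then show "H (gr N i) w - step_fun (gr N0) (2^N0) H (gr N i) w = Z (gr N i) w"
     unfolding Z_def by (simp add: trc_id)
   qed
   finally show ?thesis using w t unfolding B3_def by (auto simp: not_less)
  qed
  show "\<exists>B\<in>sets P. measure P B <= kp \<and> (\<forall>w\<in>space P - B. \<forall>t\<in>{lo..hi}.
    \<bar>tr (gr N) (2^N) H M t w - tr (gr N0) (2^N0) H M t w\<bar> <= \<eta>)"
   by (rule bexI[of _ "B1 \<union> B2 \<union> B3"]) (use meas main B1(3) m(6) B3(1) in auto)
 qed
qed

lemma tr_meas:
 assumes H: "\<And>s. s \<in> {lo..hi} ==> H s \<in> bm (Fm s)"
  and M: "\<And>s. s \<in> {lo..hi} ==> M s \<in> bm (Fm s)" and u: "grid_in u" and t: "t \<in> {lo..hi}"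
 shows "tr u n H M t \<in> bm (Fm t)"
 unfolding tr_def
proof (intro borel_measurable_sum)
 fix j
 have uin: "u i \<in> {lo..hi}" for i using grid_inD[OF u] by auto
 show "(\<lambda>w. H (u j) w * (M (min (u (Suc j)) t) w - M (min (u j) t) w)) \<in> bm (Fm t)"
 proof (cases "t <= u j")
  case True
  then have "min (u (Suc j)) t = t" "min (u j) t = t" using grid_inD(3)[OF u, of j "Suc j"] by auto
  then show ?thesis by simp
 next
  case False
  have [measurable]: "H (u j) \<in> bm (Fm t)"
   by (rule meas_mono[OF H]) (use False uin[of j] t in auto)
  have [measurable]: "M (min (u i) t) \<in> bm (Fm t)" for i
   by (rule meas_mono[OF M]) (use uin[of i] t in auto)
  show ?thesis by measurable
 qed
qed

text \<open>A subsequence with summable errors, Borel-Cantelli and the Weierstrass test give uniform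
  convergence in time, hence continuous paths. The later lemmas use the integral only through this
  almost sure limit along \<open>n\<close>.\<close>

lemma stoch_integral_exists:
 assumes H: "\<And>s. s \<in> {lo..hi} ==> H s \<in> bm (Fm s)" and Hc: "cpaths H"
  and M: "lmart M"
 obtains I and n :: "nat => nat" where "\<And>j. j <= n j" "cpaths I"
  "\<And>w. w \<in> space P ==> I lo w = 0" "\<And>t. t \<in> {lo..hi} ==> I t \<in> bm (Fm t)"
  "AE w in P. \<forall>t\<in>{lo..hi}. (\<lambda>j. tr (gr (n j)) (2^(n j)) H M t w) \<longlonglongrightarrow> I t w"
proof -
 have Ma: "\<And>s. s \<in> {lo..hi} ==> M s \<in> bm (Fm s)" and Mc: "cpaths M"
  using M unfolding cf_cont_local_martingale_def adapted_iff by auto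
 define T where "T N t w = tr (gr N) (2^N) H M t w" for N t w
 have "\<exists>N0. \<forall>N\<ge>N0. \<exists>B\<in>sets P. measure P B <= (1/2)^j \<and> (\<forall>w\<in>space P - B. \<forall>t\<in>{lo..hi}. \<bar>T N t w - T N0 t w\<bar> <= (1/2)^j)" for j :: nat
 proof -
  have p: "(0::real) < (1/2)^j" by simp
  show ?thesis unfolding T_def using tr_small[OF H Hc M p p] by metis
 qed
 then obtain a where a: "\<And>j N. a j <= N ==> \<exists>B\<in>sets P. measure P B <= (1/2)^j \<and> (\<forall>w\<in>space P - B. \<forall>t\<in>{lo..hi}. \<bar>T N t w - T (a j) t w\<bar> <= (1/2)^j)"
  by metis
 \<comment> \<open>Both \<open>n j\<close> and \<open>n (Suc j)\<close> lie beyond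
   \<open>a j\<close>, so consecutive transforms are compared through the one at \<open>a j\<close>;
   the summand \<open>j\<close> makes \<open>n\<close> tend to infinity.\<close>
 define n where "n j = (\<Sum>i\<le>j. a i) + j" for j
 have nj: "j <= n j" "a j <= n j" "a j <= n (Suc j)" for j
 proof -
  show "j <= n j" by (simp add: n_def)
  have "a j <= (\<Sum>i\<le>j. a i)" by (rule member_le_sum) auto
  then show "a j <= n j" "a j <= n (Suc j)" by (auto simp: n_def)
 qed
 have "\<exists>B\<in>sets P. measure P B <= 2 * (1/2)^j \<and> (\<forall>w\<in>space P - B. \<forall>t\<in>{lo..hi}. \<bar>T (n (Suc j)) t w - T (n j) t w\<bar> <= 2 * (1/2)^j)" for j
 proof -
  obtain B where B: "B \<in> sets P" "measure P B <= (1/2)^j" "\<And>w t. w \<in> space P - B ==> t \<in> {lo..hi} ==> \<bar>T (n j) t w - T (a j) t w\<bar> <= (1/2)^j"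
   using a[OF nj(2)[of j]] by blast
  obtain B' where B': "B' \<in> sets P" "measure P B' <= (1/2)^j" "\<And>w t. w \<in> space P - B' ==> t \<in> {lo..hi} ==> \<bar>T (n (Suc j)) t w - T (a j) t w\<bar> <= (1/2)^j"
   using a[OF nj(3)[of j]] by blast
  show ?thesis
  proof (intro bexI[of _ "B \<union> B'"] conjI ballI)
   show "B \<union> B' \<in> sets P" using B B' by auto
   show "measure P (B \<union> B') <= 2 * (1/2)^j" using measure_Un_le[OF B(1) B'(1)] B(2) B'(2) by linarith
   fix w t assume "w \<in> space P - (B \<union> B')" "t \<in> {lo..hi}"
   then show "\<bar>T (n (Suc j)) t w - T (n j) t w\<bar> <= 2 * (1/2)^j"
    using B(3)[of w t] B'(3)[of w t] by force
  qed
 qed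
 then obtain B where B: "\<And>j. B j \<in> sets P" "\<And>j. measure P (B j) <= 2 * (1/2)^j"
  "\<And>j w t. w \<in> space P - B j ==> t \<in> {lo..hi} ==> \<bar>T (n (Suc j)) t w - T (n j) t w\<bar> <= 2 * (1/2)^j"
  by metis
 have summ: "summable (\<lambda>j. 2 * (1/2::real)^j)" by (intro summable_mult summable_geometric) auto
 have summB: "summable (\<lambda>j. measure P (B j))"
  by (rule summable_comparison_test'[OF summ, of 0]) (use B(2) in auto)
 have aeB: "AE w in P. \<forall>\<^sub>F j in sequentially. w \<in> space P - B j"
  by (rule borel_cantelli_AE1[OF B(1) _ summB]) (simp add: emeasure_eq_measure)
 define \<Omega> where "\<Omega> = {w\<in>space P. \<forall>\<^sub>F j in sequentially. w \<in> space P - B j}"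
 \<comment> \<open>The set of convergence depends on the whole path, but its complement is null and
   therefore known at time \<open>lo\<close>; setting the integral to zero off it keeps it
   adapted.\<close>
 have \<Omega>Fl: "\<Omega> \<in> sets (Fm t)" if t: "t \<in> {lo..hi}" for t
 proof -
  obtain N where N: "{w\<in>space P. \<not> (\<forall>\<^sub>F j in sequentially. w \<in> space P - B j)} \<subseteq> N" "N \<in> null_sets P"
   using aeB unfolding eventually_ae_filter by blast
  have lo: "lo \<in> {lo..hi}" using lohi by simp
  have "space P - \<Omega> \<in> sets (Fm lo)" unfolding sets_Fm[OF lo]
   by (rule null_in[OF N(2)]) (use N(1) in \<open>auto simp: \<Omega>_def\<close>)
  then have "space (Fm lo) - (space P - \<Omega>) \<in> sets (Fm lo)" by (rule sets.compl_sets)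
  moreover have "space (Fm lo) - (space P - \<Omega>) = \<Omega>" by (auto simp: \<Omega>_def)
  ultimately have "\<Omega> \<in> sets (Fm lo)" by simp
  then show ?thesis using Fm_subset[of lo t] t by auto
 qed
 define G where "G t w = T (n 0) t w + (\<Sum>j. T (n (Suc j)) t w - T (n j) t w)" for t w
 define I where "I t w = (if w \<in> \<Omega> then G t w else 0)" for t w
 have tele: "T (n 0) t w + (\<Sum>i<j. T (n (Suc i)) t w - T (n i) t w) = T (n j) t w" for j t w
  using sum_lessThan_telescope[of "\<lambda>j. T (n j) t w" j] by simp
 have ul: "uniform_limit {lo..hi} (\<lambda>j t. T (n j) t w) (\<lambda>t. G t w) sequentially" if w: "w \<in> \<Omega>" for w
 proof -
  have ev: "\<forall>\<^sub>F j in sequentially. \<forall>t\<in>{lo..hi}. norm (T (n (Suc j)) t w - T (n j) t w) <= 2 * (1/2)^j"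
  proof -
   have "\<forall>\<^sub>F j in sequentially. w \<in> space P - B j" using w unfolding \<Omega>_def by blast
   then show ?thesis by eventually_elim (use B(3) in auto)
  qed
  have "uniform_limit {lo..hi} (\<lambda>j t. \<Sum>i<j. T (n (Suc i)) t w - T (n i) t w) (\<lambda>t. \<Sum>j. T (n (Suc j)) t w - T (n j) t w) sequentially"
   by (rule Weierstrass_m_test_ev[OF ev summ])
  then have "uniform_limit {lo..hi} (\<lambda>j t. T (n 0) t w + (\<Sum>i<j. T (n (Suc i)) t w - T (n i) t w)) (\<lambda>t. T (n 0) t w + (\<Sum>j. T (n (Suc j)) t w - T (n j) t w)) sequentially"
   by (intro uniform_limit_add uniform_limit_const)
  then show ?thesis unfolding tele G_def .
 qed
 have pt: "(\<lambda>j. T (n j) t w) \<longlonglongrightarrow> I t w" if "w \<in> \<Omega>" "t \<in> {lo..hi}" for w t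
  using tendsto_uniform_limitI[OF ul[OF that(1)] that(2)] that(1) by (simp add: I_def)
 have Tm: "T N t \<in> bm (Fm t)" if t: "t \<in> {lo..hi}" for N t
  unfolding T_def[abs_def] by (rule tr_meas[OF H Ma grid_gr t])
 show ?thesis
 proof (rule that[of n I])
  show "j <= n j" for j by (rule nj)
  show "cpaths I"
   unfolding cf_cont_paths_def
  proof
   fix w assume w: "w \<in> space P"
   show "continuous_on {lo..hi} (\<lambda>t. I t w)"
   proof (cases "w \<in> \<Omega>")
    case True
    have "continuous_on {lo..hi} (\<lambda>t. T (n j) t w)" for j
     using tr_cont[OF Mc grid_gr] w unfolding cf_cont_paths_def T_def by blast
    then have "continuous_on {lo..hi} (\<lambda>t. G t w)"
     by (intro uniform_limit_theorem[OF _ ul[OF True]]) auto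
    then show ?thesis using True by (simp add: I_def)
   qed (simp add: I_def)
  qed
  show "I lo w = 0" if "w \<in> space P" for w
  proof (cases "w \<in> \<Omega>")
   case True
   have "min (gr N j) lo = lo" for N j using gr_in[of N j] by auto
   then have "T N lo w = 0" for N by (simp add: T_def tr_def)
   moreover have "(\<lambda>j. T (n j) lo w) \<longlonglongrightarrow> I lo w" by (rule pt[OF True]) (use lohi in simp)
   ultimately show ?thesis by (simp add: LIMSEQ_const_iff)
  qed (simp add: I_def)
  show "I t \<in> bm (Fm t)" if t: "t \<in> {lo..hi}" for t
  proof (rule borel_measurable_LIMSEQ_real)
   show "(\<lambda>w. indicator \<Omega> w * T (n j) t w) \<in> bm (Fm t)" for j
    using \<Omega>Fl[OF t] Tm[OF t] by simp
   show "(\<lambda>j. indicator \<Omega> w * T (n j) t w) \<longlonglongrightarrow> I t w" for w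
    using pt[OF _ t, of w] by (cases "w \<in> \<Omega>") (auto simp: I_def)
  qed
  show "AE w in P. \<forall>t\<in>{lo..hi}. (\<lambda>j. tr (gr (n j)) (2^(n j)) H M t w) \<longlonglongrightarrow> I t w"
   using aeB AE_space
  proof eventually_elim
   case (elim w)
   then have "w \<in> \<Omega>" unfolding \<Omega>_def by blast
   then show ?case using pt unfolding T_def by blast
  qed
 qed
qed


text \<open>The increment up to the stopping time is the limit of transforms of the indicator of
  times before \<open>\<sigma>\<close>.\<close>

lemma stopped_meas:
 assumes Z: "\<And>s. s \<in> {lo..hi} ==> Z s \<in> bm (Fm s)" and Zc: "cpaths Z"
  and st: "cf_stopping_time P lo hi Fl \<sigma>" and t: "t \<in> {lo..hi}"
 shows "(\<lambda>w. Z (min t (\<sigma> w)) w) \<in> bm (Fm t)"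
proof -
 have lo: "lo \<in> {lo..hi}" using lohi by simp
 have Zlo: "Z lo \<in> bm (Fm t)" by (rule meas_mono[OF Z[OF lo]]) (use t in auto)
 have \<sigma>: "\<sigma> w \<in> {lo..hi}" if "w \<in> space P" for w using st that by (auto simp: cf_stopping_time_def)
 have "(\<lambda>w. Z (min t (\<sigma> w)) w - Z lo w) \<in> bm (Fm t)"
 proof (rule borel_measurable_LIMSEQ_real)
  show "tr (gr N) (2^N) (\<lambda>u w. of_bool (u < \<sigma> w)) Z t \<in> bm (Fm t)" for N
   by (rule tr_meas[OF stop_meas[OF st] Z grid_gr t])
  fix w assume "w \<in> space (Fm t)"
  then have w: "w \<in> space P" by simp
  have "continuous_on {lo..hi} (\<lambda>t. Z t w)" using Zc w unfolding cf_cont_paths_def by auto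
  from tel_lim[OF this \<sigma>[OF w] t]
  show "(\<lambda>N. tr (gr N) (2^N) (\<lambda>u w. of_bool (u < \<sigma> w)) Z t w) \<longlonglongrightarrow> Z (min t (\<sigma> w)) w - Z lo w"
   by (simp add: tr_def min.commute)
 qed
 from borel_measurable_add[OF this Zlo] show ?thesis by simp
qed

text \<open>A bound in mean square gives uniform integrability: cutting off at \<open>R\<close>
  changes \<open>y\<close> by at most \<open>y\<^sup>2 / R\<close>.\<close>

lemma L2_bounded_limit:
 fixes Y :: "nat => 'a => real" and L :: "'a => real"
 assumes Y: "\<And>j. Y j \<in> bm P" "\<And>j. integrable P (\<lambda>w. (Y j w)\<^sup>2)" "\<And>j. (\<integral>w. (Y j w)\<^sup>2 \<partial>P) <= C"
  and L: "L \<in> bm P" "\<And>w. w \<in> space P ==> \<bar>L w\<bar> <= k"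
  and lim: "AE w in P. (\<lambda>j. Y j w) \<longlonglongrightarrow> L w" and A: "A \<in> sets P"
 shows "(\<lambda>j. \<integral>w. indicator A w * Y j w \<partial>P) \<longlonglongrightarrow> (\<integral>w. indicator A w * L w \<partial>P)"
proof (rule LIMSEQ_I)
 note [measurable] = Y(1) L(1) A
 fix e :: real assume e: "0 < e"
 have "0 <= (\<integral>w. (Y 0 w)\<^sup>2 \<partial>P)" by simp
 then have C0: "0 <= C" using Y(3)[of 0] by (rule order_trans)
 \<comment> \<open>Above \<open>k\<close>, so the limit is not cut off, and so large that the cutoff
   error \<open>C / R\<close> is below \<open>e / 2\<close>.\<close>
 define R where "R = max (max k 1) (2 * C / e + 1)"
 have R: "k <= R" "1 <= R" "C / R < e / 2"
 proof -
  show "k <= R" "1 <= R" by (auto simp: R_def)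
  have "2 * C / e < R" by (simp add: R_def)
  then have "2 * C < R * e" using e by (simp add: field_simps)
  then show "C / R < e / 2" using \<open>1 <= R\<close> by (simp add: field_simps)
 qed
 have l1: "(\<lambda>j. \<integral>w. indicator A w * trc R (Y j w) \<partial>P) \<longlonglongrightarrow> (\<integral>w. indicator A w * L w \<partial>P)"
 proof (rule integral_dominated_convergence[where w="\<lambda>_. R"])
  show "AE w in P. (\<lambda>j. indicator A w * trc R (Y j w)) \<longlonglongrightarrow> indicator A w * L w"
   using lim AE_space
  proof eventually_elim
   case (elim w)
   have "(\<lambda>j. trc R (Y j w)) \<longlonglongrightarrow> trc R (L w)" unfolding trc_def by (intro tendsto_intros elim)
   moreover have "trc R (L w) = L w" by (rule trc_id) (use L(2)[of w] elim R in auto)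
   ultimately show ?case by (intro tendsto_intros) simp
  qed
  show "AE w in P. norm (indicator A w * trc R (Y j w)) <= R" for j
   using trc_bound[of R] R by (auto simp: indicator_def)
 qed auto
 have "\<exists>no. \<forall>j\<ge>no. norm ((\<integral>w. indicator A w * trc R (Y j w) \<partial>P) - (\<integral>w. indicator A w * L w \<partial>P)) < e / 2"
  using LIMSEQ_D[OF l1, of "e/2"] e by auto
 then obtain no where no: "\<And>j. no <= j ==> \<bar>(\<integral>w. indicator A w * trc R (Y j w) \<partial>P) - (\<integral>w. indicator A w * L w \<partial>P)\<bar> < e / 2" by auto
 have d: "\<bar>(\<integral>w. indicator A w * Y j w \<partial>P) - (\<integral>w. indicator A w * trc R (Y j w) \<partial>P)\<bar> <= C / R" for j
 proof -
  have Yi: "integrable P (Y j)"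
  proof (rule Bochner_Integration.integrable_bound)
   show "integrable P (\<lambda>w. 1 + (Y j w)\<^sup>2)" using Y(2) by simp
   have "\<bar>y\<bar> <= 1 + y\<^sup>2" for y :: real
   proof -
    have "0 <= (\<bar>y\<bar> - 1)\<^sup>2" by simp
    then have "2 * \<bar>y\<bar> <= 1 + y\<^sup>2" by (simp add: power2_eq_square algebra_simps abs_mult_self_eq)
    then show ?thesis by linarith
   qed
   then show "AE w in P. norm (Y j w) <= norm (1 + (Y j w)\<^sup>2)" by (intro AE_I2) (simp add: abs_of_nonneg)
  qed (use Y in auto)
  have i1: "integrable P (\<lambda>w. indicator A w * Y j w)"
   by (rule integrable_bdd_mult[OF Yi, where C=1]) (auto simp: indicator_def)
  have i2: "integrable P (\<lambda>w. indicator A w * trc R (Y j w))"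
   by (rule integrable_bdd[where C=R]) (use trc_bound[of R] R in \<open>auto simp: indicator_def\<close>)
  have "\<bar>(\<integral>w. indicator A w * Y j w \<partial>P) - (\<integral>w. indicator A w * trc R (Y j w) \<partial>P)\<bar>
    = \<bar>\<integral>w. indicator A w * Y j w - indicator A w * trc R (Y j w) \<partial>P\<bar>" using i1 i2 by simp
  also have "... <= (\<integral>w. (Y j w)\<^sup>2 / R \<partial>P)"
  proof (rule order_trans[OF integral_abs_bound integral_mono])
   show "integrable P (\<lambda>w. \<bar>indicator A w * Y j w - indicator A w * trc R (Y j w)\<bar>)" using i1 i2 by simp
   show "integrable P (\<lambda>w. (Y j w)\<^sup>2 / R)" using Y(2) by simp
   fix w
   have "\<bar>y - trc R y\<bar> <= y\<^sup>2 / R" for y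
   proof (cases "\<bar>y\<bar> <= R")
    case True
    then show ?thesis using R by (simp add: trc_id)
   next
    case False
    have "\<bar>y - trc R y\<bar> <= \<bar>y\<bar>" using R by (auto simp: trc_def)
    also have "\<bar>y\<bar> * R <= \<bar>y\<bar> * \<bar>y\<bar>" using False by (intro mult_left_mono) auto
    then have "\<bar>y\<bar> <= y\<^sup>2 / R" using R by (simp add: field_simps power2_eq_square)
    finally show ?thesis .
   qed
   moreover have "\<bar>indicator A w * Y j w - indicator A w * trc R (Y j w)\<bar> <= \<bar>Y j w - trc R (Y j w)\<bar>"
    by (auto simp: indicator_def)
   ultimately show "\<bar>indicator A w * Y j w - indicator A w * trc R (Y j w)\<bar> <= (Y j w)\<^sup>2 / R" by (meson order_trans)
  qed
  also have "... <= C / R" using Y(3)[of j] R by (simp add: divide_right_mono)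
  finally show ?thesis .
 qed
 show "\<exists>no. \<forall>j\<ge>no. norm ((\<integral>w. indicator A w * Y j w \<partial>P) - (\<integral>w. indicator A w * L w \<partial>P)) < e"
 proof (intro exI[of _ no] allI impI)
  fix j assume "no <= j"
  from no[OF this] d[of j] R(3)
  show "norm ((\<integral>w. indicator A w * Y j w \<partial>P) - (\<integral>w. indicator A w * L w \<partial>P)) < e"
   unfolding real_norm_def by linarith
 qed
qed

text \<open>Stopping acts on integrand and integrator alike, and cells beginning after
  \<open>r\<close> drop out; the constant \<open>c w\<close> cancels in every increment.\<close>

lemma tr_stopped:
 assumes u: "grid_in u"
 shows "tr u n H M (min t r) w = tr u n (\<lambda>u w. H u w * of_bool (u < r)) (\<lambda>t w. M (min t r) w - c w) t w"
 unfolding tr_def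
proof (intro sum.cong refl)
 fix j assume "j \<in> {..<n}"
 show "H (u j) w * (M (min (u (Suc j)) (min t r)) w - M (min (u j) (min t r)) w)
   = H (u j) w * of_bool (u j < r) * (M (min (min (u (Suc j)) t) r) w - c w - (M (min (min (u j) t) r) w - c w))"
 proof (cases "u j < r")
  case False
  then have "min (u (Suc j)) (min t r) = min t r" "min (u j) (min t r) = min t r"
   using grid_inD(3)[OF u, of j "Suc j"] by auto
  then show ?thesis using False by simp
 qed (simp add: min.assoc)
qed

text \<open>Localization is applied to the maximum of \<open>H\<close> and \<open>I\<close>. Up to
  \<open>\<rho> p\<close> the transforms are martingales bounded in mean square, with a bound free
  of the grid, and their limit is bounded by \<open>p\<close>, so the martingale identity passes to
  the limit.\<close>

lemma stoch_integral_local_mart: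
 assumes H: "\<And>s. s \<in> {lo..hi} ==> H s \<in> bm (Fm s)" and Hc: "cpaths H"
  and M: "lmart M"
  and Ic: "cpaths I" and I0: "\<And>w. w \<in> space P ==> I lo w = 0"
  and Ia: "\<And>t. t \<in> {lo..hi} ==> I t \<in> bm (Fm t)"
  and lim: "AE w in P. \<forall>t\<in>{lo..hi}. (\<lambda>j. tr (gr (n j)) (2^(n j)) H M t w) \<longlonglongrightarrow> I t w"
  and C: "C \<in> bm (Fm lo)"
 shows "lmart (\<lambda>t w. C w + I t w)"
proof -
 have lo: "lo \<in> {lo..hi}" using lohi by simp
 define X where "X t w = max \<bar>H t w\<bar> \<bar>I t w\<bar>" for t w
 have Xa: "X s \<in> bm (Fm s)" if "s \<in> {lo..hi}" for s
  unfolding X_def[abs_def] using H[OF that] Ia[OF that] by simp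
 have Xc: "cpaths X"
  using Hc Ic unfolding cf_cont_paths_def X_def by (auto intro!: continuous_intros)
 have "\<exists>\<rho> :: nat => 'a => real. (\<forall>n. cf_stopping_time P lo hi Fl (\<rho> n)) \<and>
  (\<forall>n. \<forall>w\<in>space P. \<rho> n w <= \<rho> (Suc n) w) \<and> (AE w in P. \<exists>n. \<rho> n w = hi) \<and>
  (\<forall>n. mart (\<lambda>t w. M (min t (\<rho> n w)) w - M lo w)) \<and>
  (\<forall>n. \<forall>w\<in>space P. \<forall>t\<in>{lo..hi}. \<bar>M (min t (\<rho> n w)) w - M lo w\<bar> <= real n) \<and>
  (\<forall>n. \<forall>w\<in>space P. \<forall>u\<in>{lo..hi}. u < \<rho> n w \<longrightarrow> \<bar>X u w\<bar> <= real n)"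
 proof (rule localization[OF M Xa Xc])
  fix \<rho> :: "nat => 'a => real"
  assume "\<And>n. cf_stopping_time P lo hi Fl (\<rho> n)"
  "\<And>n w. w \<in> space P ==> \<rho> n w <= \<rho> (Suc n) w"
  "AE w in P. \<exists>n. \<rho> n w = hi"
  "\<And>n. mart (\<lambda>t w. M (min t (\<rho> n w)) w - M lo w)"
  "\<And>n w t. w \<in> space P ==> t \<in> {lo..hi} ==> \<bar>M (min t (\<rho> n w)) w - M lo w\<bar> <= real n"
  "\<And>n w u. w \<in> space P ==> u \<in> {lo..hi} ==> u < \<rho> n w ==> \<bar>X u w\<bar> <= real n"
  then show ?thesis by (intro exI[of _ \<rho>]) blast
 qed
 then obtain \<rho> :: "nat => 'a => real" where \<rho>: "\<And>n. cf_stopping_time P lo hi Fl (\<rho> n)"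
  "\<And>n w. w \<in> space P ==> \<rho> n w <= \<rho> (Suc n) w"
  "AE w in P. \<exists>n. \<rho> n w = hi"
  "\<And>n. mart (\<lambda>t w. M (min t (\<rho> n w)) w - M lo w)"
  "\<And>n w t. w \<in> space P ==> t \<in> {lo..hi} ==> \<bar>M (min t (\<rho> n w)) w - M lo w\<bar> <= real n"
  "\<And>n w u. w \<in> space P ==> u \<in> {lo..hi} ==> u < \<rho> n w ==> \<bar>X u w\<bar> <= real n"
  by blast
 have \<rho>in: "\<rho> n w \<in> {lo..hi}" if "w \<in> space P" for n w using \<rho>(1)[of n] that unfolding cf_stopping_time_def by blast
 have Imart: "mart (\<lambda>t w. I (min t (\<rho> p w)) w)" for p
 proof -
  define m where "m t w = M (min t (\<rho> p w)) w - M lo w" for t w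
  have m: "mart m" "\<And>t w. w \<in> space P ==> t \<in> {lo..hi} ==> \<bar>m t w\<bar> <= real p"
   unfolding m_def[abs_def] by (rule \<rho>(4), rule \<rho>(5))
  define Z where "Z u w = H u w * of_bool (u < \<rho> p w)" for u w
  have Za: "Z u \<in> bm (Fm u)" if u: "u \<in> {lo..hi}" for u
   unfolding Z_def[abs_def] using H[OF u] stop_meas[OF \<rho>(1) u, of p] by (intro borel_measurable_times)
  have Zb: "\<bar>Z u w\<bar> <= real p" if "w \<in> space P" "u \<in> {lo..hi}" for u w
   using \<rho>(6)[OF that, of p] by (cases "u < \<rho> p w") (auto simp: Z_def X_def)
  define S where "S j = tr (gr (n j)) (2^(n j)) Z m" for j
  have Sm: "mart (S j)" for j unfolding S_def by (rule mart_tr[OF m(1) grid_gr Za Zb])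
  have Seq: "S j t w = tr (gr (n j)) (2^(n j)) H M (min t (\<rho> p w)) w" for j t w
   unfolding S_def tr_stopped[OF grid_gr, where c="M lo"] by (simp add: tr_def Z_def m_def)
  define L where "L t w = I (min t (\<rho> p w)) w" for t w
  have La: "L t \<in> bm (Fm t)" if "t \<in> {lo..hi}" for t
   unfolding L_def[abs_def] by (rule stopped_meas[OF Ia Ic \<rho>(1) that])
  \<comment> \<open>The bound holds strictly before the stopping time and extends to it by
    continuity; if the stopping time is \<open>lo\<close>, the integral is zero there.\<close>
  have Lb: "\<bar>L t w\<bar> <= real p" if w: "w \<in> space P" and t: "t \<in> {lo..hi}" for t w
  proof (cases "lo < min t (\<rho> p w)")
   case True
   let ?q = "min t (\<rho> p w)"
   have q: "?q \<in> {lo..hi}" using t \<rho>in[OF w, of p] by auto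
   have clq: "closure {lo..<?q} = {lo..?q}" using True by simp
   have cI: "continuous_on {lo..hi} (\<lambda>t. \<bar>I t w\<bar>)" using Ic w unfolding cf_cont_paths_def by (auto intro: continuous_on_rabs)
   have "\<bar>I ?q w\<bar> <= real p"
   proof (rule continuous_le_on_closure[of "{lo..<?q}" "\<lambda>t. \<bar>I t w\<bar>"])
    show "continuous_on (closure {lo..<?q}) (\<lambda>t. \<bar>I t w\<bar>)" unfolding clq
     by (rule continuous_on_subset[OF cI]) (use q in auto)
    show "?q \<in> closure {lo..<?q}" unfolding clq using True by simp
    show "\<bar>I r w\<bar> <= real p" if "r \<in> {lo..<?q}" for r
     using \<rho>(6)[OF w, of r p] that q by (auto simp: X_def)
   qed
   then show ?thesis by (simp add: L_def)
  next
   case False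
   then have "min t (\<rho> p w) = lo" using t \<rho>in[OF w, of p] by auto
   then show ?thesis using I0[OF w] by (simp add: L_def)
  qed
  have limS: "AE w in P. (\<lambda>j. S j t w) \<longlonglongrightarrow> L t w" if t: "t \<in> {lo..hi}" for t
   using lim AE_space
  proof eventually_elim
   case (elim w)
   have "min t (\<rho> p w) \<in> {lo..hi}" using t \<rho>in[of w p] elim by auto
   then show ?case using elim unfolding Seq L_def by blast
  qed
  have conv: "(\<lambda>j. \<integral>w. indicator A w * S j t w \<partial>P) \<longlonglongrightarrow> (\<integral>w. indicator A w * L t w \<partial>P)"
   if t: "t \<in> {lo..hi}" and A: "A \<in> sets P" for t A
  proof (rule L2_bounded_limit[where k="real p" and C="(real p)\<^sup>2 * (real p)\<^sup>2"])
   define Z' where "Z' u w = (if u < lo then 0 else Z u w)" for u w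
   have e: "S j = tr (gr (n j)) (2^(n j)) Z' m" for j
   proof -
    have "Z' (gr N j) w = Z (gr N j) w" for N j w using gr_in[of N j] by (simp add: Z'_def)
    then show ?thesis by (simp add: S_def tr_def fun_eq_iff)
   qed
   have Z'a: "Z' u \<in> bm (Fm u)" if "u \<in> {lo..hi}" for u
    using Za[OF that] that by (simp add: Z'_def[abs_def])
   have Z'b: "\<bar>Z' u w\<bar> <= real p" if "w \<in> space P" "u \<in> {lo..hi}" for u w
    using Zb[OF that] that by (simp add: Z'_def)
   have Z'0: "Z' u w = 0" if "u < lo" for u w using that by (simp add: Z'_def)
   have lt: "lo <= lo" "lo <= t" "t <= hi" using t by auto
   note tl = tr_L2[OF m grid_gr Z'a Z'b Z'0 lt]
   show "S j t \<in> bm P" for j by (rule martD(3)[OF Sm t])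
   show "integrable P (\<lambda>w. (S j t w)\<^sup>2)" for j unfolding e by (rule tl(1))
   have "(\<integral>w. (m t w)\<^sup>2 \<partial>P) - (\<integral>w. (m lo w)\<^sup>2 \<partial>P) <= (real p)\<^sup>2"
    using mart_sq_le(1)[OF m t] mart_sq_le(2)[OF m lo] by linarith
   then have b: "(real p)\<^sup>2 * ((\<integral>w. (m t w)\<^sup>2 \<partial>P) - (\<integral>w. (m lo w)\<^sup>2 \<partial>P)) <= (real p)\<^sup>2 * (real p)\<^sup>2"
    by (intro mult_left_mono) auto
   show "(\<integral>w. (S j t w)\<^sup>2 \<partial>P) <= (real p)\<^sup>2 * (real p)\<^sup>2" for j
    unfolding e by (rule order_trans[OF tl(2) b])
   show "L t \<in> bm P" by (rule meas_P[OF La[OF t] t])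
   show "\<bar>L t w\<bar> <= real p" if "w \<in> space P" for w by (rule Lb[OF that t])
  qed (use limS[OF t] A in auto)
  have Li: "integrable P (L t)" if t: "t \<in> {lo..hi}" for t
   by (rule integrable_bdd[OF meas_P[OF La[OF t] t] Lb[OF _ t]])
  have "mart L"
  proof (rule martI[OF La Li])
   fix s t A assume *: "lo <= s" "s <= t" "t <= hi" "A \<in> sets (Fm s)"
   have in': "s \<in> {lo..hi}" "t \<in> {lo..hi}" using * by auto
   have AP: "A \<in> sets P" using * Fm_P[OF in'(1)] by auto
   have ii: "integrable P (\<lambda>w. indicator A w * f w)" if "integrable P f" for f :: "'a => real"
    by (rule integrable_bdd_mult[OF that, where C=1]) (use AP in \<open>auto simp: indicator_def\<close>)
   have "(\<integral>w. indicator A w * S j t w \<partial>P) = (\<integral>w. indicator A w * S j s w \<partial>P)" for j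
   proof -
    have "(\<integral>w. indicator A w * (S j t w - S j s w) \<partial>P) = 0"
     by (rule mart_mult[OF Sm *(1-3), where C=1]) (use *(4) in \<open>auto simp: indicator_def\<close>)
    then show ?thesis using ii[OF martD(2)[OF Sm in'(1)]] ii[OF martD(2)[OF Sm in'(2)]] by (simp add: right_diff_distrib)
   qed
   then have "(\<integral>w. indicator A w * L t w \<partial>P) = (\<integral>w. indicator A w * L s w \<partial>P)"
    using LIMSEQ_unique[OF conv[OF in'(2) AP]] conv[OF in'(1) AP] by simp
   then show "(\<integral>w. indicator A w * (L t w - L s w) \<partial>P) = 0"
    using ii[OF Li[OF in'(1)]] ii[OF Li[OF in'(2)]] by (simp add: right_diff_distrib)
  qed auto
  then show ?thesis by (simp add: L_def[abs_def])
 qed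
 show ?thesis
  unfolding cf_cont_local_martingale_def
 proof (intro conjI exI[of _ \<rho>] allI ballI)
  show "cf_adapted P lo hi Fl (\<lambda>t w. C w + I t w)"
   unfolding adapted_iff
  proof
   fix t assume t: "t \<in> {lo..hi}"
   have "C \<in> bm (Fm t)" by (rule meas_mono[OF C]) (use t in auto)
   then show "(\<lambda>w. C w + I t w) \<in> bm (Fm t)" using Ia[OF t] by simp
  qed
  show "cpaths (\<lambda>t w. C w + I t w)"
   using Ic unfolding cf_cont_paths_def by (auto intro!: continuous_intros)
  fix p
  show "mart (\<lambda>t w. C w + I (min t (\<rho> p w)) w - (C w + I lo w))"
  proof (rule martI)
   fix t assume t: "t \<in> {lo..hi}"
   have e: "C w + I (min t (\<rho> p w)) w - (C w + I lo w) = I (min t (\<rho> p w)) w" if "w \<in> space P" for w t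
    using I0[OF that] by simp
   show "(\<lambda>w. C w + I (min t (\<rho> p w)) w - (C w + I lo w)) \<in> bm (Fm t)"
    by (rule measurable_cong[THEN iffD1, rotated, OF martD(1)[OF Imart t]]) (use e in simp)
   show "integrable P (\<lambda>w. C w + I (min t (\<rho> p w)) w - (C w + I lo w))"
    by (rule Bochner_Integration.integrable_cong[OF refl e, THEN iffD2]) (use martD(2)[OF Imart t] in auto)
  next
   fix s t A assume *: "lo <= s" "s <= t" "t <= hi" "A \<in> sets (Fm s)"
   have "(\<integral>w. indicator A w * (I (min t (\<rho> p w)) w - I (min s (\<rho> p w)) w) \<partial>P) = 0"
    by (rule mart_mult[OF Imart *(1-3), where C=1]) (use *(4) in \<open>auto simp: indicator_def\<close>)
   then show "(\<integral>w. indicator A w * (C w + I (min t (\<rho> p w)) w - (C w + I lo w) - (C w + I (min s (\<rho> p w)) w - (C w + I lo w))) \<partial>P) = 0"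
    by simp
  qed
 qed (use \<rho> in auto)
qed

text \<open>Convergence is not presupposed: the bad event is where the lower limit of the squares
  reaches \<open>l\<^sup>2\<close>, and off it any limit that exists is bounded by
  \<open>l\<close>.\<close>

lemma fatou_markov:
 fixes Y :: "nat => 'a => real" and l :: real
 assumes Y: "\<And>j. Y j \<in> bm P" "\<And>j. integrable P (\<lambda>w. (Y j w)\<^sup>2)" "\<And>j. (\<integral>w. (Y j w)\<^sup>2 \<partial>P) <= C"
  and l: "0 < l"
 shows "\<exists>B\<in>sets P. measure P B <= C / l\<^sup>2 \<and> (\<forall>w\<in>space P - B. \<forall>y. (\<lambda>j. Y j w) \<longlonglongrightarrow> y \<longrightarrow> \<bar>y\<bar> <= l)"
proof -
 have "0 <= (\<integral>w. (Y 0 w)\<^sup>2 \<partial>P)" by simp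
 then have C0: "0 <= C" using Y(3)[of 0] by (rule order_trans)
 note [measurable] = Y(1)
 define g where "g w = liminf (\<lambda>j. ennreal ((Y j w)\<^sup>2))" for w
 have gm[measurable]: "g \<in> bm P" unfolding g_def[abs_def] by measurable
 have "(\<integral>\<^sup>+w. g w \<partial>P) <= liminf (\<lambda>j. \<integral>\<^sup>+w. ennreal ((Y j w)\<^sup>2) \<partial>P)"
  unfolding g_def by (rule nn_integral_liminf) measurable
 also have "... <= liminf (\<lambda>j. ennreal C)"
 proof (rule Liminf_mono[OF always_eventually], rule allI)
  fix j
  have "(\<integral>\<^sup>+w. ennreal ((Y j w)\<^sup>2) \<partial>P) = ennreal (\<integral>w. (Y j w)\<^sup>2 \<partial>P)"
   by (rule nn_integral_eq_integral[OF Y(2)]) auto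
  then show "(\<integral>\<^sup>+w. ennreal ((Y j w)\<^sup>2) \<partial>P) <= ennreal C" using Y(3)[of j] by (simp add: ennreal_leI)
 qed
 also have "... = ennreal C" by (simp add: Liminf_const)
 finally have gC: "(\<integral>\<^sup>+w. g w \<partial>P) <= ennreal C" .
 define c where "c = ennreal (1 / l\<^sup>2)"
 define B where "B = {w\<in>space P. 1 <= c * g w}"
 have B[measurable]: "B \<in> sets P" unfolding B_def by measurable
 have "emeasure P B <= c * (\<integral>\<^sup>+w. g w * indicator (space P) w \<partial>P)"
  unfolding B_def by (rule nn_integral_Markov_inequality) auto
 also have "(\<integral>\<^sup>+w. g w * indicator (space P) w \<partial>P) = (\<integral>\<^sup>+w. g w \<partial>P)"
  by (rule nn_integral_cong) simp
 also have "c * (\<integral>\<^sup>+w. g w \<partial>P) <= c * ennreal C" by (rule mult_left_mono[OF gC]) simp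
 also have "... = ennreal (C / l\<^sup>2)" using C0 by (simp add: c_def ennreal_mult[symmetric])
 finally have "measure P B <= C / l\<^sup>2" using C0 by (simp add: emeasure_eq_measure)
 moreover have "\<bar>y\<bar> <= l" if w: "w \<in> space P - B" and y: "(\<lambda>j. Y j w) \<longlonglongrightarrow> y" for w y
 proof -
  have "(\<lambda>j. ennreal ((Y j w)\<^sup>2)) \<longlonglongrightarrow> ennreal (y\<^sup>2)" by (intro tendsto_intros y)
  then have "g w = ennreal (y\<^sup>2)" unfolding g_def by (intro lim_imp_Liminf) auto
  then have "c * g w = ennreal (y\<^sup>2 / l\<^sup>2)" by (simp add: c_def ennreal_mult[symmetric])
  moreover have "\<not> 1 <= c * g w" using w by (simp add: B_def)
  ultimately have "y\<^sup>2 / l\<^sup>2 < 1" by (simp add: not_le)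
  then have "y\<^sup>2 < l\<^sup>2" using l by (simp add: field_simps)
  then show ?thesis using l abs_le_square_iff[of y l] by simp
 qed
 ultimately show ?thesis using B by blast
qed


lemma pointwise_imp_prob:
 fixes f :: "nat => 'a => real"
 assumes [measurable]: "\<And>n. f n \<in> bm P" and lim: "\<And>w. w \<in> space P ==> (\<lambda>n. f n w) \<longlonglongrightarrow> 0" and c: "0 < c"
 shows "(\<lambda>n. measure P {w\<in>space P. c < \<bar>f n w\<bar>}) \<longlonglongrightarrow> 0"
proof -
 have "(\<lambda>n. \<integral>w. indicator {w\<in>space P. c < \<bar>f n w\<bar>} w \<partial>P) \<longlonglongrightarrow> (\<integral>w. (0::real) \<partial>P)"
 proof (rule integral_dominated_convergence[where w="\<lambda>_. 1"])
  show "AE w in P. (\<lambda>n. indicator {w\<in>space P. c < \<bar>f n w\<bar>} w :: real) \<longlonglongrightarrow> 0"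
  proof (rule AE_I2)
   fix w assume "w \<in> space P"
   have "(\<lambda>n. \<bar>f n w\<bar>) \<longlonglongrightarrow> \<bar>0\<bar>" by (intro tendsto_rabs lim \<open>w \<in> space P\<close>)
   then have "\<forall>\<^sub>F n in sequentially. \<bar>f n w\<bar> < c" using order_tendstoD(2)[of _ "\<bar>0\<bar>" _ c] c by auto
   then show "(\<lambda>n. indicator {w\<in>space P. c < \<bar>f n w\<bar>} w :: real) \<longlonglongrightarrow> 0"
    by (intro tendsto_eventually) (auto elim!: eventually_mono)
  qed
 qed (auto simp: indicator_def)
 moreover have "(\<integral>w. indicator {w\<in>space P. c < \<bar>f n w\<bar>} w \<partial>P) = measure P {w\<in>space P. c < \<bar>f n w\<bar>}" for n
 proof -
  have "{w\<in>space P. c < \<bar>f n w\<bar>} \<inter> space P = {w\<in>space P. c < \<bar>f n w\<bar>}" by auto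
  then show ?thesis by simp
 qed
 ultimately show ?thesis by simp
qed

text \<open>A uniform Riemann sum is the exact integral of a step function, so its distance to
  \<open>I\<close> is the limit of dyadic transforms of step function minus \<open>H\<close>. This
  integrand is small on the good event. The budget is split evenly between the modulus of
  \<open>H\<close>, the bounded version of M and the Markov estimate.\<close>

lemma riemann_conv:
 assumes H: "\<And>s. s \<in> {lo..hi} ==> H s \<in> bm (Fm s)" and Hc: "cpaths H"
  and M: "lmart M" and nj: "\<And>j. j <= (n j :: nat)"
  and lim: "AE w in P. \<forall>t\<in>{lo..hi}. (\<lambda>j. tr (gr (n j)) (2^(n j)) H M t w) \<longlonglongrightarrow> I t w"
  and t: "t \<in> {lo..hi}" and l: "0 < l" and kp: "0 < kp"
 shows "\<exists>n0. \<forall>p\<ge>n0. \<exists>B\<in>sets P. measure P B <= kp \<and> (\<forall>w\<in>space P - B.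
  \<bar>(\<Sum>k<p. H (lo + real k * (t - lo) / real p) w * (M (lo + real (Suc k) * (t - lo) / real p) w - M (lo + real k * (t - lo) / real p) w)) - I t w\<bar> <= l)"
proof -
 have HP: "H t \<in> bm P" if "t \<in> {lo..hi}" for t by (rule meas_P[OF H[OF that] that])
 have Mc: "cpaths M" using M unfolding cf_cont_local_martingale_def by auto
 have k3: "0 < kp / 3" using kp by simp
 obtain R d B1 where B1: "\<And>j. 0 < d j" "0 < R" "B1 \<in> sets P" "measure P B1 <= kp / 3"
  "\<And>w. w \<in> space P - B1 ==> ppath R d (\<lambda>s. cf_ext lo hi H s w)"
  using ppath_tight[OF HP Hc k3] by blast
 obtain m k B2 where m: "mart m" "cpaths m" "0 <= (k::real)"
  "\<And>t w. w \<in> space P ==> t \<in> {lo..hi} ==> \<bar>m t w\<bar> <= k"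
  "\<And>w. w \<in> space P ==> m lo w = 0"
  "B2 \<in> sets P" "measure P B2 <= kp / 3" "\<And>w t. w \<in> space P - B2 ==> t \<in> {lo..hi} ==> m t w = M t w - M lo w"
  using bounded_version[OF M k3] by blast
 obtain dl where dl: "0 < dl" "dl\<^sup>2 * k\<^sup>2 / l\<^sup>2 <= kp / 3" using delta_choice[OF l k3 m(3)] by blast
 obtain Nu where Nu: "Nu \<in> null_sets P" "{w\<in>space P. \<not> (\<forall>t\<in>{lo..hi}. (\<lambda>j. tr (gr (n j)) (2^(n j)) H M t w) \<longlonglongrightarrow> I t w)} \<subseteq> Nu"
  using lim unfolding eventually_ae_filter by blast
 obtain j0 where j0: "1 / real (Suc j0) < dl" using nat_approx_posE[OF dl(1)] by (metis of_nat_Suc)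
 obtain n0 :: nat where n0: "(t - lo) / d j0 < real n0" using reals_Archimedean2 by blast
 show ?thesis
 proof (intro exI[of _ "max 1 n0"] allI impI)
  fix p assume p: "max 1 n0 <= p"
  then have p0: "0 < real p" by simp
  define wt where "wt k = lo + real (min k p) * (t - lo) / real p" for k
  have wk: "wt k = lo + real k * (t - lo) / real p" if "k <= p" for k using that by (simp add: wt_def min_absorb1)
  have tl: "0 <= (t - lo) / real p" using t p0 by simp
  have wmono: "mono wt"
   unfolding wt_def using tl by (intro monoI add_left_mono) (simp add: mult_right_mono divide_right_mono t[unfolded atLeastAtMost_iff])
  have w0: "wt 0 = lo" and wp: "wt p = t" using p0 by (auto simp: wt_def)
  have wt: "wt k <= t" for k
  proof -
   have "real (min k p) * ((t - lo) / real p) <= real p * ((t - lo) / real p)" using tl by (intro mult_right_mono) auto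
   then show ?thesis using p0 by (simp add: wt_def)
  qed
  have wlo: "lo <= wt k" for k using monoD[OF wmono, of 0 k] w0 by simp
  have wg: "grid_in wt" 
  proof -
   have "wt k <= hi" for k using wt[of k] t by auto
   then show ?thesis unfolding grid_in_def using wmono wlo by auto
  qed
  have wstep: "wt (Suc k) <= wt k + d j0" for k
  proof -
   have "real (min (Suc k) p) <= real (min k p) + 1" by auto
   then have "real (min (Suc k) p) * ((t - lo) / real p) <= (real (min k p) + 1) * ((t - lo) / real p)" using tl by (rule mult_right_mono)
   then have "wt (Suc k) <= wt k + (t - lo) / real p" by (simp add: wt_def distrib_right add_divide_distrib)
   moreover have "(t - lo) / real p <= d j0"
   proof -
    have "(t - lo) / d j0 < real p" using n0 p by linarith
    then show ?thesis using B1(1)[of j0] p0 by (simp add: field_simps)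
   qed
   ultimately show ?thesis by linarith
  qed
  \<comment> \<open>Truncated to be bounded for all outcomes; off the first two bad events it equals
    step function minus \<open>H\<close> at the grid points used.\<close>
  define Z where "Z u w = (if u < lo then 0 else trc dl (step_fun wt p H u w - H u w))" for u w
  have Zm: "Z u \<in> bm (Fm u)" if "u \<in> {lo..hi}" for u
  proof -
   have [measurable]: "H u \<in> bm (Fm u)" "step_fun wt p H u \<in> bm (Fm u)"
    using H[OF that] step_fun_meas[OF wg H that] by auto
   show ?thesis unfolding Z_def[abs_def] by measurable
  qed
  have Zb: "\<bar>Z u w\<bar> <= dl" for u w using trc_bound[of dl] dl by (simp add: Z_def)
  have Z0: "Z u w = 0" if "u < lo" for u w using that by (simp add: Z_def)
  have lt: "lo <= lo" "lo <= t" "t <= hi" and loin: "lo \<in> {lo..hi}" using t by auto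
  note tl2 = tr_L2[OF m(1,4) grid_gr Zm Zb Z0 lt]
  define Y where "Y j = tr (gr (n j)) (2^(n j)) Z m t" for j
  have "(\<integral>w. (m t w)\<^sup>2 \<partial>P) - (\<integral>w. (m lo w)\<^sup>2 \<partial>P) <= k\<^sup>2"
   using mart_sq_le(1)[OF m(1,4) t] mart_sq_le(2)[OF m(1,4) loin] by linarith
  then have b: "dl\<^sup>2 * ((\<integral>w. (m t w)\<^sup>2 \<partial>P) - (\<integral>w. (m lo w)\<^sup>2 \<partial>P)) <= dl\<^sup>2 * k\<^sup>2" by (intro mult_left_mono) auto
  have "\<exists>B\<in>sets P. measure P B <= dl\<^sup>2 * k\<^sup>2 / l\<^sup>2 \<and> (\<forall>w\<in>space P - B. \<forall>y. (\<lambda>j. Y j w) \<longlonglongrightarrow> y \<longrightarrow> \<bar>y\<bar> <= l)"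
  proof (rule fatou_markov[OF _ _ _ l])
   show "Y j \<in> bm P" for j unfolding Y_def by (rule martD(3)[OF mart_tr[OF m(1) grid_gr Zm Zb] t])
   show "integrable P (\<lambda>w. (Y j w)\<^sup>2)" for j unfolding Y_def by (rule tl2(1))
   show "(\<integral>w. (Y j w)\<^sup>2 \<partial>P) <= dl\<^sup>2 * k\<^sup>2" for j unfolding Y_def by (rule order_trans[OF tl2(2) b])
  qed
  then obtain B3 where B3: "B3 \<in> sets P" "measure P B3 <= dl\<^sup>2 * k\<^sup>2 / l\<^sup>2" "\<And>w y. w \<in> space P - B3 ==> (\<lambda>j. Y j w) \<longlonglongrightarrow> y ==> \<bar>y\<bar> <= l"
   by blast
  have NuS: "Nu \<in> sets P" "measure P Nu = 0" using Nu(1) by (auto simp: null_sets_def measure_def)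
  let ?B = "((B1 \<union> B2) \<union> B3) \<union> Nu"
  have sB: "B1 \<union> B2 \<in> sets P" "(B1 \<union> B2) \<union> B3 \<in> sets P" "?B \<in> sets P" using B1 m B3 NuS by auto
  have "measure P ?B <= kp"
   using measure_Un_le[OF sB(2) NuS(1)] measure_Un_le[OF sB(1) B3(1)] measure_Un_le[OF B1(3) m(6)] B1(4) m(7) B3(2) dl(2) NuS(2) by linarith
  moreover have "\<bar>(\<Sum>k<p. H (lo + real k * (t - lo) / real p) w * (M (lo + real (Suc k) * (t - lo) / real p) w - M (lo + real k * (t - lo) / real p) w)) - I t w\<bar> <= l"
   if om: "w \<in> space P - ?B" for w
  proof (rule B3(3))
   show "w \<in> space P - B3" using om by auto
   have pp: "ppath R d (\<lambda>s. cf_ext lo hi H s w)" using B1(5) om by blast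
   have ext: "cf_ext lo hi H s w = H s w" if "s \<in> {lo..hi}" for s using that by (simp add: cf_ext_def cf_clamp_def)
   have cM: "continuous_on {lo..hi} (\<lambda>t. M t w)" using Mc om unfolding cf_cont_paths_def by auto
   have fl: "filterlim n at_top sequentially"
    by (rule filterlim_at_top_mono[OF filterlim_ident]) (use nj in auto)
   have "(\<lambda>N. tr (gr N) (2^N) (step_fun wt p H) M t w) \<longlonglongrightarrow> (\<Sum>k<p. H (wt k) w * (M (min (wt (Suc k)) t) w - M (min (wt k) t) w))"
    by (rule tr_step_fun_lim[where M=M, OF wg cM t])
   from filterlim_compose[OF this fl]
   have l1: "(\<lambda>j. tr (gr (n j)) (2^(n j)) (step_fun wt p H) M t w) \<longlonglongrightarrow> (\<Sum>k<p. H (wt k) w * (M (min (wt (Suc k)) t) w - M (min (wt k) t) w))" .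
   have e: "(\<Sum>k<p. H (wt k) w * (M (min (wt (Suc k)) t) w - M (min (wt k) t) w)) =
    (\<Sum>k<p. H (lo + real k * (t - lo) / real p) w * (M (lo + real (Suc k) * (t - lo) / real p) w - M (lo + real k * (t - lo) / real p) w))"
   proof (intro sum.cong refl)
    fix q assume "q \<in> {..<p}"
    then have "wt q = lo + real q * (t - lo) / real p" "wt (Suc q) = lo + real (Suc q) * (t - lo) / real p"
     using wk[of q] wk[of "Suc q"] by auto
    moreover have "min (wt q) t = wt q" "min (wt (Suc q)) t = wt (Suc q)" using wt[of q] wt[of "Suc q"] by auto
    ultimately show "H (wt q) w * (M (min (wt (Suc q)) t) w - M (min (wt q) t) w) =
     H (lo + real q * (t - lo) / real p) w * (M (lo + real (Suc q) * (t - lo) / real p) w - M (lo + real q * (t - lo) / real p) w)"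
     by (simp only:)
   qed
   have l2: "(\<lambda>j. tr (gr (n j)) (2^(n j)) H M t w) \<longlonglongrightarrow> I t w" using Nu(2) om t by blast
   have Yeq: "Y j w = tr (gr (n j)) (2^(n j)) (step_fun wt p H) M t w - tr (gr (n j)) (2^(n j)) H M t w" for j
    unfolding tr_diff_Z Y_def
   proof (rule tr_cong[where c="- M lo w", OF _ _ grid_gr t])
    show "m s w = M s w + - M lo w" if "s \<in> {lo..hi}" for s using m(8)[of w s] om that by auto
    fix i :: nat assume "gr (n j) i < t"
    then have lt: "gr (n j) i < wt p" "wt 0 <= gr (n j) i" using gr_in[of "n j" i] by (auto simp: w0 wp)
    obtain q where q: "q < p" "wt q <= gr (n j) i" "gr (n j) i < wt (Suc q)" "step_fun wt p H (gr (n j) i) w = H (wt q) w"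
     using step_fun_val[OF wmono lt(2,1), of H w] by blast
    have wq: "wt q \<in> {lo..hi}" using wlo[of q] wt[of q] t by auto
    have "\<bar>wt q - gr (n j) i\<bar> <= d j0" using q(2,3) wstep[of q] by linarith
    then have "\<bar>cf_ext lo hi H (wt q) w - cf_ext lo hi H (gr (n j) i) w\<bar> <= 1 / real (Suc j0)"
     using pp unfolding ppath_def by blast
    then have "\<bar>step_fun wt p H (gr (n j) i) w - H (gr (n j) i) w\<bar> <= dl"
     using q(4) j0 ext[OF gr_in] ext[OF wq] by simp
    then show "Z (gr (n j) i) w = step_fun wt p H (gr (n j) i) w - H (gr (n j) i) w"
     using gr_in[of "n j" i] unfolding Z_def by (simp add: trc_id)
   qed
   show "(\<lambda>j. Y j w) \<longlonglongrightarrow> (\<Sum>k<p. H (lo + real k * (t - lo) / real p) w * (M (lo + real (Suc k) * (t - lo) / real p) w - M (lo + real k * (t - lo) / real p) w)) - I t w"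
    unfolding Yeq e[symmetric] by (intro tendsto_diff l1 l2)
  qed
  ultimately show "\<exists>B\<in>sets P. measure P B <= kp \<and> (\<forall>w\<in>space P - B.
   \<bar>(\<Sum>k<p. H (lo + real k * (t - lo) / real p) w * (M (lo + real (Suc k) * (t - lo) / real p) w - M (lo + real k * (t - lo) / real p) w)) - I t w\<bar> <= l)"
   using sB(3) by blast
 qed
qed

text \<open>The value of the integrand at \<open>lo\<close> is irrelevant, because the first increment of \<open>M\<close> tends to \<open>0\<close>.\<close>

lemma stoch_int_char:
 assumes H: "\<And>s. s \<in> {lo..hi} ==> H s \<in> bm (Fm s)" and Hc: "cpaths H"
  and M: "lmart M" and nj: "\<And>j. j <= (n j :: nat)"
  and Ic: "cpaths I" and I0: "\<And>w. w \<in> space P ==> I lo w = 0"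
  and Ia: "\<And>t. t \<in> {lo..hi} ==> I t \<in> bm (Fm t)"
  and lim: "AE w in P. \<forall>t\<in>{lo..hi}. (\<lambda>j. tr (gr (n j)) (2^(n j)) H M t w) \<longlonglongrightarrow> I t w"
  and H': "\<And>s w. s \<in> {lo<..hi} ==> w \<in> space P ==> H' s w = H s w" and H'lo: "H' lo \<in> bm P"
 shows "cf_stoch_int P lo hi H' M I"
 unfolding cf_stoch_int_def cf_seq_conv_prob_def
proof (intro conjI ballI allI impI)
 show "cpaths I" by (rule Ic)
 show "I lo w = 0" if "w \<in> space P" for w by (rule I0[OF that])
 fix t assume t: "t \<in> {lo..hi}"
 have Ma: "\<And>s. s \<in> {lo..hi} ==> M s \<in> bm (Fm s)" and Mc: "cpaths M"
  using M unfolding cf_cont_local_martingale_def adapted_iff by auto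
 have loin: "lo \<in> {lo..hi}" using lohi by simp
 show It: "I t \<in> bm P" by (rule meas_P[OF Ia[OF t] t])
 have H'm: "H' s \<in> bm P" if s: "s \<in> {lo..hi}" for s
 proof (cases "s = lo")
  case False
  then have "s \<in> {lo<..hi}" using s by auto
  then have "\<And>w. w \<in> space P ==> H' s w = H s w" by (rule H')
  then show ?thesis using meas_P[OF H[OF s] s] by (simp cong: measurable_cong)
 qed (use H'lo in simp)
 define v where "v p k = lo + real k * (t - lo) / real p" for p k :: nat
 have vin: "v p k \<in> {lo..t}" if "k <= p" for p k
 proof (cases "p = 0")
  case False
  have "real k * ((t - lo) / real p) <= real p * ((t - lo) / real p)" using that t False by (intro mult_right_mono) auto
  then show ?thesis using t False by (auto simp: v_def)
 qed (use t in \<open>auto simp: v_def\<close>)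
 have vin': "v p k \<in> {lo..hi}" if "k <= p" for p k using vin[OF that] t by auto
 define S where "S G p w = (\<Sum>k<p. G (v p k) w * (M (v p (Suc k)) w - M (v p k) w))" for G p w
 have MP: "M s \<in> bm P" if "s \<in> {lo..hi}" for s by (rule meas_P[OF Ma[OF that] that])
 have Sm: "S H' p \<in> bm P" for p
  unfolding S_def[abs_def]
  by (intro borel_measurable_sum borel_measurable_times borel_measurable_diff MP H'm vin') auto
 show "(\<lambda>w. \<Sum>k<p. H' (lo + real k * (t - lo) / real p) w * (M (lo + real (Suc k) * (t - lo) / real p) w - M (lo + real k * (t - lo) / real p) w)) \<in> bm P" for p
  using Sm[of p] by (simp add: S_def[abs_def] v_def)
 \<comment> \<open>The single summand in which \<open>H'\<close> and \<open>H\<close> can differ.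
   \<open>min 1 p\<close> keeps the index within the grid for \<open>p = 0\<close>.\<close>
 define D where "D p w = (H' lo w - H lo w) * (M (v p (min 1 p)) w - M lo w)" for p w
 have Dm[measurable]: "D p \<in> bm P" for p
  unfolding D_def[abs_def]
  by (intro borel_measurable_times borel_measurable_diff MP H'lo meas_P[OF H[OF loin] loin] vin' loin) auto
 have SD: "S H' p w = S H p w + D p w" if "w \<in> space P" "0 < p" for p w
 proof -
  have "S H' p w - S H p w = (\<Sum>k<p. (H' (v p k) w - H (v p k) w) * (M (v p (Suc k)) w - M (v p k) w))"
   unfolding S_def sum_subtractf[symmetric] by (intro sum.cong) (auto simp: left_diff_distrib)
  also have "... = (\<Sum>k\<in>{0}. (H' (v p k) w - H (v p k) w) * (M (v p (Suc k)) w - M (v p k) w))"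
  proof (rule sum.mono_neutral_right)
   show "\<forall>k\<in>{..<p} - {0}. (H' (v p k) w - H (v p k) w) * (M (v p (Suc k)) w - M (v p k) w) = 0"
   proof
    fix k assume k: "k \<in> {..<p} - {0}"
    show "(H' (v p k) w - H (v p k) w) * (M (v p (Suc k)) w - M (v p k) w) = 0"
    proof (cases "t = lo")
     case False
     then have "v p k \<noteq> lo" using k t by (auto simp: v_def)
     then have "v p k \<in> {lo<..hi}" using vin'[of k p] k by auto
     then show ?thesis using H' that by simp
    qed (simp add: v_def)
   qed
  qed (use that in auto)
  also have "... = D p w" using that by (simp add: D_def v_def)
  finally show ?thesis by simp
 qed
 fix dl :: real assume dl: "0 < dl"
 have Dlim: "(\<lambda>p. measure P {w\<in>space P. dl / 2 < \<bar>D p w\<bar>}) \<longlonglongrightarrow> 0"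
 proof (rule pointwise_imp_prob[OF Dm])
  fix w assume w: "w \<in> space P"
  have cM: "continuous_on {lo..hi} (\<lambda>t. M t w)" using Mc w unfolding cf_cont_paths_def by auto
  have "(\<lambda>p. lo + real (min 1 p) * (t - lo) / real p) \<longlonglongrightarrow> lo"
  proof (rule Lim_transform_eventually)
   have "(\<lambda>p. lo + (t - lo) * inverse (real p)) \<longlonglongrightarrow> lo + (t - lo) * 0"
    by (intro tendsto_intros LIMSEQ_inverse_real_of_nat[THEN LIMSEQ_imp_Suc] lim_inverse_n)
   then show "(\<lambda>p. lo + (t - lo) * inverse (real p)) \<longlonglongrightarrow> lo" by simp
   show "\<forall>\<^sub>F p in sequentially. lo + (t - lo) * inverse (real p) = lo + real (min 1 p) * (t - lo) / real p"
    using eventually_gt_at_top[of 0] by eventually_elim (simp add: min_def divide_inverse)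
  qed
  then have "(\<lambda>p. v p (min 1 p)) \<longlonglongrightarrow> lo" by (simp add: v_def)
  then have "(\<lambda>p. M (v p (min 1 p)) w) \<longlonglongrightarrow> M lo w"
   by (rule continuous_on_tendsto_compose[OF cM _ loin]) (intro always_eventually allI vin', simp)
  then have "(\<lambda>p. D p w) \<longlonglongrightarrow> (H' lo w - H lo w) * (M lo w - M lo w)" unfolding D_def by (intro tendsto_intros)
  then show "(\<lambda>p. D p w) \<longlonglongrightarrow> 0" by simp
 qed (use dl in simp)
 have "(\<lambda>p. measure P {w\<in>space P. dl < \<bar>S H' p w - I t w\<bar>}) \<longlonglongrightarrow> 0"
 proof (rule LIMSEQ_I)
  fix e :: real assume e: "0 < e"
  have "\<exists>n0. \<forall>p\<ge>n0. \<exists>B\<in>sets P. measure P B <= e / 4 \<and> (\<forall>w\<in>space P - B. \<bar>S H p w - I t w\<bar> <= dl / 2)"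
   unfolding S_def v_def using riemann_conv[OF H Hc M nj lim t, of "dl/2" "e/4"] dl e by auto
  then obtain n0 where n0: "\<And>p. n0 <= p ==> \<exists>B\<in>sets P. measure P B <= e / 4 \<and> (\<forall>w\<in>space P - B. \<bar>S H p w - I t w\<bar> <= dl / 2)" by blast
  obtain n1 where n1: "\<And>p. n1 <= p ==> measure P {w\<in>space P. dl / 2 < \<bar>D p w\<bar>} < e / 4"
   using LIMSEQ_D[OF Dlim, of "e/4"] e by auto
  show "\<exists>no. \<forall>p\<ge>no. norm (measure P {w\<in>space P. dl < \<bar>S H' p w - I t w\<bar>} - 0) < e"
  proof (intro exI[of _ "max 1 (max n0 n1)"] allI impI)
   fix p assume p: "max 1 (max n0 n1) <= p"
   then obtain B where B: "B \<in> sets P" "measure P B <= e / 4" "\<And>w. w \<in> space P - B ==> \<bar>S H p w - I t w\<bar> <= dl / 2"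
    using n0[of p] by auto
   let ?D = "{w\<in>space P. dl / 2 < \<bar>D p w\<bar>}"
   have D: "?D \<in> sets P" by measurable
   have "{w\<in>space P. dl < \<bar>S H' p w - I t w\<bar>} \<subseteq> B \<union> ?D"
   proof
    fix w assume "w \<in> {w\<in>space P. dl < \<bar>S H' p w - I t w\<bar>}"
    then have w: "w \<in> space P" "dl < \<bar>S H p w + D p w - I t w\<bar>" using SD p by auto
    show "w \<in> B \<union> ?D"
    proof (rule ccontr)
     assume "w \<notin> B \<union> ?D"
     then have "\<bar>S H p w - I t w\<bar> <= dl / 2" "\<bar>D p w\<bar> <= dl / 2" using B(3) w(1) by auto
     then show False using w(2) by linarith
    qed
   qed
   then have "measure P {w\<in>space P. dl < \<bar>S H' p w - I t w\<bar>} <= measure P (B \<union> ?D)"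
    by (rule finite_measure_mono) (use B D in auto)
   also have "... <= measure P B + measure P ?D" by (rule measure_Un_le[OF B(1) D])
   also have "... < e" using B(2) n1[of p] p e by auto
   finally show "norm (measure P {w\<in>space P. dl < \<bar>S H' p w - I t w\<bar>} - 0) < e" by simp
  qed
 qed
 then show "(\<lambda>p. measure P {w\<in>space P. dl < \<bar>(\<Sum>k<p. H' (lo + real k * (t - lo) / real p) w * (M (lo + real (Suc k) * (t - lo) / real p) w - M (lo + real k * (t - lo) / real p) w)) - I t w\<bar>}) \<longlonglongrightarrow> 0"
  by (simp add: S_def v_def)
qed


text \<open>Cutting the integrand at \<open>s\<close> and stopping the integrator at
  \<open>s\<close> differ only in the cell that straddles \<open>s\<close>; there is at most one,
  and the oscillation of M over it vanishes with the mesh.\<close>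

lemma tr_indicator_lim:
 assumes M: "continuous_on {lo..hi} (\<lambda>t. M t w)" and H: "\<And>u. u \<in> {lo..hi} ==> \<bar>H u w\<bar> <= C"
  and st: "lo <= s" "s <= t" "t <= hi"
 shows "(\<lambda>N. tr (gr N) (2^N) (\<lambda>u w. of_bool (u < s) * H u w) M t w - tr (gr N) (2^N) H M s w) \<longlonglongrightarrow> 0"
proof (rule LIMSEQ_I)
 fix e :: real assume e: "0 < e"
 have C0: "0 <= C" using H[of lo] lohi by auto
 define e' where "e' = e / 2 / (C + 1)"
 have e': "0 < e'" using e C0 by (simp add: e'_def)
 have "uniformly_continuous_on {lo..hi} (\<lambda>t. M t w)" by (intro compact_uniformly_continuous M) auto
 then obtain d where d: "d > 0" "\<And>p q. p \<in> {lo..hi} ==> q \<in> {lo..hi} ==> dist p q < d ==> dist (M p w) (M q w) < e'"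
  using e' unfolding uniformly_continuous_on_def by metis
 obtain N0 where N0: "\<And>N. N0 <= N ==> mesh N < d"
  using order_tendstoD(2)[OF mesh_lim d(1)] by (auto simp: eventually_sequentially)
 show "\<exists>no. \<forall>N\<ge>no. norm (tr (gr N) (2^N) (\<lambda>u w. of_bool (u < s) * H u w) M t w - tr (gr N) (2^N) H M s w - 0) < e"
 proof (intro exI[of _ N0] allI impI)
  fix N assume N: "N0 <= N"
  let ?u = "gr N"
  define S where "S = {j. j < 2^N \<and> ?u j < s \<and> s < ?u (Suc j)}"
  define f where "f j = of_bool (?u j < s) * H (?u j) w * (M (min (?u (Suc j)) t) w - M (min (?u j) t) w)
    - H (?u j) w * (M (min (?u (Suc j)) s) w - M (min (?u j) s) w)" for j
  have um: "?u i <= ?u j" if "i <= j" for i j by (rule grid_inD(3)[OF grid_gr that])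
  have f0: "f j = 0" if "j < 2^N" "j \<notin> S" for j
  proof (cases "?u j < s")
   case True
   then have "?u (Suc j) <= s" using that by (auto simp: S_def)
   then have "min (?u (Suc j)) t = ?u (Suc j)" "min (?u j) t = ?u j" "min (?u (Suc j)) s = ?u (Suc j)" "min (?u j) s = ?u j"
    using True st by auto
   then show ?thesis using True by (simp add: f_def)
  next
   case False
   then have "min (?u (Suc j)) s = s" "min (?u j) s = s" using um[of j "Suc j"] by auto
   then show ?thesis using False by (simp add: f_def)
  qed
  have fS: "\<bar>f j\<bar> <= C * e'" if "j \<in> S" for j
  proof -
   have j: "?u j < s" "s < ?u (Suc j)" using that by (auto simp: S_def)
   have "min (?u j) t = ?u j" "min (?u (Suc j)) s = s" "min (?u j) s = ?u j" using j st by auto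
   then have fj: "f j = H (?u j) w * (M (min (?u (Suc j)) t) w - M s w)" using j by (simp add: f_def algebra_simps)
   have "dist (min (?u (Suc j)) t) s < d" using j st gr_Suc_le[of N j] N0[OF N] by (auto simp: dist_real_def min_def)
   then have "dist (M (min (?u (Suc j)) t) w) (M s w) < e'"
    using gr_in[of N "Suc j"] st by (intro d(2)) auto
   then show ?thesis unfolding fj abs_mult using H[OF gr_in] C0
    by (intro mult_mono) (auto simp: dist_real_def)
  qed
  have same: "i = j" if "i \<in> S" "j \<in> S" for i j
  proof (rule ccontr)
   assume "i \<noteq> j"
   then have "Suc i <= j \<or> Suc j <= i" by auto
   then show False using um[of "Suc i" j] um[of "Suc j" i] that by (auto simp: S_def)
  qed
  have "tr ?u (2^N) (\<lambda>u w. of_bool (u < s) * H u w) M t w - tr ?u (2^N) H M s w = (\<Sum>j<2^N. f j)"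
   unfolding tr_def sum_subtractf[symmetric] f_def by (rule refl)
  also have "... = (\<Sum>j\<in>S. f j)"
   by (rule sum.mono_neutral_right) (use f0 in \<open>auto simp: S_def\<close>)
  finally have eq: "tr ?u (2^N) (\<lambda>u w. of_bool (u < s) * H u w) M t w - tr ?u (2^N) H M s w = (\<Sum>j\<in>S. f j)" .
  have "\<bar>\<Sum>j\<in>S. f j\<bar> <= C * e'"
  proof (cases "S = {}")
   case True
   then show ?thesis using C0 e' by simp
  next
   case False
   then obtain j where "j \<in> S" by blast
   then have "S = {j}" using same by blast
   then show ?thesis using fS[OF \<open>j \<in> S\<close>] by simp
  qed
  also have "C * e' < e"
  proof -
   have "C * e' <= (C + 1) * e'" using e' by simp
   also have "... = e / 2"
   proof -
    have "C + 1 \<noteq> 0" using C0 by simp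
    from nonzero_mult_div_cancel_left[OF this, of "e / 2"] show ?thesis
     unfolding e'_def by (simp only: times_divide_eq_right)
   qed
   finally show ?thesis using e by simp
  qed
  finally show "norm (tr ?u (2^N) (\<lambda>u w. of_bool (u < s) * H u w) M t w - tr ?u (2^N) H M s w - 0) < e"
   using eq by simp
 qed
qed

text \<open>The left side is the limit of transforms of \<open>H u - H s\<close> over times
  \<open>u \<ge> s\<close>, which on \<open>G\<close> is at most \<open>dl\<close>. Fatou and the
  bound for transforms that vanish before \<open>s\<close> leave exactly the energy of
  \<open>m\<close> between \<open>s\<close> and \<open>t\<close>.\<close>

lemma stoch_integral_increment_L2:
 assumes H: "\<And>s. s \<in> {lo..hi} ==> H s \<in> bm (Fm s)" and Hc: "cpaths H"
  and Mc: "cpaths M" and nj: "\<And>j. j <= (n j :: nat)"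
  and lim: "AE w in P. \<forall>t\<in>{lo..hi}. (\<lambda>j. tr (gr (n j)) (2^(n j)) H M t w) \<longlonglongrightarrow> I t w"
  and m: "mart m" "\<And>t w. w \<in> space P ==> t \<in> {lo..hi} ==> \<bar>m t w\<bar> <= k"
  and st: "lo <= s" "s <= t" "t <= hi" and dl: "0 <= dl"
  and G1: "\<And>w r. w \<in> G ==> r \<in> {lo..hi} ==> m r w = M r w - M lo w"
  and G2: "\<And>w u. w \<in> G ==> u \<in> {s..t} ==> \<bar>H u w - H s w\<bar> <= dl"
 shows "(\<integral>\<^sup>+w. ennreal ((I t w - I s w - H s w * (M t w - M s w))\<^sup>2) * indicator G w \<partial>P)
  <= ennreal (dl\<^sup>2 * ((\<integral>w. (m t w)\<^sup>2 \<partial>P) - (\<integral>w. (m s w)\<^sup>2 \<partial>P)))" (is "_ <= ennreal ?E")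
proof -
 have tin: "t \<in> {lo..hi}" and sin: "s \<in> {lo..hi}" using st by auto
 \<comment> \<open>Known at time \<open>u\<close> and bounded everywhere by truncation; on
   \<open>G\<close> and for grid points before \<open>t\<close> it is the integrand described
   above.\<close>
 define Z where "Z u w = of_bool (s <= u) * trc dl (H (min u t) w - H s w)" for u w
 have Zm: "Z u \<in> bm (Fm u)" if u: "u \<in> {lo..hi}" for u
 proof (cases "s <= u")
  case True
  have [measurable]: "H (min u t) \<in> bm (Fm u)" "H s \<in> bm (Fm u)"
   by (rule meas_mono[OF H]; use u st True in auto)+
  show ?thesis unfolding Z_def[abs_def] by measurable
 qed (simp add: Z_def[abs_def])
 have Zb: "\<bar>Z u w\<bar> <= dl" for u w using trc_bound[OF dl] dl by (auto simp: Z_def)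
 have Z0: "Z u w = 0" if "u < s" for u w using that by (simp add: Z_def)
 note tl = tr_L2[OF m grid_gr Zm Zb Z0 st]
 define Y where "Y j = tr (gr (n j)) (2^(n j)) Z m t" for j
 have Ym[measurable]: "Y j \<in> bm P" for j
  unfolding Y_def by (rule martD(3)[OF mart_tr[OF m(1) grid_gr Zm Zb] tin])
 have Yi: "(\<integral>\<^sup>+w. ennreal ((Y j w)\<^sup>2) \<partial>P) <= ennreal ?E" for j
 proof -
  have "(\<integral>\<^sup>+w. ennreal ((Y j w)\<^sup>2) \<partial>P) = ennreal (\<integral>w. (Y j w)\<^sup>2 \<partial>P)"
   unfolding Y_def by (rule nn_integral_eq_integral[OF tl(1)]) auto
  also have "... <= ennreal ?E" unfolding Y_def by (rule ennreal_leI[OF tl(2)])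
  finally show ?thesis .
 qed
 have fl: "filterlim n at_top sequentially"
  by (rule filterlim_at_top_mono[OF filterlim_ident]) (use nj in auto)
 have Ylim: "(\<lambda>j. Y j w) \<longlonglongrightarrow> I t w - I s w - H s w * (M t w - M s w)"
  if w: "w \<in> space P" and G: "w \<in> G" and li: "\<forall>t\<in>{lo..hi}. (\<lambda>j. tr (gr (n j)) (2^(n j)) H M t w) \<longlonglongrightarrow> I t w" for w
 proof -
  have cM: "continuous_on {lo..hi} (\<lambda>t. M t w)" and cH: "continuous_on {lo..hi} (\<lambda>t. H t w)"
   using Mc Hc w unfolding cf_cont_paths_def by auto
  have "bounded ((\<lambda>t. H t w) ` {lo..hi})" by (intro compact_imp_bounded compact_continuous_image cH) auto
  then obtain C where "\<forall>x\<in>(\<lambda>t. H t w) ` {lo..hi}. norm x <= C" unfolding bounded_iff by blast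
  then have C: "\<And>u. u \<in> {lo..hi} ==> \<bar>H u w\<bar> <= C" by simp
  let ?D = "\<lambda>N j. M (min (gr N (Suc j)) t) w - M (min (gr N j) t) w"
  have Yeq: "Y j w = (tr (gr (n j)) (2^(n j)) H M t w - tr (gr (n j)) (2^(n j)) (\<lambda>u w. of_bool (u < s) * H u w) M t w)
    - H s w * ((\<Sum>i<2^(n j). of_bool (gr (n j) i < hi) * ?D (n j) i) - (\<Sum>i<2^(n j). of_bool (gr (n j) i < s) * ?D (n j) i))" for j
  proof -
   have "Y j w = tr (gr (n j)) (2^(n j)) (\<lambda>u w. of_bool (s <= u) * (H u w - H s w)) M t w"
    unfolding Y_def
   proof (rule tr_cong[where c="- M lo w", OF _ _ grid_gr tin])
    show "m r w = M r w + - M lo w" if "r \<in> {lo..hi}" for r using G1[OF G that] by simp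
    fix i :: nat assume "gr (n j) i < t"
    then show "Z (gr (n j) i) w = of_bool (s <= gr (n j) i) * (H (gr (n j) i) w - H s w)"
     using G2[OF G, of "gr (n j) i"] by (auto simp: Z_def trc_id)
   qed
   also have "... = (\<Sum>i<2^(n j). H (gr (n j) i) w * ?D (n j) i - of_bool (gr (n j) i < s) * H (gr (n j) i) w * ?D (n j) i
      - H s w * (?D (n j) i - of_bool (gr (n j) i < s) * ?D (n j) i))"
    unfolding tr_def by (intro sum.cong refl) (auto simp: algebra_simps)
   also have "... = (tr (gr (n j)) (2^(n j)) H M t w - tr (gr (n j)) (2^(n j)) (\<lambda>u w. of_bool (u < s) * H u w) M t w)
    - H s w * ((\<Sum>i<2^(n j). ?D (n j) i) - (\<Sum>i<2^(n j). of_bool (gr (n j) i < s) * ?D (n j) i))"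
    unfolding tr_def by (simp only: sum_subtractf sum_distrib_left[symmetric])
   also have "(\<Sum>i<2^(n j). ?D (n j) i) = (\<Sum>i<2^(n j). of_bool (gr (n j) i < hi) * ?D (n j) i)"
   proof (intro sum.cong refl)
    fix i
    show "?D (n j) i = of_bool (gr (n j) i < hi) * ?D (n j) i"
    proof (cases "gr (n j) i < hi")
     case False
     then have "gr (n j) i = hi" "gr (n j) (Suc i) = hi"
      using gr_in[of "n j" i] gr_in[of "n j" "Suc i"] grid_inD(3)[OF grid_gr, of i "Suc i" "n j"] by auto
     then show ?thesis by simp
    qed simp
   qed
   finally show ?thesis .
  qed
  have l1: "(\<lambda>j. tr (gr (n j)) (2^(n j)) H M t w) \<longlonglongrightarrow> I t w" "(\<lambda>j. tr (gr (n j)) (2^(n j)) H M s w) \<longlonglongrightarrow> I s w"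
   using li tin sin by blast+
  have l2: "(\<lambda>j. tr (gr (n j)) (2^(n j)) (\<lambda>u w. of_bool (u < s) * H u w) M t w - tr (gr (n j)) (2^(n j)) H M s w) \<longlonglongrightarrow> 0"
   by (rule filterlim_compose[OF tr_indicator_lim[where M=M and H=H, OF cM C st] fl])
  from tendsto_add[OF l2 l1(2)]
  have l3: "(\<lambda>j. tr (gr (n j)) (2^(n j)) (\<lambda>u w. of_bool (u < s) * H u w) M t w) \<longlonglongrightarrow> I s w" by simp
  have hiin: "hi \<in> {lo..hi}" using lohi by simp
  have l4: "(\<lambda>j. \<Sum>i<2^(n j). of_bool (gr (n j) i < r) * ?D (n j) i) \<longlonglongrightarrow> M (min r t) w - M lo w" if "r \<in> {lo..hi}" for r
   by (rule filterlim_compose[OF tel_lim[OF cM that tin] fl])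
  have "(\<lambda>j. Y j w) \<longlonglongrightarrow> (I t w - I s w) - H s w * ((M (min hi t) w - M lo w) - (M (min s t) w - M lo w))"
   unfolding Yeq by (intro tendsto_intros l1 l3 l4 hiin sin)
  then show ?thesis using st by (simp add: min_absorb1 min_absorb2)
 qed
 have "(\<integral>\<^sup>+w. ennreal ((I t w - I s w - H s w * (M t w - M s w))\<^sup>2) * indicator G w \<partial>P)
   <= (\<integral>\<^sup>+w. liminf (\<lambda>j. ennreal ((Y j w)\<^sup>2)) \<partial>P)"
 proof (rule nn_integral_mono_AE)
  show "AE w in P. ennreal ((I t w - I s w - H s w * (M t w - M s w))\<^sup>2) * indicator G w <= liminf (\<lambda>j. ennreal ((Y j w)\<^sup>2))"
   using lim AE_space
  proof eventually_elim
   case (elim w)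
   show ?case
   proof (cases "w \<in> G")
    case True
    have "(\<lambda>j. ennreal ((Y j w)\<^sup>2)) \<longlonglongrightarrow> ennreal ((I t w - I s w - H s w * (M t w - M s w))\<^sup>2)"
     by (intro tendsto_ennrealI tendsto_power Ylim elim True)
    then have "liminf (\<lambda>j. ennreal ((Y j w)\<^sup>2)) = ennreal ((I t w - I s w - H s w * (M t w - M s w))\<^sup>2)"
     by (intro lim_imp_Liminf) auto
    then show ?thesis using True by simp
   qed simp
  qed
 qed
 also have "... <= liminf (\<lambda>j. \<integral>\<^sup>+w. ennreal ((Y j w)\<^sup>2) \<partial>P)" by (rule nn_integral_liminf) measurable
 also have "... <= liminf (\<lambda>j. ennreal ?E)" by (rule Liminf_mono[OF always_eventually]) (use Yi in auto)
 also have "... = ennreal ?E" by (simp add: Liminf_const)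
 finally show ?thesis .
qed

text \<open>Markov's inequality in the form in which it is consumed: a small event and a pointwise
  bound off it.\<close>

lemma markov_set:
 assumes [measurable]: "g \<in> bm P" and g: "(\<integral>\<^sup>+w. g w \<partial>P) <= ennreal c" and c: "0 < c" and kp: "0 < kp"
 shows "\<exists>B\<in>sets P. measure P B <= kp \<and> (\<forall>w\<in>space P - B. g w <= ennreal (c / kp))"
proof -
 define B where "B = {w\<in>space P. 1 <= ennreal (kp / c) * g w}"
 have B[measurable]: "B \<in> sets P" unfolding B_def by measurable
 have "emeasure P B <= ennreal (kp / c) * (\<integral>\<^sup>+w. g w * indicator (space P) w \<partial>P)"
  unfolding B_def by (rule nn_integral_Markov_inequality) auto
 also have "(\<integral>\<^sup>+w. g w * indicator (space P) w \<partial>P) = (\<integral>\<^sup>+w. g w \<partial>P)"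
  by (rule nn_integral_cong) simp
 also have "ennreal (kp / c) * (\<integral>\<^sup>+w. g w \<partial>P) <= ennreal (kp / c) * ennreal c" by (rule mult_left_mono[OF g]) simp
 also have "... = ennreal kp" using c kp by (simp add: ennreal_mult[symmetric])
 finally have "measure P B <= kp" using kp by (simp add: emeasure_eq_measure)
 moreover have "g w <= ennreal (c / kp)" if w: "w \<in> space P - B" for w
 proof -
  have "ennreal (kp / c) * g w <= 1" using w by (auto simp: B_def not_le intro: less_imp_le)
  then have "ennreal (c / kp) * (ennreal (kp / c) * g w) <= ennreal (c / kp) * 1" by (rule mult_left_mono) simp
  moreover have "ennreal (c / kp) * (ennreal (kp / c) * g w) = g w"
   using c kp by (simp add: mult.assoc[symmetric] ennreal_mult[symmetric])
  ultimately show ?thesis by simp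
 qed
 ultimately show ?thesis using B by blast
qed

text \<open>Rounding \<open>s\<close> down to multiples of \<open>1 / Suc n\<close> leaves countably
  many sections; continuity in \<open>s\<close> gives the limit.\<close>

lemma joint_measurable:
 fixes f :: "real => 'a => real"
 assumes m: "\<And>s. f s \<in> bm P" and c: "\<And>w. w \<in> space P ==> continuous_on UNIV (\<lambda>s. f s w)"
 shows "(\<lambda>(s, w). f s w) \<in> bm (lborel \<Otimes>\<^sub>M P)"
proof (rule borel_measurable_LIMSEQ_real)
 fix x :: "real \<times> 'a" assume "x \<in> space (lborel \<Otimes>\<^sub>M P)"
 then obtain s w where x: "x = (s, w)" "w \<in> space P" by (auto simp: space_pair_measure)
 have fl: "(\<lambda>n. real_of_int \<lfloor>real (Suc n) * s\<rfloor> / real (Suc n)) \<longlonglongrightarrow> s"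
 proof (rule tendsto_sandwich[of "\<lambda>n. s - 1 / real (Suc n)" _ sequentially "\<lambda>_. s"])
  have "(\<lambda>n. s - 1 / real (Suc n)) \<longlonglongrightarrow> s - 0" by (intro tendsto_intros LIMSEQ_Suc[OF lim_1_over_n])
  then show "(\<lambda>n. s - 1 / real (Suc n)) \<longlonglongrightarrow> s" by simp
  have *: "s - 1 / real (Suc n) <= real_of_int \<lfloor>real (Suc n) * s\<rfloor> / real (Suc n)" "real_of_int \<lfloor>real (Suc n) * s\<rfloor> / real (Suc n) <= s" for n
  proof -
   have a: "real (Suc n) * s - 1 <= real_of_int \<lfloor>real (Suc n) * s\<rfloor>" "real_of_int \<lfloor>real (Suc n) * s\<rfloor> <= real (Suc n) * s" by linarith+
   from divide_right_mono[OF a(1), of "real (Suc n)"] show "s - 1 / real (Suc n) <= real_of_int \<lfloor>real (Suc n) * s\<rfloor> / real (Suc n)"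
    by (simp add: diff_divide_distrib del: of_nat_Suc)
   from divide_right_mono[OF a(2), of "real (Suc n)"] show "real_of_int \<lfloor>real (Suc n) * s\<rfloor> / real (Suc n) <= s"
    by (simp del: of_nat_Suc)
  qed
  show "\<forall>\<^sub>F n in sequentially. s - 1 / real (Suc n) <= real_of_int \<lfloor>real (Suc n) * s\<rfloor> / real (Suc n)"
   "\<forall>\<^sub>F n in sequentially. real_of_int \<lfloor>real (Suc n) * s\<rfloor> / real (Suc n) <= s"
   using * by (intro always_eventually allI; blast)+
 qed simp
 have "(\<lambda>n. f (real_of_int \<lfloor>real (Suc n) * s\<rfloor> / real (Suc n)) w) \<longlonglongrightarrow> f s w"
  by (rule continuous_on_tendsto_compose[OF c[OF x(2)] fl]) auto
 then show "(\<lambda>n. (\<lambda>n (s, w). f (real_of_int \<lfloor>real (Suc n) * s\<rfloor> / real (Suc n)) w) n x) \<longlonglongrightarrow> (\<lambda>(s, w). f s w) x"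
  by (simp add: x)
next
 fix n
 have "(\<lambda>x. f (real_of_int \<lfloor>real (Suc n) * fst x\<rfloor> / real (Suc n)) (snd x)) \<in> bm (lborel \<Otimes>\<^sub>M P)"
 proof (rule measurable_compose_countable[where f="\<lambda>i x. f (real_of_int i / real (Suc n)) (snd x)" and g="\<lambda>x. \<lfloor>real (Suc n) * fst x\<rfloor>"])
  show "(\<lambda>x. f (real_of_int i / real (Suc n)) (snd x)) \<in> bm (lborel \<Otimes>\<^sub>M P)" for i :: int
   by (rule measurable_compose[OF measurable_snd m])
  show "(\<lambda>x. \<lfloor>real (Suc n) * fst x\<rfloor>) \<in> measurable (lborel \<Otimes>\<^sub>M P) (count_space UNIV)" by measurable
 qed
 then show "(\<lambda>n (s, w). f (real_of_int \<lfloor>real (Suc n) * s\<rfloor> / real (Suc n)) w) n \<in> bm (lborel \<Otimes>\<^sub>M P)"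
  by (simp add: case_prod_beta')
qed

text \<open>\<open>indicator G\<close> restricts the mean to a good event. The second part supplies
  the measurability that \<open>markov_set\<close> asks for.\<close>

lemma nn_integral_swap:
 fixes f :: "real => 'a => real"
 assumes m: "\<And>s. f s \<in> bm P" and c: "\<And>w. w \<in> space P ==> continuous_on UNIV (\<lambda>s. f s w)" and G: "G \<in> sets P"
 shows "(\<integral>\<^sup>+w. (\<integral>\<^sup>+s. ennreal (f s w) * indicator {l..h} s \<partial>lborel) * indicator G w \<partial>P)
   = (\<integral>\<^sup>+s. (\<integral>\<^sup>+w. ennreal (f s w) * indicator G w \<partial>P) * indicator {l..h} s \<partial>lborel)"
  and "(\<lambda>w. (\<integral>\<^sup>+s. ennreal (f s w) * indicator {l..h} s \<partial>lborel)) \<in> bm P"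
proof -
 interpret pair_sigma_finite lborel P ..
 note J[measurable] = joint_measurable[OF m c]
 have Jm: "(\<lambda>x. f (fst x) (snd x)) \<in> bm (lborel \<Otimes>\<^sub>M P)" using J by (simp add: case_prod_beta')
 note [measurable] = Jm G
 have M1: "(\<lambda>x. ennreal (f (fst x) (snd x)) * indicator {l..h} (fst x)) \<in> bm (lborel \<Otimes>\<^sub>M P)" by measurable
 have M2: "(\<lambda>x. ennreal (f (fst x) (snd x)) * indicator {l..h} (fst x) * indicator G (snd x)) \<in> bm (lborel \<Otimes>\<^sub>M P)" by measurable
 have "(\<lambda>x. ennreal (f (snd x) (fst x)) * indicator {l..h} (snd x)) \<in> bm (P \<Otimes>\<^sub>M lborel)"
  using measurable_compose[OF measurable_pair_swap' M1] by (simp add: case_prod_beta')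
 from lborel.borel_measurable_nn_integral_fst[OF this]
 show inner: "(\<lambda>w. (\<integral>\<^sup>+s. ennreal (f s w) * indicator {l..h} s \<partial>lborel)) \<in> bm P" by simp
 have "(\<integral>\<^sup>+w. (\<integral>\<^sup>+s. ennreal (f s w) * indicator {l..h} s \<partial>lborel) * indicator G w \<partial>P)
   = (\<integral>\<^sup>+w. (\<integral>\<^sup>+s. ennreal (f s w) * indicator {l..h} s * indicator G w \<partial>lborel) \<partial>P)"
 proof (intro nn_integral_cong)
  fix w assume w: "w \<in> space P"
  have "(\<lambda>s. f s w) \<in> bm borel" by (rule borel_measurable_continuous_onI[OF c[OF w]])
  then show "(\<integral>\<^sup>+s. ennreal (f s w) * indicator {l..h} s \<partial>lborel) * indicator G w = (\<integral>\<^sup>+s. ennreal (f s w) * indicator {l..h} s * indicator G w \<partial>lborel)"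
   by (subst nn_integral_multc) auto
 qed
 also have "... = (\<integral>\<^sup>+s. (\<integral>\<^sup>+w. ennreal (f s w) * indicator {l..h} s * indicator G w \<partial>P) \<partial>lborel)"
  using Fubini[OF M2] by simp
 also have "... = (\<integral>\<^sup>+s. (\<integral>\<^sup>+w. ennreal (f s w) * indicator G w \<partial>P) * indicator {l..h} s \<partial>lborel)"
 proof (intro nn_integral_cong)
  fix s
  have [measurable]: "f s \<in> bm P" by (rule m)
  show "(\<integral>\<^sup>+w. ennreal (f s w) * indicator {l..h} s * indicator G w \<partial>P) = (\<integral>\<^sup>+w. ennreal (f s w) * indicator G w \<partial>P) * indicator {l..h} s"
   by (subst nn_integral_multc[symmetric]) (auto intro!: nn_integral_cong simp: mult_ac)
 qed
 finally show "(\<integral>\<^sup>+w. (\<integral>\<^sup>+s. ennreal (f s w) * indicator {l..h} s \<partial>lborel) * indicator G w \<partial>P)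
   = (\<integral>\<^sup>+s. (\<integral>\<^sup>+w. ennreal (f s w) * indicator G w \<partial>P) * indicator {l..h} s \<partial>lborel)" .
qed

end

text \<open>Up to sign the integral is that of \<open>e\<close> over a strip of length
  \<open>ep\<close> at the right end minus one at the left end. For an energy function this is what
  turns bounds on single increments into an integrated bound of order \<open>ep\<close>.\<close>

lemma mono_shift_integral:
 fixes e :: "real => real"
 assumes m: "mono e" and b: "\<And>s. 0 <= e s" "\<And>s. e s <= K" and ep: "0 < ep" and lh: "l <= h"
 shows "(\<integral>\<^sup>+s. ennreal (e (s + ep) - e s) * indicator {l..h} s \<partial>lborel) <= ennreal (ep * K)"
proof -
 have em[measurable]: "e \<in> bm borel" by (rule borel_measurable_mono[OF m])
 have K0: "0 <= K" using b(1)[of 0] b(2)[of 0] by linarith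
 let ?J = "\<integral>\<^sup>+s. ennreal (e s) * indicator {l..h} s \<partial>lborel"
 \<comment> \<open>Finiteness allows the integral of \<open>e\<close> to be added to both sides and
   cancelled, in place of subtracting nonnegative integrals.\<close>
 have Jfin: "?J \<noteq> \<infinity>"
 proof -
  have "?J <= (\<integral>\<^sup>+s. ennreal K * indicator {l..h} s \<partial>lborel)"
   using b by (intro nn_integral_mono mult_right_mono ennreal_leI) auto
  also have "... = ennreal K * ennreal (h - l)" using lh by (simp add: nn_integral_cmult_indicator)
  also have "... < \<infinity>" by (simp add: ennreal_mult_less_top)
  finally show ?thesis by simp
 qed
 have "(\<integral>\<^sup>+s. ennreal (e (s + ep) - e s) * indicator {l..h} s \<partial>lborel) + ?J
   = (\<integral>\<^sup>+s. ennreal (e (s + ep) - e s) * indicator {l..h} s + ennreal (e s) * indicator {l..h} s \<partial>lborel)"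
  by (rule nn_integral_add[symmetric]) measurable
 also have "... = (\<integral>\<^sup>+s. ennreal (e (s + ep)) * indicator {l..h} s \<partial>lborel)"
 proof (intro nn_integral_cong)
  fix s
  have "0 <= e (s + ep) - e s" using monoD[OF m, of s "s + ep"] ep by simp
  then have "ennreal (e (s + ep) - e s) + ennreal (e s) = ennreal (e (s + ep))"
   using b(1)[of s] by (subst ennreal_plus[symmetric]) auto
  then show "ennreal (e (s + ep) - e s) * indicator {l..h} s + ennreal (e s) * indicator {l..h} s = ennreal (e (s + ep)) * indicator {l..h} s"
   by (simp add: distrib_right[symmetric])
 qed
 also have "... = (\<integral>\<^sup>+s. ennreal (e s) * indicator {l..h} (s - ep) \<partial>lborel)"
  by (subst nn_integral_real_affine[where c=1 and t="-ep"]) auto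
 also have "... <= (\<integral>\<^sup>+s. ennreal (e s) * indicator {l..h} s + ennreal K * indicator {h..h+ep} s \<partial>lborel)"
 proof (rule nn_integral_mono)
  fix s
  show "ennreal (e s) * indicator {l..h} (s - ep) <= ennreal (e s) * indicator {l..h} s + ennreal K * indicator {h..h+ep} s"
   using b(2)[of s] ep by (auto simp: indicator_def ennreal_leI)
 qed
 also have "... = ?J + (\<integral>\<^sup>+s. ennreal K * indicator {h..h+ep} s \<partial>lborel)" by (rule nn_integral_add) measurable
 also have "(\<integral>\<^sup>+s. ennreal K * indicator {h..h+ep} s \<partial>lborel) = ennreal (ep * K)"
  using ep K0 by (simp add: nn_integral_cmult_indicator ennreal_mult[symmetric] mult.commute)
 finally have "?J + (\<integral>\<^sup>+s. ennreal (e (s + ep) - e s) * indicator {l..h} s \<partial>lborel) <= ?J + ennreal (ep * K)"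
  by (simp add: add.commute)
 then show ?thesis using Jfin by (simp add: ennreal_add_left_cancel_le)
qed

lemma nn_integral_eq_integral_Icc:
 fixes f :: "real => real"
 assumes c: "continuous_on {l..h} f" and nn: "\<And>s. s \<in> {l..h} ==> 0 <= f s"
 shows "(\<integral>\<^sup>+s. ennreal (f s) * indicator {l..h} s \<partial>lborel) = ennreal (integral {l..h} f)"
proof -
 have i: "set_integrable lborel {l..h} f" by (rule borel_integrable_atLeastAtMost'[OF c])
 have "(\<integral>\<^sup>+s. ennreal (f s) * indicator {l..h} s \<partial>lborel) = (\<integral>\<^sup>+s. ennreal (indicator {l..h} s *\<^sub>R f s) \<partial>lborel)"
  by (intro nn_integral_cong) (auto simp: indicator_def)
 also have "... = ennreal (\<integral>s. indicator {l..h} s *\<^sub>R f s \<partial>lborel)"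
  by (rule nn_integral_eq_integral[OF i[unfolded set_integrable_def]]) (use nn in \<open>auto simp: indicator_def\<close>)
 also have "(\<integral>s. indicator {l..h} s *\<^sub>R f s \<partial>lborel) = integral {l..h} f"
  using set_borel_integral_eq_integral(2)[OF i] by (simp add: set_lebesgue_integral_def)
 finally show ?thesis .
qed

text \<open>Folds consecutive blocks onto \<open>[0, ep]\<close>, so that for a fixed offset the
  evaluation points are exactly \<open>ep\<close> apart.\<close>

lemma block_integral:
 fixes g :: "real => real"
 assumes ep: "0 < ep" and g: "continuous_on {l..l + real n * ep} g"
 shows "integral {l..l + real n * ep} g = integral {0..ep} (\<lambda>v. \<Sum>j<n. g (l + real j * ep + v))"
 using g
proof (induction n)
 case (Suc n)
 have le: "l <= l + real n * ep" "l + real n * ep <= l + real (Suc n) * ep" using ep by (auto simp: distrib_right)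
 have c1: "continuous_on {l..l + real n * ep} g" by (rule continuous_on_subset[OF Suc.prems]) (use le in auto)
 have c2: "continuous_on {l + real n * ep..l + real (Suc n) * ep} g" by (rule continuous_on_subset[OF Suc.prems]) (use le in auto)
 have "integral {l..l + real (Suc n) * ep} g = integral {l..l + real n * ep} g + integral {l + real n * ep..l + real (Suc n) * ep} g"
  by (rule Henstock_Kurzweil_Integration.integral_combine[symmetric, OF le integrable_continuous_interval[OF Suc.prems]])
 also have "integral {l + real n * ep..l + real (Suc n) * ep} g = integral {0..ep} (g \<circ> (\<lambda>v. v + (l + real n * ep)))"
 proof (subst integral_shift)
  show "continuous_on {0 + (l + real n * ep)..ep + (l + real n * ep)} g" using c2 by (simp add: algebra_simps)
 qed (simp add: algebra_simps)
 also have "integral {l..l + real n * ep} g = integral {0..ep} (\<lambda>v. \<Sum>j<n. g (l + real j * ep + v))" by (rule Suc.IH[OF c1])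
 also have "integral {0..ep} (\<lambda>v. \<Sum>j<n. g (l + real j * ep + v)) + integral {0..ep} (g \<circ> (\<lambda>v. v + (l + real n * ep)))
   = integral {0..ep} (\<lambda>v. \<Sum>j<Suc n. g (l + real j * ep + v))"
 proof -
  have cj: "continuous_on {0..ep} (\<lambda>v. g (l + real j * ep + v))" if "j <= n" for j
  proof (rule continuous_on_compose2[OF Suc.prems])
   have "real j * ep + ep <= real (Suc n) * ep" using that ep mult_right_mono[of "real j + 1" "real (Suc n)" ep] by (simp add: distrib_right)
   then show "(\<lambda>v. l + real j * ep + v) ` {0..ep} \<subseteq> {l..l + real (Suc n) * ep}" using ep by auto
  qed (intro continuous_intros)
  have i1: "(\<lambda>v. \<Sum>j<n. g (l + real j * ep + v)) integrable_on {0..ep}"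
   by (intro integrable_continuous_interval continuous_on_sum cj) auto
  have i2: "(\<lambda>v. g (l + real n * ep + v)) integrable_on {0..ep}"
   by (intro integrable_continuous_interval cj) auto
  have "(g \<circ> (\<lambda>v. v + (l + real n * ep))) = (\<lambda>v. g (l + real n * ep + v))" by (auto simp: fun_eq_iff add_ac)
  then show ?thesis using Henstock_Kurzweil_Integration.integral_add[OF i1 i2] by simp
 qed
 finally show ?case .
qed simp

section \<open>Increments over time \<open>ep\<close> and their energy\<close>

context filtered_prob
begin

lemma clamp_in: "cf_clamp lo hi s \<in> {lo..hi}"
 using lohi by (auto simp: cf_clamp_def)

lemma clamp_mono: "s <= t ==> cf_clamp lo hi s <= cf_clamp lo hi t"
 by (auto simp: cf_clamp_def)

lemma clamp_id: "s \<in> {lo..hi} ==> cf_clamp lo hi s = s"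
 by (auto simp: cf_clamp_def)

lemma ext_id: "s \<in> {lo..hi} ==> cf_ext lo hi X s = X s"
 by (simp add: cf_ext_def clamp_id)

lemma ext_cont:
 assumes "cpaths X" "w \<in> space P" shows "continuous_on A (\<lambda>s. cf_ext lo hi X s w)"
proof -
 have "continuous_on {lo..hi} (\<lambda>t. X t w)" using assms unfolding cf_cont_paths_def by auto
 then show ?thesis unfolding cf_ext_def
  by (rule continuous_on_compose2) (use clamp_in in \<open>auto simp: cf_clamp_def intro!: continuous_intros\<close>)
qed

lemma ext_cont_shift:
 assumes "cpaths X" "w \<in> space P" shows "continuous_on A (\<lambda>s. cf_ext lo hi X (s + ep) w)"
 by (rule continuous_on_compose2[OF ext_cont[OF assms, of UNIV]]) (auto intro!: continuous_intros)

lemma ext_meas: "(\<And>t. t \<in> {lo..hi} ==> X t \<in> bm P) ==> cf_ext lo hi X s \<in> bm P"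
 unfolding cf_ext_def[abs_def] using clamp_in by auto

lemma ext_sq_props:
 assumes m: "mart m" "\<And>t w. w \<in> space P ==> t \<in> {lo..hi} ==> \<bar>m t w\<bar> <= k"
 defines "e \<equiv> \<lambda>s. \<integral>w. (cf_ext lo hi m s w)\<^sup>2 \<partial>P"
 shows "mono e" "\<And>s. 0 <= e s" "\<And>s. e s <= k\<^sup>2"
proof -
 show "mono e"
 proof (rule monoI)
  fix s t :: real assume "s <= t"
  then show "e s <= e t" unfolding e_def cf_ext_def
   by (intro mart_sq_mono[OF m] clamp_mono) (use clamp_in in auto)
 qed
 show "0 <= e s" "e s <= k\<^sup>2" for s
  using mart_sq_le[OF m clamp_in[of s]] by (auto simp: e_def cf_ext_def)
qed

text \<open>The mean of a squared increment is the increment of the energy, whose shifts integrate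
  to at most \<open>ep * k\<^sup>2\<close>. The summand 1 keeps the constant positive for
  \<open>markov_set\<close>.\<close>

lemma energy_bounded_mart:
 assumes m: "mart m" "\<And>t w. w \<in> space P ==> t \<in> {lo..hi} ==> \<bar>m t w\<bar> <= k" and mc: "cpaths m"
  and ep: "0 < ep" and kp: "0 < kp"
 shows "\<exists>B\<in>sets P. measure P B <= kp \<and> (\<forall>w\<in>space P - B.
  integral {lo..hi} (\<lambda>s. (incr ep m s w)\<^sup>2) <= ep * (k\<^sup>2 + 1) / kp)"
proof -
 define e where "e s = (\<integral>w. (cf_ext lo hi m s w)\<^sup>2 \<partial>P)" for s
 have e: "mono e" "\<And>s. 0 <= e s" "\<And>s. e s <= k\<^sup>2"
 proof -
  show "mono e" unfolding e_def[abs_def] by (rule ext_sq_props(1)[OF m])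
  show "0 <= e s" "e s <= k\<^sup>2" for s unfolding e_def using ext_sq_props(2,3)[OF m] by auto
 qed
 define f where "f s w = (incr ep m s w)\<^sup>2" for s w
 have em: "cf_ext lo hi m s \<in> bm P" for s by (rule ext_meas[OF martD(3)[OF m(1)]])
 have fm: "f s \<in> bm P" for s unfolding f_def[abs_def] using em[of s] em[of "s + ep"] by measurable
 have fc: "continuous_on UNIV (\<lambda>s. f s w)" if "w \<in> space P" for w
  unfolding f_def by (intro continuous_intros ext_cont[OF mc that] ext_cont_shift[OF mc that])
 have inner: "(\<integral>\<^sup>+w. ennreal (f s w) * indicator (space P) w \<partial>P) = ennreal (e (s + ep) - e s)" for s
 proof -
  have le: "lo <= cf_clamp lo hi s" "cf_clamp lo hi s <= cf_clamp lo hi (s + ep)" "cf_clamp lo hi (s + ep) <= hi"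
   using clamp_in[of s] clamp_in[of "s + ep"] clamp_mono[of s "s + ep"] ep by auto
  have i: "integrable P (f s)"
  proof (rule integrable_bdd[OF fm, where C="(2 * k)\<^sup>2"])
   fix w assume w: "w \<in> space P"
   have "\<bar>incr ep m s w\<bar> <= 2 * k"
    using m(2)[OF w clamp_in[of s]] m(2)[OF w clamp_in[of "s + ep"]] unfolding cf_ext_def by linarith
   from power_mono[OF this, of 2] show "\<bar>f s w\<bar> <= (2 * k)\<^sup>2" by (simp add: f_def)
  qed
  have "(\<integral>\<^sup>+w. ennreal (f s w) * indicator (space P) w \<partial>P) = (\<integral>\<^sup>+w. ennreal (f s w) \<partial>P)"
   by (rule nn_integral_cong) simp
  also have "... = ennreal (\<integral>w. f s w \<partial>P)" by (rule nn_integral_eq_integral[OF i]) (simp add: f_def)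
  also have "(\<integral>w. f s w \<partial>P) = e (s + ep) - e s"
   unfolding f_def e_def cf_ext_def by (rule mart_sq_incr(1)[OF m le, of "\<lambda>_. 0" 0]) auto
  finally show ?thesis .
 qed
 define g where "g w = (\<integral>\<^sup>+s. ennreal (f s w) * indicator {lo..hi} s \<partial>lborel)" for w
 have gm: "g \<in> bm P" unfolding g_def[abs_def] by (rule nn_integral_swap(2)[OF fm fc sets.top])
 have "(\<integral>\<^sup>+w. g w \<partial>P) = (\<integral>\<^sup>+w. g w * indicator (space P) w \<partial>P)" by (rule nn_integral_cong) simp
 also have "... = (\<integral>\<^sup>+s. ennreal (e (s + ep) - e s) * indicator {lo..hi} s \<partial>lborel)"
  unfolding g_def using nn_integral_swap(1)[OF fm fc sets.top, of lo hi] by (simp only: inner)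
 also have "... <= ennreal (ep * k\<^sup>2)"
  by (rule mono_shift_integral[OF e ep]) (use lohi in auto)
 also have "... <= ennreal (ep * (k\<^sup>2 + 1))" using ep by (intro ennreal_leI mult_left_mono) auto
 finally have "(\<integral>\<^sup>+w. g w \<partial>P) <= ennreal (ep * (k\<^sup>2 + 1))" .
 moreover have "0 < ep * (k\<^sup>2 + 1)" using ep by (intro mult_pos_pos) (auto intro: add_nonneg_pos)
 ultimately obtain B where B: "B \<in> sets P" "measure P B <= kp" "\<And>w. w \<in> space P - B ==> g w <= ennreal (ep * (k\<^sup>2 + 1) / kp)"
  using markov_set[OF gm _ _ kp] by blast
 have "integral {lo..hi} (\<lambda>s. f s w) <= ep * (k\<^sup>2 + 1) / kp" if w: "w \<in> space P - B" for w
 proof -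
  have "g w = ennreal (integral {lo..hi} (\<lambda>s. f s w))"
   unfolding g_def by (rule nn_integral_eq_integral_Icc) (use fc w in \<open>auto simp: f_def intro: continuous_on_subset\<close>)
  then show ?thesis using B(3)[OF w] ep kp by (simp add: ennreal_le_iff)
 qed
 then show ?thesis using B(1,2) unfolding f_def by blast
qed

text \<open>The constant depends on \<open>kp\<close> alone; the exceptional event may vary with
  \<open>ep\<close>.\<close>

lemma energy_local_mart:
 assumes M: "lmart M" and kp: "0 < kp"
 shows "\<exists>C>0. \<forall>ep>0. \<exists>B\<in>sets P. measure P B <= kp \<and> (\<forall>w\<in>space P - B.
  integral {lo..hi} (\<lambda>s. (incr ep M s w)\<^sup>2) <= C * ep)"
proof -
 have k2: "0 < kp / 2" using kp by simp
 obtain m k B2 where m: "mart m" "cpaths m" "0 <= (k::real)"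
  "\<And>t w. w \<in> space P ==> t \<in> {lo..hi} ==> \<bar>m t w\<bar> <= k"
  "\<And>w. w \<in> space P ==> m lo w = 0"
  "B2 \<in> sets P" "measure P B2 <= kp / 2" "\<And>w t. w \<in> space P - B2 ==> t \<in> {lo..hi} ==> m t w = M t w - M lo w"
  using bounded_version[OF M k2] by blast
 show ?thesis
 proof (intro exI[of _ "(k\<^sup>2 + 1) / (kp / 2)"] conjI allI impI)
  show "0 < (k\<^sup>2 + 1) / (kp / 2)" using kp by (intro divide_pos_pos) (auto intro: add_nonneg_pos)
  fix ep :: real assume ep: "0 < ep"
  obtain B1 where B1: "B1 \<in> sets P" "measure P B1 <= kp / 2" "\<And>w. w \<in> space P - B1 ==>
   integral {lo..hi} (\<lambda>s. (incr ep m s w)\<^sup>2) <= ep * (k\<^sup>2 + 1) / (kp / 2)"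
   using energy_bounded_mart[OF m(1,4,2) ep k2] by blast
  show "\<exists>B\<in>sets P. measure P B <= kp \<and> (\<forall>w\<in>space P - B.
   integral {lo..hi} (\<lambda>s. (incr ep M s w)\<^sup>2) <= (k\<^sup>2 + 1) / (kp / 2) * ep)"
  proof (intro bexI[of _ "B1 \<union> B2"] conjI ballI)
   show "B1 \<union> B2 \<in> sets P" using B1 m by auto
   show "measure P (B1 \<union> B2) <= kp" using measure_Un_le[OF B1(1) m(6)] B1(2) m(7) by linarith
   fix w assume w: "w \<in> space P - (B1 \<union> B2)"
   have "cf_ext lo hi M s w = cf_ext lo hi m s w + M lo w" for s
    using m(8)[of w "cf_clamp lo hi s"] w clamp_in[of s] by (auto simp: cf_ext_def)
   then have "(\<lambda>s. (incr ep M s w)\<^sup>2) = (\<lambda>s. (incr ep m s w)\<^sup>2)"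
    by (simp add: fun_eq_iff)
   moreover have "integral {lo..hi} (\<lambda>s. (incr ep m s w)\<^sup>2) <= ep * (k\<^sup>2 + 1) / (kp / 2)"
    by (rule B1(3)) (use w in auto)
   moreover have "(k\<^sup>2 + 1) / (kp / 2) * ep = ep * (k\<^sup>2 + 1) / (kp / 2)" by (simp add: mult.commute)
   ultimately show "integral {lo..hi} (\<lambda>s. (incr ep M s w)\<^sup>2) <= (k\<^sup>2 + 1) / (kp / 2) * ep"
    by (simp only:)
  qed
 qed
qed

text \<open>Compared with the energy of M itself there is an extra factor \<open>dl\<^sup>2\<close>,
  the squared oscillation of the integrand over time \<open>ep\<close>, which is made as small as
  desired by taking \<open>ep\<close> below the radius \<open>d j\<close>.\<close>

lemma stoch_integral_energy:
 assumes H: "\<And>s. s \<in> {lo..hi} ==> H s \<in> bm (Fm s)" and Hc: "cpaths H"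
  and M: "lmart M" and nj: "\<And>j. j <= (n j :: nat)"
  and Ic: "cpaths I" and Ia: "\<And>t. t \<in> {lo..hi} ==> I t \<in> bm (Fm t)"
  and lim: "AE w in P. \<forall>t\<in>{lo..hi}. (\<lambda>j. tr (gr (n j)) (2^(n j)) H M t w) \<longlonglongrightarrow> I t w"
  and \<eta>: "0 < \<eta>" and kp: "0 < kp"
 shows "\<exists>ep0>0. \<forall>ep. 0 < ep \<and> ep <= ep0 \<longrightarrow> (\<exists>B\<in>sets P. measure P B <= kp \<and> (\<forall>w\<in>space P - B.
  integral {lo..hi} (\<lambda>s. (incr ep I s w
    - cf_ext lo hi H s w * (incr ep M s w))\<^sup>2) <= \<eta> * ep))"
proof -
 have HP: "H t \<in> bm P" and IP: "I t \<in> bm P" if "t \<in> {lo..hi}" for t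
  using meas_P[OF H[OF that] that] meas_P[OF Ia[OF that] that] by auto
 have MP: "M t \<in> bm P" if "t \<in> {lo..hi}" for t
  using M meas_P[OF _ that] that unfolding cf_cont_local_martingale_def adapted_iff by blast
 have Mc: "cpaths M" using M unfolding cf_cont_local_martingale_def by auto
 have k3: "0 < kp / 3" using kp by simp
 obtain R d B1 where B1: "\<And>j. 0 < d j" "0 < R" "B1 \<in> sets P" "measure P B1 <= kp / 3"
  "\<And>w. w \<in> space P - B1 ==> ppath R d (\<lambda>s. cf_ext lo hi H s w)"
  using ppath_tight[OF HP Hc k3] by blast
 obtain m k B2 where m: "mart m" "cpaths m" "0 <= (k::real)"
  "\<And>t w. w \<in> space P ==> t \<in> {lo..hi} ==> \<bar>m t w\<bar> <= k"
  "\<And>w. w \<in> space P ==> m lo w = 0"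
  "B2 \<in> sets P" "measure P B2 <= kp / 3" "\<And>w t. w \<in> space P - B2 ==> t \<in> {lo..hi} ==> m t w = M t w - M lo w"
  using bounded_version[OF M k3] by blast
 \<comment> \<open>Markov's inequality will cost a factor \<open>3 / kp\<close>, which is absorbed
   in the choice of \<open>dl\<close>.\<close>
 have "0 < \<eta> * (kp / 3)" using \<eta> k3 by simp
 then obtain dl where dl: "0 < dl" "dl\<^sup>2 * (k + 1)\<^sup>2 / 1\<^sup>2 <= \<eta> * (kp / 3)"
  using delta_choice[of 1 "\<eta> * (kp / 3)" "k + 1"] m(3) by auto
 obtain j where j: "1 / real (Suc j) < dl" using nat_approx_posE[OF dl(1)] by (metis of_nat_Suc)
 define G where "G = space P - (B1 \<union> B2)"
 have G: "G \<in> sets P" using B1 m by (auto simp: G_def)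
 show ?thesis
 proof (intro exI[of _ "d j"] conjI allI impI)
  show "0 < d j" by (rule B1)
  fix ep assume "0 < ep \<and> ep <= d j"
  then have ep: "0 < ep" "ep <= d j" by auto
  define e where "e s = (\<integral>w. (cf_ext lo hi m s w)\<^sup>2 \<partial>P)" for s
  have e: "mono e" "\<And>s. 0 <= e s" "\<And>s. e s <= k\<^sup>2"
 proof -
  show "mono e" unfolding e_def[abs_def] by (rule ext_sq_props(1)[OF m(1,4)])
  show "0 <= e s" "e s <= k\<^sup>2" for s unfolding e_def using ext_sq_props(2,3)[OF m(1,4)] by auto
 qed
  define f where "f s w = (incr ep I s w
    - cf_ext lo hi H s w * (incr ep M s w))\<^sup>2" for s w
  have [measurable]: "cf_ext lo hi I s \<in> bm P" for s by (rule ext_meas[OF IP])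
  have [measurable]: "cf_ext lo hi H s \<in> bm P" for s by (rule ext_meas[OF HP])
  have [measurable]: "cf_ext lo hi M s \<in> bm P" for s by (rule ext_meas[OF MP])
  have fm: "f s \<in> bm P" for s unfolding f_def[abs_def] by measurable
  have fc: "continuous_on UNIV (\<lambda>s. f s w)" if "w \<in> space P" for w
   unfolding f_def by (intro continuous_intros ext_cont[OF Ic that] ext_cont_shift[OF Ic that]
    ext_cont[OF Hc that] ext_cont[OF Mc that] ext_cont_shift[OF Mc that])
  have inner: "(\<integral>\<^sup>+w. ennreal (f s w) * indicator G w \<partial>P) <= ennreal (dl\<^sup>2 * (e (s + ep) - e s))" for s
  proof -
   have le: "lo <= cf_clamp lo hi s" "cf_clamp lo hi s <= cf_clamp lo hi (s + ep)" "cf_clamp lo hi (s + ep) <= hi"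
    using clamp_in[of s] clamp_in[of "s + ep"] clamp_mono[of s "s + ep"] ep by auto
   show ?thesis
    unfolding f_def e_def cf_ext_def
   proof (rule stoch_integral_increment_L2[OF H Hc Mc nj lim m(1,4) le])
    show "0 <= dl" using dl by simp
    show "m r w = M r w - M lo w" if "w \<in> G" "r \<in> {lo..hi}" for w r
     using m(8)[of w r] that by (auto simp: G_def)
    fix w u assume w: "w \<in> G" and u: "u \<in> {cf_clamp lo hi s..cf_clamp lo hi (s + ep)}"
    have uin: "u \<in> {lo..hi}" using u le by auto
    have "cf_clamp lo hi (s + ep) <= cf_clamp lo hi s + ep" using ep by (auto simp: cf_clamp_def)
    then have "\<bar>u - cf_clamp lo hi s\<bar> <= d j" using u ep by auto
    then have "\<bar>cf_ext lo hi H u w - cf_ext lo hi H (cf_clamp lo hi s) w\<bar> <= 1 / real (Suc j)"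
     using B1(5)[of w] w unfolding ppath_def G_def by blast
    then have "\<bar>H u w - H (cf_clamp lo hi s) w\<bar> <= 1 / real (Suc j)"
     by (simp only: ext_id[OF uin] ext_id[OF clamp_in])
    then show "\<bar>H u w - H (cf_clamp lo hi s) w\<bar> <= dl" using j by linarith
   qed
  qed
  define g where "g w = (\<integral>\<^sup>+s. ennreal (f s w) * indicator {lo..hi} s \<partial>lborel) * indicator G w" for w
  have gm: "g \<in> bm P" unfolding g_def[abs_def]
   using nn_integral_swap(2)[OF fm fc G] G by measurable
  have "(\<integral>\<^sup>+w. g w \<partial>P) = (\<integral>\<^sup>+s. (\<integral>\<^sup>+w. ennreal (f s w) * indicator G w \<partial>P) * indicator {lo..hi} s \<partial>lborel)"
   unfolding g_def by (rule nn_integral_swap(1)[OF fm fc G])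
  also have "... <= (\<integral>\<^sup>+s. ennreal (dl\<^sup>2 * (e (s + ep) - e s)) * indicator {lo..hi} s \<partial>lborel)"
   by (intro nn_integral_mono mult_right_mono inner) auto
  also have "... = (\<integral>\<^sup>+s. ennreal ((\<lambda>r. dl\<^sup>2 * e r) (s + ep) - (\<lambda>r. dl\<^sup>2 * e r) s) * indicator {lo..hi} s \<partial>lborel)"
   by (simp add: right_diff_distrib)
  also have "... <= ennreal (ep * (dl\<^sup>2 * k\<^sup>2))"
  proof (rule mono_shift_integral[OF _ _ _ ep(1)])
   show "mono (\<lambda>r. dl\<^sup>2 * e r)" using monoD[OF e(1)] by (intro monoI mult_left_mono) auto
  qed (use e lohi in \<open>auto intro!: mult_left_mono\<close>)
  also have "... <= ennreal (ep * (dl\<^sup>2 * (k + 1)\<^sup>2))"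
   using ep m(3) by (intro ennreal_leI mult_left_mono power_mono) auto
  finally have gint: "(\<integral>\<^sup>+w. g w \<partial>P) <= ennreal (ep * (dl\<^sup>2 * (k + 1)\<^sup>2))" .
  have pos: "0 < ep * (dl\<^sup>2 * (k + 1)\<^sup>2)" using ep dl m(3) by simp
  obtain B3 where B3: "B3 \<in> sets P" "measure P B3 <= kp / 3" "\<And>w. w \<in> space P - B3 ==> g w <= ennreal (ep * (dl\<^sup>2 * (k + 1)\<^sup>2) / (kp / 3))"
   using markov_set[OF gm gint pos k3] by blast
  have fin: "integral {lo..hi} (\<lambda>s. f s w) <= \<eta> * ep" if w: "w \<in> space P - ((B1 \<union> B2) \<union> B3)" for w
  proof -
   have "g w = ennreal (integral {lo..hi} (\<lambda>s. f s w))"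
    unfolding g_def using w
    by (subst nn_integral_eq_integral_Icc) (use fc in \<open>auto simp: f_def G_def intro: continuous_on_subset\<close>)
   moreover have "0 <= ep * (dl\<^sup>2 * (k + 1)\<^sup>2) / (kp / 3)" using pos kp by simp
   ultimately have "integral {lo..hi} (\<lambda>s. f s w) <= ep * (dl\<^sup>2 * (k + 1)\<^sup>2) / (kp / 3)"
    using B3(3)[of w] w by (simp add: ennreal_le_iff)
   also have "... <= ep * (\<eta> * (kp / 3)) / (kp / 3)"
    using dl(2) ep kp by (intro divide_right_mono mult_left_mono) auto
   also have "... = \<eta> * ep" using kp by simp
   finally show ?thesis .
  qed
  have sB: "B1 \<union> B2 \<in> sets P" using B1 m by auto
  have "measure P ((B1 \<union> B2) \<union> B3) <= kp"
   using measure_Un_le[OF sB B3(1)] measure_Un_le[OF B1(3) m(6)] B1(4) m(7) B3(2) by linarith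
  moreover have "(B1 \<union> B2) \<union> B3 \<in> sets P" using sB B3 by auto
  ultimately show "\<exists>B\<in>sets P. measure P B <= kp \<and> (\<forall>w\<in>space P - B.
   integral {lo..hi} (\<lambda>s. (incr ep I s w
    - cf_ext lo hi H s w * (incr ep M s w))\<^sup>2) <= \<eta> * ep)"
   using fin unfolding f_def by blast
 qed
qed

text \<open>Cutting \<open>[lo, t]\<close> into blocks of length \<open>ep\<close> turns the integral, up to a remainder, into an average over
 \<open>v \<in> [0, ep]\<close> of martingale transforms along the grids \<open>lo + v + j ep\<close>.\<close>

lemma predictable_integral_small:
 assumes m: "mart m" "\<And>t w. w \<in> space P ==> t \<in> {lo..hi} ==> \<bar>m t w\<bar> <= k" and mc: "cpaths m"
  and k: "0 <= k" and ep: "0 < ep" and dl: "0 < dl" and kp: "0 < kp" and t: "lo <= t" "t <= hi - ep"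
  and U: "\<And>s. s \<in> {lo..t} ==> U s \<in> bm (Fm s)" and Ub: "\<And>s w. s \<in> {lo..t} ==> \<bar>U s w\<bar> <= dl"
  and Uc: "\<And>w. w \<in> space P ==> continuous_on {lo..t} (\<lambda>s. U s w)"
 shows "\<exists>B\<in>sets P. measure P B <= kp \<and> (\<forall>w\<in>space P - B.
  \<bar>integral {lo..t} (\<lambda>s. U s w * (incr ep m s w))\<bar> <= ep * dl * ((k + 1) / kp + 2 * k))"
proof -
 have thi: "t \<in> {lo..hi}" using t ep by auto
 \<comment> \<open>The number of full blocks; the remainder is shorter than one block and is
   estimated trivially.\<close>
 define n where "n = nat \<lfloor>(t - lo) / ep\<rfloor>"
 have n: "real n * ep <= t - lo" "t - lo <= real n * ep + ep"
 proof -
  have "0 <= (t - lo) / ep" using t ep by simp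
  then have "real n <= (t - lo) / ep" "(t - lo) / ep <= real n + 1" unfolding n_def by linarith+
  then show "real n * ep <= t - lo" "t - lo <= real n * ep + ep" using ep by (auto simp: field_simps)
 qed
 define U' where "U' s w = U (cf_clamp lo t s) w" for s w
 have ct: "cf_clamp lo t s \<in> {lo..t}" for s using t by (auto simp: cf_clamp_def)
 have ctid: "cf_clamp lo t s = s" if "s \<in> {lo..t}" for s using that by (auto simp: cf_clamp_def)
 have U'c: "continuous_on A (\<lambda>s. U' s w)" if "w \<in> space P" for A w
  unfolding U'_def by (rule continuous_on_compose2[OF Uc[OF that]]) (use ct in \<open>auto simp: cf_clamp_def intro!: continuous_intros\<close>)
 have U'b: "\<bar>U' s w\<bar> <= dl" for s w unfolding U'_def by (rule Ub[OF ct])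
 have U'm[measurable]: "U' s \<in> bm P" for s
  unfolding U'_def[abs_def] by (rule meas_P[OF U[OF ct]]) (use ct[of s] t ep in auto)
 have em[measurable]: "cf_ext lo hi m s \<in> bm P" for s by (rule ext_meas[OF martD(3)[OF m(1)]])
 define g where "g s w = U' s w * (incr ep m s w)" for s w
 have gc: "continuous_on A (\<lambda>s. g s w)" if "w \<in> space P" for A w
  unfolding g_def by (intro continuous_intros U'c that ext_cont[OF mc that] ext_cont_shift[OF mc that])
 have gb: "\<bar>g s w\<bar> <= dl * (2 * k)" if w: "w \<in> space P" for s w
 proof -
  have "\<bar>incr ep m s w\<bar> <= 2 * k"
   using m(2)[OF w clamp_in[of s]] m(2)[OF w clamp_in[of "s + ep"]] unfolding cf_ext_def by linarith
  then show ?thesis unfolding g_def abs_mult using U'b[of s w] dl by (intro mult_mono) auto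
 qed
 define S where "S v w = (\<Sum>j<n. g (lo + real j * ep + v) w)" for v w
 have Sm[measurable]: "S v \<in> bm P" for v unfolding S_def[abs_def] g_def by measurable
 have Sc: "continuous_on A (\<lambda>v. S v w)" if "w \<in> space P" for A w
  unfolding S_def
  by (intro continuous_on_sum continuous_on_compose2[OF gc[OF that, of UNIV]]) (auto intro!: continuous_intros)
 define Z where "Z r w = (if r \<in> {lo..t} then U r w else 0)" for r w
 have Zm: "Z r \<in> bm (Fm r)" for r using U[of r] by (cases "r \<in> {lo..t}") (auto simp: Z_def[abs_def])
 have Zb: "\<bar>Z r w\<bar> <= dl" for r w using Ub[of r w] dl by (auto simp: Z_def)
 have Z0: "Z r w = 0" if "r < lo" for r w using that by (simp add: Z_def)
 have L1: "(\<integral>\<^sup>+w. ennreal \<bar>S v w\<bar> * indicator (space P) w \<partial>P) <= ennreal (dl * (k + 1))" if v: "v \<in> {0..ep}" for v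
 proof -
  \<comment> \<open>Capped at \<open>hi\<close> to be a grid; for the indices up to \<open>n\<close>
    that occur the cap is inactive, as \<open>t\<close> stays \<open>ep\<close> away from
    \<open>hi\<close>.\<close>
  define u where "u j = min hi (lo + real j * ep + v)" for j :: nat
  have u: "grid_in u"
   unfolding grid_in_def
  proof
   show "mono u"
   proof (rule monoI)
    fix i j :: nat assume "i <= j"
    then have "real i * ep <= real j * ep" using ep by (intro mult_right_mono) auto
    then show "u i <= u j" unfolding u_def by auto
   qed
   show "range u \<subseteq> {lo..hi}" using v ep lohi by (auto simp: u_def)
  qed
  have ul: "u j = lo + real j * ep + v" if "j <= n" for j
  proof -
   have "real j * ep <= real n * ep" using that ep by (intro mult_right_mono) auto
   then have "lo + real j * ep + v <= hi" using n(1) v t by auto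
   then show ?thesis by (simp add: u_def)
  qed
  have uin: "u j \<in> {lo..hi}" for j using grid_inD[OF u] by auto
  have eq: "S v w = tr u n Z m hi w" for w
   unfolding S_def tr_def
  proof (intro sum.cong refl)
   fix j assume "j \<in> {..<n}"
   then have j: "j < n" by simp
   have "(real j + 1) * ep <= real n * ep" using j ep by (intro mult_right_mono) auto
   then have "u j \<in> {lo..t}" using n(1) v t ep ul[of j] j by (auto simp: distrib_right)
   then have 1: "U' (lo + real j * ep + v) w = Z (u j) w" using ctid[of "u j"] ul[of j] j by (simp add: U'_def Z_def)
   have 2: "lo + real j * ep + v + ep = u (Suc j)" using ul[of "Suc j"] j by (simp add: distrib_right)
   have 3: "min (u (Suc j)) hi = u (Suc j)" "min (u j) hi = u j" using uin[of j] uin[of "Suc j"] by auto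
   show "g (lo + real j * ep + v) w = Z (u j) w * (m (min (u (Suc j)) hi) w - m (min (u j) hi) w)"
    unfolding g_def 1 2 3 using ul[of j] j ext_id[OF uin[of j], of m] ext_id[OF uin[of "Suc j"], of m] by simp
  qed
  have lt: "lo <= lo" "lo <= hi" "hi <= hi" and loin: "lo \<in> {lo..hi}" "hi \<in> {lo..hi}" using lohi by auto
  note tl = tr_L2[OF m u Zm Zb Z0 lt]
  have Sq: "integrable P (\<lambda>w. (S v w)\<^sup>2)" "(\<integral>w. (S v w)\<^sup>2 \<partial>P) <= dl\<^sup>2 * k\<^sup>2"
  proof -
   show "integrable P (\<lambda>w. (S v w)\<^sup>2)" unfolding eq by (rule tl(1))
   have "(\<integral>w. (m hi w)\<^sup>2 \<partial>P) - (\<integral>w. (m lo w)\<^sup>2 \<partial>P) <= k\<^sup>2"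
    using mart_sq_le(1)[OF m loin(2)] mart_sq_le(2)[OF m loin(1)] by linarith
   then have "dl\<^sup>2 * ((\<integral>w. (m hi w)\<^sup>2 \<partial>P) - (\<integral>w. (m lo w)\<^sup>2 \<partial>P)) <= dl\<^sup>2 * k\<^sup>2" by (intro mult_left_mono) auto
   from order_trans[OF tl(2) this] show "(\<integral>w. (S v w)\<^sup>2 \<partial>P) <= dl\<^sup>2 * k\<^sup>2" unfolding eq .
  qed
  \<comment> \<open>The size of \<open>S v\<close> in mean square up to the 1 that keeps it
    positive; with this weight the inequality of arithmetic and geometric means yields a first
    moment bound by the same \<open>c\<close>.\<close>
  define c where "c = dl * (k + 1)"
  have c: "0 < c" using dl k by (simp add: c_def)
  have am: "\<bar>y\<bar> <= (y\<^sup>2 / c + c) / 2" for y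
  proof -
   have "0 <= (\<bar>y\<bar> - c)\<^sup>2" by simp
   then have "2 * \<bar>y\<bar> * c <= y\<^sup>2 + c * c" by (simp add: power2_eq_square algebra_simps abs_mult_self_eq)
   then have "\<bar>y\<bar> * (2 * c) / (2 * c) <= (y\<^sup>2 + c * c) / (2 * c)" using c by (intro divide_right_mono) auto
   also have "(y\<^sup>2 + c * c) / (2 * c) = (y\<^sup>2 / c + c) / 2" using c by (simp add: field_simps)
   finally show ?thesis using c by simp
  qed
  have "(\<integral>\<^sup>+w. ennreal \<bar>S v w\<bar> * indicator (space P) w \<partial>P) <= (\<integral>\<^sup>+w. ennreal (((S v w)\<^sup>2 / c + c) / 2) \<partial>P)"
   by (rule nn_integral_mono) (use am in \<open>simp add: ennreal_leI\<close>)
  also have "... = ennreal (\<integral>w. ((S v w)\<^sup>2 / c + c) / 2 \<partial>P)"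
   by (rule nn_integral_eq_integral) (use Sq(1) c in auto)
  also have "(\<integral>w. ((S v w)\<^sup>2 / c + c) / 2 \<partial>P) = ((\<integral>w. (S v w)\<^sup>2 \<partial>P) / c + c) / 2"
   using Sq(1) prob_space by simp
  also have "... <= (dl\<^sup>2 * k\<^sup>2 / c + c) / 2" using Sq(2) c by (intro divide_right_mono add_right_mono) auto
  also have "... <= c"
  proof -
   have "dl\<^sup>2 * k\<^sup>2 <= dl\<^sup>2 * (k + 1)\<^sup>2" using k by (intro mult_left_mono power_mono) auto
   also have "... = c * c" by (simp add: c_def power2_eq_square)
   finally have "dl\<^sup>2 * k\<^sup>2 / c <= c" using c by (simp add: field_simps)
   then show ?thesis by simp
  qed
  finally show ?thesis by (simp add: c_def ennreal_leI)
 qed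
 define h where "h w = (\<integral>\<^sup>+v. ennreal \<bar>S v w\<bar> * indicator {0..ep} v \<partial>lborel)" for w
 have am: "(\<lambda>w. \<bar>S v w\<bar>) \<in> bm P" for v by measurable
 have ac: "continuous_on UNIV (\<lambda>v. \<bar>S v w\<bar>)" if "w \<in> space P" for w by (intro continuous_intros Sc that)
 have hm: "h \<in> bm P" unfolding h_def[abs_def] by (rule nn_integral_swap(2)[OF am ac sets.top])
 have "(\<integral>\<^sup>+w. h w \<partial>P) = (\<integral>\<^sup>+w. h w * indicator (space P) w \<partial>P)" by (rule nn_integral_cong) simp
 also have "... = (\<integral>\<^sup>+v. (\<integral>\<^sup>+w. ennreal \<bar>S v w\<bar> * indicator (space P) w \<partial>P) * indicator {0..ep} v \<partial>lborel)"
  unfolding h_def by (rule nn_integral_swap(1)[OF am ac sets.top])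
 also have "... <= (\<integral>\<^sup>+v. ennreal (dl * (k + 1)) * indicator {0..ep} v \<partial>lborel)"
  by (rule nn_integral_mono) (use L1 in \<open>auto simp: indicator_def\<close>)
 also have "... = ennreal (ep * (dl * (k + 1)))"
  by (subst nn_integral_cmult_indicator) (use ep dl k in \<open>auto simp: ennreal_mult[symmetric] mult.commute\<close>)
 finally have hint: "(\<integral>\<^sup>+w. h w \<partial>P) <= ennreal (ep * (dl * (k + 1)))" .
 have pos: "0 < ep * (dl * (k + 1))" using ep dl k by simp
 obtain B where B: "B \<in> sets P" "measure P B <= kp" "\<And>w. w \<in> space P - B ==> h w <= ennreal (ep * (dl * (k + 1)) / kp)"
  using markov_set[OF hm hint pos kp] by blast
 have "\<bar>integral {lo..t} (\<lambda>s. U s w * (incr ep m s w))\<bar> <= ep * dl * ((k + 1) / kp + 2 * k)"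
  if w: "w \<in> space P - B" for w
 proof -
  have ws: "w \<in> space P" using w by simp
  have "integral {lo..t} (\<lambda>s. U s w * (incr ep m s w)) = integral {lo..t} (\<lambda>s. g s w)"
   by (rule Henstock_Kurzweil_Integration.integral_cong) (simp add: g_def U'_def ctid)
  also have "... = integral {lo..lo + real n * ep} (\<lambda>s. g s w) + integral {lo + real n * ep..t} (\<lambda>s. g s w)"
   by (rule Henstock_Kurzweil_Integration.integral_combine[symmetric])
     (use n ep in \<open>auto intro!: integrable_continuous_interval gc ws\<close>)
  finally have split: "integral {lo..t} (\<lambda>s. U s w * (incr ep m s w))
   = integral {lo..lo + real n * ep} (\<lambda>s. g s w) + integral {lo + real n * ep..t} (\<lambda>s. g s w)" .
  have "\<bar>integral {lo + real n * ep..t} (\<lambda>s. g s w)\<bar> <= dl * (2 * k) * (t - (lo + real n * ep))"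
   using integral_bound[of "lo + real n * ep" t "\<lambda>s. g s w" "dl * (2 * k)"] gc[OF ws] gb[OF ws] n by auto
  also have "... <= dl * (2 * k) * ep" using n dl k by (intro mult_left_mono) auto
  finally have r: "\<bar>integral {lo + real n * ep..t} (\<lambda>s. g s w)\<bar> <= dl * (2 * k) * ep" .
  have "integral {lo..lo + real n * ep} (\<lambda>s. g s w) = integral {0..ep} (\<lambda>v. S v w)"
   unfolding S_def by (rule block_integral[OF ep gc[OF ws]])
  also have "\<bar>...\<bar> <= integral {0..ep} (\<lambda>v. \<bar>S v w\<bar>)"
   using integral_norm_bound_integral[of "\<lambda>v. S v w" "{0..ep}" "\<lambda>v. \<bar>S v w\<bar>"]
   by (simp add: integrable_continuous_interval Sc[OF ws] continuous_on_rabs)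
  finally have b1: "\<bar>integral {lo..lo + real n * ep} (\<lambda>s. g s w)\<bar> <= integral {0..ep} (\<lambda>v. \<bar>S v w\<bar>)" .
  have "h w = ennreal (integral {0..ep} (\<lambda>v. \<bar>S v w\<bar>))"
   unfolding h_def by (rule nn_integral_eq_integral_Icc) (auto intro!: continuous_on_rabs Sc ws)
  then have "ennreal (integral {0..ep} (\<lambda>v. \<bar>S v w\<bar>)) <= ennreal (ep * (dl * (k + 1)) / kp)" using B(3)[OF w] by simp
  then have "integral {0..ep} (\<lambda>v. \<bar>S v w\<bar>) <= ep * (dl * (k + 1)) / kp"
   by (rule ennreal_le_iff[THEN iffD1, rotated]) (use pos kp in simp)
  moreover have "ep * dl * ((k + 1) / kp + 2 * k) = ep * (dl * (k + 1)) / kp + dl * (2 * k) * ep"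
   by (simp add: algebra_simps add_divide_distrib)
  ultimately show ?thesis using split r b1 by linarith
 qed
 then show ?thesis using B(1,2) by blast
qed

end

section \<open>The covariation of a window functional with a martingale\<close>

context prob_space
begin

text \<open>Convergence in probability as a budget: for all small \<open>ep\<close> the property
  holds off an event of probability at most \<open>kp\<close> that may depend on \<open>ep\<close>.
  Finitely many such properties are combined by adding budgets.\<close>

definition ev_prob :: "real => (real => 'a => bool) => bool" where
 "ev_prob kp Q \<longleftrightarrow> (\<exists>ep0>0. \<forall>ep. 0 < ep \<and> ep <= ep0 \<longrightarrow> (\<exists>B\<in>events. prob B <= kp \<and> (\<forall>w\<in>space M - B. Q ep w)))"

lemma ev_probI:
 assumes "0 < ep0" "\<And>ep. 0 < ep ==> ep <= ep0 ==> \<exists>B\<in>events. prob B <= kp \<and> (\<forall>w\<in>space M - B. Q ep w)"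
 shows "ev_prob kp Q"
 using assms unfolding ev_prob_def by blast

lemma ev_prob_conj:
 assumes "ev_prob kp1 Q1" "ev_prob kp2 Q2" shows "ev_prob (kp1 + kp2) (\<lambda>ep w. Q1 ep w \<and> Q2 ep w)"
proof -
 obtain e1 where e1: "0 < e1" "\<And>ep. 0 < ep ==> ep <= e1 ==> \<exists>B\<in>events. prob B <= kp1 \<and> (\<forall>w\<in>space M - B. Q1 ep w)"
  using assms(1) unfolding ev_prob_def by blast
 obtain e2 where e2: "0 < e2" "\<And>ep. 0 < ep ==> ep <= e2 ==> \<exists>B\<in>events. prob B <= kp2 \<and> (\<forall>w\<in>space M - B. Q2 ep w)"
  using assms(2) unfolding ev_prob_def by blast
 show ?thesis
 proof (rule ev_probI[of "min e1 e2"])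
  fix ep :: real assume e: "0 < ep" "ep <= min e1 e2"
  obtain B1 where B1: "B1 \<in> events" "prob B1 <= kp1" "\<forall>w\<in>space M - B1. Q1 ep w" using e1(2)[of ep] e by auto
  obtain B2 where B2: "B2 \<in> events" "prob B2 <= kp2" "\<forall>w\<in>space M - B2. Q2 ep w" using e2(2)[of ep] e by auto
  have "prob (B1 \<union> B2) <= kp1 + kp2" using measure_Un_le[OF B1(1) B2(1)] B1(2) B2(2) by linarith
  then show "\<exists>B\<in>events. prob B <= kp1 + kp2 \<and> (\<forall>w\<in>space M - B. Q1 ep w \<and> Q2 ep w)"
   using B1 B2 by (intro bexI[of _ "B1 \<union> B2"]) auto
 qed (use e1 e2 in auto)
qed

lemma ev_prob_mono:
 assumes "ev_prob kp Q" "0 < ep1" "\<And>ep w. 0 < ep ==> ep <= ep1 ==> w \<in> space M ==> Q ep w ==> Q' ep w"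
 shows "ev_prob kp Q'"
proof -
 obtain e1 where e1: "0 < e1" "\<And>ep. 0 < ep ==> ep <= e1 ==> \<exists>B\<in>events. prob B <= kp \<and> (\<forall>w\<in>space M - B. Q ep w)"
  using assms(1) unfolding ev_prob_def by blast
 show ?thesis
 proof (rule ev_probI[of "min e1 ep1"])
  fix ep :: real assume e: "0 < ep" "ep <= min e1 ep1"
  obtain B where B: "B \<in> events" "prob B <= kp" "\<forall>w\<in>space M - B. Q ep w" using e1(2)[of ep] e by auto
  then show "\<exists>B\<in>events. prob B <= kp \<and> (\<forall>w\<in>space M - B. Q' ep w)"
   using assms(3)[of ep] e by (intro bexI[of _ B]) auto
 qed (use e1 assms in auto)
qed

lemma ev_prob_set:
 assumes "B \<in> events" "prob B <= kp" "\<And>w. w \<in> space M - B ==> Q w" shows "ev_prob kp (\<lambda>_. Q)"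
 by (rule ev_probI[of 1]) (use assms in auto)

lemma ev_prob_all:
 assumes "\<And>k. k <= n ==> ev_prob kp (Q k)" shows "ev_prob (real (Suc n) * kp) (\<lambda>ep w. \<forall>k\<le>(n::nat). Q k ep w)"
 using assms
proof (induction n)
 case (Suc n)
 have "ev_prob (real (Suc n) * kp) (\<lambda>ep w. \<forall>k\<le>n. Q k ep w)" by (rule Suc.IH) (use Suc.prems in auto)
 from ev_prob_conj[OF this Suc.prems[OF order_refl]]
 have "ev_prob (real (Suc n) * kp + kp) (\<lambda>ep w. (\<forall>k\<le>n. Q k ep w) \<and> Q (Suc n) ep w)" .
 moreover have "real (Suc n) * kp + kp = real (Suc (Suc n)) * kp" by (simp add: distrib_right)
 ultimately have "ev_prob (real (Suc (Suc n)) * kp) (\<lambda>ep w. (\<forall>k\<le>n. Q k ep w) \<and> Q (Suc n) ep w)" by (simp only:)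
 then show ?case by (rule ev_prob_mono[of _ _ 1]) (auto simp: le_Suc_eq)
qed simp

lemma conv_prob_ev:
 assumes Z: "cf_conv_prob M Z L" and dl: "0 < dl" and kp: "0 < kp"
 shows "ev_prob kp (\<lambda>ep w. \<bar>Z ep w - L w\<bar> <= dl)"
proof -
 have "((\<lambda>ep. prob {w\<in>space M. dl < \<bar>Z ep w - L w\<bar>}) \<longlongrightarrow> 0) (at_right 0)"
  using Z dl unfolding cf_conv_prob_def by auto
 then have "eventually (\<lambda>ep. prob {w\<in>space M. dl < \<bar>Z ep w - L w\<bar>} < kp) (at_right 0)"
  using kp by (rule order_tendstoD(2))
 then obtain e0 where e0: "0 < e0" "\<And>ep. 0 < ep ==> ep < e0 ==> prob {w\<in>space M. dl < \<bar>Z ep w - L w\<bar>} < kp"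
  unfolding eventually_at_right_field by auto
 show ?thesis
 proof (rule ev_probI[of "e0 / 2"])
  fix ep :: real assume e: "0 < ep" "ep <= e0 / 2"
  have [measurable]: "Z ep \<in> bm M" "L \<in> bm M" using Z e unfolding cf_conv_prob_def by auto
  have "{w\<in>space M. dl < \<bar>Z ep w - L w\<bar>} \<in> events" by measurable
  then show "\<exists>B\<in>events. prob B <= kp \<and> (\<forall>w\<in>space M - B. \<bar>Z ep w - L w\<bar> <= dl)"
   using e0(2)[of ep] e e0(1) by (intro bexI[of _ "{w\<in>space M. dl < \<bar>Z ep w - L w\<bar>}"]) auto
 qed (use e0 in auto)
qed

lemma conv_prob_zeroI:
 assumes Z: "\<And>ep. 0 < ep ==> Z ep \<in> bm M"
  and ev: "\<And>dl kp. 0 < dl ==> 0 < kp ==> ev_prob kp (\<lambda>ep w. \<bar>Z ep w\<bar> <= dl)"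
 shows "cf_conv_prob M Z (\<lambda>_. 0)"
 unfolding cf_conv_prob_def
proof (intro conjI allI impI)
 fix dl :: real assume dl: "0 < dl"
 show "((\<lambda>ep. prob {w\<in>space M. dl < \<bar>Z ep w - 0\<bar>}) \<longlongrightarrow> 0) (at_right 0)"
 proof (rule order_tendstoI)
  fix kp :: real assume kp: "0 < kp"
  then have kp2: "0 < kp / 2" by simp
  obtain e0 where e0: "0 < e0" "\<And>ep. 0 < ep ==> ep <= e0 ==>
   \<exists>B\<in>events. prob B <= kp / 2 \<and> (\<forall>w\<in>space M - B. \<bar>Z ep w\<bar> <= dl)"
   using ev[OF dl kp2] unfolding ev_prob_def by blast
  show "eventually (\<lambda>ep. prob {w\<in>space M. dl < \<bar>Z ep w - 0\<bar>} < kp) (at_right 0)"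
   unfolding eventually_at_right_field
  proof (intro exI[of _ e0] conjI allI impI e0(1))
   fix ep :: real assume e: "0 < ep" "ep < e0"
   obtain B where B: "B \<in> events" "prob B <= kp / 2" "\<forall>w\<in>space M - B. \<bar>Z ep w\<bar> <= dl"
    using e0(2)[of ep] e by auto
   have "prob {w\<in>space M. dl < \<bar>Z ep w - 0\<bar>} <= prob B"
    by (rule finite_measure_mono[OF _ B(1)]) (use B(3) in force)
   then show "prob {w\<in>space M. dl < \<bar>Z ep w - 0\<bar>} < kp" using B(2) kp by linarith
  qed
 next
  fix l :: real assume l: "l < 0"
  show "eventually (\<lambda>ep. l < prob {w\<in>space M. dl < \<bar>Z ep w - 0\<bar>}) (at_right 0)"
   by (intro always_eventually allI less_le_trans[OF l measure_nonneg])
 qed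
qed (use Z in auto)

end

text \<open>Freeze \<open>h\<close> at the left end of each of the \<open>n\<close> blocks. The
  integral of \<open>g\<close> over a block is a difference of two initial integrals, hence at most
  \<open>2 * c\<close>; the oscillation of \<open>h\<close> is paid for with the integral of the
  absolute value of \<open>g\<close>.\<close>

lemma step_weight_integral:
 fixes h g :: "real => real"
 assumes n: "0 < (n::nat)" and t: "a <= t" and hc: "continuous_on UNIV h" and gc: "continuous_on UNIV g"
  and hdl: "\<And>s s'. \<bar>s - s'\<bar> <= (t - a) / real n ==> \<bar>h s - h s'\<bar> <= dl" and hR: "\<And>s. \<bar>h s\<bar> <= R"
  and gint: "\<And>k. k <= n ==> \<bar>integral {a..a + real k * ((t - a) / real n)} g\<bar> <= c"
 shows "\<bar>integral {a..t} (\<lambda>s. h s * g s)\<bar> <= 2 * real n * R * c + dl * integral {a..t} (\<lambda>s. \<bar>g s\<bar>)"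
proof -
 define w where "w = (t - a) / real n"
 have w0: "0 <= w" using t by (simp add: w_def)
 define p where "p k = a + real k * w" for k :: nat
 have int: "f integrable_on {u..v}" if "continuous_on UNIV f" for f :: "real => real" and u v
  by (rule integrable_continuous_interval) (rule continuous_on_subset[OF that subset_UNIV])
 have ci: "continuous_on UNIV (\<lambda>s. h s * g s)" "continuous_on UNIV (\<lambda>s. \<bar>g s\<bar>)" by (intro continuous_intros hc gc)+
 have "\<bar>integral {a..p k} (\<lambda>s. h s * g s)\<bar> <= 2 * real k * R * c + dl * integral {a..p k} (\<lambda>s. \<bar>g s\<bar>)" if "k <= n" for k
  using that
 proof (induction k)
  case (Suc k)
  have le: "a <= p k" "p k <= p (Suc k)" using w0 by (auto simp: p_def distrib_right)
  have comb: "integral {a..p k} f + integral {p k..p (Suc k)} f = integral {a..p (Suc k)} f"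
   if "continuous_on UNIV f" for f :: "real => real"
   by (rule Henstock_Kurzweil_Integration.integral_combine[OF le int[OF that]])
  have R0: "0 <= R" using hR[of 0] by linarith
  have g1: "\<bar>integral {p k..p (Suc k)} g\<bar> <= 2 * c"
   using comb[OF gc] gint[of k] gint[of "Suc k"] Suc.prems unfolding p_def w_def by simp
  have cd: "continuous_on UNIV (\<lambda>s. (h s - h (p k)) * g s)" "continuous_on UNIV (\<lambda>s. h (p k) * g s)"
   "continuous_on UNIV (\<lambda>s. dl * \<bar>g s\<bar>)"
   by (intro continuous_intros hc gc)+
  have "integral {p k..p (Suc k)} (\<lambda>s. h s * g s) = integral {p k..p (Suc k)} (\<lambda>s. (h s - h (p k)) * g s + h (p k) * g s)"
   by (simp add: algebra_simps)
  also have "... = integral {p k..p (Suc k)} (\<lambda>s. (h s - h (p k)) * g s) + h (p k) * integral {p k..p (Suc k)} g"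
   using Henstock_Kurzweil_Integration.integral_add[OF int[OF cd(1)] int[OF cd(2)]] by simp
  finally have s: "integral {p k..p (Suc k)} (\<lambda>s. h s * g s) =
   integral {p k..p (Suc k)} (\<lambda>s. (h s - h (p k)) * g s) + h (p k) * integral {p k..p (Suc k)} g" .
  have "norm (integral {p k..p (Suc k)} (\<lambda>s. (h s - h (p k)) * g s)) <= integral {p k..p (Suc k)} (\<lambda>s. dl * \<bar>g s\<bar>)"
  proof (rule integral_norm_bound_integral[OF int[OF cd(1)] int[OF cd(3)]])
   fix s assume s: "s \<in> {p k..p (Suc k)}"
   then have "\<bar>h s - h (p k)\<bar> <= dl" by (intro hdl) (auto simp: p_def w_def[symmetric] distrib_right)
   then show "norm ((h s - h (p k)) * g s) <= dl * \<bar>g s\<bar>" by (simp add: abs_mult mult_right_mono)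
  qed
  then have 1: "\<bar>integral {p k..p (Suc k)} (\<lambda>s. (h s - h (p k)) * g s)\<bar> <= dl * integral {p k..p (Suc k)} (\<lambda>s. \<bar>g s\<bar>)" by simp
  have 2: "\<bar>h (p k) * integral {p k..p (Suc k)} g\<bar> <= R * (2 * c)" unfolding abs_mult by (rule mult_mono[OF hR g1 R0]) simp
  have 3: "dl * integral {a..p (Suc k)} (\<lambda>s. \<bar>g s\<bar>) = dl * integral {a..p k} (\<lambda>s. \<bar>g s\<bar>) + dl * integral {p k..p (Suc k)} (\<lambda>s. \<bar>g s\<bar>)"
   using comb[OF ci(2)] by (simp add: distrib_left[symmetric])
  have 4: "2 * real (Suc k) * R * c = 2 * real k * R * c + R * (2 * c)" by (simp add: algebra_simps)
  have "\<bar>integral {a..p k} (\<lambda>s. h s * g s)\<bar> <= 2 * real k * R * c + dl * integral {a..p k} (\<lambda>s. \<bar>g s\<bar>)" using Suc by simp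
  then show ?case using comb[OF ci(1)] s 1 2 3 4 by linarith
 qed (simp add: p_def)
 moreover have "p n = t" using n by (simp add: p_def w_def)
 ultimately show ?thesis by force
qed

section \<open>The pathwise covariation estimate\<close>

abbreviation (input) inc :: "real => (real => real) => real => real" where
 "inc ep f s \<equiv> f (s + ep) - f s"

lemma amgm_weighted: "0 < c ==> \<bar>u\<bar> * \<bar>v\<bar> <= u\<^sup>2 / (2 * c) + c * v\<^sup>2 / 2" for u v c :: real
proof -
 assume c: "0 < c"
 have "(\<bar>u\<bar> - c * \<bar>v\<bar>)\<^sup>2 = u\<^sup>2 + c * c * v\<^sup>2 - 2 * c * (\<bar>u\<bar> * \<bar>v\<bar>)"
  by (simp add: power2_diff power_mult_distrib power2_eq_square[of c])
 then have "0 <= (u\<^sup>2 + c * c * v\<^sup>2 - 2 * c * (\<bar>u\<bar> * \<bar>v\<bar>)) / (2 * c)"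
  using c by (metis divide_nonneg_pos mult_pos_pos zero_le_power2 zero_less_numeral)
 moreover have "c * c * v\<^sup>2 / (2 * c) = c * v\<^sup>2 / 2" "2 * c * (\<bar>u\<bar> * \<bar>v\<bar>) / (2 * c) = \<bar>u\<bar> * \<bar>v\<bar>"
  using c by auto
 ultimately show ?thesis unfolding diff_divide_distrib add_divide_distrib by linarith
qed

text \<open>The deterministic core. For one outcome, \<open>y\<close> is the functional,
  \<open>i\<close> the stochastic integral, \<open>h\<close> the derivative along the windows,
  \<open>x\<close> and \<open>m\<close> the paths of X and M, \<open>n\<close> the test martingale,
  \<open>U\<close> the part known at time \<open>s\<close> and \<open>p\<close> the error from the
  mass near 0. Integrals stop at \<open>t'\<close> because the expansion needs
  \<open>s + ep <= b\<close>. The constant rounds up: \<open>1 + 1 / 2\<close> to 2 and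
  \<open>3 / 2 * E\<close> to \<open>2 * E\<close>.\<close>

lemma covariation_estimate:
 fixes y i h x m n U p :: "real => real"
 assumes ep: "0 < ep" "ep <= b - a" and t: "a <= t" "t <= b" and dl: "0 < dl"
 defines "t' \<equiv> min t (b - ep)"
 assumes c: "continuous_on UNIV y" "continuous_on UNIV i" "continuous_on UNIV h" "continuous_on UNIV x"
   "continuous_on UNIV m" "continuous_on UNIV n" "continuous_on {a..t'} U" "continuous_on {a..t'} p"
  and U: "\<bar>integral {a..t'} (\<lambda>s. U s * inc ep n s)\<bar> <= ep * dl * C1"
  and q: "\<And>s. s \<in> {a..t'} ==> \<bar>inc ep y s - U s - h s * inc ep x s\<bar> <= dl * \<bar>inc ep x s\<bar> + p s"
   "\<And>s. s \<in> {a..t'} ==> 0 <= p s"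
  and p: "integral {a..t'} p <= C2 * ep\<^sup>2"
  and v: "integral {a..t'} (\<lambda>s. (inc ep i s - h s * inc ep m s)\<^sup>2) <= dl\<^sup>2 * ep"
  and ex: "integral {a..b} (\<lambda>s. (inc ep x s)\<^sup>2) <= E * ep"
  and en: "integral {a..b} (\<lambda>s. (inc ep n s)\<^sup>2) <= E * ep"
  and w: "\<bar>integral {a..t} (\<lambda>s. h s * (inc ep x s - inc ep m s) * inc ep n s)\<bar> <= dl * ep"
  and R: "\<And>s. \<bar>y s\<bar> <= R" "\<And>s. \<bar>i s\<bar> <= R" "\<And>s. \<bar>h s\<bar> <= R" "\<And>s. \<bar>x s\<bar> <= R" "\<And>s. \<bar>m s\<bar> <= R" "\<And>s. \<bar>n s\<bar> <= R"
  and ndl: "\<And>s. \<bar>inc ep n s\<bar> <= dl"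
 shows "\<bar>integral {a..t} (\<lambda>s. (inc ep y s - inc ep i s) * inc ep n s)\<bar>
  <= ep * dl * (C1 + 2 + 2 * E + 4 * R + 4 * R\<^sup>2) + 2 * R * C2 * ep\<^sup>2"
proof -
 have t': "a <= t'" "t' <= t" "t - t' <= ep" "t' <= b" using ep t by (auto simp: t'_def)
 have R0: "0 <= R" using R(1)[of 0] by linarith
 have sh: "continuous_on A (\<lambda>s. f (s + ep))" "continuous_on A f" if "continuous_on UNIV f" for f :: "real => real" and A
  by (rule continuous_on_compose2[OF that]) (auto intro!: continuous_intros continuous_on_subset[OF that])
 have sh2: "continuous_on A (\<lambda>s. inc ep f s)" if "continuous_on UNIV f" for f :: "real => real" and A
  by (intro continuous_on_diff sh[OF that])
 note cc = c(1-6)[THEN sh(1)] c(1-6)[THEN sh(2)] c(1-6)[THEN sh2]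
 define J where "J s = (inc ep y s - inc ep i s) * inc ep n s" for s
 define W where "W s = h s * (inc ep x s - inc ep m s) * inc ep n s" for s
 define V where "V s = inc ep i s - h s * inc ep m s" for s
 \<comment> \<open>What remains of the increment of \<open>y - i\<close> after removing
   \<open>U\<close> and the orthogonal part \<open>h\<close> times the increment of
   \<open>x - m\<close>.\<close>
 define r where "r s = inc ep y s - U s - h s * inc ep x s - V s" for s
 have cJ: "continuous_on A J" and cW: "continuous_on A W" and cV: "continuous_on A V" for A
  unfolding J_def W_def V_def by (intro continuous_intros cc)+
 have cU: "continuous_on {a..t'} (\<lambda>s. U s * inc ep n s)" by (intro continuous_on_mult cc c(7))
 have cr: "continuous_on {a..t'} (\<lambda>s. r s * inc ep n s)" unfolding r_def by (intro continuous_intros cc c(7) cV)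
 note ii = integrable_continuous_interval
 have "integral {a..t'} J = integral {a..t'} (\<lambda>s. U s * inc ep n s + W s + r s * inc ep n s)"
  by (rule arg_cong2[where f=integral]) (auto simp: J_def W_def r_def V_def algebra_simps)
 also have "... = integral {a..t'} (\<lambda>s. U s * inc ep n s) + integral {a..t'} W + integral {a..t'} (\<lambda>s. r s * inc ep n s)"
  using Henstock_Kurzweil_Integration.integral_add[OF integrable_add[OF ii[OF cU] ii[OF cW]] ii[OF cr]]
   Henstock_Kurzweil_Integration.integral_add[OF ii[OF cU] ii[OF cW]] by simp
 finally have J1: "integral {a..t'} J = integral {a..t'} (\<lambda>s. U s * inc ep n s) + integral {a..t'} W + integral {a..t'} (\<lambda>s. r s * inc ep n s)" .
 have comb: "integral {a..t'} f + integral {t'..t} f = integral {a..t} f" if "\<And>A. continuous_on A f" for f :: "real => real"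
  by (rule Henstock_Kurzweil_Integration.integral_combine[OF t'(1,2) ii[OF that]])
 \<comment> \<open>An interval of length at most \<open>ep\<close> on which the small increments of
   \<open>n\<close> suffice.\<close>
 have tail: "\<bar>integral {t'..t} f\<bar> <= ep * B" if f: "\<And>A. continuous_on A f" "\<And>s. \<bar>f s\<bar> <= B" for f :: "real => real" and B
 proof -
  have "0 <= B" using f(2)[of 0] by linarith
  have "\<bar>integral {t'..t} f\<bar> <= B * (t - t')" using integral_bound[OF t'(2) f(1), of B] f(2) by simp
  also have "... <= B * ep" using t' \<open>0 <= B\<close> by (intro mult_left_mono) auto
  finally show ?thesis by (simp add: mult.commute)
 qed
 have inc2: "\<bar>inc ep f s\<bar> <= 2 * R" if "\<And>s. \<bar>f s\<bar> <= R" for f :: "real => real" and s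
  using that[of s] that[of "s + ep"] by linarith
 have T1: "\<bar>integral {t'..t} J\<bar> <= ep * (4 * R * dl)"
 proof (rule tail[OF cJ])
  show "\<bar>J s\<bar> <= 4 * R * dl" for s unfolding J_def abs_mult
   using inc2[of y s, OF R(1)] inc2[of i s, OF R(2)] ndl[of s] R0 dl by (intro mult_mono) auto
 qed
 have T2: "\<bar>integral {t'..t} W\<bar> <= ep * (R * (4 * R) * dl)"
 proof (rule tail[OF cW])
  show "\<bar>W s\<bar> <= R * (4 * R) * dl" for s unfolding W_def abs_mult
   using inc2[of x s, OF R(4)] inc2[of m s, OF R(5)] ndl[of s] R(3)[of s] R0 dl by (intro mult_mono) auto
 qed
 have E: "integral {a..t'} (\<lambda>s. (f s)\<^sup>2) <= integral {a..b} (\<lambda>s. (f s)\<^sup>2)" if "\<And>A. continuous_on A f" for f :: "real => real"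
  by (rule integral_subset_le) (use t' in \<open>auto intro!: ii continuous_intros that\<close>)
 \<comment> \<open>The product of the increments of \<open>x\<close> and \<open>n\<close> already
   carries a factor \<open>dl\<close>, so equal weights do. For \<open>V\<close>, whose energy is
   \<open>dl\<^sup>2 * ep\<close>, the weights \<open>1 / dl\<close> and \<open>dl\<close> bring
   both halves to order \<open>dl * ep\<close>.\<close>
 define bd where "bd s = (dl / 2) * (inc ep x s)\<^sup>2 + dl * (inc ep n s)\<^sup>2 + 2 * R * p s + (1 / (2 * dl)) * (V s)\<^sup>2" for s
 have hx: "((\<lambda>s. (inc ep x s)\<^sup>2) has_integral integral {a..t'} (\<lambda>s. (inc ep x s)\<^sup>2)) {a..t'}"
  and hn: "((\<lambda>s. (inc ep n s)\<^sup>2) has_integral integral {a..t'} (\<lambda>s. (inc ep n s)\<^sup>2)) {a..t'}"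
  and hp: "(p has_integral integral {a..t'} p) {a..t'}"
  and hV: "((\<lambda>s. (V s)\<^sup>2) has_integral integral {a..t'} (\<lambda>s. (V s)\<^sup>2)) {a..t'}"
  by (intro integrable_integral ii continuous_on_power cc c(8) cV)+
 have hb: "(bd has_integral ((dl / 2) * integral {a..t'} (\<lambda>s. (inc ep x s)\<^sup>2) + dl * integral {a..t'} (\<lambda>s. (inc ep n s)\<^sup>2)
   + 2 * R * integral {a..t'} p + (1 / (2 * dl)) * integral {a..t'} (\<lambda>s. (V s)\<^sup>2))) {a..t'}"
  unfolding bd_def by (intro has_integral_add has_integral_mult_right hx hn hp hV)
 have "norm (integral {a..t'} (\<lambda>s. r s * inc ep n s)) <= integral {a..t'} bd"
 proof (rule integral_norm_bound_integral[OF ii[OF cr] has_integral_integrable[OF hb]])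
  fix s assume s: "s \<in> {a..t'}"
  have "\<bar>r s\<bar> <= dl * \<bar>inc ep x s\<bar> + p s + \<bar>V s\<bar>" using q(1)[OF s] unfolding r_def by linarith
  then have "\<bar>r s\<bar> * \<bar>inc ep n s\<bar> <= (dl * \<bar>inc ep x s\<bar> + p s + \<bar>V s\<bar>) * \<bar>inc ep n s\<bar>" by (rule mult_right_mono) simp
  also have "... = dl * (\<bar>inc ep x s\<bar> * \<bar>inc ep n s\<bar>) + \<bar>inc ep n s\<bar> * p s + \<bar>V s\<bar> * \<bar>inc ep n s\<bar>" by (simp only: algebra_simps)
  finally have a1: "\<bar>r s\<bar> * \<bar>inc ep n s\<bar> <= dl * (\<bar>inc ep x s\<bar> * \<bar>inc ep n s\<bar>) + \<bar>inc ep n s\<bar> * p s + \<bar>V s\<bar> * \<bar>inc ep n s\<bar>" .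
  have a2: "dl * (\<bar>inc ep x s\<bar> * \<bar>inc ep n s\<bar>) <= dl * ((inc ep x s)\<^sup>2 / (2 * 1) + 1 * (inc ep n s)\<^sup>2 / 2)"
   using dl by (intro mult_left_mono amgm_weighted) auto
  have a3: "\<bar>inc ep n s\<bar> * p s <= 2 * R * p s" by (rule mult_right_mono[OF inc2[of n s, OF R(6)] q(2)[OF s]])
  have a4: "\<bar>V s\<bar> * \<bar>inc ep n s\<bar> <= (V s)\<^sup>2 / (2 * dl) + dl * (inc ep n s)\<^sup>2 / 2" by (rule amgm_weighted[OF dl])
  have "bd s = dl * ((inc ep x s)\<^sup>2 / (2 * 1) + 1 * (inc ep n s)\<^sup>2 / 2) + 2 * R * p s + ((V s)\<^sup>2 / (2 * dl) + dl * (inc ep n s)\<^sup>2 / 2)"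
   unfolding bd_def by (simp add: distrib_left)
  then show "norm (r s * inc ep n s) <= bd s" unfolding real_norm_def abs_mult using a1 a2 a3 a4 by linarith
 qed
 also have "integral {a..t'} bd = (dl / 2) * integral {a..t'} (\<lambda>s. (inc ep x s)\<^sup>2) + dl * integral {a..t'} (\<lambda>s. (inc ep n s)\<^sup>2)
   + 2 * R * integral {a..t'} p + (1 / (2 * dl)) * integral {a..t'} (\<lambda>s. (V s)\<^sup>2)"
  by (rule integral_unique[OF hb])
 also have "... <= (dl / 2) * (E * ep) + dl * (E * ep) + 2 * R * (C2 * ep\<^sup>2) + (1 / (2 * dl)) * (dl\<^sup>2 * ep)"
 proof (intro add_mono mult_left_mono p)
  show "integral {a..t'} (\<lambda>s. (inc ep x s)\<^sup>2) <= E * ep" by (rule order_trans[OF E ex]) (intro cc)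
  show "integral {a..t'} (\<lambda>s. (inc ep n s)\<^sup>2) <= E * ep" by (rule order_trans[OF E en]) (intro cc)
  show "integral {a..t'} (\<lambda>s. (V s)\<^sup>2) <= dl\<^sup>2 * ep" using v unfolding V_def .
 qed (use dl R0 in auto)
 also have "(1 / (2 * dl)) * (dl\<^sup>2 * ep) = dl * ep / 2" using dl by (simp add: power2_eq_square)
 finally have T3: "\<bar>integral {a..t'} (\<lambda>s. r s * inc ep n s)\<bar> <= (dl / 2) * (E * ep) + dl * (E * ep) + 2 * R * (C2 * ep\<^sup>2) + dl * ep / 2" by simp
 have "0 <= integral {a..b} (\<lambda>s. (inc ep n s)\<^sup>2)" by (rule integral_nonneg) (auto intro!: ii continuous_on_power cc)
 then have "0 <= E * ep" using en by linarith
 then have "0 <= dl * (E * ep)" "0 <= dl * ep" using dl ep by auto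
 moreover have "ep * dl * (C1 + 2 + 2 * E + 4 * R + 4 * R\<^sup>2) + 2 * R * C2 * ep\<^sup>2
  = ep * dl * C1 + 2 * (dl * ep) + 2 * (dl * (E * ep)) + ep * (4 * R * dl) + ep * (R * (4 * R) * dl) + 2 * R * (C2 * ep\<^sup>2)"
  by (simp add: algebra_simps power2_eq_square)
 moreover have "(dl / 2) * (E * ep) = dl * (E * ep) / 2" by simp
 moreover have "\<bar>integral {a..t} W\<bar> <= dl * ep" using w unfolding W_def .
 ultimately have "\<bar>integral {a..t} J\<bar> <= ep * dl * (C1 + 2 + 2 * E + 4 * R + 4 * R\<^sup>2) + 2 * R * C2 * ep\<^sup>2"
  using J1 comb[OF cJ] comb[OF cW] T1 T2 T3 U by linarith
 then show ?thesis unfolding J_def .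
qed

context filtered_prob
begin

lemma cov_eps_eq:
 assumes A: "cpaths A" and N: "cpaths N" and w: "w \<in> space P"
 shows "cf_cov_eps lo hi A N ep t w = integral {lo..t} (\<lambda>s. (incr ep A s w) *
  (incr ep N s w)) / ep"
proof -
 have "continuous_on {lo..t} (\<lambda>s. (incr ep A s w) *
  (incr ep N s w) * (1 / ep))"
  by (intro continuous_intros ext_cont[OF A w] ext_cont_shift[OF A w] ext_cont[OF N w] ext_cont_shift[OF N w])
 from set_borel_integral_eq_integral(2)[OF borel_integrable_atLeastAtMost'[OF this]]
 show ?thesis unfolding cf_cov_eps_def by simp
qed

lemma cov_eps_meas:
 assumes A: "cpaths A" "\<And>t. t \<in> {lo..hi} ==> A t \<in> bm P"
  and N: "cpaths N" "\<And>t. t \<in> {lo..hi} ==> N t \<in> bm P"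
 shows "cf_cov_eps lo hi A N ep t \<in> bm P"
proof -
 define f where "f s w = (incr ep A s w) *
  (incr ep N s w) * (1 / ep)" for s w
 have [measurable]: "cf_ext lo hi A s \<in> bm P" for s by (rule ext_meas[OF A(2)])
 have [measurable]: "cf_ext lo hi N s \<in> bm P" for s by (rule ext_meas[OF N(2)])
 have "(\<lambda>(s, w). f s w) \<in> bm (lborel \<Otimes>\<^sub>M P)"
 proof (rule joint_measurable)
  show "f s \<in> bm P" for s unfolding f_def[abs_def] by measurable
  show "continuous_on UNIV (\<lambda>s. f s w)" if w: "w \<in> space P" for w unfolding f_def
   by (intro continuous_intros ext_cont[OF A(1) w] ext_cont_shift[OF A(1) w] ext_cont[OF N(1) w] ext_cont_shift[OF N(1) w])
 qed
 from measurable_pair_swap[OF this] have [measurable]: "(\<lambda>(w, s). f s w) \<in> bm (P \<Otimes>\<^sub>M lborel)"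
  by (simp add: split_def)
 have "cf_cov_eps lo hi A N ep t = (\<lambda>w. \<integral>s. indicator {lo..t} s * f s w \<partial>lborel)"
  unfolding cf_cov_eps_def[abs_def] set_lebesgue_integral_def f_def by simp
 also have "... \<in> bm P" by (rule lborel.borel_measurable_lebesgue_integral) measurable
 finally show ?thesis .
qed

lemma ppath_ev:
 assumes "\<And>t. t \<in> {lo..hi} ==> X t \<in> bm P" "cpaths X" "0 < kp"
 shows "\<exists>d R. (\<forall>j. 0 < d j) \<and> 0 < R \<and> ev_prob kp (\<lambda>_ w. ppath R d (\<lambda>s. cf_ext lo hi X s w))"
proof -
 obtain d R B where B: "\<forall>j. 0 < d j" "0 < R" "B \<in> sets P" "measure P B <= kp"
  "\<forall>w\<in>space P - B. ppath R d (\<lambda>s. cf_ext lo hi X s w)" using ppath_tight[OF assms] by blast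
 have "ev_prob kp (\<lambda>_ w. ppath R d (\<lambda>s. cf_ext lo hi X s w))" by (rule ev_prob_set[OF B(3,4)]) (use B(5) in blast)
 then show ?thesis using B(1,2) by blast
qed

text \<open>Tightness of paths, applied to a process constant in time.\<close>

lemma random_variable_bound_ex:
 assumes "L \<in> bm P" "0 < kp"
 shows "\<exists>R B. 0 < R \<and> B \<in> sets P \<and> measure P B <= kp \<and> (\<forall>w\<in>space P - B. \<bar>L w\<bar> <= (R::real))"
proof -
 obtain d R B where B: "0 < R" "B \<in> sets P" "measure P B <= kp" "\<forall>w\<in>space P - B. ppath R d (\<lambda>s. cf_ext lo hi (\<lambda>_. L) s w)"
  using ppath_tight[of "\<lambda>_. L" kp] assms by (auto simp: cf_cont_paths_def)
 then show ?thesis unfolding ppath_def cf_ext_def by blast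
qed

text \<open>The energy divided by \<open>ep\<close> is the approximation of the bracket at the final
  time, hence close to a random variable that is bounded with high probability.\<close>

lemma energy_finite_qv:
 assumes X: "cf_finite_qv P lo hi X" and kp: "0 < kp"
 shows "\<exists>E>0. ev_prob kp (\<lambda>ep w. integral {lo..hi} (\<lambda>s. (incr ep X s w)\<^sup>2) <= E * ep)"
proof -
 obtain C where C: "cf_has_covariation P lo hi X X C" using X unfolding cf_finite_qv_def by blast
 have hi: "hi \<in> {lo..hi}" using lohi by simp
 have Xc: "cpaths X" and cp: "cf_conv_prob P (\<lambda>ep. cf_cov_eps lo hi X X ep hi) (C hi)"
  using C hi unfolding cf_has_covariation_def by auto
 have k2: "0 < kp / 2" using kp by simp
 have "C hi \<in> bm P" using cp unfolding cf_conv_prob_def by auto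
 then obtain R B where B: "0 < R" "B \<in> sets P" "measure P B <= kp / 2" "\<forall>w\<in>space P - B. \<bar>C hi w\<bar> <= R"
  using random_variable_bound_ex[OF _ k2] by blast
 have "ev_prob (kp / 2) (\<lambda>_ w. \<bar>C hi w\<bar> <= R)" by (rule ev_prob_set) (use B in auto)
 from ev_prob_conj[OF this conv_prob_ev[OF cp zero_less_one k2]]
 have "ev_prob kp (\<lambda>ep w. \<bar>C hi w\<bar> <= R \<and> \<bar>cf_cov_eps lo hi X X ep hi w - C hi w\<bar> <= 1)" by simp
 then have "ev_prob kp (\<lambda>ep w. integral {lo..hi} (\<lambda>s. (incr ep X s w)\<^sup>2) <= (R + 1) * ep)"
 proof (rule ev_prob_mono[OF _ zero_less_one])
  fix ep w assume a: "(0::real) < ep" "w \<in> space P" "\<bar>C hi w\<bar> <= R \<and> \<bar>cf_cov_eps lo hi X X ep hi w - C hi w\<bar> <= 1"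
  then have "cf_cov_eps lo hi X X ep hi w <= R + 1" by linarith
  then show "integral {lo..hi} (\<lambda>s. (incr ep X s w)\<^sup>2) <= (R + 1) * ep"
   unfolding cov_eps_eq[OF Xc Xc a(2)] power2_eq_square using a(1) by (simp add: divide_le_eq)
 qed
 then show ?thesis using B(1) by (intro exI[of _ "R + 1"]) auto
qed

lemma energy_local_mart_ev:
 assumes "lmart M" "0 < kp"
 shows "\<exists>E>0. ev_prob kp (\<lambda>ep w. integral {lo..hi} (\<lambda>s. (incr ep M s w)\<^sup>2) <= E * ep)"
proof -
 obtain C where "0 < C" "\<forall>ep>0. \<exists>B\<in>sets P. measure P B <= kp \<and> (\<forall>w\<in>space P - B.
  integral {lo..hi} (\<lambda>s. (incr ep M s w)\<^sup>2) <= C * ep)"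
  using energy_local_mart[OF assms] by blast
 then show ?thesis by (intro exI[of _ C] conjI ev_probI[of 1]) auto
qed

lemma mart_cong:
 assumes Y: "mart Y" and eq: "\<And>t w. w \<in> space P ==> t \<in> {lo..hi} ==> Y t w = Y' t w"
 shows "mart Y'"
 unfolding cf_martingale_def adapted_iff
proof (intro conjI ballI allI impI)
 show "Y' t \<in> bm (Fm t)" if t: "t \<in> {lo..hi}" for t
  by (rule measurable_cong[THEN iffD1, OF _ martD(1)[OF Y t]]) (use eq t in auto)
 show "integrable P (Y' t)" if t: "t \<in> {lo..hi}" for t
  by (rule Bochner_Integration.integrable_cong[THEN iffD1, OF refl _ martD(2)[OF Y t]]) (use eq t in auto)
 fix s t A assume st: "lo <= s" "s <= t" "t <= hi" and A: "A \<in> Fl s"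
 have r: "set_lebesgue_integral P A (Y' r) = set_lebesgue_integral P A (Y r)" if "r \<in> {lo..hi}" for r
  unfolding set_lebesgue_integral_def by (rule Bochner_Integration.integral_cong) (use eq that in auto)
 have "set_lebesgue_integral P A (Y t) = set_lebesgue_integral P A (Y s)"
  using Y st A unfolding cf_martingale_def by blast
 moreover have "s \<in> {lo..hi}" "t \<in> {lo..hi}" using st by auto
 ultimately show "set_lebesgue_integral P A (Y' t) = set_lebesgue_integral P A (Y' s)" by (simp only: r)
qed

lemma local_martD:
 assumes "lmart M"
 shows "cpaths M" "\<And>t. t \<in> {lo..hi} ==> M t \<in> bm (Fm t)" "\<And>t. t \<in> {lo..hi} ==> M t \<in> bm P"
proof -
 show "M t \<in> bm (Fm t)" if "t \<in> {lo..hi}" for t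
  using assms that unfolding cf_cont_local_martingale_def adapted_iff by auto
 then show "M t \<in> bm P" if "t \<in> {lo..hi}" for t using meas_P that by blast
 show "cpaths M" using assms unfolding cf_cont_local_martingale_def by auto
qed

lemma ext_adapted:
 assumes X: "\<And>t. t \<in> {lo..hi} ==> X t \<in> bm (Fm t)" and s: "s \<in> {lo..hi}" and r: "r <= s"
 shows "cf_ext lo hi X r \<in> bm (Fm s)"
proof -
 have "cf_clamp lo hi r \<in> {lo..hi}" "cf_clamp lo hi r <= s" using clamp_in r s by (auto simp: cf_clamp_def)
 then show ?thesis unfolding cf_ext_def[abs_def] using meas_mono[OF X[of "cf_clamp lo hi r"], of s] s by auto
qed

end

text \<open>X and M live on \<open>[lo, hi]\<close> and A is orthogonal to martingales there, while
  the conclusion is about test martingales on \<open>[a, b]\<close>; the lemmas of this locale move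
  martingales between the two intervals.\<close>

locale filtered_subinterval = filtered_prob P lo hi Fl
 for P :: "'a measure" and lo hi :: real and Fl :: "real => 'a set set" +
 fixes a b :: real
 assumes loa: "lo <= a" and ab: "a < b" and bhi: "b <= hi"
begin

sublocale sub: filtered_prob P a b Fl
proof
 show "a < b" by (rule ab)
 show "cf_filtration P a b Fl" using filt loa bhi unfolding cf_filtration_def by auto
 have "Fl lo \<subseteq> Fl a" using filt loa ab bhi unfolding cf_filtration_def by auto
 then show "N \<in> Fl a" if "A \<in> null_sets P" "N \<subseteq> A" for A N using null_in[OF that] by auto
qed

lemma ab_in: "t \<in> {a..b} ==> t \<in> {lo..hi}"
 using loa bhi by auto

text \<open>The localizing times are clamped to \<open>[a, b]\<close>, which leaves their sublevel
  events for \<open>a \<le> t < b\<close> unchanged. The increment is then taken from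
  \<open>a\<close> in place of \<open>lo\<close>.\<close>

lemma restrict_local_mart:
 assumes M: "lmart M" shows "sub.lmart M"
proof -
 obtain \<sigma> :: "nat => 'a => real" where \<sigma>: "\<And>n. cf_stopping_time P lo hi Fl (\<sigma> n)" "\<And>n w. w \<in> space P ==> \<sigma> n w <= \<sigma> (Suc n) w"
  "AE w in P. \<exists>n. \<sigma> n w = hi" "\<And>n. mart (\<lambda>t w. M (min t (\<sigma> n w)) w - M lo w)"
  using M unfolding cf_cont_local_martingale_def by blast
 define \<rho> where "\<rho> n w = min b (max a (\<sigma> n w))" for n w
 show ?thesis
  unfolding cf_cont_local_martingale_def
 proof (intro conjI exI[of _ \<rho>] allI ballI)
  show "cf_adapted P a b Fl M" using local_martD(2)[OF M] ab_in unfolding sub.adapted_iff by auto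
  show "sub.cpaths M" using local_martD(1)[OF M] loa bhi unfolding cf_cont_paths_def
   by (auto intro: continuous_on_subset)
  show "cf_stopping_time P a b Fl (\<rho> n)" for n
   unfolding cf_stopping_time_def
  proof (intro conjI ballI)
   show "\<rho> n w \<in> {a..b}" for w using ab by (auto simp: \<rho>_def)
   fix t assume t: "t \<in> {a..b}"
   show "{w\<in>space P. \<rho> n w <= t} \<in> Fl t"
   proof (cases "t = b")
    case True
    then have "{w\<in>space P. \<rho> n w <= t} = space (Fm t)" by (auto simp: \<rho>_def)
    then show ?thesis using sets.top[of "Fm t"] unfolding sets_Fm[OF ab_in[OF t]] by simp
   next
    case False
    then have "{w\<in>space P. \<rho> n w <= t} = {w\<in>space P. \<sigma> n w <= t}" using t by (auto simp: \<rho>_def min_def max_def)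
    then show ?thesis using \<sigma>(1)[of n] ab_in[OF t] unfolding cf_stopping_time_def by auto
   qed
  qed
  show "\<rho> n w <= \<rho> (Suc n) w" if "w \<in> space P" for n w using \<sigma>(2)[OF that, of n] by (auto simp: \<rho>_def)
  show "AE w in P. \<exists>n. \<rho> n w = b" using \<sigma>(3)
  proof eventually_elim
   case (elim w)
   then obtain n where "\<sigma> n w = hi" by blast
   then have "\<rho> n w = b" using ab bhi by (auto simp: \<rho>_def)
   then show ?case by blast
  qed
  fix n
  define Z where "Z t w = M (min t (\<sigma> n w)) w - M lo w" for t w
  have "sub.mart Z" using \<sigma>(4)[of n, folded Z_def[abs_def]] ab_in loa bhi
   unfolding cf_martingale_def cf_adapted_def by auto
  then have "sub.mart (\<lambda>t w. Z t w - Z a w)" by (rule sub.mart_diff_const)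
  then show "sub.mart (\<lambda>t w. M (min t (\<rho> n w)) w - M a w)"
   by (rule sub.mart_cong) (use ab in \<open>auto simp: Z_def \<rho>_def min_def max_def\<close>)
 qed
qed

text \<open>Constant before \<open>a\<close> and after \<open>b\<close>; an event known before
  \<open>a\<close> is also known at \<open>a\<close>. Starting at zero is what makes the extension
  adapted before \<open>a\<close>.\<close>

lemma mart_clamp:
 assumes Z: "sub.mart Z" and Z0: "\<And>w. w \<in> space P ==> Z a w = 0"
 shows "mart (\<lambda>t. Z (cf_clamp a b t))"
 unfolding cf_martingale_def
proof (intro conjI ballI allI impI)
 have Zm: "Z t \<in> bm (Fm t)" if "t \<in> {a..b}" for t
  using Z that unfolding cf_martingale_def sub.adapted_iff by auto
 show "cf_adapted P lo hi Fl (\<lambda>t. Z (cf_clamp a b t))"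
  unfolding adapted_iff
 proof
  fix t assume t: "t \<in> {lo..hi}"
  show "Z (cf_clamp a b t) \<in> bm (Fm t)"
  proof (cases "t < a")
   case True
   then have "cf_clamp a b t = a" by (auto simp: cf_clamp_def)
   then show ?thesis using Z0 by (subst measurable_cong[where g="\<lambda>_. 0"]) auto
  next
   case False
   then have "cf_clamp a b t <= t" "lo <= cf_clamp a b t" using loa by (auto simp: cf_clamp_def)
   then show ?thesis using meas_mono[OF Zm[OF sub.clamp_in]] t by auto
  qed
 qed
 show "integrable P (Z (cf_clamp a b t))" for t using Z sub.clamp_in unfolding cf_martingale_def by auto
 fix s t A assume st: "lo <= s" "s <= t" "t <= hi" and A: "A \<in> Fl s"
 show "set_lebesgue_integral P A (Z (cf_clamp a b t)) = set_lebesgue_integral P A (Z (cf_clamp a b s))"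
 proof (cases "s <= b")
  case True
  then have "s <= cf_clamp a b s" using ab by (auto simp: cf_clamp_def)
  moreover have "cf_clamp a b s \<in> {lo..hi}" by (rule ab_in[OF sub.clamp_in])
  ultimately have "A \<in> Fl (cf_clamp a b s)" using A st(1) filt unfolding cf_filtration_def
   by (meson atLeastAtMost_iff in_mono)
  moreover have "a <= cf_clamp a b s" "cf_clamp a b s <= cf_clamp a b t" "cf_clamp a b t <= b"
   using sub.clamp_in[of s] sub.clamp_in[of t] sub.clamp_mono[OF st(2)] by auto
  ultimately show ?thesis using Z unfolding cf_martingale_def by blast
 next
  case False
  then have "cf_clamp a b s = b" "cf_clamp a b t = b" using st ab by (auto simp: cf_clamp_def)
  then show ?thesis by simp
 qed
qed

text \<open>\<open>N a\<close> is subtracted because it is known only from time \<open>a\<close> on,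
  while the extension has to be adapted from \<open>lo\<close>.\<close>

lemma extend_local_mart:
 assumes N: "sub.lmart N"
 shows "lmart (\<lambda>t w. cf_ext a b N t w - N a w)"
proof -
 obtain \<sigma> :: "nat => 'a => real" where \<sigma>: "\<And>n. cf_stopping_time P a b Fl (\<sigma> n)" "\<And>n w. w \<in> space P ==> \<sigma> n w <= \<sigma> (Suc n) w"
  "AE w in P. \<exists>n. \<sigma> n w = b" "\<And>n. sub.mart (\<lambda>t w. N (min t (\<sigma> n w)) w - N a w)"
  using N unfolding cf_cont_local_martingale_def by blast
 have \<sigma>in: "\<sigma> n w \<in> {a..b}" if "w \<in> space P" for n w using \<sigma>(1)[of n] that unfolding cf_stopping_time_def by auto
 \<comment> \<open>A localizing time that has reached \<open>b\<close> must jump to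
   \<open>hi\<close> for the sequence to exhaust the larger interval; the process does not move in
   between.\<close>
 define \<rho> where "\<rho> n w = (if \<sigma> n w < b then \<sigma> n w else hi)" for n w
 have Na: "cf_ext a b N lo w = N a w" for w using loa ab by (simp add: cf_ext_def cf_clamp_def)
 have cm: "mart (\<lambda>t. (\<lambda>t w. N (min t (\<sigma> n w)) w - N a w) (cf_clamp a b t))" for n
  by (rule mart_clamp[OF \<sigma>(4)]) (use \<sigma>in in \<open>auto simp: min_def\<close>)
 have agree: "N (min (cf_clamp a b t) (\<sigma> n w)) w - N a w
   = (cf_ext a b N (min t (\<rho> n w)) w - N a w) - (cf_ext a b N lo w - N a w)" if "w \<in> space P" "t \<in> {lo..hi}" for n t w
 proof -
  have "cf_clamp a b (min t (\<rho> n w)) = min (cf_clamp a b t) (\<sigma> n w)"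
   using \<sigma>in[OF that(1), of n] that(2) ab bhi by (auto simp: \<rho>_def cf_clamp_def)
  then show ?thesis unfolding Na by (simp add: cf_ext_def)
 qed
 show ?thesis
  unfolding cf_cont_local_martingale_def
 proof (intro conjI exI[of _ \<rho>] allI ballI)
  show "cf_adapted P lo hi Fl (\<lambda>t w. cf_ext a b N t w - N a w)"
   unfolding adapted_iff
  proof
   fix t assume t: "t \<in> {lo..hi}"
   show "(\<lambda>w. cf_ext a b N t w - N a w) \<in> bm (Fm t)"
   proof (cases "t < a")
    case True
    then have "cf_clamp a b t = a" by (auto simp: cf_clamp_def)
    then show ?thesis by (simp add: cf_ext_def)
   next
    case False
    then have le: "cf_clamp a b t <= t" "lo <= cf_clamp a b t" "a <= t" using loa by (auto simp: cf_clamp_def)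
    have "N (cf_clamp a b t) \<in> bm (Fm t)" "N a \<in> bm (Fm t)"
     using meas_mono[OF sub.local_martD(2)[OF N sub.clamp_in], of t t] meas_mono[OF sub.local_martD(2)[OF N], of a t] le t loa ab by auto
    then show ?thesis unfolding cf_ext_def by measurable
   qed
  qed
  show "cpaths (\<lambda>t w. cf_ext a b N t w - N a w)"
   using sub.ext_cont[OF sub.local_martD(1)[OF N]] unfolding cf_cont_paths_def by (auto intro: continuous_on_diff)
  show "cf_stopping_time P lo hi Fl (\<rho> n)" for n
   unfolding cf_stopping_time_def
  proof (intro conjI ballI)
   show "\<rho> n w \<in> {lo..hi}" if "w \<in> space P" for w using \<sigma>in[OF that, of n] loa bhi lohi by (auto simp: \<rho>_def)
   fix t assume t: "t \<in> {lo..hi}"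
   have st: "{w\<in>space P. \<sigma> n w <= r} \<in> sets (Fm t)" if "a <= r" "r <= t" "r <= b" for r
   proof -
    have "{w\<in>space P. \<sigma> n w <= r} \<in> sets (Fm r)"
     using \<sigma>(1)[of n] that ab_in[of r] unfolding cf_stopping_time_def by (auto simp: sets_Fm)
    then show ?thesis using Fm_subset[of r t] that t loa by auto
   qed
   have \<rho>in: "a <= \<rho> n w \<and> \<rho> n w <= hi" if "w \<in> space P" for w
    using \<sigma>in[OF that, of n] ab bhi by (auto simp: \<rho>_def)
   have "{w\<in>space P. \<rho> n w <= t} \<in> sets (Fm t)"
   proof -
    consider "t = hi" | "t < a" | "t < hi" "a <= t" "t < b" | "t < hi" "b <= t" using t by fastforce
    then show ?thesis
    proof cases
     case 1
     then have "{w\<in>space P. \<rho> n w <= t} = space (Fm t)" using \<rho>in by auto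
     then show ?thesis by (simp only: sets.top)
    next
     case 2
     then have "{w\<in>space P. \<rho> n w <= t} = {}" using \<rho>in by force
     then show ?thesis by (simp only: sets.empty_sets)
    next
     case 3
     then have "{w\<in>space P. \<rho> n w <= t} = {w\<in>space P. \<sigma> n w <= t}" by (auto simp: \<rho>_def)
     then show ?thesis using st[of t] 3 by simp
    next
     case 4
     \<comment> \<open>From \<open>b\<close> on this is the event \<open>\<sigma> n w < b\<close>, a
       countable union of sublevel events below \<open>b\<close>. The maximum with \<open>a\<close>
       keeps the levels where \<open>\<sigma> n\<close> is a stopping time.\<close>
     have "{w\<in>space P. \<rho> n w <= t} = (\<Union>k::nat. {w\<in>space P. \<sigma> n w <= max a (b - 1 / real (Suc k))})"
     proof (intro set_eqI iffI)
      fix w assume "w \<in> {w\<in>space P. \<rho> n w <= t}"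
      then have w: "w \<in> space P" "\<sigma> n w < b" using 4 by (auto simp: \<rho>_def split: if_splits)
      then obtain k where "1 / real (Suc k) < b - \<sigma> n w" using nat_approx_posE[of "b - \<sigma> n w"] by (metis diff_gt_0_iff_gt of_nat_Suc)
      then have "\<sigma> n w <= max a (b - 1 / real (Suc k))" by linarith
      then show "w \<in> (\<Union>k::nat. {w\<in>space P. \<sigma> n w <= max a (b - 1 / real (Suc k))})" using w by blast
     next
      fix w assume "w \<in> (\<Union>k::nat. {w\<in>space P. \<sigma> n w <= max a (b - 1 / real (Suc k))})"
      then obtain k where k: "w \<in> space P" "\<sigma> n w <= max a (b - 1 / real (Suc k))" by blast
      have "b - 1 / real (Suc k) < b" by simp
      then have "\<sigma> n w < b" using k(2) ab by linarith
      then show "w \<in> {w\<in>space P. \<rho> n w <= t}" using k 4 by (auto simp: \<rho>_def)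
     qed
     also have "... \<in> sets (Fm t)"
     proof (rule sets.countable_UN, rule image_subsetI)
      fix k :: nat
      have "b - 1 / real (Suc k) < b" by simp
      then have le: "max a (b - 1 / real (Suc k)) <= b" using ab by linarith
      show "{w\<in>space P. \<sigma> n w <= max a (b - 1 / real (Suc k))} \<in> sets (Fm t)"
       by (rule st[OF max.cobounded1 _ le]) (rule order_trans[OF le 4(2)])
     qed
     finally show ?thesis .
    qed
   qed
   then show "{w\<in>space P. \<rho> n w <= t} \<in> Fl t" using sets_Fm[OF t] by simp
  qed
  show "\<rho> n w <= \<rho> (Suc n) w" if "w \<in> space P" for n w
   using \<sigma>(2)[OF that, of n] \<sigma>in[OF that, of n] bhi by (auto simp: \<rho>_def)
  show "AE w in P. \<exists>n. \<rho> n w = hi" using \<sigma>(3)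
  proof eventually_elim
   case (elim w)
   then obtain n where "\<sigma> n w = b" by blast
   then have "\<rho> n w = hi" by (simp add: \<rho>_def)
   then show ?case by blast
  qed
  fix n
  show "mart (\<lambda>t w. (cf_ext a b N (min t (\<rho> n w)) w - N a w) - (cf_ext a b N lo w - N a w))"
   by (rule mart_cong[OF cm[of n]]) (rule agree)
 qed
qed

text \<open>Orthogonality survives integration against a continuous weight: freeze the weight on a fine partition of
 \<open>[a, t]\<close>; each block is a difference of two covariation approximations.\<close>

lemma weighted_orthogonal:
 assumes Ac: "cpaths A"
  and orth: "\<And>N'. lmart N' ==> cf_has_covariation P lo hi A N' (\<lambda>t w. 0)"
  and EA: "0 < E1" "ev_prob (kp / 4) (\<lambda>ep w. integral {lo..hi} (\<lambda>s. (incr ep A s w)\<^sup>2) <= E1 * ep)"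
  and N: "sub.lmart N"
  and H: "sub.cpaths H" "\<And>s. s \<in> {a..b} ==> H s \<in> bm P"
  and t: "t \<in> {a..b}" and dl: "0 < dl" and kp: "0 < kp"
 shows "ev_prob kp (\<lambda>ep w. \<bar>integral {a..t} (\<lambda>s. cf_ext a b H s w * (incr ep A s w) *
  (sub.incr ep N s w))\<bar> <= dl * ep)"
proof -
 have k4: "0 < kp / 4" using kp by simp
 define N' where "N' t w = cf_ext a b N t w - N a w" for t w
 have N': "lmart N'" unfolding N'_def[abs_def] by (rule extend_local_mart[OF N])
 have N'e: "cf_ext lo hi N' s w = cf_ext a b N s w - N a w" for s w
 proof -
  have "cf_clamp a b (cf_clamp lo hi s) = cf_clamp a b s" using loa ab bhi by (auto simp: cf_clamp_def)
  then show ?thesis by (simp add: cf_ext_def N'_def)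
 qed
 obtain d R where B: "\<forall>j. 0 < d j" "0 < R" and e2: "ev_prob (kp / 4) (\<lambda>_ w. ppath R d (\<lambda>s. cf_ext a b H s w))"
  using sub.ppath_ev[OF H(2,1) k4] by blast
 obtain E2 where E2: "0 < E2" "ev_prob (kp / 4) (\<lambda>ep w. integral {lo..hi} (\<lambda>s. (incr ep N' s w)\<^sup>2) <= E2 * ep)"
  using energy_local_mart_ev[OF N' k4] by blast
 \<comment> \<open>Oscillation of the weight; times the energy bound
   \<open>(E1 + E2) * ep / 2\<close> it gives half of \<open>dl * ep\<close>.\<close>
 define dl1 where "dl1 = dl / (E1 + E2)"
 have dl1: "0 < dl1" using dl EA E2 by (simp add: dl1_def)
 obtain j where j: "1 / real (Suc j) < dl1" using nat_approx_posE[OF dl1] by (metis of_nat_Suc)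
 obtain n0 :: nat where n0: "(t - a) / d j < real n0" using reals_Archimedean2 by blast
 define n where "n = Suc n0"
 define wt where "wt = (t - a) / real n"
 have n: "0 < n" by (simp add: n_def)
 have dj: "0 < d j" using B by simp
 have w: "0 <= wt" "wt <= d j"
 proof -
  show "0 <= wt" using t by (simp add: wt_def)
  have "(t - a) / d j <= real n" using n0 by (simp add: n_def)
  then show "wt <= d j" using dj n unfolding wt_def by (simp add: field_simps)
 qed
 \<comment> \<open>Accuracy of the covariations at the partition points; each block uses
   \<open>2 * dl2 * ep\<close> for its initial integrals, and \<open>2 * n * R\<close> times this is
   the other half.\<close>
 define dl2 where "dl2 = dl / (8 * real n * R)"
 have dl2: "0 < dl2" using dl n B by (simp add: dl2_def)
 define \<pi> where "\<pi> k = a + real k * wt" for k :: nat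
 have \<pi>: "\<pi> k \<in> {lo..hi}" "a <= \<pi> k" if "k <= n" for k
 proof -
  have "real k * wt <= real n * wt" using that w by (intro mult_right_mono) auto
  also have "... = t - a" using n by (simp add: wt_def)
  finally have "real k * wt <= t - a" .
  moreover have "0 <= real k * wt" using w by simp
  ultimately show "\<pi> k \<in> {lo..hi}" "a <= \<pi> k" using t loa bhi unfolding \<pi>_def atLeastAtMost_iff by linarith+
 qed
 \<comment> \<open>A quarter of the budget is shared by the \<open>n + 1\<close> partition points;
   the other quarters go to the path of \<open>H\<close> and the two energies.\<close>
 define kn where "kn = kp / 4 / real (Suc n)"
 have kn: "0 < kn" using k4 by (simp add: kn_def)
 have e1: "ev_prob (real (Suc n) * kn) (\<lambda>ep w. \<forall>k\<le>n. \<bar>cf_cov_eps lo hi A N' ep (\<pi> k) w - 0\<bar> <= dl2)"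
 proof (rule ev_prob_all)
  fix k assume k: "k <= n"
  have "cf_conv_prob P (\<lambda>ep. cf_cov_eps lo hi A N' ep (\<pi> k)) (\<lambda>w. 0)"
   using orth[OF N'] \<pi>[OF k] unfolding cf_has_covariation_def by auto
  then show "ev_prob kn (\<lambda>ep w. \<bar>cf_cov_eps lo hi A N' ep (\<pi> k) w - 0\<bar> <= dl2)" by (rule conv_prob_ev[OF _ dl2 kn])
 qed
 have "real (Suc n) * kn = kp / 4" unfolding kn_def by (simp del: of_nat_Suc)
 then have "real (Suc n) * kn + kp / 4 + (kp / 4 + kp / 4) = kp" by linarith
 note e = ev_prob_conj[OF ev_prob_conj[OF e1 e2] ev_prob_conj[OF EA(2) E2(2)], unfolded this]
 show ?thesis
 proof (rule ev_prob_mono[OF e zero_less_one], goal_cases)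
  case (1 ep w)
  note ep = 1(1) and ws = 1(3) and Q = 1(4)
  define al where "al s = incr ep A s w" for s
  define nu where "nu s = incr ep N' s w" for s
  have c: "continuous_on S al" "continuous_on S nu" for S unfolding al_def nu_def
   by (intro continuous_intros ext_cont[OF Ac ws] ext_cont_shift[OF Ac ws] ext_cont[OF local_martD(1)[OF N'] ws]
     ext_cont_shift[OF local_martD(1)[OF N'] ws])+
  have hc: "continuous_on UNIV (\<lambda>s. cf_ext a b H s w)" by (rule sub.ext_cont[OF H(1) ws])
  have gc: "continuous_on S (\<lambda>s. al s * nu s)" for S by (intro continuous_intros c)
  have cov: "\<bar>integral {lo..\<pi> k} (\<lambda>s. al s * nu s)\<bar> <= dl2 * ep" if "k <= n" for k
  proof -
   have "\<bar>integral {lo..\<pi> k} (\<lambda>s. al s * nu s) / ep\<bar> <= dl2"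
    using Q that unfolding cov_eps_eq[OF Ac local_martD(1)[OF N'] ws] al_def nu_def by auto
   then show ?thesis using ep by (simp add: divide_le_eq)
  qed
  have "\<bar>integral {a..t} (\<lambda>s. cf_ext a b H s w * (al s * nu s))\<bar>
    <= 2 * real n * R * (2 * dl2 * ep) + dl1 * integral {a..t} (\<lambda>s. \<bar>al s * nu s\<bar>)"
  proof (rule step_weight_integral[OF n _ hc gc])
   show "a <= t" using t by simp
   show "\<bar>cf_ext a b H s w\<bar> <= R" for s using Q unfolding ppath_def by blast
   show "\<bar>cf_ext a b H s w - cf_ext a b H s' w\<bar> <= dl1" if "\<bar>s - s'\<bar> <= (t - a) / real n" for s s'
   proof -
    have "\<bar>s - s'\<bar> <= d j" using that w unfolding wt_def by linarith
    then have "\<bar>cf_ext a b H s w - cf_ext a b H s' w\<bar> <= 1 / real (Suc j)" using Q unfolding ppath_def by blast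
    then show ?thesis using j by linarith
   qed
   fix k assume k: "k <= n"
   have "integral {lo..a} (\<lambda>s. al s * nu s) + integral {a..\<pi> k} (\<lambda>s. al s * nu s) = integral {lo..\<pi> k} (\<lambda>s. al s * nu s)"
    by (rule Henstock_Kurzweil_Integration.integral_combine[OF loa \<pi>(2)[OF k] integrable_continuous_interval[OF gc]])
   moreover have "\<bar>integral {lo..a} (\<lambda>s. al s * nu s)\<bar> <= dl2 * ep" using cov[of 0] by (simp add: \<pi>_def)
   ultimately have "\<bar>integral {a..\<pi> k} (\<lambda>s. al s * nu s)\<bar> <= 2 * dl2 * ep" using cov[OF k] by linarith
   then show "\<bar>integral {a..a + real k * ((t - a) / real n)} (\<lambda>s. al s * nu s)\<bar> <= 2 * dl2 * ep" by (simp add: \<pi>_def wt_def)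
  qed
  also have "2 * real n * R * (2 * dl2 * ep) = dl / 2 * ep" using n B(2) by (simp add: dl2_def)
  also have "dl1 * integral {a..t} (\<lambda>s. \<bar>al s * nu s\<bar>) <= dl1 * ((E1 + E2) * ep / 2)"
  proof (rule mult_left_mono)
   have sub: "{a..t} \<subseteq> {lo..hi}" using t loa bhi by auto
   have i: "(\<lambda>s. (al s)\<^sup>2 * (1 / 2)) integrable_on {lo..hi}" "(\<lambda>s. (nu s)\<^sup>2 * (1 / 2)) integrable_on {lo..hi}"
    by (intro integrable_continuous_interval continuous_intros c)+
   have "integral {a..t} (\<lambda>s. \<bar>al s * nu s\<bar>) <= integral {a..t} (\<lambda>s. (al s)\<^sup>2 * (1 / 2) + (nu s)\<^sup>2 * (1 / 2))"
   proof (rule integral_le)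
    show "\<bar>al s * nu s\<bar> <= (al s)\<^sup>2 * (1 / 2) + (nu s)\<^sup>2 * (1 / 2)" for s
     using amgm_weighted[of 1 "al s" "nu s"] by (simp add: abs_mult)
   qed (auto intro!: integrable_continuous_interval continuous_intros c)
   also have "... <= integral {lo..hi} (\<lambda>s. (al s)\<^sup>2 * (1 / 2) + (nu s)\<^sup>2 * (1 / 2))"
    by (rule integral_subset_le[OF sub]) (auto intro!: integrable_continuous_interval continuous_intros c)
   also have "... = integral {lo..hi} (\<lambda>s. (al s)\<^sup>2) * (1 / 2) + integral {lo..hi} (\<lambda>s. (nu s)\<^sup>2) * (1 / 2)"
    using Henstock_Kurzweil_Integration.integral_add[OF i] by simp
   also have "... <= (E1 + E2) * ep / 2" using Q unfolding al_def nu_def by (simp add: distrib_right)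
   finally show "integral {a..t} (\<lambda>s. \<bar>al s * nu s\<bar>) <= (E1 + E2) * ep / 2" .
  qed (use dl1 in simp)
  also have "dl1 * ((E1 + E2) * ep / 2) = dl / 2 * ep" using EA(1) E2(1) by (simp add: dl1_def)
  finally show "\<bar>integral {a..t} (\<lambda>s. cf_ext a b H s w * (incr ep A s w) *
   (sub.incr ep N s w))\<bar> <= dl * ep"
   unfolding al_def nu_def N'e by (simp add: mult.assoc)
 qed
qed

end

text \<open>The test paths equal one at 0 and shrink to the indicator of that point, so integrals
  against either measure of the pair converge to its atom at 0.\<close>

lemma Ddelta0_limit:
 assumes \<tau>: "0 < \<tau>" and diff: "cf_differentiable \<tau> (F t)" and \<eta>: "\<eta> \<in> cf_C \<tau>"
 obtains L where "cf_frechet \<tau> (F t) \<eta> L"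
  "(\<lambda>m. L (cfun \<tau> (\<lambda>r. max 0 (1 + real m * r)))) \<longlonglongrightarrow> cf_Ddelta0 \<tau> F t \<eta>"
proof -
 obtain L where L: "cf_frechet \<tau> (F t) \<eta> L" and J: "cf_jordan_rep \<tau> L (fst (cf_DF \<tau> F t \<eta>)) (snd (cf_DF \<tau> F t \<eta>))"
  using cf_DF_spec[of \<tau> F t \<eta>, OF \<tau> diff \<eta>] by metis
 define h where "h m = cfun \<tau> (\<lambda>r. max 0 (1 + real m * r))" for m
 have cont: "continuous_on {-\<tau>..0} (\<lambda>r. max 0 (1 + real m * r))" for m by (intro continuous_intros)
 have hC: "h m \<in> cf_C \<tau>" for m unfolding h_def using cfun_in_C[OF _ cont] \<tau> by simp
 have ha: "ap (h m) y = max 0 (1 + real m * clampw \<tau> y)" for m y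
  unfolding h_def using cfun_apply[OF _ cont] \<tau> by simp
 have lim: "(\<lambda>m. \<integral>y. ap (h m) y \<partial>q) \<longlonglongrightarrow> measure q {0}"
  if q: "sets q = sets borel" "finite_measure q" "emeasure q (- {-\<tau>..0}) = 0" for q
 proof -
  interpret finite_measure q by fact
  have sp: "space q = UNIV" using sets_eq_imp_space_eq[OF q(1)] by simp
  have s0: "{0} \<in> sets q" using q by auto
  have "(\<lambda>m. \<integral>y. ap (h m) y \<partial>q) \<longlonglongrightarrow> (\<integral>y. indicator {0} y \<partial>q)"
  proof (rule integral_dominated_convergence[where w="\<lambda>_. 1"])
   show "(\<lambda>y. indicator {0} y :: real) \<in> bm q" using s0 by simp
   show "ap (h m) \<in> bm q" for m
    using q(1) cont_apply_bcontfun by (simp add: borel_measurable_continuous_onI cong: measurable_cong_sets)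
   show "integrable q (\<lambda>_. 1 :: real)" by simp
   show "AE y in q. norm (ap (h m) y) <= 1" for m
    using clampw_in[of \<tau>] \<tau> by (intro AE_I2) (auto simp: ha mult_nonneg_nonpos)
   have "AE y in q. y \<in> {-\<tau>..0}" by (rule AE_I'[of "- {-\<tau>..0}"]) (use q in auto)
   then show "AE y in q. (\<lambda>m. ap (h m) y) \<longlonglongrightarrow> indicator {0} y"
   proof eventually_elim
    case (elim y)
    then have cy: "clampw \<tau> y = y" by (rule clampw_id)
    show ?case
    proof (cases "y = 0")
     case True
     then show ?thesis unfolding ha cy by simp
    next
     case False
     then have y: "y < 0" using elim by auto
     obtain k :: nat where k: "1 / (- y) < real k" using reals_Archimedean2 by blast
     have "ap (h m) y = 0" if "k <= m" for m
     proof -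
      have "1 / (- y) <= real m" using k that by linarith
      moreover have "0 < - y" using y by simp
      ultimately have "1 <= real m * (- y)" by (simp only: pos_divide_le_eq)
      then show ?thesis unfolding ha cy by simp
     qed
     then have "eventually (\<lambda>m. ap (h m) y = indicator {0} y) sequentially"
      using False unfolding eventually_sequentially by (intro exI[of _ k]) auto
     then show ?thesis by (rule tendsto_eventually)
    qed
   qed
  qed
  then show ?thesis using s0 sp by simp
 qed
 note J = J[unfolded cf_jordan_rep_def]
 have "(\<lambda>m. L (h m)) \<longlonglongrightarrow> cf_Ddelta0 \<tau> F t \<eta>"
 proof -
  have "L (h m) = (\<integral>y. ap (h m) y \<partial>fst (cf_DF \<tau> F t \<eta>)) - (\<integral>y. ap (h m) y \<partial>snd (cf_DF \<tau> F t \<eta>))" for m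
   using J hC[of m] by blast
  then show ?thesis unfolding cf_Ddelta0_def using J by (simp only:) (intro tendsto_diff lim; blast)
 qed
 then show ?thesis using that[OF L] unfolding h_def by blast
qed

text \<open>At the left end point the derivative need not agree with its continuous extension, so its measurability along
 the window is read off difference quotients.\<close>

lemma Ddelta0_window_measurable:
 assumes \<tau>: "0 < \<tau>" and diff: "cf_differentiable \<tau> (F t)" and F: "continuous_on (cf_C \<tau>) (F t)"
  and Y: "\<And>r. r \<in> {u-\<tau>..u} ==> Y r \<in> bm N"
  and cont: "\<And>w. w \<in> space N ==> continuous_on UNIV (\<lambda>r. Y r w)"
 shows "(\<lambda>w. cf_Ddelta0 \<tau> F t (win \<tau> (\<lambda>r. Y r w) u)) \<in> bm N"
proof -
 define h where "h m = cfun \<tau> (\<lambda>r. max 0 (1 + real m * r))" for m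
 have hC: "h m \<in> cf_C \<tau>" for m unfolding h_def by (rule cfun_in_C) (use \<tau> in \<open>auto intro!: continuous_intros\<close>)
 \<comment> \<open>The limit in \<open>n\<close> is the directional derivative along
   \<open>h m\<close>, and the limit in \<open>m\<close> is then the atom at 0; each quotient is
   continuous in the path.\<close>
 define D where "D m n \<eta> = (F t (\<eta> + (1 / real (Suc n)) *\<^sub>R h m) - F t \<eta>) / (1 / real (Suc n))" for m n \<eta>
 have Dl: "(\<lambda>n. D m n \<eta>) \<longlonglongrightarrow> L (h m)" if L: "cf_frechet \<tau> (F t) \<eta> L" for L m \<eta>
 proof -
  have "((\<lambda>c. (F t (\<eta> + c *\<^sub>R h m) - F t \<eta>) / c) \<longlongrightarrow> L (h m)) (at 0)"
   using cf_frechet_DERIV[OF L hC, of m] unfolding DERIV_def by simp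
  moreover have "filterlim (\<lambda>n. 1 / real (Suc n)) (at 0) sequentially"
   using LIMSEQ_inverse_real_of_nat by (auto simp: filterlim_at inverse_eq_divide)
  ultimately show ?thesis unfolding D_def by (rule filterlim_compose)
 qed
 have wC: "win \<tau> (\<lambda>r. Y r w) u \<in> cf_C \<tau>" if "w \<in> space N" for w using win_in_C[OF _ cont[OF that]] \<tau> by simp
 have Dm: "(\<lambda>w. D m n (win \<tau> (\<lambda>r. Y r w) u)) \<in> bm N" for m n
 proof (rule measurable_window_functional[where \<phi>="D m n", OF \<tau> Y cont])
  have "continuous_on (cf_C \<tau>) (\<lambda>\<eta>. F t (\<eta> + (1 / real (Suc n)) *\<^sub>R h m))"
   by (rule continuous_on_compose2[OF F]) (auto intro!: continuous_intros cf_C_add cf_C_scaleR hC)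
  then show "continuous_on (cf_C \<tau>) (D m n)" unfolding D_def[abs_def]
   by (intro continuous_on_divide continuous_on_diff F continuous_on_const) auto
 qed
 have lm: "(\<lambda>w. lim (\<lambda>n. D m n (win \<tau> (\<lambda>r. Y r w) u))) \<in> bm N" for m
 proof (rule borel_measurable_LIMSEQ_real[OF _ Dm[of m]])
  fix w assume "w \<in> space N"
  then obtain L where "cf_frechet \<tau> (F t) (win \<tau> (\<lambda>r. Y r w) u) L" using diff wC unfolding cf_differentiable_def by blast
  from Dl[OF this, of m] show "(\<lambda>n. D m n (win \<tau> (\<lambda>r. Y r w) u)) \<longlonglongrightarrow> lim (\<lambda>n. D m n (win \<tau> (\<lambda>r. Y r w) u))"
   by (simp add: limI)
 qed
 show ?thesis
 proof (rule borel_measurable_LIMSEQ_real[OF _ lm])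
  fix w assume w: "w \<in> space N"
  obtain L where L: "cf_frechet \<tau> (F t) (win \<tau> (\<lambda>r. Y r w) u) L"
   "(\<lambda>m. L (h m)) \<longlonglongrightarrow> cf_Ddelta0 \<tau> F t (win \<tau> (\<lambda>r. Y r w) u)"
   using Ddelta0_limit[of \<tau> F t, OF \<tau> diff wC[OF w]] unfolding h_def by blast
  then show "(\<lambda>m. lim (\<lambda>n. D m n (win \<tau> (\<lambda>r. Y r w) u))) \<longlonglongrightarrow> cf_Ddelta0 \<tau> F t (win \<tau> (\<lambda>r. Y r w) u)"
   using limI[OF Dl[OF L(1)]] by simp
 qed
qed

lemma continuous_on_slice: "continuous_on (S \<times> T) f ==> s \<in> S ==> continuous_on T (\<lambda>\<eta>. f (s, \<eta>))"
 by (rule continuous_on_compose2[of "S \<times> T" f]) (auto intro!: continuous_intros)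

section \<open>The window functional as a process and its covariations\<close>

context filtered_subinterval
begin

lemma window_functional_cont_paths:
 fixes \<phi> :: "real \<times> (real \<Rightarrow>\<^sub>C real) => real"
 assumes "0 < \<tau>" "cpaths X" "continuous_on ({a..b} \<times> cf_C \<tau>) \<phi>"
 shows "sub.cpaths (\<lambda>s w. \<phi> (s, win \<tau> (\<lambda>r. cf_ext lo hi X r w) s))"
 unfolding cf_cont_paths_def
proof
 fix w assume "w \<in> space P"
 then have x: "continuous_on UNIV (\<lambda>r. cf_ext lo hi X r w)" by (rule ext_cont[OF assms(2)])
 have "continuous_on {a..b} (\<lambda>s. win \<tau> (\<lambda>r. cf_ext lo hi X r w) s)"
  using continuous_on_win(2)[OF _ x x, of \<tau> _ 0] assms(1) by simp
 then show "continuous_on {a..b} (\<lambda>s. \<phi> (s, win \<tau> (\<lambda>r. cf_ext lo hi X r w) s))"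
  by (intro continuous_on_compose2[OF assms(3)] continuous_intros) (use win_in_C[OF _ x] assms(1) in auto)
qed

lemma window_functional_adapted:
 fixes \<phi> :: "real \<times> (real \<Rightarrow>\<^sub>C real) => real"
 assumes "0 < \<tau>" and X: "\<And>t. t \<in> {lo..hi} ==> X t \<in> bm (Fm t)" "cpaths X"
  and \<phi>: "continuous_on ({a..b} \<times> cf_C \<tau>) \<phi>" and s: "s \<in> {a..b}"
 shows "(\<lambda>w. \<phi> (s, win \<tau> (\<lambda>r. cf_ext lo hi X r w) s)) \<in> bm (Fm s)"
proof (rule measurable_window_functional[where Y="cf_ext lo hi X" and u=s and \<phi>="\<lambda>\<eta>. \<phi> (s, \<eta>)", OF assms(1)])
 show "cf_ext lo hi X r \<in> bm (Fm s)" if "r \<in> {s-\<tau>..s}" for r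
  using ext_adapted[OF X(1) ab_in[OF s]] that by auto
 show "continuous_on UNIV (\<lambda>r. cf_ext lo hi X r w)" if "w \<in> space (Fm s)" for w using ext_cont[OF X(2)] that by simp
qed (rule continuous_on_slice[OF \<phi> s])

text \<open>Every random ingredient becomes an event within the budget \<open>kp\<close>, and
  \<open>covariation_estimate\<close> is applied outcome by outcome. \<open>C\<close> stands for a
  starting value and cancels in the increments.\<close>

lemma functional_covariation:
 fixes F :: "real => (real \<Rightarrow>\<^sub>C real) => real" and G :: "real \<times> (real \<Rightarrow>\<^sub>C real) => real"
 assumes \<tau>: "0 < \<tau>" and Xm: "\<And>t. t \<in> {lo..hi} ==> X t \<in> bm (Fm t)" and Xc: "cpaths X"
  and M: "lmart M"
  and orth: "\<And>N'. lmart N' ==> cf_has_covariation P lo hi (\<lambda>t w. X t w - M t w) N' (\<lambda>t w. 0)"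
  and qv: "cf_finite_qv P lo hi X"
  and F: "continuous_on ({a..b} \<times> cf_C \<tau>) (\<lambda>(t, \<eta>). F t \<eta>)"
  and diff: "\<And>t. t \<in> {a..b} ==> cf_differentiable \<tau> (F t)" and sp: "cf_support_predictable \<tau> a b F"
  and G: "continuous_on ({a..b} \<times> cf_C \<tau>) G"
  and GD: "\<And>t \<eta>. t \<in> {a<..b} ==> \<eta> \<in> cf_C \<tau> ==> G (t, \<eta>) = cf_Ddelta0 \<tau> F t \<eta>"
 defines "Y \<equiv> \<lambda>s w. F s (win \<tau> (\<lambda>r. cf_ext lo hi X r w) s)"
  and "H \<equiv> \<lambda>s w. G (s, win \<tau> (\<lambda>r. cf_ext lo hi X r w) s)"
 assumes nj: "\<And>j. j <= (n j :: nat)" and Ic: "sub.cpaths I" and Ia: "\<And>t. t \<in> {a..b} ==> I t \<in> bm (Fm t)"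
  and lim: "AE w in P. \<forall>t\<in>{a..b}. (\<lambda>j. sub.tr (sub.gr (n j)) (2^(n j)) H M t w) \<longlonglongrightarrow> I t w"
  and N: "sub.lmart N" and t: "t \<in> {a..b}" and dl: "0 < dl" and kp: "0 < kp"
 shows "ev_prob kp (\<lambda>ep w. \<bar>cf_cov_eps a b (\<lambda>t w. Y t w - (C w + I t w)) N ep t w\<bar> <= dl)"
proof -
 define F' where "F' = (\<lambda>(t, \<eta>). F t \<eta>)"
 have F'c: "continuous_on ({a..b} \<times> cf_C \<tau>) F'" using F unfolding F'_def .
 have Yc: "sub.cpaths Y" using window_functional_cont_paths[OF \<tau> Xc F'c] by (simp add: Y_def F'_def)
 have Ya: "Y s \<in> bm (Fm s)" if "s \<in> {a..b}" for s
  using window_functional_adapted[OF \<tau> Xm Xc F'c that] by (simp add: Y_def F'_def)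
 have Hc: "sub.cpaths H" unfolding H_def by (rule window_functional_cont_paths[OF \<tau> Xc G])
 have Ha: "H s \<in> bm (Fm s)" if "s \<in> {a..b}" for s
  unfolding H_def by (rule window_functional_adapted[OF \<tau> Xm Xc G that])
 have YP: "Y s \<in> bm P" and HP: "H s \<in> bm P" and IP: "I s \<in> bm P" if "s \<in> {a..b}" for s
  using sub.meas_P[OF Ya[OF that] that] sub.meas_P[OF Ha[OF that] that] sub.meas_P[OF Ia[OF that] that] by auto
 have XP: "X s \<in> bm P" if "s \<in> {lo..hi}" for s using meas_P[OF Xm[OF that] that] .
 note MD = local_martD[OF M] and ND = sub.local_martD[OF N]
 have Mab: "sub.lmart M" by (rule restrict_local_mart[OF M])
 \<comment> \<open>Nineteen shares: seven for the path conditions and the bounded version of N, one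
   each for the energies of X and N, for the part known at time \<open>s\<close> and for the
   stochastic integral, and eight for the weighted orthogonality.\<close>
 define k0 where "k0 = kp / 19"
 have k0: "0 < k0" using kp by (simp add: k0_def)
 obtain d R1 where B1: "\<forall>j. 0 < d j" "0 < R1" and b1: "ev_prob k0 (\<lambda>_ w. ppath R1 d (\<lambda>s. cf_ext lo hi X s w))"
  using ppath_ev[OF XP Xc k0] by blast
 obtain d2 R2 where B2: "\<forall>j. 0 < d2 j" "0 < R2" and b2: "ev_prob k0 (\<lambda>_ w. ppath R2 d2 (\<lambda>s. cf_ext a b Y s w))"
  using sub.ppath_ev[OF YP Yc k0] by blast
 obtain d3 R3 where B3: "\<forall>j. 0 < d3 j" "0 < R3" and b3: "ev_prob k0 (\<lambda>_ w. ppath R3 d3 (\<lambda>s. cf_ext a b I s w))"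
  using sub.ppath_ev[OF IP Ic k0] by blast
 obtain d4 R4 where B4: "\<forall>j. 0 < d4 j" "0 < R4" and b4: "ev_prob k0 (\<lambda>_ w. ppath R4 d4 (\<lambda>s. cf_ext a b H s w))"
  using sub.ppath_ev[OF HP Hc k0] by blast
 obtain d5 R5 where B5: "\<forall>j. 0 < d5 j" "0 < R5" and b5: "ev_prob k0 (\<lambda>_ w. ppath R5 d5 (\<lambda>s. cf_ext lo hi M s w))"
  using ppath_ev[OF MD(3,1) k0] by blast
 obtain d6 R6 where B6: "\<forall>j. 0 < d6 j" "0 < R6" and b6: "ev_prob k0 (\<lambda>_ w. ppath R6 d6 (\<lambda>s. cf_ext a b N s w))"
  using sub.ppath_ev[OF ND(3,1) k0] by blast
 obtain m k B7 where m: "sub.mart m" "sub.cpaths m" "0 <= (k::real)"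
  "\<And>t w. w \<in> space P ==> t \<in> {a..b} ==> \<bar>m t w\<bar> <= k"
  "B7 \<in> sets P" "measure P B7 <= k0" "\<And>w t. w \<in> space P - B7 ==> t \<in> {a..b} ==> m t w = N t w - N a w"
  using sub.bounded_version[OF N k0] by blast
 define R where "R = R1 + R2 + R3 + R4 + R5 + R6"
 have Rle: "R1 <= R" "R2 <= R" "R3 <= R" "R4 <= R" "R5 <= R" "R6 <= R" "0 < R"
  using B1 B2 B3 B4 B5 B6 by (auto simp: R_def)
 obtain Ex where Ex: "0 < Ex" "ev_prob k0 (\<lambda>ep w. integral {lo..hi} (\<lambda>s. (incr ep X s w)\<^sup>2) <= Ex * ep)"
  using energy_finite_qv[OF qv k0] by blast
 obtain Em where Em: "0 < Em" "ev_prob k0 (\<lambda>ep w. integral {lo..hi} (\<lambda>s. (incr ep M s w)\<^sup>2) <= Em * ep)"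
  using energy_local_mart_ev[OF M k0] by blast
 obtain En where En: "0 < En" "ev_prob k0 (\<lambda>ep w. integral {a..b} (\<lambda>s. (sub.incr ep N s w)\<^sup>2) <= En * ep)"
  using sub.energy_local_mart_ev[OF N k0] by blast
 define A where "A t w = X t w - M t w" for t w
 have Ac: "cpaths A" using Xc MD(1) unfolding cf_cont_paths_def A_def by (auto intro: continuous_on_diff)
 \<comment> \<open>Two shares, those of the energies of X and M, are the quarter of eight that
   \<open>weighted_orthogonal\<close> reserves for the energy of A.\<close>
 have EA: "ev_prob (8 * k0 / 4) (\<lambda>ep w. integral {lo..hi} (\<lambda>s. (incr ep A s w)\<^sup>2) <= (2 * Ex + 2 * Em) * ep)"
 proof -
  have e: "k0 + k0 = 8 * k0 / 4" by simp
  show ?thesis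
  proof (rule ev_prob_mono[OF ev_prob_conj[OF Ex(2) Em(2), unfolded e] zero_less_one], goal_cases)
   case (1 ep w)
   note ws = 1(3) and Q = 1(4)
   define u where "u s = incr ep X s w" for s
   define v where "v s = incr ep M s w" for s
   have c: "continuous_on S u" "continuous_on S v" for S unfolding u_def v_def
    by (intro continuous_intros ext_cont[OF Xc ws] ext_cont_shift[OF Xc ws] ext_cont[OF MD(1) ws] ext_cont_shift[OF MD(1) ws])+
   have i: "(\<lambda>s. 2 * (u s)\<^sup>2) integrable_on {lo..hi}" "(\<lambda>s. 2 * (v s)\<^sup>2) integrable_on {lo..hi}"
    by (intro integrable_continuous_interval continuous_intros c)+
   have "integral {lo..hi} (\<lambda>s. (u s - v s)\<^sup>2) <= integral {lo..hi} (\<lambda>s. 2 * (u s)\<^sup>2 + 2 * (v s)\<^sup>2)"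
   proof (rule integral_le)
    show "(u s - v s)\<^sup>2 <= 2 * (u s)\<^sup>2 + 2 * (v s)\<^sup>2" for s
     using zero_le_power2[of "u s + v s"] unfolding power2_sum power2_diff by linarith
   qed (auto intro!: integrable_continuous_interval continuous_intros c)
   also have "... = 2 * integral {lo..hi} (\<lambda>s. (u s)\<^sup>2) + 2 * integral {lo..hi} (\<lambda>s. (v s)\<^sup>2)"
    using Henstock_Kurzweil_Integration.integral_add[OF i] by simp
   also have "... <= (2 * Ex + 2 * Em) * ep" using Q unfolding u_def v_def distrib_right by linarith
   finally have "integral {lo..hi} (\<lambda>s. (u s - v s)\<^sup>2) <= (2 * Ex + 2 * Em) * ep" .
   moreover have "(\<lambda>s. (u s - v s)\<^sup>2) = (\<lambda>s. (incr ep A s w)\<^sup>2)"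
    by (simp add: fun_eq_iff u_def v_def cf_ext_def A_def algebra_simps)
   ultimately show "integral {lo..hi} (\<lambda>s. (incr ep A s w)\<^sup>2) <= (2 * Ex + 2 * Em) * ep"
    by (simp only:)
  qed
 qed
 define C1 where "C1 = (k + 1) / k0 + 2 * k"
 define E where "E = Ex + En"
 define Ct where "Ct = C1 + 2 + 2 * E + 4 * R + 4 * R\<^sup>2"
 have "0 <= C1" using m(3) k0 by (simp add: C1_def)
 then have Ct: "0 < Ct" using Ex(1) En(1) Rle(7) unfolding Ct_def E_def by (simp add: add_pos_nonneg)
 \<comment> \<open>All terms linear in \<open>dl1\<close> together use half of
   \<open>dl\<close>.\<close>
 define dl1 where "dl1 = dl / (2 * Ct)"
 have dl1: "0 < dl1" using dl Ct by (simp add: dl1_def)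
 define K where "K = ppath_set \<tau> R1 d"
 have dp: "0 < d j" for j using B1(1) by blast
 have K: "compact K" "K \<subseteq> cf_C \<tau>" unfolding K_def
  using compact_ppath_set[of \<tau> d R1] \<tau> dp by (auto simp: ppath_set_def)
 obtain Cs e1 where Cs: "0 <= Cs" "0 < e1"
  "\<And>ep R q. 0 < ep ==> ep <= e1 ==> 0 < R ==> q \<in> bm borel ==>
   (\<And>s. s \<in> {a..b-ep} ==> ennreal (q s) <= ennreal R * (SUP \<eta>\<in>K. cf_Dperp_tv \<tau> F (s + ep) \<eta> {max (-ep) (-\<tau>)..0})) ==>
   (\<integral>\<^sup>+s. ennreal (q s) * indicator {a..b-ep} s \<partial>lborel) <= ennreal (R * Cs * ep\<^sup>2)"
 proof (rule support_predictable_integral[OF sp K], goal_cases)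
  case (1 C e1)
  show ?case by (rule 1(1)[OF 1(2-4)])
 qed
 obtain e2 where e2: "0 < e2" "e2 <= \<tau>"
  "\<And>ep x s. 0 < ep ==> ep <= e2 ==> ppath R1 d x ==> s \<in> {a..b-ep} ==>
    \<bar>F (s + ep) (win \<tau> (\<lambda>r. x (min s r)) (s + ep)) - F s (win \<tau> x s)\<bar> <= dl1"
  "\<And>ep x s. 0 < ep ==> ep <= e2 ==> ppath R1 d x ==> s \<in> {a..b-ep} ==>
    ennreal (\<bar>F (s + ep) (win \<tau> x (s + ep)) - F (s + ep) (win \<tau> (\<lambda>r. x (min s r)) (s + ep))
     - G (s, win \<tau> x s) * (x (s + ep) - x s)\<bar> - dl1 * \<bar>x (s + ep) - x s\<bar>)
   <= ennreal (2 * R1) * (SUP \<eta>\<in>ppath_set \<tau> R1 d. cf_Dperp_tv \<tau> F (s + ep) \<eta> {max (-ep) (-\<tau>)..0})"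
 proof (rule frozen_uniform[where R=R1 and d=d and a=a and b=b and F=F and G=G and dl=dl1 and \<tau>=\<tau>, OF \<tau> dp diff F G GD dl1], goal_cases)
  case (4 e2)
  show ?case by (rule 4(1)[OF 4(2-5)])
 qed
 obtain j where j: "1 / real (Suc j) < dl1" using nat_approx_posE[OF dl1] by (metis of_nat_Suc)
 define C2 where "C2 = 2 * R1 * Cs"
 have C2: "0 <= C2" using Cs(1) B1(2) by (simp add: C2_def)
 \<comment> \<open>Below this \<open>ep\<close> the quadratic term of the estimate uses at most the
   other half; adding 1 keeps the denominator positive.\<close>
 define e4 where "e4 = dl / (4 * R * C2 + 1)"
 have c4: "0 < 4 * R * C2 + 1" using C2 Rle(7) by (intro add_nonneg_pos) auto
 have e4: "0 < e4" using dl c4 by (simp add: e4_def)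
 have e4': "2 * R * C2 * ep <= dl / 2" if "0 < ep" "ep <= e4" for ep
 proof -
  have "ep * (4 * R * C2 + 1) <= dl" using that(2) c4 by (simp add: e4_def le_divide_eq)
  then show ?thesis using that(1) by (simp add: distrib_left algebra_simps)
 qed
 define e where "e = min (min e1 e2) (min (min e4 (d6 j)) (b - a))"
 have e: "0 < e" using Cs e2 e4 B6(1) ab by (simp add: e_def)
 have ele: "ep <= e1" "ep <= e2" "ep <= e4" "ep <= d6 j" "ep <= b - a" if "ep <= e" for ep using that by (auto simp: e_def)
 \<comment> \<open>The path is read only up to time \<open>s\<close>, so this increment is known at
   time \<open>s\<close> although \<open>F\<close> is evaluated at \<open>s + ep\<close>.\<close>
 define U where "U ep s w = F (s + ep) (win \<tau> (\<lambda>r. cf_ext lo hi X (min s r) w) (s + ep)) - F s (win \<tau> (\<lambda>r. cf_ext lo hi X r w) s)" for ep s w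
 have Uc: "continuous_on {a..b-ep} (\<lambda>s. U ep s w)" if ws: "w \<in> space P" and ep: "0 < ep" for ep w
 proof -
  have x: "continuous_on UNIV (\<lambda>r. cf_ext lo hi X r w)" by (rule ext_cont[OF Xc ws])
  have xm: "continuous_on UNIV (\<lambda>r. cf_ext lo hi X (min s r) w)" for s
   by (rule continuous_on_compose2[OF x]) (auto intro!: continuous_intros)
  have "continuous_on {a..b-ep} (\<lambda>s. win \<tau> (\<lambda>r. cf_ext lo hi X (min s r) w) (s + ep))"
   using continuous_on_win(1)[OF _ x continuous_on_id] \<tau> by simp
  then have "continuous_on {a..b-ep} (\<lambda>s. F' (s + ep, win \<tau> (\<lambda>r. cf_ext lo hi X (min s r) w) (s + ep)))"
   by (intro continuous_on_compose2[OF F'c] continuous_intros) (use win_in_C[OF _ xm] \<tau> ep in auto)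
  moreover have "continuous_on {a..b-ep} (\<lambda>s. Y s w)"
   using Yc ws ep unfolding cf_cont_paths_def by (auto intro: continuous_on_subset)
  ultimately show ?thesis unfolding U_def Y_def F'_def by (auto intro: continuous_on_diff)
 qed
 have Um: "U ep s \<in> bm (Fm s)" if ep: "0 < ep" and s: "s \<in> {a..b-ep}" for ep s
 proof -
  have s': "s \<in> {a..b}" "s + ep \<in> {a..b}" using s ep by auto
  have "(\<lambda>w. F' (s + ep, win \<tau> (\<lambda>r. cf_ext lo hi X (min s r) w) (s + ep))) \<in> bm (Fm s)"
  proof (rule measurable_window_functional[where Y="\<lambda>r. cf_ext lo hi X (min s r)" and u="s + ep" and \<phi>="\<lambda>\<eta>. F' (s + ep, \<eta>)", OF \<tau>])
   show "cf_ext lo hi X (min s r) \<in> bm (Fm s)" for r using ext_adapted[OF Xm ab_in[OF s'(1)], of "min s r"] by simp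
   show "continuous_on UNIV (\<lambda>r. cf_ext lo hi X (min s r) w)" if "w \<in> space (Fm s)" for w
    by (rule continuous_on_compose2[OF ext_cont[OF Xc, of w UNIV]]) (use that in \<open>auto intro!: continuous_intros\<close>)
  qed (rule continuous_on_slice[OF F'c s'(2)])
  then show ?thesis using Ya[OF s'(1)] unfolding U_def[abs_def] Y_def F'_def by simp
 qed
 \<comment> \<open>\<open>predictable_integral_small\<close> asks for a bound at every outcome,
   hence the truncation, and for a bounded martingale, hence \<open>m\<close>. On the good event
   both coincide with the original quantities in the integral.\<close>
 have evP: "ev_prob k0 (\<lambda>ep w. \<bar>integral {a..min t (b - ep)} (\<lambda>s. trc dl1 (U ep s w) * (sub.incr ep m s w))\<bar> <= ep * dl1 * C1)"
 proof (rule ev_probI[of "b - a"])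
  show "0 < b - a" using ab by simp
  fix ep assume ep: "0 < ep" "ep <= b - a"
  show "\<exists>B\<in>sets P. measure P B <= k0 \<and> (\<forall>w\<in>space P - B.
   \<bar>integral {a..min t (b - ep)} (\<lambda>s. trc dl1 (U ep s w) * (sub.incr ep m s w))\<bar> <= ep * dl1 * C1)"
   unfolding C1_def
  proof (rule sub.predictable_integral_small[OF m(1,4,2,3) ep(1) dl1 k0])
   show "a <= min t (b - ep)" "min t (b - ep) <= b - ep" using t ep by auto
   show "(\<lambda>w. trc dl1 (U ep s w)) \<in> bm (Fm s)" if "s \<in> {a..min t (b - ep)}" for s
    using measurable_compose[OF Um[OF ep(1), of s] trc_measurable] that by auto
   show "\<bar>trc dl1 (U ep s w)\<bar> <= dl1" for s w by (rule trc_bound) (use dl1 in simp)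
   show "continuous_on {a..min t (b - ep)} (\<lambda>s. trc dl1 (U ep s w))" if "w \<in> space P" for w
    unfolding trc_def
    by (intro continuous_on_max continuous_on_min continuous_on_const continuous_on_subset[OF Uc[OF that ep(1)]]) auto
  qed
 qed
 have evV: "ev_prob k0 (\<lambda>ep w. integral {a..b} (\<lambda>s. (sub.incr ep I s w
    - cf_ext a b H s w * (sub.incr ep M s w))\<^sup>2) <= dl1\<^sup>2 * ep)"
  unfolding ev_prob_def by (rule sub.stoch_integral_energy[OF Ha Hc Mab nj Ic Ia lim _ k0]) (use dl1 in auto)
 have evW: "ev_prob (8 * k0) (\<lambda>ep w. \<bar>integral {a..t} (\<lambda>s. cf_ext a b H s w * (incr ep A s w) *
  (sub.incr ep N s w))\<bar> <= dl1 * ep)"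
  by (rule weighted_orthogonal[OF Ac _ _ EA N Hc HP t dl1]) (use orth Ex(1) Em(1) k0 in \<open>auto simp: A_def[abs_def]\<close>)
 have b7: "ev_prob k0 (\<lambda>_ w. \<forall>t\<in>{a..b}. m t w = N t w - N a w)" by (rule ev_prob_set[OF m(5,6)]) (use m(7) in blast)
 note evB = ev_prob_conj[OF b1 ev_prob_conj[OF b2 ev_prob_conj[OF b3 ev_prob_conj[OF b4 ev_prob_conj[OF b5 ev_prob_conj[OF b6 b7]]]]]]
 have "k0 + (k0 + (k0 + (k0 + (k0 + (k0 + k0))))) + (k0 + (k0 + (k0 + (k0 + 8 * k0)))) = kp" by (simp add: k0_def)
 note ev = ev_prob_conj[OF evB ev_prob_conj[OF Ex(2) ev_prob_conj[OF En(2) ev_prob_conj[OF evP ev_prob_conj[OF evV evW]]]], unfolded this]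
 show ?thesis
 proof (rule ev_prob_mono[OF ev e], goal_cases)
  case (1 ep w)
  note ep = 1(1,2) and ws = 1(3) and Q = 1(4)
  note eple = ele[OF ep(2)]
  define x y i h mm nn where "x = (\<lambda>s. cf_ext lo hi X s w)" and "y = (\<lambda>s. cf_ext a b Y s w)" and "i = (\<lambda>s. cf_ext a b I s w)"
   and "h = (\<lambda>s. cf_ext a b H s w)" and "mm = (\<lambda>s. cf_ext lo hi M s w)" and "nn = (\<lambda>s. cf_ext a b N s w)"
  note defs = x_def y_def i_def h_def mm_def nn_def
  have pp: "ppath R1 d x" "ppath R2 d2 y" "ppath R3 d3 i" "ppath R4 d4 h" "ppath R5 d5 mm" "ppath R6 d6 nn"
   using Q unfolding defs by blast+
  have c: "continuous_on S x" "continuous_on S y" "continuous_on S i" "continuous_on S h" "continuous_on S mm" "continuous_on S nn" for S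
   unfolding defs by (intro ext_cont[OF Xc ws] sub.ext_cont[OF Yc ws] sub.ext_cont[OF Ic ws] sub.ext_cont[OF Hc ws]
    ext_cont[OF MD(1) ws] sub.ext_cont[OF ND(1) ws])+
  have cs: "continuous_on S (\<lambda>s. f (s + ep))" if "continuous_on UNIV f" for f :: "real => real" and S
   by (rule continuous_on_compose2[OF that]) (auto intro!: continuous_intros)
  define t' where "t' = min t (b - ep)"
  have t': "a <= t'" "t' <= b - ep" using t eple(5) by (auto simp: t'_def)
  define u where "u s = trc dl1 (U ep s w)" for s
  define q where "q s = inc ep y s - u s - h s * inc ep x s" for s
  define p where "p s = max 0 (\<bar>q s\<bar> - dl1 * \<bar>inc ep x s\<bar>)" for s
  have uU: "u s = U ep s w" if "s \<in> {a..b-ep}" for s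
   unfolding u_def by (rule trc_id) (use e2(3)[OF ep(1) eple(2) pp(1) that] in \<open>simp add: U_def x_def\<close>)
  have uc: "continuous_on {a..b-ep} u"
   using Uc[OF ws ep(1)] by (rule continuous_on_eq) (simp add: uU)
  have pc: "continuous_on {a..b-ep} p" unfolding p_def q_def by (intro continuous_intros uc c cs)
  have abid: "cf_ext a b Z s = Z s" "cf_ext a b Z (s + ep) = Z (s + ep)" if "s \<in> {a..b-ep}" for s and Z :: "real => 'a => real"
   using that ep(1) by (auto intro!: sub.ext_id)
  have lhid: "cf_ext lo hi Z s = Z s" "cf_ext lo hi Z (s + ep) = Z (s + ep)" if "s \<in> {a..b-ep}" for s and Z :: "real => 'a => real"
   using that ep(1) loa bhi by (auto intro!: ext_id)
  have pest: "ennreal (p s) <= ennreal (2 * R1) * (SUP \<eta>\<in>K. cf_Dperp_tv \<tau> F (s + ep) \<eta> {max (-ep) (-\<tau>)..0})"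
   if s: "s \<in> {a..b-ep}" for s
  proof -
   have "q s = F (s + ep) (win \<tau> x (s + ep)) - F (s + ep) (win \<tau> (\<lambda>r. x (min s r)) (s + ep)) - G (s, win \<tau> x s) * (x (s + ep) - x s)"
    unfolding q_def uU[OF s] y_def h_def abid[OF s] unfolding U_def Y_def H_def x_def by simp
   then have "ennreal (p s) = ennreal (\<bar>F (s + ep) (win \<tau> x (s + ep)) - F (s + ep) (win \<tau> (\<lambda>r. x (min s r)) (s + ep))
     - G (s, win \<tau> x s) * (x (s + ep) - x s)\<bar> - dl1 * \<bar>x (s + ep) - x s\<bar>)"
    unfolding p_def by (simp add: max_def ennreal_neg)
   then show ?thesis using e2(4)[OF ep(1) eple(2) pp(1) s] unfolding K_def by simp
  qed
  \<comment> \<open>Extended to the whole line, since \<open>support_predictable_integral\<close>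
    takes Borel functions on it.\<close>
  define pe where "pe s = p (cf_clamp a (b - ep) s)" for s
  have clid: "cf_clamp a (b - ep) s = s" if "s \<in> {a..b-ep}" for s using that by (auto simp: cf_clamp_def)
  have "continuous_on UNIV pe" unfolding pe_def
   by (rule continuous_on_compose2[OF pc]) (use t' in \<open>auto simp: cf_clamp_def intro!: continuous_intros\<close>)
  then have pm: "pe \<in> bm borel" by (rule borel_measurable_continuous_onI)
  have "(\<integral>\<^sup>+s. ennreal (pe s) * indicator {a..b-ep} s \<partial>lborel) <= ennreal (2 * R1 * Cs * ep\<^sup>2)"
   by (rule Cs(3)[OF ep(1) eple(1) _ pm]) (use B1(2) pest in \<open>auto simp: pe_def clid\<close>)
  moreover have "(\<integral>\<^sup>+s. ennreal (pe s) * indicator {a..b-ep} s \<partial>lborel) = (\<integral>\<^sup>+s. ennreal (p s) * indicator {a..b-ep} s \<partial>lborel)"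
   by (intro nn_integral_cong) (auto simp: indicator_def pe_def clid)
  moreover have "... = ennreal (integral {a..b-ep} p)"
   by (rule nn_integral_eq_integral_Icc[OF pc]) (simp add: p_def)
  ultimately have "ennreal (integral {a..b-ep} p) <= ennreal (C2 * ep\<^sup>2)" by (simp add: C2_def)
  then have p1: "integral {a..b-ep} p <= C2 * ep\<^sup>2" by (rule ennreal_le_iff[THEN iffD1, rotated]) (use C2 in simp)
  have p0: "0 <= p s" for s by (simp add: p_def)
  have p2: "integral {a..t'} p <= integral {a..b-ep} p"
   by (rule integral_subset_le) (use t' p0 in \<open>auto intro!: integrable_continuous_interval pc continuous_on_subset[OF pc]\<close>)
  have bnd: "\<bar>f s\<bar> <= R" if "ppath R' d' f" "R' <= R" for f d' R' s using that unfolding ppath_def by (meson order_trans)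
  have "\<bar>integral {a..t} (\<lambda>s. (inc ep y s - inc ep i s) * inc ep nn s)\<bar>
   <= ep * dl1 * (C1 + 2 + 2 * E + 4 * R + 4 * R\<^sup>2) + 2 * R * C2 * ep\<^sup>2"
  proof (rule covariation_estimate[where y=y and i=i and n=nn and a=a and b=b and t=t and U=u and p=p and h=h and x=x and m=mm, OF ep(1) eple(5) _ _ dl1, folded t'_def])
   show "a <= t" "t <= b" using t by auto
   show "continuous_on {a..t'} u" by (rule continuous_on_subset[OF uc]) (use t' in auto)
   show "continuous_on {a..t'} p" by (rule continuous_on_subset[OF pc]) (use t' in auto)
   \<comment> \<open>On the good event \<open>m\<close> and N differ by a constant in time, so their
     increments agree.\<close>
   have "(\<lambda>s. trc dl1 (U ep s w) * (sub.incr ep m s w)) = (\<lambda>s. u s * inc ep nn s)"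
    using Q sub.clamp_in by (auto simp: fun_eq_iff u_def nn_def cf_ext_def)
   then show "\<bar>integral {a..t'} (\<lambda>s. u s * inc ep nn s)\<bar> <= ep * dl1 * C1" using Q unfolding t'_def by simp
   show "\<bar>inc ep y s - u s - h s * inc ep x s\<bar> <= dl1 * \<bar>inc ep x s\<bar> + p s" "0 <= p s" for s
    unfolding p_def q_def by auto
   show "integral {a..t'} p <= C2 * ep\<^sup>2" using p1 p2 by linarith
   \<comment> \<open>M is extended once from \<open>[lo, hi]\<close> and once from
     \<open>[a, b]\<close>; for \<open>s\<close> in \<open>[a, t']\<close> both \<open>s\<close> and
     \<open>s + ep\<close> lie in \<open>[a, b]\<close>, where the extensions agree.\<close>
   have v1: "integral {a..t'} (\<lambda>s. (inc ep i s - h s * inc ep mm s)\<^sup>2)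
     = integral {a..t'} (\<lambda>s. (inc ep i s - h s * (sub.incr ep M s w))\<^sup>2)"
    by (rule Henstock_Kurzweil_Integration.integral_cong) (use t' in \<open>simp add: mm_def lhid abid\<close>)
   also have "... <= integral {a..b} (\<lambda>s. (inc ep i s - h s * (sub.incr ep M s w))\<^sup>2)"
    by (rule integral_subset_le) (use t' ep(1) in \<open>auto intro!: integrable_continuous_interval continuous_intros c cs
      sub.ext_cont[OF sub.local_martD(1)[OF Mab] ws] sub.ext_cont_shift[OF sub.local_martD(1)[OF Mab] ws]\<close>)
   also have "... <= dl1\<^sup>2 * ep" using Q unfolding i_def h_def by blast
   finally show "integral {a..t'} (\<lambda>s. (inc ep i s - h s * inc ep mm s)\<^sup>2) <= dl1\<^sup>2 * ep" .
   have EE: "Ex * ep <= E * ep" "En * ep <= E * ep" using Ex(1) En(1) ep(1) by (auto simp: E_def)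
   have "integral {a..b} (\<lambda>s. (inc ep x s)\<^sup>2) <= integral {lo..hi} (\<lambda>s. (inc ep x s)\<^sup>2)"
    by (rule integral_subset_le) (use loa bhi in \<open>auto intro!: integrable_continuous_interval continuous_intros c cs\<close>)
   also have "... <= Ex * ep" using Q unfolding x_def by blast
   finally show "integral {a..b} (\<lambda>s. (inc ep x s)\<^sup>2) <= E * ep" using EE by linarith
   have "integral {a..b} (\<lambda>s. (inc ep nn s)\<^sup>2) <= En * ep" using Q unfolding nn_def by blast
   then show "integral {a..b} (\<lambda>s. (inc ep nn s)\<^sup>2) <= E * ep" using EE by linarith
   have "(\<lambda>s. cf_ext a b H s w * (incr ep A s w) * (sub.incr ep N s w))
    = (\<lambda>s. h s * (inc ep x s - inc ep mm s) * inc ep nn s)"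
    by (simp add: fun_eq_iff h_def x_def mm_def nn_def cf_ext_def A_def algebra_simps)
   then show "\<bar>integral {a..t} (\<lambda>s. h s * (inc ep x s - inc ep mm s) * inc ep nn s)\<bar> <= dl1 * ep" using Q by simp
   show "\<bar>inc ep nn s\<bar> <= dl1" for s
   proof -
    have "\<bar>(s + ep) - s\<bar> <= d6 j" using ep(1) eple(4) by simp
    then have "\<bar>nn (s + ep) - nn s\<bar> <= 1 / real (Suc j)" using pp(6) unfolding ppath_def by blast
    then show ?thesis using j by linarith
   qed
   show "\<bar>y s\<bar> <= R" "\<bar>i s\<bar> <= R" "\<bar>h s\<bar> <= R" "\<bar>x s\<bar> <= R" "\<bar>mm s\<bar> <= R" "\<bar>nn s\<bar> <= R" for s
    by (rule bnd[OF pp(2) Rle(2)] bnd[OF pp(3) Rle(3)] bnd[OF pp(4) Rle(4)] bnd[OF pp(1) Rle(1)] bnd[OF pp(5) Rle(5)] bnd[OF pp(6) Rle(6)])+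
  qed (rule c)+
  also have "ep * dl1 * (C1 + 2 + 2 * E + 4 * R + 4 * R\<^sup>2) = ep * (dl / 2)"
   unfolding Ct_def[symmetric] dl1_def using Ct by simp
  also have "2 * R * C2 * ep\<^sup>2 = (2 * R * C2 * ep) * ep" by (simp add: power2_eq_square)
  also have "ep * (dl / 2) + (2 * R * C2 * ep) * ep <= ep * (dl / 2) + (dl / 2) * ep"
   by (intro add_left_mono mult_right_mono e4') (use ep(1) eple(3) in auto)
  finally have fin: "\<bar>integral {a..t} (\<lambda>s. (inc ep y s - inc ep i s) * inc ep nn s)\<bar> <= dl * ep" by simp
  have Zc: "sub.cpaths (\<lambda>t w. Y t w - (C w + I t w))"
   using Yc Ic unfolding cf_cont_paths_def by (auto intro!: continuous_intros)
  have "(\<lambda>s. (cf_ext a b (\<lambda>t w. Y t w - (C w + I t w)) (s + ep) w - cf_ext a b (\<lambda>t w. Y t w - (C w + I t w)) s w) *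
   (sub.incr ep N s w)) = (\<lambda>s. (inc ep y s - inc ep i s) * inc ep nn s)"
   by (simp add: fun_eq_iff y_def i_def nn_def cf_ext_def)
  then show "\<bar>cf_cov_eps a b (\<lambda>t w. Y t w - (C w + I t w)) N ep t w\<bar> <= dl"
   unfolding sub.cov_eps_eq[OF Zc ND(1) ws] using fin ep(1) by (simp add: divide_le_eq)
 qed
qed

end

theorem theorem5p15:
  fixes P :: "'a measure" and Fl :: "real \<Rightarrow> 'a set set"
    and T \<tau> a b :: real
    and X Mm :: "real \<Rightarrow> 'a \<Rightarrow> real"
    and F :: "real \<Rightarrow> (real \<Rightarrow>\<^sub>C real) \<Rightarrow> real"
  assumes "prob_space P"
    and "cf_usual P 0 T Fl"
    and "0 < \<tau>" and "0 \<le> a" and "a < b" and "b \<le> T"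
    and "cf_weak_dirichlet P 0 T Fl X Mm"
    and "cf_finite_qv P 0 T X"
    and "continuous_on ({a..b} \<times> cf_C \<tau>) (\<lambda>(t, \<eta>). F t \<eta>)"
    and "\<forall>t\<in>{a..b}. cf_differentiable \<tau> (F t)"
    and "\<forall>K. compact K \<and> K \<subseteq> {a..b} \<times> cf_C \<tau> \<longrightarrow>
           (\<exists>B. \<forall>(t, \<eta>)\<in>K. cf_Dperp_tv \<tau> F t \<eta> {-\<tau>..0} \<le> ennreal B)"
    and "cf_support_predictable \<tau> a b F"
    and "continuous_on ({a<..b} \<times> cf_C \<tau>) (\<lambda>(t, \<eta>). cf_Ddelta0 \<tau> F t \<eta>)"
    and "\<exists>G. continuous_on ({a..b} \<times> cf_C \<tau>) G \<and>
           (\<forall>t\<in>{a<..b}. \<forall>\<eta>\<in>cf_C \<tau>. G (t, \<eta>) = cf_Ddelta0 \<tau> F t \<eta>)"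
  shows "\<exists>I. cf_stoch_int P a b (\<lambda>s \<omega>. cf_Ddelta0 \<tau> F s (cf_window \<tau> (cf_ext 0 T X) s \<omega>)) Mm I \<and>
             cf_weak_dirichlet P a b Fl
               (\<lambda>t \<omega>. F t (cf_window \<tau> (cf_ext 0 T X) t \<omega>))
               (\<lambda>t \<omega>. F a (cf_window \<tau> (cf_ext 0 T X) a \<omega>) + I t \<omega>)"
proof -
  interpret prob_space P by fact
  interpret filtered_subinterval P 0 T Fl a b
    by unfold_locales (use assms(2,4-6) in \<open>auto simp: cf_usual_def\<close>)
  note \<tau> = assms(3) and F = assms(9) and sp = assms(12)
  have diff: "cf_differentiable \<tau> (F t)" if "t \<in> {a..b}" for t using assms(10) that by blast
  obtain G where G: "continuous_on ({a..b} \<times> cf_C \<tau>) G"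
    "\<And>t \<eta>. t \<in> {a<..b} \<Longrightarrow> \<eta> \<in> cf_C \<tau> \<Longrightarrow> G (t, \<eta>) = cf_Ddelta0 \<tau> F t \<eta>" using assms(14) by blast
  note wd = assms(7)[unfolded cf_weak_dirichlet_def]
  have Xc: "cf_cont_paths P 0 T X" and M: "cf_cont_local_martingale P 0 T Fl Mm" using wd by blast+
  have Xm: "X t \<in> borel_measurable (Fm t)" if "t \<in> {0..T}" for t using wd that unfolding adapted_iff by blast
  have orth: "cf_has_covariation P 0 T (\<lambda>t \<omega>. X t \<omega> - Mm t \<omega>) N (\<lambda>t \<omega>. 0)"
    if "cf_cont_local_martingale P 0 T Fl N" for N
    using wd that unfolding cf_mart_orthogonal_def by blast
  have Mab: "cf_cont_local_martingale P a b Fl Mm" by (rule restrict_local_mart[OF M])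
  define W where "W t \<omega> = win \<tau> (\<lambda>r. cf_ext 0 T X r \<omega>) t" for t \<omega>
  have Weq: "cf_window \<tau> (cf_ext 0 T X) = W" by (simp add: fun_eq_iff W_def cf_window_win)
  have WC: "W t \<omega> \<in> cf_C \<tau>" if "\<omega> \<in> space P" for t \<omega>
    unfolding W_def by (rule win_in_C) (use \<tau> ext_cont[OF Xc that] in auto)
  \<comment> \<open>The integral is built from the continuous extension, because its construction
    needs an integrand with continuous paths on all of \<open>[a, b]\<close>; the derivative itself
    may jump at \<open>a\<close>.\<close>
  define H where "H s \<omega> = G (s, W s \<omega>)" for s \<omega>
  define Y where "Y t \<omega> = F t (W t \<omega>)" for t \<omega>
  have Hc: "cf_cont_paths P a b H" unfolding H_def[abs_def] W_def by (rule window_functional_cont_paths[OF \<tau> Xc G(1)])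
  have Ha: "H s \<in> borel_measurable (Fm s)" if "s \<in> {a..b}" for s
    unfolding H_def[abs_def] W_def by (rule window_functional_adapted[OF \<tau> Xm Xc G(1) that])
  have Yc: "cf_cont_paths P a b Y" using window_functional_cont_paths[OF \<tau> Xc F] by (simp add: Y_def[abs_def] W_def)
  have Ya: "Y s \<in> borel_measurable (Fm s)" if "s \<in> {a..b}" for s
    using window_functional_adapted[OF \<tau> Xm Xc F that] by (simp add: Y_def[abs_def] W_def)
  have a: "a \<in> {a..b}" using ab by simp
  obtain I and n :: "nat \<Rightarrow> nat" where nj: "\<And>j. j \<le> n j" and Ic: "cf_cont_paths P a b I"
    and I0: "\<And>\<omega>. \<omega> \<in> space P \<Longrightarrow> I a \<omega> = 0" and Ia: "\<And>t. t \<in> {a..b} \<Longrightarrow> I t \<in> borel_measurable (Fm t)"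
    and lim: "AE \<omega> in P. \<forall>t\<in>{a..b}. (\<lambda>j. sub.tr (sub.gr (n j)) (2^(n j)) H Mm t \<omega>) \<longlonglongrightarrow> I t \<omega>"
  proof (rule sub.stoch_integral_exists[OF Ha Hc Mab], goal_cases)
    case (2 I n)
    show ?case by (rule 2(1)[OF 2(2-6)])
  qed
  have D: "cf_stoch_int P a b (\<lambda>s \<omega>. cf_Ddelta0 \<tau> F s (W s \<omega>)) Mm I"
  proof (rule sub.stoch_int_char[OF Ha Hc Mab nj Ic I0 Ia lim])
    show "cf_Ddelta0 \<tau> F s (W s \<omega>) = H s \<omega>" if "s \<in> {a<..b}" "\<omega> \<in> space P" for s \<omega>
      using G(2)[OF that(1) WC[OF that(2)]] by (simp add: H_def)
    show "(\<lambda>\<omega>. cf_Ddelta0 \<tau> F a (W a \<omega>)) \<in> borel_measurable P"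
      unfolding W_def
    proof (rule Ddelta0_window_measurable[where F=F and t=a and Y="cf_ext 0 T X" and u=a, OF \<tau> diff[OF a]])
      show "continuous_on (cf_C \<tau>) (F a)" using continuous_on_slice[OF F a] by simp
      show "cf_ext 0 T X r \<in> borel_measurable P" for r by (rule ext_meas) (rule meas_P[OF Xm])
    qed (rule ext_cont[OF Xc])
  qed
  \<comment> \<open>The starting value of the functional is known at time \<open>a\<close> and may
    be unbounded; the local martingale condition concerns the increment from \<open>a\<close>
    only.\<close>
  have loc: "cf_cont_local_martingale P a b Fl (\<lambda>t \<omega>. Y a \<omega> + I t \<omega>)"
    by (rule sub.stoch_integral_local_mart[OF Ha Hc Mab Ic I0 Ia lim Ya[OF a]])
  let ?A = "\<lambda>t \<omega>. Y t \<omega> - (Y a \<omega> + I t \<omega>)"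
  have Ac: "cf_cont_paths P a b ?A" using Yc Ic unfolding cf_cont_paths_def by (auto intro!: continuous_intros)
  have Am: "?A t \<in> borel_measurable (Fm t)" if t: "t \<in> {a..b}" for t
    using Ya[OF t] Ia[OF t] sub.meas_mono[OF Ya[OF a], of t] t by auto
  have orthA: "cf_mart_orthogonal P a b Fl ?A"
    unfolding cf_mart_orthogonal_def
  proof (intro conjI allI impI)
    show "cf_adapted P a b Fl ?A" unfolding sub.adapted_iff using Am by blast
    fix N assume N: "cf_cont_local_martingale P a b Fl N"
    show "cf_has_covariation P a b ?A N (\<lambda>t \<omega>. 0)"
      unfolding cf_has_covariation_def
    proof (intro conjI ballI Ac)
      show "cf_cont_paths P a b (\<lambda>t \<omega>. 0)" by (simp add: cf_cont_paths_def)
      fix t assume t: "t \<in> {a..b}"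
      show "cf_conv_prob P (\<lambda>\<epsilon>. cf_cov_eps a b ?A N \<epsilon> t) (\<lambda>\<omega>. 0)"
      proof (rule conv_prob_zeroI)
        show "cf_cov_eps a b ?A N \<epsilon> t \<in> borel_measurable P" for \<epsilon>
          by (rule sub.cov_eps_meas[OF Ac sub.meas_P[OF Am] sub.local_martD(1)[OF N] sub.local_martD(3)[OF N]])
        fix \<delta> \<kappa> :: real assume "0 < \<delta>" "0 < \<kappa>"
        from functional_covariation[OF \<tau> Xm Xc M orth assms(8) F diff sp G nj Ic Ia lim[unfolded H_def[abs_def] W_def] N t this, of "Y a"]
        show "ev_prob \<kappa> (\<lambda>\<epsilon> \<omega>. \<bar>cf_cov_eps a b ?A N \<epsilon> t \<omega>\<bar> \<le> \<delta>)" unfolding Y_def W_def .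
      qed
    qed
  qed
  have "cf_weak_dirichlet P a b Fl Y (\<lambda>t \<omega>. Y a \<omega> + I t \<omega>)"
    unfolding cf_weak_dirichlet_def sub.adapted_iff using Yc Ya loc orthA I0 by simp
  then show ?thesis unfolding Weq using D unfolding Y_def[abs_def] by blast
qed

end
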